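(* Let $\mathbf U=(u^b,u^a,\widehat u^0)\in\mathbb V'$ be the solution of $$\int_{\Omega^b}a^be(u^b):e(v^b)\,dx+\int_{\Omega^a}a^ae(u^a):e(v^a)\,dx+\int_{\omega\times Y^0}a^Me_y(\widehat u^0):e_y(\widehat v^0)\,dx'dy=\int_{\Omega^b}f\cdot v^b\,dx+\int_{\Omega^a}f\cdot v^a\,dx$$ for all $\mathbf V=(v^b,v^a,\widehat v^0)\in\mathbb V'$. Then $$\widehat u^0(x',y)=\sum_{i=1}^3\widehat\chi^i(x',y)\,u^a_{i|\Sigma}(x')+\sum_{i=1}^3(\mathbf e_i-\widehat\chi^i(x',y))\,u^b_{i|\Sigma}(x')\qquad\text{for a.e. }(x',y)\in\omega\times Y^0,$$ and the couple $(u^a,u^b)\in H^1(\Omega^a;\mathbb R^3)\times H^1_\Gamma(\Omega^b;\mathbb R^3)$ is the solution of the variational problem $$\begin{aligned} \int_{\Omega^b}a^be(u^b):e(v^b)\,dx+\int_{\Omega^a}a^ae(u^a):e(v^a)\,dx&+\int_\omega H(u^a_{|\Sigma}-u^b_{|\Sigma})\cdot(v^a_{|\Sigma}-v^b_{|\Sigma})\,dx'\\ &=\int_{\Omega^b}f\cdot v^b\,dx+\int_{\Omega^a}f\cdot v^a\,dx \end{aligned}$$ for all $(v^a,v^b)\in H^1(\Omega^a;\mathbb R^3)\times H^1_\Gamma(\Omega^b;\mathbb R^3)$, where $H$ is the $3\times3$ symmetric matrix with coefficients in $L^\infty(\omega)$ defined by $$H_{ij}=\int_{Y^0}a^Me_y(\widehat\chi^i):e_y(\widehat\chi^j)\,dy,\qquad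 i,j=1,2,3.$$
   Context: $\omega\subset\mathbb R^2$ is a bounded connected domain with Lipschitz boundary, $L>0$, $\Omega^b=\omega\times(-L,0)$, $\Omega^a=\omega\times(0,L)$, $\Sigma=\omega\times\{0\}$, $\Omega=\omega\times(-L,L)$, $\Gamma\subset\partial\Omega^b$ of positive surface measure, $H^1_\Gamma(\Omega^b)=\{\phi\in H^1(\Omega^b):\phi=0\text{ a.e. on }\Gamma\}$, $f\in L^2(\Omega;\mathbb R^3)$. $Y=(0,1)^3$, $Y'=(0,1)^2$. $Y^1,\dots,Y^m$ (here holes) are open Lipschitz sets with pairwise disjoint closures and connected boundaries, $\bigcup_j\overline{Y^j}\subset Y$; $S^0$ is a closed set, a finite union of disjoint orientable $\mathcal C^1$ surfaces contained in $Y\setminus\bigcup_j\overline{Y^j}$ and having a continuous unit normal field $\nu$; $Y^0=Y\setminus(\bigcup_{j=1}^m\overline{Y^j}\cup S^0)$, there is $t_0>0$ with $[x-t_0\nu(x),x+t_0\nu(x)]\setminus\{x\}\subset Y^0$ for $x\in S^0$, and $Y^0$ is a Korn-domain: there is $C$ such that each $v\in H^1(Y^0;\mathbb R^3)$ admits a rigid displacement $r(y)=a+b\wedge y$ with $\|v-r\|_{H^1(Y^0)}\le C\|e_y(v)\|_{L^2(Y^0)}$. $e$, $e_y$ denote symmetric gradients in $x$, $y$; $x'=(x_1,x_2)$. The fourth order tensor fields $a^b$ on $\Omega^b$, $a^a$ on $\Omega^a$, $a^M$ on $\omega\times Y$ belong to $L^\infty$, are symmetric ($a\eta:\xi=a\xi:\eta$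 for all $\xi,\eta\in\mathbb R^{3\times3}$) and coercive: $\overline\alpha\,\eta:\eta\le a\eta:\eta$ for all $\eta\in\mathbb R^{3\times3}$, with $\overline\alpha>0$. $H^1_{per}(Y^0)$: functions of $H^1(Y^0)$ with equal traces on $y_1=0$ and $y_1=1$, and on $y_2=0$ and $y_2=1$. $\mathbb V'$ is the set of $(v^b,v^a,\widehat v^0)\in H^1_\Gamma(\Omega^b;\mathbb R^3)\times H^1(\Omega^a;\mathbb R^3)\times L^2(\omega;H^1_{per}(Y^0;\mathbb R^3))$ with $v^b(x',0)=\widehat v^0(x',y_1,y_2,0)$ and $v^a(x',0)=\widehat v^0(x',y_1,y_2,1)$ for a.e. $(x',y_1,y_2)\in\omega\times Y'$. $\widehat V_0=\{\widehat w\in H^1_{per}(Y^0;\mathbb R^3):\widehat w(y_1,y_2,0)=\widehat w(y_1,y_2,1)=0\text{ for a.e. }(y_1,y_2)\in Y'\}$. The correctors $\widehat\chi^i\in L^\infty(\omega;H^1_{per}(Y^0;\mathbb R^3))$, $i=1,2,3$, are defined by $\widehat\chi^i(x',y_1,y_2,1)=\mathbf e_i$, $\widehat\chi^i(x',y_1,y_2,0)=0$ for a.e. $(x',y_1,y_2)\in\omega\times Y'$, and $\int_{Y^0}a^Me_y(\widehat\chi^i):e_y(\psi)\,dy=0$ for a.e. $x'\in\omega$ and all $\psi\in\widehat V_0$, where $(\mathbf e_1,\mathbf e_2,\mathbf e_3)$ is the canonical basis of $\mathbb R^3$. *)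

theory Defs
  imports "HOL-Analysis.Analysis"
begin

section \<open>Geometry\<close>

definition hpart :: "real^3 \<Rightarrow> real^2" where
  "hpart x = vector [x$1, x$2]"

definition pt3 :: "real^2 \<Rightarrow> real \<Rightarrow> real^3" where
  "pt3 x' t = vector [x'$1, x'$2, t]"

definition cylinder :: "(real^2) set \<Rightarrow> real set \<Rightarrow> (real^3) set" where
  "cylinder \<omega> I = {x. hpart x \<in> \<omega> \<and> x$3 \<in> I}"

abbreviation unit_square :: "(real^2) set" where
  "unit_square \<equiv> {z. \<forall>i. 0 < z$i \<and> z$i < 1}"

abbreviation unit_cube :: "(real^3) set" where
  "unit_cube \<equiv> {y. \<forall>i. 0 < y$i \<and> y$i < 1}"

text \<open>Near each boundary point \<open>p\<close> the set is the strict epigraph, in some direction \<open>e\<close>, of a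
  Lipschitz function on the hyperplane orthogonal to \<open>e\<close> (coordinates centred at \<open>p\<close>).\<close>

definition lipschitz_boundary :: "'a::euclidean_space set \<Rightarrow> bool" where
  "lipschitz_boundary U \<longleftrightarrow>
     (\<forall>p\<in>frontier U. \<exists>e C \<gamma> \<epsilon>. norm e = 1 \<and> \<epsilon> > 0 \<and> C-lipschitz_on {z. z \<bullet> e = 0} \<gamma> \<and>
        U \<inter> ball p \<epsilon> = {x \<in> ball p \<epsilon>. (x - p) \<bullet> e > \<gamma> ((x - p) - ((x - p) \<bullet> e) *\<^sub>R e)})"

text \<open>Two-dimensional Hausdorff (outer) measure; on a Lipschitz boundary in three-space it is the
  surface measure.\<close>

definition surface_measure :: "(real^3) set \<Rightarrow> ennreal" where
  "surface_measure A =
     (SUP \<delta>\<in>{0<..}. INF C\<in>{C :: nat \<Rightarrow> (real^3) set.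
          A \<subseteq> (\<Union>i. C i) \<and> (\<forall>i. bounded (C i) \<and> diameter (C i) \<le> \<delta>)}.
        (\<Sum>i. ennreal (pi / 4 * (diameter (C i))\<^sup>2)))"

text \<open>A regular \<open>C\<^sup>1\<close> parametrisation of \<open>S\<close> near \<open>p\<close> by a relatively open part \<open>D\<close> of a closed
  half-plane, so that surfaces may have a boundary; interior points are covered by taking \<open>D\<close>
  inside the open half-plane.\<close>

definition surface_chart ::
  "(real^3) set \<Rightarrow> real^3 \<Rightarrow> (real^2 \<Rightarrow> real^3) \<Rightarrow> (real^2 \<Rightarrow> ((real^2) \<Rightarrow>\<^sub>L (real^3))) \<Rightarrow> (real^2) set \<Rightarrow> bool"
where
  "surface_chart S p \<phi> \<phi>' D \<longleftrightarrow>
     (\<exists>V W \<psi>. open V \<and> open W \<and> p \<in> W \<and> D = V \<inter> {s. s$1 \<ge> 0} \<and>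
        (\<forall>s\<in>V. (\<phi> has_derivative blinfun_apply (\<phi>' s)) (at s)) \<and> continuous_on V \<phi>' \<and>
        (\<forall>s\<in>V. inj (blinfun_apply (\<phi>' s))) \<and>
        homeomorphism D (S \<inter> W) \<phi> \<psi>)"

definition C1_surface :: "(real^3) set \<Rightarrow> bool" where
  "C1_surface S \<longleftrightarrow> (\<forall>p\<in>S. \<exists>\<phi> \<phi>' D. surface_chart S p \<phi> \<phi>' D)"

definition normal_to_surface :: "(real^3) set \<Rightarrow> (real^3 \<Rightarrow> real^3) \<Rightarrow> bool" where
  "normal_to_surface S \<nu> \<longleftrightarrow>
     (\<forall>p\<in>S. \<forall>\<phi> \<phi>' D. surface_chart S p \<phi> \<phi>' D \<longrightarrow>
        (\<forall>s\<in>D. \<forall>h. \<nu> (\<phi> s) \<bullet> blinfun_apply (\<phi>' s) h = 0))"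

text \<open>The closed set \<open>S0\<close> is a finite disjoint union of \<open>C\<^sup>1\<close> surfaces, oriented by \<open>\<nu>\<close>.\<close>

definition oriented_surfaces :: "(real^3) set \<Rightarrow> (real^3 \<Rightarrow> real^3) \<Rightarrow> bool" where
  "oriented_surfaces S0 \<nu> \<longleftrightarrow>
     closed S0 \<and> continuous_on S0 \<nu> \<and> (\<forall>x\<in>S0. norm (\<nu> x) = 1) \<and>
     (\<exists>\<S>. finite \<S> \<and> disjoint \<S> \<and> S0 = \<Union>\<S> \<and> (\<forall>S\<in>\<S>. C1_surface S \<and> normal_to_surface S \<nu>))"

section \<open>Sobolev spaces\<close>

definition L2 :: "'a::euclidean_space set \<Rightarrow> ('a \<Rightarrow> 'b::euclidean_space) set" where
  "L2 U = {u. u \<in> borel_measurable (lebesgue_on U) \<and> integrable (lebesgue_on U) (\<lambda>x. (norm (u x))\<^sup>2)}"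

definition Linf :: "'a::euclidean_space set \<Rightarrow> ('a \<Rightarrow> 'b::euclidean_space) set" where
  "Linf U = {u. u \<in> borel_measurable (lebesgue_on U) \<and> (\<exists>C. AE x in lebesgue_on U. norm (u x) \<le> C)}"

text \<open>\<open>g\<close> is the gradient of the \<open>C\<^sup>1\<close> function \<open>\<phi>\<close>, which is compactly supported in \<open>U\<close>.\<close>

definition test_function :: "(real^3) set \<Rightarrow> (real^3 \<Rightarrow> real) \<Rightarrow> (real^3 \<Rightarrow> real^3) \<Rightarrow> bool" where
  "test_function U \<phi> g \<longleftrightarrow>
     (\<forall>x. (\<phi> has_derivative (\<lambda>h. g x \<bullet> h)) (at x)) \<and> continuous_on UNIV g \<and>
     (\<exists>K. compact K \<and> K \<subseteq> U \<and> (\<forall>x. x \<notin> K \<longrightarrow> \<phi> x = 0))"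

text \<open>\<open>G x $ i $ j\<close> is the weak derivative of the \<open>i\<close>-th component with respect to \<open>x$j\<close>.\<close>

definition has_weak_grad ::
  "(real^3) set \<Rightarrow> (real^3 \<Rightarrow> real^3) \<Rightarrow> (real^3 \<Rightarrow> real^3^3) \<Rightarrow> bool" where
  "has_weak_grad U u G \<longleftrightarrow> u \<in> L2 U \<and> G \<in> L2 U \<and>
     (\<forall>\<phi> g. test_function U \<phi> g \<longrightarrow>
        (\<forall>i j. (LINT x|lebesgue_on U. u x $ i * g x $ j) = - (LINT x|lebesgue_on U. G x $ i $ j * \<phi> x)))"

definition H1 :: "(real^3) set \<Rightarrow> (real^3 \<Rightarrow> real^3) set" where
  "H1 U = {u. \<exists>G. has_weak_grad U u G}"

text \<open>A representative of the weak gradient, which is unique up to null sets.\<close>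

definition weak_grad :: "(real^3) set \<Rightarrow> (real^3 \<Rightarrow> real^3) \<Rightarrow> real^3 \<Rightarrow> real^3^3" where
  "weak_grad U u = (SOME G. has_weak_grad U u G)"

definition sym_part :: "real^3^3 \<Rightarrow> real^3^3" where
  "sym_part M = (1/2) *\<^sub>R (M + transpose M)"

definition strain :: "(real^3) set \<Rightarrow> (real^3 \<Rightarrow> real^3) \<Rightarrow> real^3 \<Rightarrow> real^3^3" where
  "strain U u x = sym_part (weak_grad U u x)"

definition norm_L2 :: "(real^3) set \<Rightarrow> (real^3 \<Rightarrow> 'b::euclidean_space) \<Rightarrow> real" where
  "norm_L2 U u = sqrt (LINT x|lebesgue_on U. (norm (u x))\<^sup>2)"

definition norm_H1 :: "(real^3) set \<Rightarrow> (real^3 \<Rightarrow> real^3) \<Rightarrow> real" where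
  "norm_H1 U u = sqrt ((norm_L2 U u)\<^sup>2 + (norm_L2 U (weak_grad U u))\<^sup>2)"

text \<open>Boundary traces, as Lebesgue boundary values: the mean of \<open>norm (u y - z)\<close> over
  \<open>U \<inter> ball p r\<close> tends to \<open>0\<close> with \<open>r\<close>. For \<open>H\<^sup>1\<close> functions this limit value exists at almost every
  point of a Lipschitz part of the boundary and is the usual trace; unlike the extension by density
  of the restriction map it does not require \<open>U\<close> to be Lipschitz elsewhere (cracks).\<close>

definition has_trace :: "(real^3) set \<Rightarrow> (real^3 \<Rightarrow> real^3) \<Rightarrow> real^3 \<Rightarrow> real^3 \<Rightarrow> bool" where
  "has_trace U u p z \<longleftrightarrow>
     ((\<lambda>r. (LINT y|lebesgue_on (U \<inter> ball p r). norm (u y - z)) / measure lebesgue (U \<inter> ball p r))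
        \<longlongrightarrow> 0) (at_right 0)"

definition trace_at :: "(real^3) set \<Rightarrow> (real^3 \<Rightarrow> real^3) \<Rightarrow> real^3 \<Rightarrow> real^3" where
  "trace_at U u p = (THE z. has_trace U u p z)"

definition H1_zero_on :: "(real^3) set \<Rightarrow> (real^3) set \<Rightarrow> (real^3 \<Rightarrow> real^3) set" where
  "H1_zero_on \<Gamma> U = {u \<in> H1 U. surface_measure {p \<in> \<Gamma>. \<not> has_trace U u p 0} = 0}"

definition korn_domain :: "(real^3) set \<Rightarrow> bool" where
  "korn_domain U \<longleftrightarrow>
     (\<exists>C. \<forall>v\<in>H1 U. \<exists>a b. norm_H1 U (\<lambda>y. v y - (a + cross3 b y)) \<le> C * norm_L2 U (strain U v))"

section \<open>Functions on the cell and unfolded functions\<close>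

definition H1_per :: "(real^3) set \<Rightarrow> (real^3 \<Rightarrow> real^3) set" where
  "H1_per Y0 = {v \<in> H1 Y0.
     (AE z in lebesgue_on unit_square. \<exists>c.
        has_trace Y0 v (vector [0, z$1, z$2]) c \<and> has_trace Y0 v (vector [1, z$1, z$2]) c) \<and>
     (AE z in lebesgue_on unit_square. \<exists>c.
        has_trace Y0 v (vector [z$1, 0, z$2]) c \<and> has_trace Y0 v (vector [z$1, 1, z$2]) c)}"

definition V0_cell :: "(real^3) set \<Rightarrow> (real^3 \<Rightarrow> real^3) set" where
  "V0_cell Y0 = {w \<in> H1_per Y0.
     AE z in lebesgue_on unit_square. has_trace Y0 w (pt3 z 0) 0 \<and> has_trace Y0 w (pt3 z 1) 0}"

text \<open>\<open>G\<close> is a jointly measurable version of the gradient in the second variable. Since \<open>H\<^sup>1\<close> is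
  separable, strong measurability of \<open>x' \<mapsto> v x'\<close> with values in \<open>H\<^sup>1\<close> amounts to joint
  measurability of \<open>v\<close> and of such a \<open>G\<close>.\<close>

definition has_weak_grad_y ::
  "(real^2) set \<Rightarrow> (real^3) set \<Rightarrow> (real^2 \<Rightarrow> real^3 \<Rightarrow> real^3) \<Rightarrow> (real^2 \<Rightarrow> real^3 \<Rightarrow> real^3^3) \<Rightarrow> bool"
where
  "has_weak_grad_y \<omega> Y0 v G \<longleftrightarrow>
     (\<lambda>(x', y). G x' y) \<in> borel_measurable (lebesgue_on (\<omega> \<times> Y0)) \<and>
     (AE x' in lebesgue_on \<omega>. has_weak_grad Y0 (v x') (G x'))"

definition weak_grad_y ::
  "(real^2) set \<Rightarrow> (real^3) set \<Rightarrow> (real^2 \<Rightarrow> real^3 \<Rightarrow> real^3) \<Rightarrow> real^2 \<Rightarrow> real^3 \<Rightarrow> real^3^3" where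
  "weak_grad_y \<omega> Y0 v = (SOME G. has_weak_grad_y \<omega> Y0 v G)"

definition strain_y ::
  "(real^2) set \<Rightarrow> (real^3) set \<Rightarrow> (real^2 \<Rightarrow> real^3 \<Rightarrow> real^3) \<Rightarrow> real^2 \<Rightarrow> real^3 \<Rightarrow> real^3^3" where
  "strain_y \<omega> Y0 v x' y = sym_part (weak_grad_y \<omega> Y0 v x' y)"

definition meas_H1_per :: "(real^2) set \<Rightarrow> (real^3) set \<Rightarrow> (real^2 \<Rightarrow> real^3 \<Rightarrow> real^3) set" where
  "meas_H1_per \<omega> Y0 = {v.
     (\<lambda>(x', y). v x' y) \<in> borel_measurable (lebesgue_on (\<omega> \<times> Y0)) \<and>
     (\<exists>G. has_weak_grad_y \<omega> Y0 v G) \<and>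
     (AE x' in lebesgue_on \<omega>. v x' \<in> H1_per Y0)}"

definition L2_H1_per :: "(real^2) set \<Rightarrow> (real^3) set \<Rightarrow> (real^2 \<Rightarrow> real^3 \<Rightarrow> real^3) set" where
  "L2_H1_per \<omega> Y0 = {v \<in> meas_H1_per \<omega> Y0.
     integrable (lebesgue_on \<omega>) (\<lambda>x'. (norm_H1 Y0 (v x'))\<^sup>2)}"

definition Linf_H1_per :: "(real^2) set \<Rightarrow> (real^3) set \<Rightarrow> (real^2 \<Rightarrow> real^3 \<Rightarrow> real^3) set" where
  "Linf_H1_per \<omega> Y0 = {v \<in> meas_H1_per \<omega> Y0.
     \<exists>C. AE x' in lebesgue_on \<omega>. norm_H1 Y0 (v x') \<le> C}"

section \<open>The two variational problems\<close>

definition tens :: "real^3^3^3^3 \<Rightarrow> real^3^3 \<Rightarrow> real^3^3" where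
  "tens a \<eta> = (\<chi> i j. \<Sum>k\<in>UNIV. \<Sum>l\<in>UNIV. a $ i $ j $ k $ l * \<eta> $ k $ l)"

text \<open>The inner product of \<open>real^3^3\<close> is the contraction \<open>\<eta>:\<xi>\<close>.\<close>

definition elasticity_tensor :: "real \<Rightarrow> 'a::euclidean_space set \<Rightarrow> ('a \<Rightarrow> real^3^3^3^3) \<Rightarrow> bool" where
  "elasticity_tensor \<alpha> U a \<longleftrightarrow> a \<in> Linf U \<and>
     (AE x in lebesgue_on U. \<forall>\<eta> \<xi>. tens (a x) \<eta> \<bullet> \<xi> = tens (a x) \<xi> \<bullet> \<eta>) \<and>
     (AE x in lebesgue_on U. \<forall>\<eta>. \<alpha> * (\<eta> \<bullet> \<eta>) \<le> tens (a x) \<eta> \<bullet> \<eta>)"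

definition V_prime ::
  "(real^2) set \<Rightarrow> real \<Rightarrow> (real^3) set \<Rightarrow> (real^3) set \<Rightarrow>
     ((real^3 \<Rightarrow> real^3) \<times> (real^3 \<Rightarrow> real^3) \<times> (real^2 \<Rightarrow> real^3 \<Rightarrow> real^3)) set" where
  "V_prime \<omega> L \<Gamma> Y0 = {(vb, va, v0).
     vb \<in> H1_zero_on \<Gamma> (cylinder \<omega> {-L<..<0}) \<and> va \<in> H1 (cylinder \<omega> {0<..<L}) \<and>
     v0 \<in> L2_H1_per \<omega> Y0 \<and>
     (AE (x', z) in lebesgue_on (\<omega> \<times> unit_square). \<exists>c.
        has_trace (cylinder \<omega> {-L<..<0}) vb (pt3 x' 0) c \<and> has_trace Y0 (v0 x') (pt3 z 0) c) \<and>
     (AE (x', z) in lebesgue_on (\<omega> \<times> unit_square). \<exists>c.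
        has_trace (cylinder \<omega> {0<..<L}) va (pt3 x' 0) c \<and> has_trace Y0 (v0 x') (pt3 z 1) c)}"

definition energy ::
  "(real^3) set \<Rightarrow> (real^3 \<Rightarrow> real^3^3^3^3) \<Rightarrow> (real^3 \<Rightarrow> real^3) \<Rightarrow> (real^3 \<Rightarrow> real^3) \<Rightarrow> real" where
  "energy U a u v = (LINT x|lebesgue_on U. tens (a x) (strain U u x) \<bullet> strain U v x)"

definition load :: "(real^3) set \<Rightarrow> (real^3 \<Rightarrow> real^3) \<Rightarrow> (real^3 \<Rightarrow> real^3) \<Rightarrow> real" where
  "load U f v = (LINT x|lebesgue_on U. f x \<bullet> v x)"

definition unfolded_solution ::
  "(real^2) set \<Rightarrow> real \<Rightarrow> (real^3) set \<Rightarrow> (real^3) set \<Rightarrow>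
     (real^3 \<Rightarrow> real^3^3^3^3) \<Rightarrow> (real^3 \<Rightarrow> real^3^3^3^3) \<Rightarrow> (real^2 \<Rightarrow> real^3 \<Rightarrow> real^3^3^3^3) \<Rightarrow>
     (real^3 \<Rightarrow> real^3) \<Rightarrow>
     (real^3 \<Rightarrow> real^3) \<Rightarrow> (real^3 \<Rightarrow> real^3) \<Rightarrow> (real^2 \<Rightarrow> real^3 \<Rightarrow> real^3) \<Rightarrow> bool" where
  "unfolded_solution \<omega> L \<Gamma> Y0 ab aa aM f ub ua u0 \<longleftrightarrow>
     (ub, ua, u0) \<in> V_prime \<omega> L \<Gamma> Y0 \<and>
     (\<forall>(vb, va, v0) \<in> V_prime \<omega> L \<Gamma> Y0.
        energy (cylinder \<omega> {-L<..<0}) ab ub vb + energy (cylinder \<omega> {0<..<L}) aa ua va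
        + (LINT (x', y)|lebesgue_on (\<omega> \<times> Y0).
             tens (aM x' y) (strain_y \<omega> Y0 u0 x' y) \<bullet> strain_y \<omega> Y0 v0 x' y)
        = load (cylinder \<omega> {-L<..<0}) f vb + load (cylinder \<omega> {0<..<L}) f va)"

definition interface_solution ::
  "(real^2) set \<Rightarrow> real \<Rightarrow> (real^3) set \<Rightarrow>
     (real^3 \<Rightarrow> real^3^3^3^3) \<Rightarrow> (real^3 \<Rightarrow> real^3^3^3^3) \<Rightarrow> (real^2 \<Rightarrow> real^3^3) \<Rightarrow>
     (real^3 \<Rightarrow> real^3) \<Rightarrow> (real^3 \<Rightarrow> real^3) \<Rightarrow> (real^3 \<Rightarrow> real^3) \<Rightarrow> bool" where
  "interface_solution \<omega> L \<Gamma> ab aa H f ua ub \<longleftrightarrow>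
     ua \<in> H1 (cylinder \<omega> {0<..<L}) \<and> ub \<in> H1_zero_on \<Gamma> (cylinder \<omega> {-L<..<0}) \<and>
     (\<forall>va \<in> H1 (cylinder \<omega> {0<..<L}). \<forall>vb \<in> H1_zero_on \<Gamma> (cylinder \<omega> {-L<..<0}).
        energy (cylinder \<omega> {-L<..<0}) ab ub vb + energy (cylinder \<omega> {0<..<L}) aa ua va
        + (LINT x'|lebesgue_on \<omega>.
             (H x' *v (trace_at (cylinder \<omega> {0<..<L}) ua (pt3 x' 0)
                       - trace_at (cylinder \<omega> {-L<..<0}) ub (pt3 x' 0)))
             \<bullet> (trace_at (cylinder \<omega> {0<..<L}) va (pt3 x' 0)
                - trace_at (cylinder \<omega> {-L<..<0}) vb (pt3 x' 0)))
        = load (cylinder \<omega> {-L<..<0}) f vb + load (cylinder \<omega> {0<..<L}) f va)"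

definition correctors ::
  "(real^2) set \<Rightarrow> (real^3) set \<Rightarrow> (real^2 \<Rightarrow> real^3 \<Rightarrow> real^3^3^3^3) \<Rightarrow>
     (3 \<Rightarrow> real^2 \<Rightarrow> real^3 \<Rightarrow> real^3) \<Rightarrow> bool" where
  "correctors \<omega> Y0 aM X \<longleftrightarrow>
     (\<forall>i. X i \<in> Linf_H1_per \<omega> Y0 \<and>
        (AE (x', z) in lebesgue_on (\<omega> \<times> unit_square).
           has_trace Y0 (X i x') (pt3 z 1) (axis i 1) \<and> has_trace Y0 (X i x') (pt3 z 0) 0) \<and>
        (AE x' in lebesgue_on \<omega>. \<forall>\<psi>\<in>V0_cell Y0.
           (LINT y|lebesgue_on Y0. tens (aM x' y) (strain_y \<omega> Y0 (X i) x' y) \<bullet> strain Y0 \<psi> y) = 0))"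

definition interface_matrix ::
  "(real^2) set \<Rightarrow> (real^3) set \<Rightarrow> (real^2 \<Rightarrow> real^3 \<Rightarrow> real^3^3^3^3) \<Rightarrow>
     (3 \<Rightarrow> real^2 \<Rightarrow> real^3 \<Rightarrow> real^3) \<Rightarrow> real^2 \<Rightarrow> real^3^3" where
  "interface_matrix \<omega> Y0 aM X x' = (\<chi> i j.
     LINT y|lebesgue_on Y0. tens (aM x' y) (strain_y \<omega> Y0 (X i) x' y) \<bullet> strain_y \<omega> Y0 (X j) x' y)"

end

theory Submission
  imports Defs
begin

text \<open>The unfolded displacement minus the combination of correctors with the same boundary values is
  admissible as a test function; it has zero energy, so its strain vanishes by coercivity, and the
  Korn inequality together with the boundary values on one face of the cell forces it to vanish. Inserting
  combinations of correctors as test functions then turns the cell energy into the quadratic form of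
  \<open>H\<close>. Uniqueness is the same energy argument: a displacement with zero strain in a cylinder is
  rigid, and a rigid displacement vanishing on a set of positive surface measure is zero.

  Two analytic facts carry the argument. By the Lebesgue differentiation theorem a function whose weak
  derivative in the direction \<open>h\<close> vanishes takes the same value at Lebesgue points \<open>z\<close> and \<open>z + h\<close>; applied
  to \<open>u \<bullet> h\<close> this shows that zero strain implies \<open>(u x - u y) \<bullet> (x - y) = 0\<close>, hence rigidity, without any
  second derivatives. Applied to \<open>u\<close> minus its vertical primitive it represents \<open>u\<close> on a cylinder as
  \<open>c (x') + \<integral> \<partial>\<^sub>3 u\<close>, and \<open>c\<close> is the square integrable Lebesgue boundary value.\<close>

section \<open>Lebesgue points\<close>


text \<open>The notion of boundary value shapes the proof. Traces are pointwise limits of means, so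
  neither existence nor measurability comes for free. On the cell, correctors and the unfolded
  displacement carry their face values in their definitions, and linear combinations inherit them.
  On the two cylinders existence has to be proved, because every pair of displacements must be
  completed to an element of \<open>V_prime\<close>, and this needs square integrable values on the
  interface. A second difficulty is that strains of functions of (x', y) come in two versions, one
  chosen slice by slice and one jointly measurable; passing between cell and product identities
  requires that they agree almost everywhere. Coercivity of \<open>H\<close> is not established on
  its own: the quadratic form is read back as the energy of a combination of correctors, to which
  coercivity of the cell tensor and Korn apply. Positive surface measure of \<Gamma> excludes a
  nonzero rotation because the zero set of such a rigid displacement lies in a line, and segments
  have no area.\<close>

lemma integrable_lebesgue_on:
  fixes f :: "'a::euclidean_space \<Rightarrow> 'b::euclidean_space"
  assumes "integrable lebesgue f" "S \<in> sets lebesgue"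
  shows "integrable (lebesgue_on S) f"
  using integrable_mult_indicator[OF assms(2,1)] assms(2) by (simp add: integrable_restrict_space)

lemma integrable_lebesgue_on_subset:
  fixes f :: "'a::euclidean_space \<Rightarrow> 'b::euclidean_space"
  assumes "integrable (lebesgue_on T) f" "S \<in> sets lebesgue" "T \<in> sets lebesgue" "S \<subseteq> T"
  shows "integrable (lebesgue_on S) f"
proof -
  have "integrable lebesgue (\<lambda>x. indicator T x *\<^sub>R f x)"
    using assms by (simp add: integrable_restrict_space)
  from integrable_lebesgue_on[OF this assms(2)] show ?thesis
    by (rule Bochner_Integration.integrable_cong[THEN iffD1, rotated -1]) (use assms(4) in \<open>auto simp: indicator_def\<close>)
qed

text \<open>Stands in for absolute continuity of the integral: from
  \<open>g <= K + max 0 (g - K)\<close>, the integral of \<open>g\<close> over a set of measure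
  \<open>\<epsilon>\<close> is at most \<open>K * \<epsilon>\<close> plus this tail.\<close>

lemma integrable_tail_small:
  fixes g :: "'a \<Rightarrow> real"
  assumes g: "integrable M g" and "\<eta> > 0"
  obtains K where "K \<ge> 0" "(LINT x|M. max 0 (g x - K)) \<le> \<eta>"
proof -
  have "(\<lambda>n::nat. LINT x|M. max 0 (g x - real n)) \<longlonglongrightarrow> (LINT x|M. 0)"
  proof (rule integral_dominated_convergence)
    show "integrable M (\<lambda>x. \<bar>g x\<bar>)" using g by simp
    show "AE x in M. (\<lambda>n. max 0 (g x - real n)) \<longlonglongrightarrow> 0"
    proof (rule AE_I2)
      fix x
      obtain N where "g x \<le> real N" using real_arch_simple by blast
      hence "\<forall>n\<ge>N. max 0 (g x - real n) = 0" by auto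
      thus "(\<lambda>n. max 0 (g x - real n)) \<longlonglongrightarrow> 0"
        by (intro tendsto_eventually) (auto simp: eventually_sequentially)
    qed
  qed (use g in auto)
  then obtain n where "(LINT x|M. max 0 (g x - real n)) < \<eta>"
    using \<open>\<eta> > 0\<close> by (auto simp: tendsto_iff eventually_sequentially dist_real_def)
  thus ?thesis by (intro that[of "real n"]) auto
qed

text \<open>Vitali selects disjoint balls inside \<open>W\<close> that cover \<open>S\<close> up to
  a null set, and each has average above \<open>q\<close>; summing bounds their total measure.
  \<open>S\<close> is not assumed measurable, so the bound is given for a measurable superset
  \<open>C\<close>, the balls together with the null remainder.\<close>

lemma Vitali_average_bound:
  fixes g :: "'a::euclidean_space \<Rightarrow> real"
  assumes g: "integrable lebesgue g" and g0: "\<And>x. 0 \<le> g x" and q: "0 < q"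
    and S: "\<And>x d. x \<in> S \<Longrightarrow> 0 < d \<Longrightarrow>
       \<exists>r. 0 < r \<and> r < d \<and> q * measure lebesgue (ball x r) < (LINT y|lebesgue_on (ball x r). g y)"
    and W: "open W" "S \<subseteq> W" "W \<in> lmeasurable"
  obtains C where "C \<in> lmeasurable" "S \<subseteq> C" "q * measure lebesgue C \<le> (LINT y|lebesgue_on W. g y)"
proof -
  define K where "K = {(x, r). 0 < r \<and> ball x r \<subseteq> W \<and> q * measure lebesgue (ball x r) < (LINT y|lebesgue_on (ball x r). g y)}"
  obtain D where D: "countable D" "D \<subseteq> K"
     "pairwise (\<lambda>i j. disjnt (ball (fst i) (snd i)) (ball (fst j) (snd j))) D"
     "negligible (S - (\<Union>i \<in> D. ball (fst i) (snd i)))"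
  proof (rule Vitali_covering_theorem_balls[of S K fst snd])
    fix x d assume x: "x \<in> S" and "(0::real) < d"
    then obtain e where e: "e > 0" "ball x e \<subseteq> W"
      using W by (meson openE subsetD)
    obtain r where "0 < r" "r < min d e" "q * measure lebesgue (ball x r) < (LINT y|lebesgue_on (ball x r). g y)"
      using S[OF x, of "min d e"] \<open>0<d\<close> e by auto
    moreover have "ball x r \<subseteq> W" using e \<open>r < min d e\<close> by (meson min_less_iff_conj subset_ball order_trans less_imp_le)
    ultimately show "\<exists>i. i \<in> K \<and> x \<in> ball (fst i) (snd i) \<and> snd i < d"
      by (intro exI[of _ "(x,r)"]) (auto simp: K_def)
  qed auto
  define B where "B = (\<Union>i \<in> D. ball (fst i) (snd i))"
  define N where "N = S - B"
  have BW: "B \<subseteq> W" using D(2) unfolding B_def K_def by (force simp: case_prod_unfold)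
  have Bs: "B \<in> sets lebesgue"
    unfolding B_def by (intro sets.countable_UN'' D(1)) auto
  have Bm: "B \<in> lmeasurable" using BW Bs W(3) fmeasurableI2 by blast
  have gm [measurable]: "g \<in> borel_measurable lebesgue" using g by auto
  \<comment> \<open>The integral of \<open>g\<close> as a measure: the sum over the disjoint balls
    becomes countable additivity.\<close>
  define \<nu> where "\<nu> = density lebesgue (\<lambda>x. ennreal (g x))"
  have \<nu>: "emeasure \<nu> A = ennreal (LINT y|lebesgue_on A. g y)" if A[measurable]: "A \<in> sets lebesgue" for A
  proof -
    have "integrable lebesgue (\<lambda>y. indicator A y * g y)"
      using integrable_mult_indicator[OF A g] by simp
    hence "(\<integral>\<^sup>+ y. ennreal (indicator A y * g y) \<partial>lebesgue) = ennreal (LINT y|lebesgue. indicator A y * g y)"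
      by (intro nn_integral_eq_integral) (auto simp: g0)
    thus ?thesis using A
      by (simp add: \<nu>_def emeasure_density integral_restrict_space set_lebesgue_integral_def ennreal_mult' ennreal_indicator mult.commute ennreal_mult'')
  qed
  have disj: "disjoint_family_on (\<lambda>i. ball (fst i) (snd i)) D"
    using D(3) by (auto simp: disjoint_family_on_def pairwise_def disjnt_def)
  have "ennreal q * emeasure lebesgue B = ennreal q * (\<integral>\<^sup>+i. emeasure lebesgue (ball (fst i) (snd i)) \<partial>count_space D)"
    unfolding B_def by (subst emeasure_UN_countable) (use D(1) disj in auto)
  also have "\<dots> = (\<integral>\<^sup>+i. ennreal q * emeasure lebesgue (ball (fst i) (snd i)) \<partial>count_space D)"
    by (subst nn_integral_cmult) auto
  also have "\<dots> \<le> (\<integral>\<^sup>+i. emeasure \<nu> (ball (fst i) (snd i)) \<partial>count_space D)"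
  proof (rule nn_integral_mono)
    fix i assume "i \<in> space (count_space D)"
    hence "q * measure lebesgue (ball (fst i) (snd i)) < (LINT y|lebesgue_on (ball (fst i) (snd i)). g y)"
      using D(2) by (auto simp: K_def case_prod_unfold)
    hence "ennreal (q * measure lebesgue (ball (fst i) (snd i))) \<le> ennreal (LINT y|lebesgue_on (ball (fst i) (snd i)). g y)"
      by (intro ennreal_leI) auto
    thus "ennreal q * emeasure lebesgue (ball (fst i) (snd i)) \<le> emeasure \<nu> (ball (fst i) (snd i))"
      using q by (simp add: \<nu> ennreal_mult emeasure_eq_measure2 lmeasurable_ball)
  qed
  also have "\<dots> = emeasure \<nu> B"
    unfolding B_def by (subst emeasure_UN_countable) (use D(1) disj in \<open>auto simp: \<nu>_def\<close>)
  also have "\<dots> \<le> emeasure \<nu> W"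
    by (rule emeasure_mono[OF BW]) (use W in \<open>auto simp: \<nu>_def\<close>)
  also have "\<dots> = ennreal (LINT y|lebesgue_on W. g y)" using W by (intro \<nu>) auto
  finally have "ennreal (q * measure lebesgue B) \<le> ennreal (LINT y|lebesgue_on W. g y)"
    using q Bm by (simp add: ennreal_mult emeasure_eq_measure2)
  moreover have "0 \<le> (LINT y|lebesgue_on W. g y)" by (simp add: g0)
  ultimately have *: "q * measure lebesgue B \<le> (LINT y|lebesgue_on W. g y)" by simp
  have Nn: "negligible N" using D(4) by (simp add: N_def B_def)
  hence "measure lebesgue (B \<union> N) = measure lebesgue B"
    by (metis Bm fmeasurableD measure_Un_null_set negligible_iff_null_sets)
  moreover have "B \<union> N \<in> lmeasurable" using Bm Nn by (simp add: fmeasurable.Un negligible_imp_measurable)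
  ultimately show ?thesis using * by (intro that[of "B \<union> N"]) (auto simp: N_def)
qed

text \<open>\<open>m\<close> is the outer measure of the exceptional set \<open>S\<close>, which is
  not known to be measurable. An open set that exceeds a nearly optimal cover by little has
  \<open>g < p\<close> on most of it, so the covering estimate gives \<open>q * m <= p * m\<close>
  up to an arbitrary error, and \<open>p < q\<close> forces \<open>m = 0\<close>.\<close>

lemma average_le_negligible:
  fixes g :: "'a::euclidean_space \<Rightarrow> real"
  assumes g: "integrable lebesgue g" and g0: "\<And>x. 0 \<le> g x" and pq: "0 < p" "p < q"
    and W: "open W" "bounded W"
  shows "negligible {x \<in> W. g x < p \<and> (\<forall>d>0. \<exists>r. 0 < r \<and> r < d \<and>
           q * measure lebesgue (ball x r) < (LINT y|lebesgue_on (ball x r). g y))}" (is "negligible ?S")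
proof -
  define S where "S = ?S"
  define T where "T = {x \<in> W. g x < p}"
  define m where "m = (INF C\<in>{C\<in>lmeasurable. S \<subseteq> C}. measure lebesgue C)"
  have gm [measurable]: "g \<in> borel_measurable lebesgue" using g by auto
  have Wm: "W \<in> lmeasurable" using W by (simp add: bounded_set_imp_lmeasurable)
  have "{x \<in> space lebesgue. g x < p} \<in> sets lebesgue" by measurable
  moreover have "T = W \<inter> {x \<in> space lebesgue. g x < p}" by (auto simp: T_def)
  ultimately have Ts: "T \<in> sets lebesgue" using Wm by (auto simp: fmeasurableD)
  have bdd: "bdd_below (measure lebesgue ` {C\<in>lmeasurable. S \<subseteq> C})"
    by (rule bdd_belowI[of _ 0]) auto
  have ne: "{C\<in>lmeasurable. S \<subseteq> C} \<noteq> {}" using Wm by (auto simp: S_def)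
  have m0: "0 \<le> m" unfolding m_def using ne by (intro cINF_greatest) auto
  have "(q - p) * m \<le> \<eta>" if "\<eta> > 0" for \<eta>
  proof -
    obtain K where K: "K \<ge> 0" "(LINT x|lebesgue. max 0 (g x - K)) \<le> \<eta> / 2"
      using integrable_tail_small[OF g, of "\<eta>/2"] \<open>\<eta>>0\<close> by auto
    \<comment> \<open>Half of \<open>\<eta>\<close> goes to the tail. This choice makes
      \<open>(p + K) * \<epsilon>\<close> the other half: \<open>p * \<epsilon>\<close> for the
      excess of the cover over \<open>m\<close>, \<open>K * \<epsilon>\<close> for the part of the
      open set outside \<open>T1\<close>.\<close>
    define \<epsilon> where "\<epsilon> = \<eta> / (2 * (p + K))"
    have eps: "\<epsilon> > 0" "(p + K) * \<epsilon> = \<eta> / 2" using \<open>\<eta>>0\<close> pq K by (auto simp: \<epsilon>_def field_simps)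
    have "m < m + \<epsilon>" using eps by simp
    then obtain C1 where C1: "C1 \<in> lmeasurable" "S \<subseteq> C1" "measure lebesgue C1 < m + \<epsilon>"
      unfolding m_def by (subst (asm) (1) cINF_less_iff[OF ne bdd]) auto
    \<comment> \<open>Cutting the cover down to \<open>T\<close> keeps \<open>S\<close> covered and
      gives \<open>g < p\<close> on all of it.\<close>
    define T1 where "T1 = C1 \<inter> T"
    have T1: "T1 \<in> lmeasurable" using C1 Ts by (simp add: T1_def fmeasurable_Int_fmeasurable)
    have T1m: "measure lebesgue T1 \<le> m + \<epsilon>"
      using measure_mono_fmeasurable[of T1 C1 lebesgue] C1 T1 by (auto simp: T1_def)
    obtain V where V: "open V" "T1 \<subseteq> V" "(V - T1) \<in> lmeasurable" "emeasure lebesgue (V - T1) < ennreal \<epsilon>"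
      using sets_lebesgue_outer_open[of T1 \<epsilon>] T1 eps by auto
    define U where "U = V \<inter> W"
    have U: "open U" "T1 \<subseteq> U" "U \<in> lmeasurable"
      using V W Wm by (auto simp: U_def T1_def T_def fmeasurable_Int_fmeasurable fmeasurableD bounded_set_imp_lmeasurable
           bounded_Int lmeasurable_open)
    have UT: "U - T1 \<in> lmeasurable" using U T1 by auto
    have "measure lebesgue (U - T1) \<le> measure lebesgue (V - T1)"
      by (rule measure_mono_fmeasurable) (use V UT in \<open>auto simp: U_def\<close>)
    also have "\<dots> < \<epsilon>" using V eps by (simp add: emeasure_eq_measure2 ennreal_less_iff)
    finally have UTm: "measure lebesgue (U - T1) \<le> \<epsilon>" by simp
    have ST: "S \<subseteq> T1" using C1 by (auto simp: T1_def S_def T_def)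
    obtain C where C: "C \<in> lmeasurable" "S \<subseteq> C" "q * measure lebesgue C \<le> (LINT y|lebesgue_on U. g y)"
      by (rule Vitali_average_bound[OF g g0, of q S U]) (use pq U ST in \<open>auto simp: S_def\<close>)
    have "m \<le> measure lebesgue C" unfolding m_def using C by (intro cINF_lower bdd) auto
    hence "q * m \<le> q * measure lebesgue C" using pq by simp
    also note C(3)
    also have "(LINT y|lebesgue_on U. g y) = (LINT y|lebesgue. indicator U y * g y)"
      using U by (simp add: integral_restrict_space set_lebesgue_integral_def fmeasurableD)
    also have "\<dots> \<le> (LINT y|lebesgue. p * indicator T1 y + (K * indicator (U - T1) y + max 0 (g y - K)))"
    proof (rule integral_mono)
      show "integrable lebesgue (\<lambda>y. indicat_real U y * g y)"
        using integrable_mult_indicator[of U lebesgue g] U g by auto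
      have "integrable lebesgue (\<lambda>y. max 0 (g y - K))"
        by (rule Bochner_Integration.integrable_bound[OF g]) (use K g0 in \<open>auto simp: max_def\<close>)
      thus "integrable lebesgue (\<lambda>y. p * indicator T1 y + (K * indicator (U - T1) y + max 0 (g y - K)))"
        using T1 UT by (intro Bochner_Integration.integrable_add) (auto simp: lmeasurable_iff_integrable)
      show "indicat_real U y * g y \<le> p * indicator T1 y + (K * indicator (U - T1) y + max 0 (g y - K))" for y
        using U K by (auto simp: indicator_def T1_def T_def)
    qed
    also have "\<dots> = p * measure lebesgue T1 + (K * measure lebesgue (U - T1) + (LINT y|lebesgue. max 0 (g y - K)))"
    proof -
      have "integrable lebesgue (\<lambda>y. max 0 (g y - K))"
        by (rule Bochner_Integration.integrable_bound[OF g]) (use K g0 in \<open>auto simp: max_def\<close>)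
      thus ?thesis using T1 UT by (simp add: lmeasurable_iff_integrable)
    qed
    also have "\<dots> \<le> p * (m + \<epsilon>) + (K * \<epsilon> + \<eta> / 2)"
      using T1m UTm K pq by (intro add_mono mult_left_mono) auto
    also have "\<dots> = p * m + (p + K) * \<epsilon> + \<eta> / 2" by (simp add: algebra_simps)
    finally show ?thesis using eps(2) by (simp add: algebra_simps)
  qed
  hence "(q - p) * m \<le> 0" using dense_ge by blast
  hence "m = 0" using m0 pq by (simp add: mult_le_0_iff)
  have "negligible S" unfolding negligible_outer
  proof (intro allI impI)
    fix e :: real assume "e > 0"
    hence "m < e" using \<open>m = 0\<close> by simp
    thus "\<exists>T. S \<subseteq> T \<and> T \<in> lmeasurable \<and> measure lebesgue T < e"
      unfolding m_def by (subst (asm) cINF_less_iff[OF ne bdd]) auto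
  qed
  thus ?thesis by (simp add: S_def)
qed


lemma integral_norm_diff_le:
  fixes f :: "'a::euclidean_space \<Rightarrow> 'b::euclidean_space"
  assumes "integrable (lebesgue_on U) f" "U \<in> lmeasurable"
  shows "(LINT y|lebesgue_on U. norm (f y - a)) \<le> (LINT y|lebesgue_on U. norm (f y - c)) + norm (a - c) * measure lebesgue U"
proof -
  interpret finite_measure "lebesgue_on U" using assms(2) by (rule finite_measure_lebesgue_on)
  have "(LINT y|lebesgue_on U. norm (f y - a)) \<le> (LINT y|lebesgue_on U. norm (f y - c) + norm (a - c))"
  proof (rule integral_mono)
    show "norm (f x - a) \<le> norm (f x - c) + norm (a - c)" for x
      using norm_triangle_ineq4[of "f x - c" "a - c"] by simp
  qed (use assms in auto)
  also have "\<dots> = (LINT y|lebesgue_on U. norm (f y - c)) + norm (a - c) * measure lebesgue U"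
    using assms by (subst Bochner_Integration.integral_add) (auto simp: measure_restrict_space fmeasurableD)
  finally show ?thesis .
qed

definition lebesgue_point :: "('a::euclidean_space \<Rightarrow> 'b::euclidean_space) \<Rightarrow> 'a \<Rightarrow> bool" where
  "lebesgue_point f x \<longleftrightarrow>
     ((\<lambda>r. (LINT y|lebesgue_on (ball x r). norm (f y - f x)) / measure lebesgue (ball x r)) \<longlongrightarrow> 0) (at_right 0)"

text \<open>\<open>average_le_negligible\<close> is applied to \<open>norm (f y - c)\<close> for
  countably many centres \<open>c\<close>, radii \<open>N\<close> and rational \<open>p < q\<close>.
  Outside the union of these null sets, some \<open>c\<close> within \<open>\<epsilon> / 4\<close>
  of \<open>f x\<close> bounds the mean oscillation by \<open>q\<close> plus the distance from
  \<open>f x\<close> to \<open>c\<close>, which is below \<open>\<epsilon>\<close>.\<close>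

theorem AE_lebesgue_point:
  fixes f :: "'a::euclidean_space \<Rightarrow> 'b::euclidean_space"
  assumes f: "integrable lebesgue f"
  shows "AE x in lebesgue. lebesgue_point f x"
proof -
  obtain D :: "'b set" where D: "countable D" "\<And>X. open X \<Longrightarrow> X \<noteq> {} \<Longrightarrow> \<exists>d\<in>D. d \<in> X"
    using countable_dense_exists by blast
  \<comment> \<open>The cutoff to a ball of radius \<open>N\<close> makes
    \<open>norm (f y - c)\<close> integrable on the whole space.\<close>
  define g where "g = (\<lambda>(c, N::nat) y. indicator (ball 0 (real N)) y * norm (f y - c))"
  have gi: "integrable lebesgue (g (c, N))" for c N
  proof -
    have "integrable lebesgue (\<lambda>y. indicator (ball 0 (real N)) y *\<^sub>R (f y - c))"
      unfolding scaleR_diff_right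
    proof (intro Bochner_Integration.integrable_diff)
      show "integrable lebesgue (\<lambda>y. indicat_real (ball 0 (real N)) y *\<^sub>R f y)"
        using f by (intro integrable_mult_indicator) auto
      show "integrable lebesgue (\<lambda>y. indicat_real (ball 0 (real N)) y *\<^sub>R c)"
        by (intro integrable_scaleR_left) (simp add: flip: lmeasurable_iff_integrable)
    qed
    from integrable_norm[OF this] show ?thesis by (simp add: g_def)
  qed
  have Z: "AE x in lebesgue. \<not> (x \<in> ball 0 (real N) \<and> g (c, N) x < p \<and> (\<forall>d>0. \<exists>r. 0 < r \<and> r < d \<and>
           q * measure lebesgue (ball x r) < (LINT y|lebesgue_on (ball x r). g (c, N) y)))"
    if "0 < p" "p < q" for c N p q
  proof -
    have "negligible {x \<in> ball 0 (real N). g (c, N) x < p \<and> (\<forall>d>0. \<exists>r. 0 < r \<and> r < d \<and>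
           q * measure lebesgue (ball x r) < (LINT y|lebesgue_on (ball x r). g (c, N) y))}"
      by (rule average_le_negligible) (use gi that in \<open>auto simp: g_def\<close>)
    from AE_not_in[OF this[unfolded negligible_iff_null_sets]] show ?thesis by simp
  qed
  have "AE x in lebesgue. \<forall>c\<in>D. \<forall>N. \<forall>p\<in>\<rat>. \<forall>q\<in>\<rat>. 0 < p \<longrightarrow> p < q \<longrightarrow>
     \<not> (x \<in> ball 0 (real N) \<and> g (c, N) x < p \<and> (\<forall>d>0. \<exists>r. 0 < r \<and> r < d \<and>
           q * measure lebesgue (ball x r) < (LINT y|lebesgue_on (ball x r). g (c, N) y)))"
    apply (intro AE_ball_countable[THEN iffD2] ballI D(1) countable_rat AE_all_countable[THEN iffD2] allI)
    subgoal for c N p q using Z[of p q N c] by (cases "0 < p \<and> p < q") auto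
    done
  thus ?thesis
  proof (rule AE_mp, intro AE_I2 impI)
    fix x assume x: "\<forall>c\<in>D. \<forall>N. \<forall>p\<in>\<rat>. \<forall>q\<in>\<rat>. 0 < p \<longrightarrow> p < q \<longrightarrow>
     \<not> (x \<in> ball 0 (real N) \<and> g (c, N) x < p \<and> (\<forall>d>0. \<exists>r. 0 < r \<and> r < d \<and>
           q * measure lebesgue (ball x r) < (LINT y|lebesgue_on (ball x r). g (c, N) y)))"
    show "lebesgue_point f x" unfolding lebesgue_point_def
    proof (rule tendstoI)
      fix \<epsilon> :: real assume "\<epsilon> > 0"
      obtain N :: nat where N: "norm x < real N" using reals_Archimedean2 by blast
      obtain c where c: "c \<in> D" "norm (f x - c) < \<epsilon> / 4"
        using D(2)[of "ball (f x) (\<epsilon>/4)"] \<open>\<epsilon> > 0\<close> by (auto simp: dist_norm)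
      obtain p where p: "p \<in> \<rat>" "norm (f x - c) < p" "p < \<epsilon> / 4" using Rats_dense_in_real[OF c(2)] by auto
      obtain q where q: "q \<in> \<rat>" "p < q" "q < \<epsilon> / 4" using Rats_dense_in_real[OF p(3)] by auto
      have p0: "0 < p" using p(2) norm_ge_zero le_less_trans by blast
      have gx: "g (c, N) x < p" using p N by (simp add: g_def)
      obtain d where d: "d > 0" and dr: "\<And>r. 0 < r \<Longrightarrow> r < d \<Longrightarrow>
          (LINT y|lebesgue_on (ball x r). g (c, N) y) \<le> q * measure lebesgue (ball x r)"
        using x c(1) p(1) q(1,2) p0 gx N by (metis mem_ball_0 not_less)
      have "dist ((LINT y|lebesgue_on (ball x r). norm (f y - f x)) / measure lebesgue (ball x r)) 0 < \<epsilon>"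
        if r: "0 < r" "r < min d (real N - norm x)" for r
      proof -
        have sub: "ball x r \<subseteq> ball 0 (real N)"
          using r(2) by (auto simp: dist_norm) (smt (verit) norm_triangle_sub norm_minus_commute)
        have mp: "measure lebesgue (ball x r) > 0" using r by (simp add: content_ball_pos)
        have "(LINT y|lebesgue_on (ball x r). norm (f y - c)) = (LINT y|lebesgue_on (ball x r). g (c, N) y)"
          by (rule Bochner_Integration.integral_cong) (use sub in \<open>auto simp: g_def indicator_def\<close>)
        also have "\<dots> \<le> q * measure lebesgue (ball x r)" using dr r by auto
        finally have 1: "(LINT y|lebesgue_on (ball x r). norm (f y - c)) \<le> q * measure lebesgue (ball x r)" .
        have "(LINT y|lebesgue_on (ball x r). norm (f y - f x))
              \<le> (LINT y|lebesgue_on (ball x r). norm (f y - c)) + norm (f x - c) * measure lebesgue (ball x r)"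
          by (rule integral_norm_diff_le) (auto intro: integrable_lebesgue_on f)
        also have "\<dots> \<le> (\<epsilon>/4 + \<epsilon>/4) * measure lebesgue (ball x r)"
          using 1 q c(2) mp unfolding distrib_right
          by (intro add_mono order_trans[OF 1] mult_right_mono) auto
        also have "\<dots> < \<epsilon> * measure lebesgue (ball x r)" using \<open>\<epsilon> > 0\<close> mp by simp
        finally show ?thesis using mp by (simp add: dist_real_def divide_less_eq)
      qed
      thus "\<forall>\<^sub>F r in at_right 0. dist ((LINT y|lebesgue_on (ball x r). norm (f y - f x)) / measure lebesgue (ball x r)) 0 < \<epsilon>"
        unfolding eventually_at_right_field using d N by (intro exI[of _ "min d (real N - norm x)"]) auto
    qed
  qed
qed

lemma lebesgue_point_average:
  fixes f :: "'a::euclidean_space \<Rightarrow> 'b::euclidean_space"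
  assumes f: "integrable lebesgue f" and x: "lebesgue_point f x"
  shows "((\<lambda>r. (LINT y|lebesgue_on (ball x r). f y) /\<^sub>R measure lebesgue (ball x r)) \<longlongrightarrow> f x) (at_right 0)"
proof -
  have "\<forall>\<^sub>F r in at_right (0::real). r > 0" by (simp add: eventually_at_right_less)
  hence "\<forall>\<^sub>F r in at_right 0. norm ((LINT y|lebesgue_on (ball x r). f y) /\<^sub>R measure lebesgue (ball x r) - f x)
     \<le> (LINT y|lebesgue_on (ball x r). norm (f y - f x)) / measure lebesgue (ball x r)"
  proof eventually_elim
    case (elim r)
    let ?m = "measure lebesgue (ball x r)"
    have m: "?m > 0" using elim by (simp add: content_ball_pos)
    interpret finite_measure "lebesgue_on (ball x r)" by (rule finite_measure_lebesgue_on) simp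
    have fi: "integrable (lebesgue_on (ball x r)) f"
      by (rule integrable_lebesgue_on[OF f]) auto
    have "(LINT y|lebesgue_on (ball x r). f y - f x) = (LINT y|lebesgue_on (ball x r). f y) - ?m *\<^sub>R f x"
      using fi by (subst Bochner_Integration.integral_diff) (auto simp: measure_restrict_space)
    hence "(LINT y|lebesgue_on (ball x r). f y) /\<^sub>R ?m - f x = (LINT y|lebesgue_on (ball x r). f y - f x) /\<^sub>R ?m"
      using m by (simp add: scaleR_diff_right)
    also have "norm \<dots> \<le> (LINT y|lebesgue_on (ball x r). norm (f y - f x)) / ?m"
      using m integral_norm_bound[of "lebesgue_on (ball x r)" "\<lambda>y. f y - f x"]
      by (simp add: divide_inverse mult.commute mult_left_mono)
    finally show ?case .
  qed
  hence "((\<lambda>r. (LINT y|lebesgue_on (ball x r). f y) /\<^sub>R measure lebesgue (ball x r) - f x) \<longlongrightarrow> 0) (at_right 0)"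
    by (rule Lim_null_comparison) (use x in \<open>simp add: lebesgue_point_def\<close>)
  thus ?thesis by (rule Lim_null[THEN iffD2])
qed

section \<open>Weak directional derivatives\<close>

lemma has_real_derivative_max0_sq:
  "((\<lambda>s::real. (max 0 s)\<^sup>2) has_real_derivative 2 * max 0 s) (at s)"
proof -
  consider "s < 0" | "s > 0" | "s = 0" by linarith
  thus ?thesis
  proof cases
    case 1
    have "((\<lambda>s::real. 0) has_real_derivative 2 * max 0 s) (at s)" using 1 by (auto intro!: derivative_eq_intros)
    thus ?thesis by (rule has_field_derivative_transform_within_open[of _ _ _ "{..<0}"]) (use 1 in auto)
  next
    case 2
    have "((\<lambda>s::real. s\<^sup>2) has_real_derivative 2 * max 0 s) (at s)" using 2 by (auto intro!: derivative_eq_intros)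
    thus ?thesis by (rule has_field_derivative_transform_within_open[of _ _ _ "{0<..}"]) (use 2 in auto)
  next
    case 3
    have "((\<lambda>h::real. (max 0 h)\<^sup>2 / h) \<longlongrightarrow> 0) (at 0)"
    proof (rule Lim_null_comparison[OF always_eventually])
      show "\<forall>h::real. norm ((max 0 h)\<^sup>2 / h) \<le> \<bar>h\<bar>" by (auto simp: max_def power2_eq_square)
      show "((\<lambda>h::real. \<bar>h\<bar>) \<longlongrightarrow> 0) (at 0)" by (intro tendsto_eq_intros) auto
    qed
    thus ?thesis using 3 by (simp add: DERIV_def)
  qed
qed

text \<open>As \<open>n\<close> grows these tend to the indicator of the open ball of radius
  \<open>r\<close>: the value is \<open>1 - 1 / (1 + n * s)\<close> for \<open>s\<close> the square
  of the positive part of \<open>r\<^sup>2 - x \<bullet> x\<close>. Squaring the positive part makes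
  the function C^1 across the sphere, which is the regularity that \<open>test_function\<close> asks
  for.\<close>

definition bump :: "real \<Rightarrow> nat \<Rightarrow> 'a::real_inner \<Rightarrow> real" where
  "bump r n x = 1 - 1 / (1 + real n * (max 0 (r\<^sup>2 - x \<bullet> x))\<^sup>2)"

definition bump_grad :: "real \<Rightarrow> nat \<Rightarrow> 'a::real_inner \<Rightarrow> 'a" where
  "bump_grad r n x = - (4 * real n * max 0 (r\<^sup>2 - x \<bullet> x) / (1 + real n * (max 0 (r\<^sup>2 - x \<bullet> x))\<^sup>2)\<^sup>2) *\<^sub>R x"

lemma bump_denom_pos: "0 < 1 + real n * (max 0 c)\<^sup>2"
  by (meson add_pos_nonneg zero_less_one mult_nonneg_nonneg of_nat_0_le_iff zero_le_power2)

lemma has_derivative_bump: "(bump r n has_derivative (\<lambda>h. bump_grad r n x \<bullet> h)) (at x)"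
proof -
  define F where "F = (\<lambda>s. 1 - 1 / (1 + real n * (max 0 s)\<^sup>2))"
  have F: "(F has_real_derivative (2 * real n * max 0 s / (1 + real n * (max 0 s)\<^sup>2)\<^sup>2)) (at s)" for s
  proof -
    define t where "t = (max 0 s)\<^sup>2"
    have t: "1 + real n * t > 0" using bump_denom_pos[of n s] by (simp add: t_def)
    have "((\<lambda>t. 1 - 1 / (1 + real n * t)) has_real_derivative (real n / (1 + real n * t)\<^sup>2)) (at t)"
      using t by (auto intro!: derivative_eq_intros simp: power2_eq_square)
    from DERIV_chain2[OF this[unfolded t_def] has_real_derivative_max0_sq]
    show ?thesis unfolding F_def by (simp add: mult_ac)
  qed
  have "((\<lambda>x. F (r\<^sup>2 - x \<bullet> x)) has_derivative (\<lambda>h. (2 * real n * max 0 (r\<^sup>2 - x \<bullet> x) / (1 + real n * (max 0 (r\<^sup>2 - x \<bullet> x))\<^sup>2)\<^sup>2) * (- 2 * (x \<bullet> h)))) (at x)"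
  proof (rule has_derivative_compose[where f="\<lambda>x. r\<^sup>2 - x \<bullet> x" and g=F, OF _ F[unfolded has_field_derivative_def]])
    show "((\<lambda>x. r\<^sup>2 - x \<bullet> x) has_derivative (\<lambda>h. - 2 * (x \<bullet> h))) (at x)"
      by (auto intro!: derivative_eq_intros simp: inner_commute)
  qed
  moreover have "bump r n = (\<lambda>x::'a. F (r\<^sup>2 - x \<bullet> x))" by (auto simp: bump_def F_def)
  ultimately show ?thesis by (simp add: bump_grad_def mult.assoc)
qed

lemma continuous_bump_grad: "continuous_on UNIV (bump_grad r n)"
  unfolding bump_grad_def using less_imp_neq[OF bump_denom_pos, of n, symmetric]
  by (intro continuous_intros) auto

lemma bump_bounds: "0 \<le> bump r n x" "bump r n x \<le> 1"
  using bump_denom_pos[of n "r\<^sup>2 - x \<bullet> x"] by (auto simp: bump_def)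

lemma bump_zero: assumes "r > 0" "r \<le> norm x" shows "bump r n x = 0"
proof -
  have "r\<^sup>2 \<le> x \<bullet> x" using assms by (metis power2_norm_eq_inner power_mono less_imp_le)
  thus ?thesis by (simp add: bump_def)
qed

lemma bump_tendsto:
  assumes "r > 0"
  shows "(\<lambda>n. bump r n (x - z)) \<longlonglongrightarrow> indicator (ball z r) x"
proof (cases "x \<in> ball z r")
  case False
  hence "bump r n (x - z) = 0" for n
    by (intro bump_zero assms) (auto simp: dist_norm norm_minus_commute)
  thus ?thesis using False by simp
next
  case True
  define c where "c = (max 0 (r\<^sup>2 - (x - z) \<bullet> (x - z)))\<^sup>2"
  have "norm (x - z) < r" using True by (simp add: dist_norm norm_minus_commute)
  hence "(x - z) \<bullet> (x - z) < r\<^sup>2"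
    by (metis power2_norm_eq_inner power_strict_mono norm_ge_zero zero_less_numeral)
  hence c: "c > 0" by (simp add: c_def)
  have "filterlim (\<lambda>n. 1 + real n * c) at_top sequentially"
    using c by (intro filterlim_tendsto_add_at_top[OF tendsto_const]
        filterlim_at_top_mult_tendsto_pos[OF tendsto_const c filterlim_real_sequentially])
  hence "(\<lambda>n. 1 - 1 / (1 + real n * c)) \<longlonglongrightarrow> 1 - 0"
    by (intro tendsto_diff tendsto_const tendsto_divide_0[OF tendsto_const] filterlim_at_top_imp_at_infinity)
  thus ?thesis using True by (simp add: bump_def c_def)
qed

lemma has_derivative_translate:
  fixes f :: "'a::real_normed_vector \<Rightarrow> 'b::real_normed_vector"
  assumes "\<And>x. (f has_derivative D x) (at x)"
  shows "((\<lambda>x. f (x - z)) has_derivative D (x - z)) (at x)"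
  by (rule has_derivative_compose[where f="\<lambda>x. x - z", OF _ assms, simplified])
     (auto intro!: derivative_eq_intros)

lemma test_function_bump:
  assumes "r > 0" "cball z r \<subseteq> U"
  shows "test_function U (\<lambda>x. bump r n (x - z)) (\<lambda>x. bump_grad r n (x - z))"
  unfolding test_function_def
proof (intro conjI allI exI[of _ "cball z r"] impI)
  show "((\<lambda>x. bump r n (x - z)) has_derivative (\<lambda>h. bump_grad r n (x - z) \<bullet> h)) (at x)" for x
    by (rule has_derivative_translate[OF has_derivative_bump])
  show "continuous_on UNIV (\<lambda>x::real^3. bump_grad r n (x - z))"
    by (rule continuous_on_compose2[OF continuous_bump_grad]) (auto intro!: continuous_intros)
  show "bump r n (x - z) = 0" if "x \<notin> cball z r" for x
    using that by (intro bump_zero assms) (auto simp: dist_norm norm_minus_commute)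
qed (use assms in auto)

lemma test_function_grad_zero:
  assumes "(\<phi> has_derivative (\<lambda>h. g x \<bullet> h)) (at (x::real^3))" "closed K" "\<And>x. x \<notin> K \<Longrightarrow> \<phi> x = (0::real)" "x \<notin> K"
  shows "g x = 0"
proof -
  have "((\<lambda>x. 0) has_derivative (\<lambda>h. g x \<bullet> h)) (at x)"
    by (rule has_derivative_transform_within_open[OF assms(1), of "- K"]) (use assms in auto)
  from has_derivative_unique[OF this has_derivative_const] have "g x \<bullet> g x = 0" by metis
  thus ?thesis by simp
qed

lemma test_function_bounded:
  assumes "test_function U \<phi> g"
  obtains B where "\<And>x. \<bar>\<phi> x\<bar> \<le> B" "\<And>x. norm (g x) \<le> B"
proof -
  obtain K where K: "compact K" "\<And>x. x \<notin> K \<Longrightarrow> \<phi> x = 0"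
    and d: "\<And>x. (\<phi> has_derivative (\<lambda>h. g x \<bullet> h)) (at x)" and c: "continuous_on UNIV g"
    using assms unfolding test_function_def by blast
  have g0: "g x = 0" if "x \<notin> K" for x
    using test_function_grad_zero[of \<phi> g x K] d K compact_imp_closed that by blast
  have "continuous_on K \<phi>" using d by (meson has_derivative_continuous continuous_at_imp_continuous_on)
  hence "bounded (\<phi> ` K)" using compact_continuous_image[OF _ K(1)] compact_imp_bounded by blast
  then obtain B1 where B1: "\<And>x. x \<in> K \<Longrightarrow> \<bar>\<phi> x\<bar> \<le> B1"
    unfolding bounded_iff by auto
  have "bounded (g ` K)"
    using compact_continuous_image[OF continuous_on_subset[OF c subset_UNIV] K(1)] compact_imp_bounded by blast
  then obtain B2 where B2: "\<And>x. x \<in> K \<Longrightarrow> norm (g x) \<le> B2"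
    unfolding bounded_iff by auto
  show ?thesis
  proof (rule that[of "max 0 (max B1 B2)"])
    show "\<bar>\<phi> x\<bar> \<le> max 0 (max B1 B2)" for x using B1[of x] K(2)[of x] by (cases "x \<in> K") auto
    show "norm (g x) \<le> max 0 (max B1 B2)" for x using B2[of x] g0[of x] by (cases "x \<in> K") auto
  qed
qed

lemma test_function_continuous:
  assumes "test_function U \<phi> g"
  shows "continuous_on UNIV \<phi>" "continuous_on UNIV g"
  using assms unfolding test_function_def
  by (auto intro!: continuous_at_imp_continuous_on has_derivative_continuous)

lemma test_function_measurable:
  assumes "test_function U \<phi> g"
  shows "\<phi> \<in> borel_measurable (lebesgue_on V)" "g \<in> borel_measurable (lebesgue_on V)"
  using test_function_continuous[OF assms]
  by (auto intro!: measurable_restrict_space1 measurable_completion borel_measurable_continuous_onI)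

lemma integrable_mult_bounded:
  fixes w \<phi> :: "'a \<Rightarrow> real"
  assumes "integrable M w" "\<phi> \<in> borel_measurable M" "\<And>x. \<bar>\<phi> x\<bar> \<le> B"
  shows "integrable M (\<lambda>x. w x * \<phi> x)"
proof (rule Bochner_Integration.integrable_bound[of _ "\<lambda>x. B * w x"])
  show "AE x in M. norm (w x * \<phi> x) \<le> norm (B * w x)"
  proof (rule AE_I2)
    fix x
    have "\<bar>w x\<bar> * \<bar>\<phi> x\<bar> \<le> \<bar>w x\<bar> * \<bar>B\<bar>" by (intro mult_left_mono order_trans[OF assms(3)]) auto
    thus "norm (w x * \<phi> x) \<le> norm (B * w x)" by (simp add: abs_mult mult.commute)
  qed
qed (use assms in auto)

lemma test_function_integrable:
  fixes w :: "real^3 \<Rightarrow> real"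
  assumes "test_function U \<phi> g" "integrable (lebesgue_on V) w"
  shows "integrable (lebesgue_on V) (\<lambda>x. w x * \<phi> x)" "integrable (lebesgue_on V) (\<lambda>x. w x * (g x \<bullet> h))"
        "integrable (lebesgue_on V) (\<lambda>x. w x * (g x $ i))"
proof -
  obtain B where B: "\<And>x. \<bar>\<phi> x\<bar> \<le> B" "\<And>x. norm (g x) \<le> B" using test_function_bounded[OF assms(1)] by blast
  note [measurable] = test_function_measurable[OF assms(1), of V]
  show "integrable (lebesgue_on V) (\<lambda>x. w x * \<phi> x)" by (rule integrable_mult_bounded[OF assms(2) _ B(1)]) measurable
  have *: "integrable (lebesgue_on V) (\<lambda>x. w x * (g x \<bullet> h))" for h
  proof (rule integrable_mult_bounded[OF assms(2)])
    show "\<bar>g x \<bullet> h\<bar> \<le> B * norm h" for x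
      by (rule order_trans[OF Cauchy_Schwarz_ineq2]) (intro mult_right_mono B norm_ge_zero)
  qed measurable
  thus "integrable (lebesgue_on V) (\<lambda>x. w x * (g x \<bullet> h))" .
  from *[of "axis i 1"] show "integrable (lebesgue_on V) (\<lambda>x. w x * (g x $ i))" by (simp add: inner_axis)
qed

text \<open>\<open>\<Phi>\<close> averages the translates of \<open>\<phi>\<close> over the segment
  from 0 to \<open>h\<close>; its derivative along \<open>h\<close> telescopes to the difference of
  the two end translates. A vanishing weak derivative along \<open>h\<close> thereby equates two
  translated means.\<close>

lemma test_function_shift:
  fixes h :: "real^3"
  assumes t: "test_function (cball z r) \<phi> g" and U: "\<And>s. 0 \<le> s \<Longrightarrow> s \<le> 1 \<Longrightarrow> cball (z + s *\<^sub>R h) r \<subseteq> U"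
  obtains \<Phi> \<gamma> where "test_function U \<Phi> \<gamma>" "\<And>x. \<gamma> x \<bullet> h = \<phi> x - \<phi> (x - h)"
proof -
  obtain K0 where K0: "K0 \<subseteq> cball z r" "\<And>x. x \<notin> K0 \<Longrightarrow> \<phi> x = 0"
    and d: "\<And>x. (\<phi> has_derivative (\<lambda>h. g x \<bullet> h)) (at x)" and c: "continuous_on UNIV g"
    using t unfolding test_function_def by blast
  have out: "\<phi> x = 0" if "x \<notin> cball z r" for x using K0 that by blast
  have c\<phi>: "continuous_on UNIV \<phi>" using test_function_continuous[OF t] by blast
  have cg: "continuous_on A (\<lambda>x. g (f x))" if "continuous_on A f" for A and f :: "'z::topological_space \<Rightarrow> real^3"
    by (rule continuous_on_compose2[OF c that]) auto
  have cp: "continuous_on A (\<lambda>x. \<phi> (f x))" if "continuous_on A f" for A and f :: "'z::topological_space \<Rightarrow> real^3"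
    by (rule continuous_on_compose2[OF c\<phi> that]) auto
  define \<Phi> where "\<Phi> x = integral (cbox 0 1) (\<lambda>s. \<phi> (x - s *\<^sub>R h))" for x
  define \<gamma> where "\<gamma> x = integral (cbox 0 1) (\<lambda>s. g (x - s *\<^sub>R h))" for x
  have ig: "(\<lambda>s. g (x - s *\<^sub>R h)) integrable_on cbox 0 1" for x
    by (intro integrable_continuous cg continuous_intros)
  have "(\<Phi> has_derivative (\<lambda>k. \<gamma> x \<bullet> k)) (at x)" for x
  proof -
    have "((\<lambda>x. integral (cbox 0 1) (\<lambda>s. \<phi> (x - s *\<^sub>R h))) has_derivative
        blinfun_apply (integral (cbox 0 1) (\<lambda>s. blinfun_inner_right (g (x - s *\<^sub>R h))))) (at x within UNIV)"
    proof (rule leibniz_rule)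
      show "((\<lambda>x. \<phi> (x - s *\<^sub>R h)) has_derivative blinfun_apply (blinfun_inner_right (g (y - s *\<^sub>R h)))) (at y within UNIV)" for y s
        using has_derivative_translate[OF d, of "s *\<^sub>R h" y] by simp
      show "(\<lambda>s. \<phi> (y - s *\<^sub>R h)) integrable_on cbox 0 1" for y
        by (intro integrable_continuous cp continuous_intros)
      show "continuous_on (UNIV \<times> cbox 0 1) (\<lambda>(y, s). blinfun_inner_right (g (y - s *\<^sub>R h)))"
        unfolding case_prod_unfold
        by (intro bounded_linear.continuous_on[OF bounded_linear_blinfun_inner_right] cg continuous_intros)
    qed auto
    moreover have "blinfun_apply (integral (cbox 0 1) (\<lambda>s. blinfun_inner_right (g (x - s *\<^sub>R h)))) k = \<gamma> x \<bullet> k" for k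
    proof -
      have ib: "(\<lambda>s. blinfun_inner_right (g (x - s *\<^sub>R h))) integrable_on cbox 0 1"
        by (intro integrable_continuous bounded_linear.continuous_on[OF bounded_linear_blinfun_inner_right] cg continuous_intros)
      have "blinfun_apply (integral (cbox 0 1) (\<lambda>s. blinfun_inner_right (g (x - s *\<^sub>R h)))) k
        = integral (cbox 0 1) (\<lambda>s. g (x - s *\<^sub>R h) \<bullet> k)"
        by (subst blinfun_apply_integral[OF ib]) simp
      also have "\<dots> = \<gamma> x \<bullet> k" unfolding \<gamma>_def
        using integral_linear[OF ig bounded_linear_inner_left[of k], of x] by (simp add: o_def)
      finally show ?thesis .
    qed
    moreover from this have "blinfun_apply (integral (cbox 0 1) (\<lambda>s. blinfun_inner_right (g (x - s *\<^sub>R h)))) = (\<lambda>k. \<gamma> x \<bullet> k)"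
      by (rule ext)
    ultimately show ?thesis unfolding \<Phi>_def by simp
  qed
  moreover have "continuous_on UNIV \<gamma>" unfolding \<gamma>_def
    by (rule integral_continuous_on_param) (auto simp: case_prod_unfold intro!: cg continuous_intros)
  \<comment> \<open>Contains the support of \<open>\<Phi>\<close>: the union of the translated
    balls, compact as a continuous image of ball times interval.\<close>
  moreover define K where "K = (\<lambda>(v, s). v + s *\<^sub>R h) ` (cball z r \<times> {0..1})"
  have "compact K" unfolding K_def
    by (intro compact_continuous_image compact_Times) (auto simp: case_prod_unfold intro!: continuous_intros)
  moreover have "K \<subseteq> U"
  proof
    fix x assume "x \<in> K"
    then obtain v s where v: "v \<in> cball z r" "0 \<le> s" "s \<le> 1" "x = v + s *\<^sub>R h" by (auto simp: K_def)
    have "x \<in> cball (z + s *\<^sub>R h) r" using v by (auto simp: dist_norm)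
    thus "x \<in> U" using U v by blast
  qed
  moreover have "\<Phi> x = 0" if "x \<notin> K" for x
  proof -
    have "\<phi> (x - s *\<^sub>R h) = 0" if "s \<in> cbox 0 1" for s
    proof (rule out, rule notI)
      assume "x - s *\<^sub>R h \<in> cball z r"
      hence "x \<in> K" unfolding K_def using that by (intro image_eqI[of _ _ "(x - s *\<^sub>R h, s)"]) auto
      thus False using \<open>x \<notin> K\<close> by simp
    qed
    hence "\<Phi> x = integral (cbox 0 1) (\<lambda>s::real. 0)" unfolding \<Phi>_def by (rule integral_cong)
    thus ?thesis by simp
  qed
  moreover have "\<gamma> x \<bullet> h = \<phi> x - \<phi> (x - h)" for x
  proof -
    have "((\<lambda>s. - (g (x - s *\<^sub>R h) \<bullet> h)) has_integral (\<phi> (x - 1 *\<^sub>R h) - \<phi> (x - 0 *\<^sub>R h))) {0..1}"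
    proof (rule fundamental_theorem_of_calculus)
      fix s :: real
      have "((\<lambda>s. \<phi> (x - s *\<^sub>R h)) has_derivative (\<lambda>t. g (x - s *\<^sub>R h) \<bullet> (- t *\<^sub>R h))) (at s within {0..1})"
        by (rule has_derivative_compose[where f="\<lambda>s. x - s *\<^sub>R h", OF _ d]) (auto intro!: derivative_eq_intros)
      thus "((\<lambda>s. \<phi> (x - s *\<^sub>R h)) has_vector_derivative - (g (x - s *\<^sub>R h) \<bullet> h)) (at s within {0..1})"
        by (simp add: has_vector_derivative_def)
    qed simp
    from has_integral_neg[OF this] have "((\<lambda>s. g (x - s *\<^sub>R h) \<bullet> h) has_integral (\<phi> x - \<phi> (x - h))) (cbox 0 1)" by simp
    moreover have "((\<lambda>s. g (x - s *\<^sub>R h) \<bullet> h) has_integral (\<gamma> x \<bullet> h)) (cbox 0 1)"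
      unfolding \<gamma>_def using has_integral_linear[OF integrable_integral[OF ig] bounded_linear_inner_left[of h], of x] by (simp add: o_def)
    ultimately show ?thesis by (metis has_integral_unique)
  qed
  ultimately show ?thesis by (intro that[of \<Phi> \<gamma>]) (auto simp: test_function_def)
qed


lemma bump_integral_tendsto:
  fixes w :: "real^3 \<Rightarrow> real"
  assumes "r > 0" "cball z r \<subseteq> U" and U: "U \<in> sets lebesgue" and w: "integrable (lebesgue_on U) w"
  shows "(\<lambda>n. LINT x|lebesgue_on U. w x * bump r n (x - z)) \<longlonglongrightarrow> (LINT x|lebesgue_on (ball z r). w x)"
proof -
  have "(\<lambda>n. LINT x|lebesgue_on U. w x * bump r n (x - z)) \<longlonglongrightarrow> (LINT x|lebesgue_on U. w x * indicator (ball z r) x)"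
  proof (rule integral_dominated_convergence)
    show "(\<lambda>x. w x * indicat_real (ball z r) x) \<in> borel_measurable (lebesgue_on U)"
      using w by (intro borel_measurable_times borel_measurable_integrable[OF w] measurable_restrict_space1 borel_measurable_indicator) auto
    show "(\<lambda>x. w x * bump r n (x - z)) \<in> borel_measurable (lebesgue_on U)" for n
      using test_function_integrable(1)[OF test_function_bump[OF assms(1,2)] w] by auto
    show "integrable (lebesgue_on U) (\<lambda>x. norm (w x))" using w by simp
    show "AE x in lebesgue_on U. (\<lambda>n. w x * bump r n (x - z)) \<longlonglongrightarrow> w x * indicat_real (ball z r) x"
      by (intro AE_I2 tendsto_mult tendsto_const bump_tendsto assms)
    show "AE x in lebesgue_on U. norm (w x * bump r n (x - z)) \<le> norm (w x)" for n
      using bump_bounds[of r n "x - z" for x] by (intro AE_I2) (auto simp: abs_mult intro!: mult_left_le)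
  qed
  also have "(LINT x|lebesgue_on U. w x * indicator (ball z r) x) = (LINT x|lebesgue_on (ball z r). w x)"
  proof -
    have "ball z r \<subseteq> U" using assms by auto
    thus ?thesis using U
      by (auto simp: integral_restrict_space indicator_def intro!: Bochner_Integration.integral_cong)
  qed
  finally show ?thesis .
qed

text \<open>The bumps on the two end balls differ by the derivative along \<open>h\<close> of a test
  function, so they have equal integrals against \<open>w\<close>; letting \<open>n\<close> grow
  replaces the bumps by indicators.\<close>

lemma ball_integral_shift:
  fixes w :: "real^3 \<Rightarrow> real"
  assumes r: "r > 0" and sub: "\<And>s. 0 \<le> s \<Longrightarrow> s \<le> 1 \<Longrightarrow> cball (z + s *\<^sub>R h) r \<subseteq> U"
    and U: "U \<in> sets lebesgue" and w: "integrable (lebesgue_on U) w"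
    and weak: "\<And>\<phi> g. test_function U \<phi> g \<Longrightarrow> (LINT x|lebesgue_on U. w x * (g x \<bullet> h)) = 0"
  shows "(LINT x|lebesgue_on (ball z r). w x) = (LINT x|lebesgue_on (ball (z + h) r). w x)"
proof (rule LIMSEQ_unique)
  have sub0: "cball z r \<subseteq> U" and sub1: "cball (z + h) r \<subseteq> U" using sub[of 0] sub[of 1] by auto
  show "(\<lambda>n. LINT x|lebesgue_on U. w x * bump r n (x - z)) \<longlonglongrightarrow> (LINT x|lebesgue_on (ball z r). w x)"
    by (rule bump_integral_tendsto[OF r sub0 U w])
  have "(LINT x|lebesgue_on U. w x * bump r n (x - z)) = (LINT x|lebesgue_on U. w x * bump r n (x - (z + h)))" for n
  proof -
    obtain \<Phi> \<gamma> where t: "test_function U \<Phi> \<gamma>" and g: "\<And>x. \<gamma> x \<bullet> h = bump r n (x - z) - bump r n (x - h - z)"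
      using test_function_shift[OF test_function_bump[OF r order_refl] sub] by blast
    have "0 = (LINT x|lebesgue_on U. w x * bump r n (x - z) - w x * bump r n (x - (z + h)))"
      using weak[OF t] by (simp add: g algebra_simps)
    also have "\<dots> = (LINT x|lebesgue_on U. w x * bump r n (x - z)) - (LINT x|lebesgue_on U. w x * bump r n (x - (z + h)))"
      by (intro Bochner_Integration.integral_diff test_function_integrable(1)[OF test_function_bump[of r _ U] w] r sub0 sub1)
    finally show ?thesis by simp
  qed
  thus "(\<lambda>n. LINT x|lebesgue_on U. w x * bump r n (x - z)) \<longlonglongrightarrow> (LINT x|lebesgue_on (ball (z + h) r). w x)"
    using bump_integral_tendsto[OF r sub1 U w] by simp
qed

lemma AE_lebesgue_point_on:
  fixes w :: "'a::euclidean_space \<Rightarrow> 'b::euclidean_space"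
  assumes U: "U \<in> sets lebesgue" and w: "integrable (lebesgue_on U) w"
  shows "AE x in lebesgue_on U. lebesgue_point (\<lambda>x. indicator U x *\<^sub>R w x) x"
proof -
  have "integrable lebesgue (\<lambda>x. indicator U x *\<^sub>R w x)" using U w by (simp add: integrable_restrict_space)
  from AE_lebesgue_point[OF this] show ?thesis using U by (auto simp: AE_restrict_space_iff)
qed

lemma lebesgue_point_on_average:
  fixes w :: "'a::euclidean_space \<Rightarrow> 'b::euclidean_space"
  assumes U: "open U" "x \<in> U" and w: "integrable (lebesgue_on U) w"
    and x: "lebesgue_point (\<lambda>x. indicator U x *\<^sub>R w x) x"
  shows "((\<lambda>r. (LINT y|lebesgue_on (ball x r). w y) /\<^sub>R measure lebesgue (ball x r)) \<longlongrightarrow> w x) (at_right 0)"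
proof -
  have Us: "U \<in> sets lebesgue" using U by auto
  have i: "integrable lebesgue (\<lambda>x. indicator U x *\<^sub>R w x)" using Us w by (simp add: integrable_restrict_space)
  obtain e where e: "e > 0" "ball x e \<subseteq> U" using U openE by blast
  have "\<forall>\<^sub>F r in at_right 0. (LINT y|lebesgue_on (ball x r). indicator U y *\<^sub>R w y) /\<^sub>R measure lebesgue (ball x r)
     = (LINT y|lebesgue_on (ball x r). w y) /\<^sub>R measure lebesgue (ball x r)"
    unfolding eventually_at_right_field
  proof (intro exI[of _ e] conjI allI impI e)
    fix r :: real assume "0 < r" "r < e"
    hence "ball x r \<subseteq> U" using e by (meson less_imp_le order_trans subset_ball)
    hence "(LINT y|lebesgue_on (ball x r). indicator U y *\<^sub>R w y) = (LINT y|lebesgue_on (ball x r). w y)"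
      by (intro Bochner_Integration.integral_cong) (auto simp: indicator_def)
    thus "(LINT y|lebesgue_on (ball x r). indicator U y *\<^sub>R w y) /\<^sub>R measure lebesgue (ball x r)
     = (LINT y|lebesgue_on (ball x r). w y) /\<^sub>R measure lebesgue (ball x r)" by simp
  qed
  from tendsto_cong[OF this, of "w x"] lebesgue_point_average[OF i x] U show ?thesis by simp
qed

text \<open>Testing with bumps makes all small ball integrals vanish, and Lebesgue points turn this
  into pointwise vanishing.\<close>

lemma fundamental_lemma:
  fixes w :: "real^3 \<Rightarrow> real"
  assumes U: "open U" and w: "integrable (lebesgue_on U) w"
    and weak: "\<And>\<phi> g. test_function U \<phi> g \<Longrightarrow> (LINT x|lebesgue_on U. w x * \<phi> x) = 0"
  shows "AE x in lebesgue_on U. w x = 0"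
proof -
  have Us: "U \<in> sets lebesgue" using U by auto
  have "w x = 0" if x: "x \<in> U" "lebesgue_point (\<lambda>x. indicator U x *\<^sub>R w x) x" for x
  proof -
    obtain e where e: "e > 0" "cball x e \<subseteq> U" using U x open_contains_cball by blast
    have "\<forall>\<^sub>F r in at_right 0. (LINT y|lebesgue_on (ball x r). w y) /\<^sub>R measure lebesgue (ball x r) = 0"
      unfolding eventually_at_right_field
    proof (intro exI[of _ e] conjI allI impI e)
      fix r :: real assume r: "0 < r" "r < e"
      hence c: "cball x r \<subseteq> U" using e by (meson less_imp_le order_trans subset_cball)
      have "(LINT y|lebesgue_on (ball x r). w y) = 0"
        using bump_integral_tendsto[OF r(1) c Us w] weak[OF test_function_bump[OF r(1) c]]
        by (simp add: LIMSEQ_const_iff)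
      thus "(LINT y|lebesgue_on (ball x r). w y) /\<^sub>R measure lebesgue (ball x r) = 0" by simp
    qed
    from tendsto_cong[OF this, of "w x"] lebesgue_point_on_average[OF U x(1) w x(2)]
    have "((\<lambda>r::real. 0) \<longlongrightarrow> w x) (at_right 0)" by simp
    thus ?thesis by (simp add: tendsto_const_iff)
  qed
  note wx = this
  from AE_lebesgue_point_on[OF Us w] AE_space[of "lebesgue_on U"] show ?thesis
    by eventually_elim (simp add: wx)
qed

text \<open>By compactness the segment has a uniform neighbourhood inside \<open>U\<close>, so for
  small radii both ball integrals agree, and so do the volumes. Limits of averages are assumed
  instead of values of \<open>w\<close>, so that the lemma applies wherever a Lebesgue point
  provides them.\<close>

lemma weak_directional_constant:
  fixes w :: "real^3 \<Rightarrow> real"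
  assumes U: "open U" and w: "integrable (lebesgue_on U) w"
    and weak: "\<And>\<phi> g. test_function U \<phi> g \<Longrightarrow> (LINT x|lebesgue_on U. w x * (g x \<bullet> h)) = 0"
    and seg: "closed_segment z (z + h) \<subseteq> U"
    and z: "((\<lambda>r. (LINT y|lebesgue_on (ball z r). w y) /\<^sub>R measure lebesgue (ball z r)) \<longlongrightarrow> a) (at_right 0)"
           "((\<lambda>r. (LINT y|lebesgue_on (ball (z + h) r). w y) /\<^sub>R measure lebesgue (ball (z + h) r)) \<longlongrightarrow> b) (at_right 0)"
  shows "a = b"
proof -
  have Us: "U \<in> sets lebesgue" using U by auto
  obtain e where e: "e > 0" "(\<Union>x\<in>closed_segment z (z + h). ball x e) \<subseteq> U"
    using compact_subset_open_imp_ball_epsilon_subset[OF compact_segment U seg] by blast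
  have sub: "cball (z + s *\<^sub>R h) r \<subseteq> U" if "0 \<le> s" "s \<le> 1" "r < e" for s r
  proof
    fix y assume y: "y \<in> cball (z + s *\<^sub>R h) r"
    have "z + s *\<^sub>R h \<in> closed_segment z (z + h)" using that unfolding closed_segment_def
      by (intro CollectI exI[of _ s]) (simp add: algebra_simps)
    moreover have "y \<in> ball (z + s *\<^sub>R h) e" using y that by auto
    ultimately show "y \<in> U" using e(2) by blast
  qed
  have "\<forall>\<^sub>F r in at_right 0. (LINT y|lebesgue_on (ball z r). w y) /\<^sub>R measure lebesgue (ball z r)
       = (LINT y|lebesgue_on (ball (z + h) r). w y) /\<^sub>R measure lebesgue (ball (z + h) r)"
    unfolding eventually_at_right_field
  proof (intro exI[of _ e] conjI allI impI e)
    fix r :: real assume r: "0 < r" "r < e"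
    show "(LINT y|lebesgue_on (ball z r). w y) /\<^sub>R measure lebesgue (ball z r)
       = (LINT y|lebesgue_on (ball (z + h) r). w y) /\<^sub>R measure lebesgue (ball (z + h) r)"
      using ball_integral_shift[OF r(1) sub[OF _ _ r(2)] Us w weak] r by (simp add: content_ball)
  qed
  from tendsto_cong[OF this, of a] z(1)
  have "((\<lambda>r. (LINT y|lebesgue_on (ball (z + h) r). w y) /\<^sub>R measure lebesgue (ball (z + h) r)) \<longlongrightarrow> a) (at_right 0)" by simp
  from tendsto_unique[OF _ this z(2)] show ?thesis by simp
qed

lemma borel_measurable_vec_nth [measurable (raw)]:
  fixes f :: "'a \<Rightarrow> 'b::euclidean_space^'n"
  shows "f \<in> borel_measurable M \<Longrightarrow> (\<lambda>x. f x $ i) \<in> borel_measurable M"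
  by (rule borel_measurable_continuous_on[of "\<lambda>v. v $ i"]) (intro continuous_intros)

text \<open>Completeness of Lebesgue measure: a change on a null set preserves
  measurability.\<close>

lemma borel_measurable_lebesgue_on_AE:
  fixes f g :: "'a::euclidean_space \<Rightarrow> 'b::euclidean_space"
  assumes f: "f \<in> borel_measurable (lebesgue_on S)" and ae: "AE x in lebesgue_on S. f x = g x" and S: "S \<in> sets lebesgue"
  shows "g \<in> borel_measurable (lebesgue_on S)"
proof -
  have "(\<lambda>x. indicator S x *\<^sub>R f x) \<in> borel_measurable lebesgue"
    using f S by (simp add: borel_measurable_restrict_space_iff)
  moreover have "AE x in lebesgue. indicator S x *\<^sub>R f x = indicator S x *\<^sub>R g x"
    using ae S by (auto simp: AE_restrict_space_iff indicator_def elim!: eventually_mono)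
  ultimately have "(\<lambda>x. indicator S x *\<^sub>R g x) \<in> borel_measurable lebesgue" by (rule borel_measurable_AE)
  thus ?thesis using S by (simp add: borel_measurable_restrict_space_iff)
qed

section \<open>Square integrable functions and weak gradients\<close>

lemma integrable_const_lebesgue_on: "U \<in> lmeasurable \<Longrightarrow> integrable (lebesgue_on U) (\<lambda>x. c :: 'b::euclidean_space)"
  using finite_measure.integrable_const[OF finite_measure_lebesgue_on] by blast

lemma L2D:
  assumes "u \<in> L2 U"
  shows "u \<in> borel_measurable (lebesgue_on U)" "integrable (lebesgue_on U) (\<lambda>x. (norm (u x))\<^sup>2)"
  using assms by (auto simp: L2_def)

lemma L2_dominated:
  assumes "u \<in> borel_measurable (lebesgue_on U)" "integrable (lebesgue_on U) g" "AE x in lebesgue_on U. (norm (u x))\<^sup>2 \<le> g x"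
  shows "u \<in> L2 U"
  unfolding L2_def mem_Collect_eq
proof (intro conjI assms(1))
  show "integrable (lebesgue_on U) (\<lambda>x. (norm (u x))\<^sup>2)"
    by (rule Bochner_Integration.integrable_bound[OF assms(2)]) (use assms in \<open>auto elim!: eventually_mono\<close>)
qed

lemma L2_integrable:
  assumes "U \<in> lmeasurable" "u \<in> L2 U"
  shows "integrable (lebesgue_on U) u"
proof (rule Bochner_Integration.integrable_bound)
  show "integrable (lebesgue_on U) (\<lambda>x. 1 + (norm (u x))\<^sup>2)"
    by (intro Bochner_Integration.integrable_add L2D assms integrable_const_lebesgue_on)
  have "norm a \<le> 1 + (norm a)\<^sup>2" for a :: 'b
    using zero_le_power2[of "norm a - 1/2"] by (simp add: power2_eq_square algebra_simps)
  thus "AE x in lebesgue_on U. norm (u x) \<le> norm (1 + (norm (u x))\<^sup>2)"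
    by (intro AE_I2) (simp add: add_nonneg_nonneg)
qed (use L2D assms in auto)

lemma L2_lincomb:
  assumes "u \<in> L2 U" "v \<in> L2 U"
  shows "(\<lambda>x. a *\<^sub>R u x + b *\<^sub>R v x) \<in> L2 U"
proof (rule L2_dominated)
  note [measurable] = L2D(1)[OF assms(1)] L2D(1)[OF assms(2)]
  show "(\<lambda>x. a *\<^sub>R u x + b *\<^sub>R v x) \<in> borel_measurable (lebesgue_on U)" by measurable
  show "integrable (lebesgue_on U) (\<lambda>x. 2 * a\<^sup>2 * (norm (u x))\<^sup>2 + 2 * b\<^sup>2 * (norm (v x))\<^sup>2)"
    using L2D assms by (intro Bochner_Integration.integrable_add integrable_mult_right) auto
  have "(norm (x + y))\<^sup>2 \<le> 2 * (norm x)\<^sup>2 + 2 * (norm y)\<^sup>2" for x y :: 'b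
  proof -
    have "(norm (x + y))\<^sup>2 \<le> (norm x + norm y)\<^sup>2" by (intro power_mono norm_triangle_ineq norm_ge_zero)
    also have "\<dots> \<le> 2 * (norm x)\<^sup>2 + 2 * (norm y)\<^sup>2"
      using zero_le_power2[of "norm x - norm y"] by (simp add: power2_eq_square algebra_simps)
    finally show ?thesis .
  qed
  from this[of "a *\<^sub>R u x" "b *\<^sub>R v x" for x]
  show "AE x in lebesgue_on U. (norm (a *\<^sub>R u x + b *\<^sub>R v x))\<^sup>2 \<le> 2 * a\<^sup>2 * (norm (u x))\<^sup>2 + 2 * b\<^sup>2 * (norm (v x))\<^sup>2"
    by (intro AE_I2) (simp add: power_mult_distrib mult.assoc)
qed

lemma L2_const: "U \<in> lmeasurable \<Longrightarrow> (\<lambda>x. c) \<in> L2 U"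
  by (auto simp: L2_def integrable_const_lebesgue_on)

lemma integrable_vec_nth: "integrable M u \<Longrightarrow> integrable M (\<lambda>x. (u x :: 'b::euclidean_space^'n) $ i)"
  using integrable_bounded_linear[OF bounded_linear_vec_nth] by blast

text \<open>Difference quotients of \<open>\<phi>\<close> have integral zero by translation
  invariance and converge to the partial derivative. This is what gives constants a zero weak
  gradient.\<close>

lemma test_function_grad_integral_zero:
  assumes U: "U \<in> sets lebesgue" and t: "test_function U \<phi> g"
  shows "(LINT x|lebesgue_on U. g x $ j) = 0"
proof -
  obtain K where K: "compact K" "K \<subseteq> U" "\<And>x. x \<notin> K \<Longrightarrow> \<phi> x = 0"
    and d: "\<And>x. (\<phi> has_derivative (\<lambda>h. g x \<bullet> h)) (at x)"
    using t unfolding test_function_def by blast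
  obtain B where B: "\<And>x. \<bar>\<phi> x\<bar> \<le> B" "\<And>x. norm (g x) \<le> B" using test_function_bounded[OF t] by blast
  obtain R where R: "K \<subseteq> ball 0 R" using K(1) bounded_subset_ballD compact_imp_bounded by blast
  have g0: "g x = 0" if "x \<notin> K" for x
    using test_function_grad_zero[of \<phi> g x K] d K compact_imp_closed that by blast
  define e :: "real^3" where "e = axis j 1"
  have ne: "norm e = 1" by (simp add: e_def)
  have \<phi>m: "\<phi> \<in> borel_measurable borel" using test_function_continuous[OF t] by (intro borel_measurable_continuous_onI)
  have gm: "g \<in> borel_measurable borel" using test_function_continuous[OF t] by (intro borel_measurable_continuous_onI)
  have ind: "integrable lborel (indicator (ball 0 c) :: real^3 \<Rightarrow> real)" for c
    using emeasure_bounded_finite[of "ball (0::real^3) c"] by (intro integrable_real_indicator) (auto simp: less_top)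
  have \<phi>i: "integrable lborel \<phi>"
  proof (rule Bochner_Integration.integrable_bound)
    show "integrable lborel (\<lambda>x::real^3. B * indicator (ball 0 R) x)" by (intro integrable_mult_right ind)
    show "AE x in lborel. norm (\<phi> x) \<le> norm (B * indicat_real (ball 0 R) x)"
    proof (rule AE_I2)
      fix x show "norm (\<phi> x) \<le> norm (B * indicat_real (ball 0 R) x)"
        using B(1)[of x] R K(3)[of x] by (cases "x \<in> K") (auto simp: indicator_def)
    qed
  qed (use \<phi>m in simp)
  have shift: "integrable lborel (\<lambda>x. \<phi> (c + x))" "(LINT x|lborel. \<phi> (c + x)) = (LINT x|lborel. \<phi> x)" for c
  proof -
    have "integrable (distr lborel borel ((+) c)) \<phi>" using \<phi>i by (simp add: lborel_distr_plus)
    thus "integrable lborel (\<lambda>x. \<phi> (c + x))" by (subst (asm) integrable_distr_eq) (use \<phi>m in auto)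
    have "(LINT x|distr lborel borel ((+) c). \<phi> x) = (LINT x|lborel. \<phi> (c + x))"
      by (rule integral_distr) (use \<phi>m in auto)
    thus "(LINT x|lborel. \<phi> (c + x)) = (LINT x|lborel. \<phi> x)" by (simp add: lborel_distr_plus)
  qed
  define D where "D n x = (\<phi> ((1 / real (Suc n)) *\<^sub>R e + x) - \<phi> x) * real (Suc n)" for n x
  have "(\<lambda>n. LINT x|lborel. D n x) \<longlonglongrightarrow> (LINT x|lborel. g x $ j)"
  proof (rule integral_dominated_convergence)
    show "(\<lambda>x. g x $ j) \<in> borel_measurable lborel" using gm by simp
    show "D n \<in> borel_measurable lborel" for n unfolding D_def using \<phi>m by simp
    \<comment> \<open>The shifts have length at most 1, so all quotients vanish outside the ball of
      radius \<open>R + 1\<close>; the gradient bound \<open>B\<close> dominates them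
      inside.\<close>
    show "integrable lborel (\<lambda>x::real^3. B * indicator (ball 0 (R + 1)) x)" by (intro integrable_mult_right ind)
    show "AE x in lborel. (\<lambda>n. D n x) \<longlonglongrightarrow> g x $ j"
    proof (rule AE_I2)
      fix x
      have "((\<lambda>t. \<phi> (x + t *\<^sub>R e)) has_derivative (\<lambda>t. g (x + 0 *\<^sub>R e) \<bullet> (t *\<^sub>R e))) (at 0)"
        by (rule has_derivative_compose[where f="\<lambda>t. x + t *\<^sub>R e", OF _ d]) (auto intro!: derivative_eq_intros)
      hence "((\<lambda>t. \<phi> (x + t *\<^sub>R e)) has_real_derivative (g x \<bullet> e)) (at 0)"
        by (simp add: has_field_derivative_def mult.commute[of _ "g x \<bullet> e"])
      hence "((\<lambda>t. (\<phi> (x + t *\<^sub>R e) - \<phi> x) / t) \<longlongrightarrow> g x \<bullet> e) (at 0)" by (simp add: DERIV_def)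
      moreover have "filterlim (\<lambda>n. 1 / real (Suc n)) (at 0) sequentially"
        unfolding filterlim_at using LIMSEQ_inverse_real_of_nat by (auto simp: inverse_eq_divide)
      ultimately have "(\<lambda>n. (\<phi> (x + (1 / real (Suc n)) *\<^sub>R e) - \<phi> x) / (1 / real (Suc n))) \<longlonglongrightarrow> g x \<bullet> e"
        by (rule filterlim_compose)
      thus "(\<lambda>n. D n x) \<longlonglongrightarrow> g x $ j" by (simp add: D_def e_def inner_axis add.commute)
    qed
    show "AE x in lborel. norm (D n x) \<le> B * indicator (ball 0 (R + 1)) x" for n
    proof (rule AE_I2)
      fix x
      define t where "t = 1 / real (Suc n)"
      have t: "0 < t" "t \<le> 1" by (auto simp: t_def)
      have "norm (\<phi> (t *\<^sub>R e + x) - \<phi> x) \<le> B * norm (t *\<^sub>R e + x - x)"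
      proof (rule differentiable_bound[of UNIV \<phi> "\<lambda>x h. g x \<bullet> h"])
        show "onorm (\<lambda>h. g y \<bullet> h) \<le> B" for y
        proof (rule onorm_bound)
          show "0 \<le> B" using B(2)[of y] norm_ge_zero order_trans by blast
          show "norm (g y \<bullet> h) \<le> B * norm h" for h
            using Cauchy_Schwarz_ineq2[of "g y" h] mult_right_mono[OF B(2)[of y] norm_ge_zero[of h]] by simp
        qed
      qed (use d in \<open>auto simp: has_derivative_at_withinI\<close>)
      hence "\<bar>\<phi> (t *\<^sub>R e + x) - \<phi> x\<bar> \<le> B * t" using t ne by simp
      moreover have "D n x = (\<phi> (t *\<^sub>R e + x) - \<phi> x) / t" by (simp add: D_def t_def)
      ultimately have 1: "\<bar>D n x\<bar> \<le> B" using t by (simp add: abs_divide divide_le_eq)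
      have 2: "D n x = 0" if "x \<notin> ball 0 (R + 1)"
      proof -
        have "norm (t *\<^sub>R e + x) \<ge> R" using that t ne norm_diff_ineq[of x "t *\<^sub>R e"] by (simp add: add.commute)
        hence "t *\<^sub>R e + x \<notin> K" "x \<notin> K" using R that by auto
        thus ?thesis using K(3) by (simp add: D_def t_def)
      qed
      show "norm (D n x) \<le> B * indicator (ball 0 (R + 1)) x" using 1 2 by (cases "x \<in> ball 0 (R + 1)") auto
    qed
  qed
  moreover have "(LINT x|lborel. D n x) = 0" for n
    unfolding D_def using shift \<phi>i by (simp)
  ultimately have "(LINT x|lborel. g x $ j) = 0" by (simp add: LIMSEQ_const_iff)
  moreover have gU: "g x = 0" if "x \<notin> U" for x using g0 K(2) that by blast
  hence "(LINT x|lebesgue_on U. g x $ j) = (LINT x|lebesgue. g x $ j)"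
    using U gU by (auto simp: integral_restrict_space indicator_def intro!: Bochner_Integration.integral_cong)
  moreover have "(LINT x|lebesgue. g x $ j) = (LINT x|lborel. g x $ j)"
    by (rule integral_completion) (use gm in simp)
  ultimately show ?thesis by simp
qed

lemma has_weak_gradD:
  assumes "has_weak_grad U u G"
  shows "u \<in> L2 U" "G \<in> L2 U"
    "\<And>\<phi> g i j. test_function U \<phi> g \<Longrightarrow> (LINT x|lebesgue_on U. u x $ i * g x $ j) = - (LINT x|lebesgue_on U. G x $ i $ j * \<phi> x)"
  using assms by (auto simp: has_weak_grad_def)

lemma has_weak_grad_const:
  assumes U: "U \<in> lmeasurable"
  shows "has_weak_grad U (\<lambda>x. c) (\<lambda>x. 0)"
  unfolding has_weak_grad_def
  using test_function_grad_integral_zero[OF fmeasurableD[OF U]] by (auto intro: L2_const U)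

lemma has_weak_grad_lincomb:
  assumes U: "U \<in> lmeasurable" and u: "has_weak_grad U u G" and v: "has_weak_grad U v H"
  shows "has_weak_grad U (\<lambda>x. a *\<^sub>R u x + b *\<^sub>R v x) (\<lambda>x. a *\<^sub>R G x + b *\<^sub>R H x)"
  unfolding has_weak_grad_def
proof (intro conjI L2_lincomb has_weak_gradD(1,2)[OF u] has_weak_gradD(1,2)[OF v] allI impI)
  fix \<phi> g i j assume t: "test_function U \<phi> g"
  note comp = integrable_vec_nth[OF L2_integrable[OF U]]
  have 1: "integrable (lebesgue_on U) (\<lambda>x. u x $ i * g x $ j)" "integrable (lebesgue_on U) (\<lambda>x. v x $ i * g x $ j)"
    using test_function_integrable(3)[OF t] comp has_weak_gradD(1) u v by blast+
  have 2: "integrable (lebesgue_on U) (\<lambda>x. G x $ i $ j * \<phi> x)" "integrable (lebesgue_on U) (\<lambda>x. H x $ i $ j * \<phi> x)"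
    using test_function_integrable(1)[OF t] integrable_vec_nth[OF comp] has_weak_gradD(2) u v by blast+
  have "(LINT x|lebesgue_on U. (a *\<^sub>R u x + b *\<^sub>R v x) $ i * g x $ j) = a * (LINT x|lebesgue_on U. u x $ i * g x $ j) + b * (LINT x|lebesgue_on U. v x $ i * g x $ j)"
    using 1 by (simp add: distrib_right mult.assoc)
  also have "\<dots> = - (a * (LINT x|lebesgue_on U. G x $ i $ j * \<phi> x) + b * (LINT x|lebesgue_on U. H x $ i $ j * \<phi> x))"
    using has_weak_gradD(3)[OF u t] has_weak_gradD(3)[OF v t] by simp
  also have "\<dots> = - (LINT x|lebesgue_on U. (a *\<^sub>R G x + b *\<^sub>R H x) $ i $ j * \<phi> x)"
    using 2 by (simp add: distrib_right mult.assoc)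
  finally show "(LINT x|lebesgue_on U. (a *\<^sub>R u x + b *\<^sub>R v x) $ i * g x $ j) = - (LINT x|lebesgue_on U. (a *\<^sub>R G x + b *\<^sub>R H x) $ i $ j * \<phi> x)" .
qed

lemma has_weak_grad_unique:
  assumes U: "open U" "U \<in> lmeasurable" and G: "has_weak_grad U u G" and H: "has_weak_grad U u H"
  shows "AE x in lebesgue_on U. G x = H x"
proof -
  have "AE x in lebesgue_on U. G x $ i $ j - H x $ i $ j = 0" for i j
  proof (rule fundamental_lemma[OF U(1)])
    note ii = integrable_vec_nth[OF integrable_vec_nth[OF L2_integrable[OF U(2) has_weak_gradD(2)]]]
    show "integrable (lebesgue_on U) (\<lambda>x. G x $ i $ j - H x $ i $ j)"
      by (intro Bochner_Integration.integrable_diff ii[OF G] ii[OF H])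
    fix \<phi> g assume t: "test_function U \<phi> g"
    show "(LINT x|lebesgue_on U. (G x $ i $ j - H x $ i $ j) * \<phi> x) = 0"
      using has_weak_gradD(3)[OF G t, of i j] has_weak_gradD(3)[OF H t, of i j]
        test_function_integrable(1)[OF t ii[OF G, of i j]] test_function_integrable(1)[OF t ii[OF H, of i j]]
      by (simp add: left_diff_distrib)
  qed
  hence "AE x in lebesgue_on U. \<forall>i j. G x $ i $ j - H x $ i $ j = 0" by (simp add: AE_all_countable)
  thus ?thesis by eventually_elim (simp add: vec_eq_iff)
qed

lemma has_weak_grad_weak_grad: "u \<in> H1 U \<Longrightarrow> has_weak_grad U u (weak_grad U u)"
  unfolding H1_def weak_grad_def by (simp add: someI_ex)

lemma weak_grad_AE:
  assumes "open U" "U \<in> lmeasurable" "has_weak_grad U u G"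
  shows "AE x in lebesgue_on U. weak_grad U u x = G x"
  using has_weak_grad_unique[OF assms(1,2) has_weak_grad_weak_grad assms(3)] assms(3) by (auto simp: H1_def)

lemma H1_lincomb:
  assumes "U \<in> lmeasurable" "u \<in> H1 U" "v \<in> H1 U"
  shows "(\<lambda>x. a *\<^sub>R u x + b *\<^sub>R v x) \<in> H1 U"
  using assms has_weak_grad_lincomb[OF assms(1)] unfolding H1_def by blast

lemma sym_part_lincomb: "sym_part (a *\<^sub>R M + b *\<^sub>R N) = a *\<^sub>R sym_part M + b *\<^sub>R sym_part N"
  by (simp add: sym_part_def vec_eq_iff transpose_def algebra_simps)

lemma strain_AE:
  assumes "open U" "U \<in> lmeasurable" "has_weak_grad U u G"
  shows "AE x in lebesgue_on U. strain U u x = sym_part (G x)"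
  using weak_grad_AE[OF assms] by eventually_elim (simp add: strain_def)

lemma strain_lincomb:
  assumes "open U" "U \<in> lmeasurable" "u \<in> H1 U" "v \<in> H1 U"
  shows "AE x in lebesgue_on U. strain U (\<lambda>x. a *\<^sub>R u x + b *\<^sub>R v x) x = a *\<^sub>R strain U u x + b *\<^sub>R strain U v x"
  using strain_AE[OF assms(1,2) has_weak_grad_lincomb[OF assms(2) has_weak_grad_weak_grad[OF assms(3)] has_weak_grad_weak_grad[OF assms(4)]]]
  by eventually_elim (simp add: sym_part_lincomb strain_def)

lemma norm_sym_part_le: "norm (sym_part M) \<le> norm M"
proof -
  have "norm (transpose M) = norm M" 
    by (simp add: norm_vec_def L2_set_def transpose_def sum.swap[of "\<lambda>i j. (M $ j $ i)\<^sup>2"] sum_nonneg)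
  hence "norm (M + transpose M) \<le> 2 * norm M" using norm_triangle_ineq[of M "transpose M"] by simp
  thus ?thesis by (simp add: sym_part_def)
qed

lemma continuous_sym_part: "continuous_on UNIV sym_part"
  unfolding sym_part_def transpose_def by (intro continuous_intros)

lemma sym_part_measurable [measurable (raw)]:
  "f \<in> borel_measurable M \<Longrightarrow> (\<lambda>x. sym_part (f x)) \<in> borel_measurable M"
  using continuous_sym_part by (rule borel_measurable_continuous_on)

lemma L2_sym_part: "G \<in> L2 U \<Longrightarrow> (\<lambda>x. sym_part (G x)) \<in> L2 U"
  by (rule L2_dominated[of _ _ "\<lambda>x. (norm (G x))\<^sup>2"])
    (auto dest: L2D intro!: sym_part_measurable power_mono norm_sym_part_le)

lemma strain_L2: "u \<in> H1 U \<Longrightarrow> strain U u \<in> L2 U"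
  using L2_sym_part[OF has_weak_gradD(2)[OF has_weak_grad_weak_grad]] by (simp add: strain_def[abs_def])

section \<open>Boundary values\<close>

lemma has_trace_lincomb:
  assumes U: "U \<in> sets lebesgue" and u: "integrable (lebesgue_on U) u" and v: "integrable (lebesgue_on U) v"
    and tu: "has_trace U u p z" and tv: "has_trace U v p w"
  shows "has_trace U (\<lambda>x. a *\<^sub>R u x + b *\<^sub>R v x) p (a *\<^sub>R z + b *\<^sub>R w)"
  unfolding has_trace_def
proof (rule Lim_null_comparison[OF always_eventually])
  let ?f = "\<lambda>u z r. (LINT y|lebesgue_on (U \<inter> ball p r). norm (u y - z)) / measure lebesgue (U \<inter> ball p r)"
  have "((\<lambda>r. \<bar>a\<bar> * ?f u z r + \<bar>b\<bar> * ?f v w r) \<longlongrightarrow> \<bar>a\<bar> * 0 + \<bar>b\<bar> * 0) (at_right 0)"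
    by (intro tendsto_add tendsto_mult tendsto_const tu[unfolded has_trace_def] tv[unfolded has_trace_def])
  thus "((\<lambda>r. \<bar>a\<bar> * ?f u z r + \<bar>b\<bar> * ?f v w r) \<longlongrightarrow> 0) (at_right 0)" by simp
  show "\<forall>r. norm (?f (\<lambda>x. a *\<^sub>R u x + b *\<^sub>R v x) (a *\<^sub>R z + b *\<^sub>R w) r) \<le> \<bar>a\<bar> * ?f u z r + \<bar>b\<bar> * ?f v w r"
  proof
    fix r
    have S: "U \<inter> ball p r \<in> sets lebesgue" using U by auto
    have lm: "U \<inter> ball p r \<in> lmeasurable" using U by (metis fmeasurable_Int_fmeasurable Int_commute lmeasurable_ball)
    have ui: "integrable (lebesgue_on (U \<inter> ball p r)) (\<lambda>y. norm (u y - z))"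
      by (intro integrable_norm Bochner_Integration.integrable_diff integrable_lebesgue_on_subset[OF u S U] integrable_const_lebesgue_on lm) auto
    have vi: "integrable (lebesgue_on (U \<inter> ball p r)) (\<lambda>y. norm (v y - w))"
      by (intro integrable_norm Bochner_Integration.integrable_diff integrable_lebesgue_on_subset[OF v S U] integrable_const_lebesgue_on lm) auto
    have "(LINT y|lebesgue_on (U \<inter> ball p r). norm (a *\<^sub>R u y + b *\<^sub>R v y - (a *\<^sub>R z + b *\<^sub>R w)))
      \<le> (LINT y|lebesgue_on (U \<inter> ball p r). \<bar>a\<bar> * norm (u y - z) + \<bar>b\<bar> * norm (v y - w))"
    proof (rule integral_mono')
      show "integrable (lebesgue_on (U \<inter> ball p r)) (\<lambda>y. \<bar>a\<bar> * norm (u y - z) + \<bar>b\<bar> * norm (v y - w))" using ui vi by simp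
      fix y
      have "a *\<^sub>R u y + b *\<^sub>R v y - (a *\<^sub>R z + b *\<^sub>R w) = a *\<^sub>R (u y - z) + b *\<^sub>R (v y - w)" by (simp add: algebra_simps)
      thus "norm (a *\<^sub>R u y + b *\<^sub>R v y - (a *\<^sub>R z + b *\<^sub>R w)) \<le> \<bar>a\<bar> * norm (u y - z) + \<bar>b\<bar> * norm (v y - w)"
        by (metis norm_triangle_ineq norm_scaleR)
    qed auto
    also have "\<dots> = \<bar>a\<bar> * (LINT y|lebesgue_on (U \<inter> ball p r). norm (u y - z)) + \<bar>b\<bar> * (LINT y|lebesgue_on (U \<inter> ball p r). norm (v y - w))"
      using ui vi by simp
    finally show "norm (?f (\<lambda>x. a *\<^sub>R u x + b *\<^sub>R v x) (a *\<^sub>R z + b *\<^sub>R w) r) \<le> \<bar>a\<bar> * ?f u z r + \<bar>b\<bar> * ?f v w r"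
      by (simp add: divide_right_mono flip: add_divide_distrib)
  qed
qed

lemma has_trace_const: "has_trace U (\<lambda>x. c) p c"
  by (simp add: has_trace_def)

lemma has_trace_cong_AE:
  assumes U: "U \<in> sets lebesgue" and m: "u \<in> borel_measurable (lebesgue_on U)" "v \<in> borel_measurable (lebesgue_on U)"
    and ae: "AE x in lebesgue_on U. u x = v x"
  shows "has_trace U u p z \<longleftrightarrow> has_trace U v p z"
proof -
  have "(LINT y|lebesgue_on (U \<inter> ball p r). norm (u y - z)) = (LINT y|lebesgue_on (U \<inter> ball p r). norm (v y - z))" for r
  proof (rule integral_cong_AE)
    have S: "U \<inter> ball p r \<in> sets lebesgue" using U by auto
    have eq: "lebesgue_on (U \<inter> ball p r) = restrict_space (lebesgue_on U) (U \<inter> ball p r)"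
      using restrict_restrict_space[of U lebesgue "U \<inter> ball p r"] U S by (simp flip: Int_assoc)
    show "(\<lambda>y. norm (u y - z)) \<in> borel_measurable (lebesgue_on (U \<inter> ball p r))" "(\<lambda>y. norm (v y - z)) \<in> borel_measurable (lebesgue_on (U \<inter> ball p r))"
      unfolding eq using m
      by (auto intro!: measurable_restrict_space1[of _ "lebesgue_on U"] borel_measurable_norm borel_measurable_diff)
    show "AE y in lebesgue_on (U \<inter> ball p r). norm (u y - z) = norm (v y - z)"
      using ae U S by (auto simp: AE_restrict_space_iff elim!: eventually_mono)
  qed
  thus ?thesis by (simp add: has_trace_def)
qed

text \<open>Guards against \<open>x / 0 = 0\<close>: at a point outside the closure of
  \<open>U\<close> the quotient in \<open>has_trace\<close> vanishes for small radii, and every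
  vector would be a boundary value there.\<close>

lemma measure_Int_ball_pos:
  fixes U :: "'a::euclidean_space set"
  assumes "open U" "p \<in> closure U" "r > 0"
  shows "measure lebesgue (U \<inter> ball p r) > 0"
proof -
  obtain x where x: "x \<in> U" "x \<in> ball p r" using assms(2,3) unfolding closure_approachable by (metis dist_commute mem_ball)
  have "open (U \<inter> ball p r)" using assms by auto
  then obtain e where e: "e > 0" "ball x e \<subseteq> U \<inter> ball p r" using x by (metis IntI openE)
  have "0 < measure lebesgue (ball x e)" using e by (simp add: content_ball_pos)
  also have "\<dots> \<le> measure lebesgue (U \<inter> ball p r)"
    by (rule measure_mono_fmeasurable) (use e assms in \<open>auto intro!: lmeasurable_open bounded_Int\<close>)
  finally show ?thesis .
qed

lemma has_trace_unique:
  assumes U: "open U" and p: "p \<in> closure U" and u: "integrable (lebesgue_on U) u"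
    and z: "has_trace U u p z" and w: "has_trace U u p w"
  shows "z = w"
proof -
  have Us: "U \<in> sets lebesgue" using U by auto
  let ?n = "\<lambda>r. LINT y|lebesgue_on (U \<inter> ball p r). norm ((1 *\<^sub>R u y + (-1) *\<^sub>R u y) - (1 *\<^sub>R z + (-1) *\<^sub>R w))"
  \<comment> \<open>The combination of \<open>u\<close> with itself is the zero function with
    boundary value \<open>z - w\<close>, so the mean is the constant
    \<open>norm (z - w)\<close>.\<close>
  have "has_trace U (\<lambda>x. 1 *\<^sub>R u x + (-1) *\<^sub>R u x) p (1 *\<^sub>R z + (-1) *\<^sub>R w)"
    by (rule has_trace_lincomb[OF Us u u z w])
  hence t: "((\<lambda>r. ?n r / measure lebesgue (U \<inter> ball p r)) \<longlongrightarrow> 0) (at_right 0)" by (simp add: has_trace_def)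
  have "\<forall>\<^sub>F r in at_right 0. ?n r / measure lebesgue (U \<inter> ball p r) = norm (z - w)"
    unfolding eventually_at_right_field
  proof (intro exI[of _ 1] conjI allI impI)
    fix r :: real assume r: "0 < r" "r < 1"
    have "measure lebesgue (U \<inter> ball p r) > 0" by (rule measure_Int_ball_pos[OF U p r(1)])
    moreover have "U \<inter> ball p r \<in> sets lebesgue" using Us by auto
    ultimately show "?n r / measure lebesgue (U \<inter> ball p r) = norm (z - w)"
      by (simp add: measure_restrict_space norm_minus_commute)
  qed simp
  from tendsto_cong[OF this, of 0] t have "((\<lambda>r::real. norm (z - w)) \<longlongrightarrow> 0) (at_right 0)" by simp
  hence "norm (z - w) = 0" by (simp add: tendsto_const_iff)
  thus ?thesis by simp
qed

lemma trace_at_eq: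
  assumes "open U" "p \<in> closure U" "integrable (lebesgue_on U) u" "has_trace U u p z"
  shows "trace_at U u p = z"
  unfolding trace_at_def using has_trace_unique[OF assms(1-3)] assms(4) by (intro the_equality) blast+

lemma has_trace_continuous:
  assumes U: "open U" and p: "p \<in> closure U" and c: "continuous_on UNIV u"
  shows "has_trace U u p (u p)"
  unfolding has_trace_def
proof (rule tendstoI)
  fix e :: real assume e: "e > 0"
  have "isCont u p" using c continuous_on_eq_continuous_at by blast
  then obtain d where d: "d > 0" "\<And>y. dist y p < d \<Longrightarrow> dist (u y) (u p) < e / 2"
    unfolding continuous_at_eps_delta using e by (metis half_gt_zero)
  show "\<forall>\<^sub>F r in at_right 0. dist ((LINT y|lebesgue_on (U \<inter> ball p r). norm (u y - u p)) / measure lebesgue (U \<inter> ball p r)) 0 < e"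
    unfolding eventually_at_right_field
  proof (intro exI[of _ d] conjI allI impI d)
    fix r :: real assume r: "0 < r" "r < d"
    let ?m = "measure lebesgue (U \<inter> ball p r)"
    have m: "?m > 0" by (rule measure_Int_ball_pos[OF U p r(1)])
    have lm: "U \<inter> ball p r \<in> lmeasurable" using U by (auto intro!: lmeasurable_open bounded_Int)
    have "(LINT y|lebesgue_on (U \<inter> ball p r). norm (u y - u p)) \<le> (LINT y|lebesgue_on (U \<inter> ball p r). e / 2)"
    proof (rule integral_mono')
      fix y assume "y \<in> space (lebesgue_on (U \<inter> ball p r))"
      hence "dist y p < d" using r by (auto simp: dist_commute)
      from d(2)[OF this] show "norm (u y - u p) \<le> e / 2" by (simp add: dist_norm)
    qed (use e lm integrable_const_lebesgue_on in auto)
    also have "\<dots> = e / 2 * ?m" using lm by (simp add: measure_restrict_space fmeasurableD)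
    also have "\<dots> < e * ?m" using e m by simp
    finally show "dist ((LINT y|lebesgue_on (U \<inter> ball p r). norm (u y - u p)) / ?m) 0 < e"
      using m by (simp add: dist_real_def divide_less_eq)
  qed
qed

section \<open>Fubini for Lebesgue measurable functions\<close>

lemma AE_lebesgue_on_iff:
  assumes "S \<in> sets lebesgue"
  shows "(AE x in lebesgue_on S. P x) \<longleftrightarrow> (AE x in lborel. x \<in> S \<longrightarrow> P x)"
  using assms by (simp add: AE_restrict_space_iff AE_completion_iff)

lemma ex_borel_lebesgue_on:
  fixes f :: "'a::euclidean_space \<Rightarrow> 'b::euclidean_space"
  assumes f: "f \<in> borel_measurable (lebesgue_on S)" and S: "S \<in> sets lebesgue"
  obtains g where "g \<in> borel_measurable borel" "AE x in lebesgue_on S. f x = g x"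
proof -
  have "\<exists>h\<in>borel_measurable lborel. AE x in lborel. (indicator S x *\<^sub>R f x) \<bullet> b = h x" for b
  proof (rule completion_ex_borel_measurable_real)
    have "(\<lambda>x. indicator S x *\<^sub>R f x) \<in> borel_measurable lebesgue"
      using f S by (simp add: borel_measurable_restrict_space_iff)
    thus "(\<lambda>x. (indicator S x *\<^sub>R f x) \<bullet> b) \<in> borel_measurable lebesgue" by (intro borel_measurable_inner) auto
  qed
  then obtain h where h: "\<And>b. h b \<in> borel_measurable lborel" "\<And>b. AE x in lborel. (indicator S x *\<^sub>R f x) \<bullet> b = h b x"
    by metis
  define g where "g x = (\<Sum>b\<in>Basis. h b x *\<^sub>R b)" for x
  have "AE x in lborel. \<forall>b\<in>Basis. (indicator S x *\<^sub>R f x) \<bullet> b = h b x"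
    by (rule AE_finite_allI) (use h in auto)
  hence "AE x in lborel. x \<in> S \<longrightarrow> f x = g x"
  proof eventually_elim
    case (elim x)
    show ?case
    proof
      assume "x \<in> S"
      hence "\<forall>b\<in>Basis. f x \<bullet> b = h b x" using elim by simp
      thus "f x = g x" unfolding g_def by (subst euclidean_representation[of "f x", symmetric]) (simp cong: sum.cong)
    qed
  qed
  hence "AE x in lebesgue_on S. f x = g x" using S by (simp add: AE_lebesgue_on_iff)
  moreover have "g \<in> borel_measurable borel" using h(1) unfolding g_def by simp
  ultimately show ?thesis using that by blast
qed

lemma AE_lborel_pair:
  fixes P :: "'a::euclidean_space \<times> 'b::euclidean_space \<Rightarrow> bool"
  assumes "AE z in lborel. P z"
  shows "AE x in lborel. AE y in lborel. P (x, y)"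
  by (rule lborel_pair.AE_pair) (unfold lborel_prod, rule assms)

lemma AE_lebesgue_on_prod:
  fixes A :: "'a::euclidean_space set" and B :: "'b::euclidean_space set"
  assumes "A \<in> sets borel" "B \<in> sets borel" and P: "AE z in lebesgue_on (A \<times> B). P z"
  shows "AE x in lebesgue_on A. AE y in lebesgue_on B. P (x, y)"
proof -
  have AB: "A \<times> B \<in> sets lebesgue" "A \<in> sets lebesgue" "B \<in> sets lebesgue"
    using assms by (auto simp: borel_prod[symmetric] intro!: sets_completionI_sets)
  have "AE z in lborel. z \<in> A \<times> B \<longrightarrow> P z" using P AB by (simp add: AE_lebesgue_on_iff)
  from AE_lborel_pair[OF this] show ?thesis
    by (auto simp: AE_lebesgue_on_iff AB elim!: eventually_mono)
qed

lemma AE_lebesgue_on_fst: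
  fixes A :: "'a::euclidean_space set" and B :: "'b::euclidean_space set"
  assumes "A \<in> sets borel" "B \<in> sets borel" and P: "AE x in lebesgue_on A. P x"
  shows "AE z in lebesgue_on (A \<times> B). P (fst z)"
proof -
  have AB: "A \<times> B \<in> sets lebesgue" "A \<in> sets lebesgue" "B \<in> sets lebesgue"
    using assms by (auto simp: borel_prod[symmetric] intro!: sets_completionI_sets)
  have "AE x in lborel. x \<in> A \<longrightarrow> P x" using P AB by (simp add: AE_lebesgue_on_iff)
  then obtain N where N: "N \<in> null_sets lborel" "{x. \<not> (x \<in> A \<longrightarrow> P x)} \<subseteq> N"
    unfolding eventually_ae_filter by auto
  have "N \<times> UNIV \<in> null_sets (lborel \<Otimes>\<^sub>M lborel :: ('a \<times> 'b) measure)"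
    using N by (auto intro!: lborel.times_in_null_sets1)
  hence "AE z in (lborel :: ('a \<times> 'b) measure). z \<notin> N \<times> UNIV" unfolding lborel_prod by (rule AE_not_in)
  thus ?thesis unfolding AE_lebesgue_on_iff[OF AB(1)] by eventually_elim (use N in auto)
qed

lemma measurable_lebesgue_on_fst:
  fixes A :: "'a::euclidean_space set" and B :: "'b::euclidean_space set" and h :: "'a \<Rightarrow> 'c::euclidean_space"
  assumes A: "A \<in> sets borel" "B \<in> sets borel" and h: "h \<in> borel_measurable (lebesgue_on A)"
  shows "(\<lambda>z. h (fst z)) \<in> borel_measurable (lebesgue_on (A \<times> B))"
proof -
  have AB: "A \<times> B \<in> sets lebesgue" "A \<in> sets lebesgue" "B \<in> sets lebesgue"
    using assms by (auto simp: borel_prod[symmetric] intro!: sets_completionI_sets)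
  obtain g where g: "g \<in> borel_measurable borel" "AE x in lebesgue_on A. h x = g x"
    using ex_borel_lebesgue_on[OF h AB(2)] by blast
  have "(\<lambda>z. g (fst z)) \<in> borel_measurable (borel \<Otimes>\<^sub>M (borel :: 'b measure))" using g(1) by measurable
  hence "(\<lambda>z. g (fst z)) \<in> borel_measurable (borel :: ('a \<times> 'b) measure)" by (simp only: borel_prod)
  hence "(\<lambda>z. g (fst z)) \<in> borel_measurable (lebesgue_on (A \<times> B))"
    by (intro measurable_restrict_space1 measurable_completion) simp
  moreover have "AE z in lebesgue_on (A \<times> B). g (fst z) = h (fst z)"
    using AE_lebesgue_on_fst[OF A g(2)] by eventually_elim simp
  ultimately show ?thesis using AB(1) by (rule borel_measurable_lebesgue_on_AE)
qed

lemma integral_lebesgue_on_lborel: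
  fixes g :: "'d::euclidean_space \<Rightarrow> 'c::euclidean_space"
  assumes "g \<in> borel_measurable borel" "S \<in> sets lebesgue" "\<And>x. x \<notin> S \<Longrightarrow> g x = 0"
  shows "(LINT x|lebesgue_on S. g x) = (LINT x|lborel. g x)" "integrable (lebesgue_on S) g \<longleftrightarrow> integrable lborel g"
proof -
  have eq: "(\<lambda>x. indicator S x *\<^sub>R g x) = g" using assms(3) by (auto simp: indicator_def)
  have "(LINT x|lebesgue_on S. g x) = (LINT x|lebesgue. g x)" "integrable (lebesgue_on S) g \<longleftrightarrow> integrable lebesgue g"
    using assms(2) by (simp_all add: integral_restrict_space integrable_restrict_space eq)
  thus "(LINT x|lebesgue_on S. g x) = (LINT x|lborel. g x)" "integrable (lebesgue_on S) g \<longleftrightarrow> integrable lborel g"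
    using assms(1) by (simp_all add: integral_completion integrable_completion)
qed

lemma lebesgue_on_measurable_borelI:
  "g \<in> borel_measurable borel \<Longrightarrow> g \<in> borel_measurable (lebesgue_on S)"
  by (intro measurable_restrict_space1 measurable_completion) simp

context
  fixes A :: "'a::euclidean_space set" and B :: "'b::euclidean_space set"
  assumes A: "A \<in> sets borel" and B: "B \<in> sets borel"
begin

lemma prod_sets_lebesgue: "A \<times> B \<in> sets lebesgue" "A \<in> sets lebesgue" "B \<in> sets lebesgue" "A \<times> B \<in> sets borel"
  using A B by (auto simp: borel_prod[symmetric] intro!: sets_completionI_sets)

text \<open>Lebesgue measure on a product is the completion of the product measure, so a section of
  a measurable \<open>f\<close> can fail to be measurable. The Borel version \<open>g\<close>, cut
  off outside the product, has good sections, and for almost every \<open>x\<close> the section of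
  \<open>f\<close> inherits measurability from it.\<close>

lemma lebesgue_on_prod_borel:
  fixes f :: "'a \<times> 'b \<Rightarrow> 'c::euclidean_space"
  assumes f: "f \<in> borel_measurable (lebesgue_on (A \<times> B))"
  obtains g where "g \<in> borel_measurable (lborel \<Otimes>\<^sub>M lborel)" "\<And>z. z \<notin> A \<times> B \<Longrightarrow> g z = 0"
    "AE z in lebesgue_on (A \<times> B). f z = g z"
    "AE x in lebesgue_on A. (AE y in lebesgue_on B. f (x, y) = g (x, y)) \<and> (\<lambda>y. f (x, y)) \<in> borel_measurable (lebesgue_on B)"
proof -
  obtain g0 where g0: "g0 \<in> borel_measurable borel" "AE x in lebesgue_on (A \<times> B). f x = g0 x"
    using ex_borel_lebesgue_on[OF f prod_sets_lebesgue(1)] by blast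
  define g where "g z = indicator (A \<times> B) z *\<^sub>R g0 z" for z
  have g: "g \<in> borel_measurable borel" unfolding g_def
    by (intro borel_measurable_scaleR borel_measurable_indicator g0 prod_sets_lebesgue)
  have gg: "g \<in> borel_measurable (borel \<Otimes>\<^sub>M borel)" using g by (simp add: borel_prod)
  have ae: "AE z in lebesgue_on (A \<times> B). f z = g z"
    using g0(2) AE_space by eventually_elim (simp add: g_def)
  have ae2: "AE x in lebesgue_on A. (AE y in lebesgue_on B. f (x, y) = g (x, y)) \<and> (\<lambda>y. f (x, y)) \<in> borel_measurable (lebesgue_on B)"
    using AE_lebesgue_on_prod[OF A B ae]
  proof eventually_elim
    case (elim x)
    have "(\<lambda>y. g (x, y)) \<in> borel_measurable borel" using gg by measurable
    hence "(\<lambda>y. g (x, y)) \<in> borel_measurable (lebesgue_on B)"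
      by (intro measurable_restrict_space1 measurable_completion) simp
    moreover have "AE y in lebesgue_on B. g (x, y) = f (x, y)" using elim by eventually_elim simp
    ultimately have "(\<lambda>y. f (x, y)) \<in> borel_measurable (lebesgue_on B)"
      using prod_sets_lebesgue(3) by (rule borel_measurable_lebesgue_on_AE)
    thus ?case using elim by simp
  qed
  show ?thesis
  proof (rule that[of g])
    show "g \<in> borel_measurable (lborel \<Otimes>\<^sub>M lborel)" using g unfolding lborel_prod by simp
  qed (use ae ae2 in \<open>auto simp: g_def\<close>)
qed

lemma section_integral:
  fixes f g :: "'a \<times> 'b \<Rightarrow> 'c::euclidean_space"
  assumes g: "g \<in> borel_measurable (lborel \<Otimes>\<^sub>M lborel)" "\<And>z. z \<notin> A \<times> B \<Longrightarrow> g z = 0"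
    and ae: "AE y in lebesgue_on B. f (x, y) = g (x, y)" and m: "(\<lambda>y. f (x, y)) \<in> borel_measurable (lebesgue_on B)"
  shows "(LINT y|lebesgue_on B. f (x, y)) = (LINT y|lborel. g (x, y))"
    "integrable (lebesgue_on B) (\<lambda>y. f (x, y)) \<longleftrightarrow> integrable lborel (\<lambda>y. g (x, y))"
    "(LINT y|lebesgue_on B. norm (f (x, y))) = (LINT y|lborel. norm (g (x, y)))"
proof -
  have gx: "(\<lambda>y. g (x, y)) \<in> borel_measurable borel" using g(1) by measurable
  have gxB: "(\<lambda>y. g (x, y)) \<in> borel_measurable (lebesgue_on B)"
    using gx by (intro measurable_restrict_space1 measurable_completion) simp
  note * = integral_lebesgue_on_lborel[of "\<lambda>y. g (x, y)" B, OF gx prod_sets_lebesgue(3)]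
  have g0: "y \<notin> B \<Longrightarrow> g (x, y) = 0" for y using g(2) by auto
  show "(LINT y|lebesgue_on B. f (x, y)) = (LINT y|lborel. g (x, y))"
    using *(1) g0 integral_cong_AE[OF m gxB ae] by simp
  show "integrable (lebesgue_on B) (\<lambda>y. f (x, y)) \<longleftrightarrow> integrable lborel (\<lambda>y. g (x, y))"
    using *(2) g0 integrable_cong_AE[OF m gxB ae] by simp
  have "(LINT y|lebesgue_on B. norm (f (x, y))) = (LINT y|lebesgue_on B. norm (g (x, y)))"
    by (rule integral_cong_AE) (use m gxB ae in auto)
  also have "\<dots> = (LINT y|lborel. norm (g (x, y)))"
    by (rule integral_lebesgue_on_lborel) (use gx prod_sets_lebesgue g0 in auto)
  finally show "(LINT y|lebesgue_on B. norm (f (x, y))) = (LINT y|lborel. norm (g (x, y)))" .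
qed

lemma measurable_marginal:
  fixes f :: "'a \<times> 'b \<Rightarrow> 'c::euclidean_space"
  assumes f: "f \<in> borel_measurable (lebesgue_on (A \<times> B))"
  shows "(\<lambda>x. LINT y|lebesgue_on B. f (x, y)) \<in> borel_measurable (lebesgue_on A)"
proof -
  obtain g where g: "g \<in> borel_measurable (lborel \<Otimes>\<^sub>M lborel)" "\<And>z. z \<notin> A \<times> B \<Longrightarrow> g z = 0"
    "AE z in lebesgue_on (A \<times> B). f z = g z"
    "AE x in lebesgue_on A. (AE y in lebesgue_on B. f (x, y) = g (x, y)) \<and> (\<lambda>y. f (x, y)) \<in> borel_measurable (lebesgue_on B)"
    by (rule lebesgue_on_prod_borel[OF f], rule that) (assumption | blast)+
  have 1: "(\<lambda>x. LINT y|lborel. g (x, y)) \<in> borel_measurable borel"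
    using lborel.borel_measurable_lebesgue_integral[of "\<lambda>x y. g (x, y)" lborel] g(1) by (simp add: case_prod_unfold)
  have 2: "AE x in lebesgue_on A. (LINT y|lborel. g (x, y)) = (LINT y|lebesgue_on B. f (x, y))"
    using g(4) by eventually_elim (use section_integral(1)[OF g(1,2), where f=f] in auto)
  show ?thesis
    by (rule borel_measurable_lebesgue_on_AE[OF lebesgue_on_measurable_borelI[OF 1] 2 prod_sets_lebesgue(2)])
qed

lemma Fubini_lebesgue_on:
  fixes f :: "'a \<times> 'b \<Rightarrow> 'c::euclidean_space"
  assumes f: "integrable (lebesgue_on (A \<times> B)) f"
  shows "AE x in lebesgue_on A. integrable (lebesgue_on B) (\<lambda>y. f (x, y))"
    "integrable (lebesgue_on A) (\<lambda>x. LINT y|lebesgue_on B. f (x, y))"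
    "(LINT z|lebesgue_on (A \<times> B). f z) = (LINT x|lebesgue_on A. LINT y|lebesgue_on B. f (x, y))"
proof -
  have fm: "f \<in> borel_measurable (lebesgue_on (A \<times> B))" using f by auto
  obtain g where g: "g \<in> borel_measurable (lborel \<Otimes>\<^sub>M lborel)" "\<And>z. z \<notin> A \<times> B \<Longrightarrow> g z = 0"
    "AE z in lebesgue_on (A \<times> B). f z = g z"
    "AE x in lebesgue_on A. (AE y in lebesgue_on B. f (x, y) = g (x, y)) \<and> (\<lambda>y. f (x, y)) \<in> borel_measurable (lebesgue_on B)"
    by (rule lebesgue_on_prod_borel[OF fm], rule that) (assumption | blast)+
  have gb: "g \<in> borel_measurable borel" using g(1) unfolding lborel_prod by simp
  have gm: "g \<in> borel_measurable (lebesgue_on (A \<times> B))" using gb by (rule lebesgue_on_measurable_borelI)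
  have "integrable (lebesgue_on (A \<times> B)) g" using f integrable_cong_AE[OF fm gm g(3)] by simp
  hence gi: "integrable (lborel \<Otimes>\<^sub>M lborel) g"
    using integral_lebesgue_on_lborel(2)[OF gb prod_sets_lebesgue(1) g(2)] unfolding lborel_prod by simp
  have 1: "AE x in lborel. integrable lborel (\<lambda>y. g (x, y))" using lborel_pair.AE_integrable_fst'[OF gi] .
  hence "AE x in lebesgue_on A. integrable lborel (\<lambda>y. g (x, y))"
    unfolding AE_lebesgue_on_iff[OF prod_sets_lebesgue(2)] by eventually_elim simp
  with g(4) show "AE x in lebesgue_on A. integrable (lebesgue_on B) (\<lambda>y. f (x, y))"
    by eventually_elim (use section_integral(2)[OF g(1,2), where f=f] in blast)
  have 2: "integrable lborel (\<lambda>x. LINT y|lborel. g (x, y))" using lborel_pair.integrable_fst'[OF gi] .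
  have 20: "x \<notin> A \<Longrightarrow> (LINT y|lborel. g (x, y)) = 0" for x using g(2)[of "(x, y)" for y] by simp
  have b2: "(\<lambda>x. LINT y|lborel. g (x, y)) \<in> borel_measurable borel" using borel_measurable_integrable[OF 2] by simp
  note gA = integral_lebesgue_on_lborel[OF b2 prod_sets_lebesgue(2) 20] 2
  have ae: "AE x in lebesgue_on A. (LINT y|lborel. g (x, y)) = (LINT y|lebesgue_on B. f (x, y))"
    using g(4) by eventually_elim (use section_integral(1)[OF g(1,2), where f=f] in auto)
  have 3: "integrable (lebesgue_on A) (\<lambda>x. LINT y|lborel. g (x, y))" using gA by simp
  show "integrable (lebesgue_on A) (\<lambda>x. LINT y|lebesgue_on B. f (x, y))"
    using integrable_cong_AE_imp[OF 3 measurable_marginal[OF fm]] ae by (auto simp: eq_commute)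
  have "(LINT z|lebesgue_on (A \<times> B). f z) = (LINT z|lebesgue_on (A \<times> B). g z)"
    by (rule integral_cong_AE[OF fm gm g(3)])
  also have "\<dots> = (LINT z|(lborel \<Otimes>\<^sub>M lborel). g z)"
    using integral_lebesgue_on_lborel(1)[OF gb prod_sets_lebesgue(1) g(2)] unfolding lborel_prod by simp
  also have "\<dots> = (LINT x|lborel. LINT y|lborel. g (x, y))" using lborel_pair.integral_fst'[OF gi] by simp
  also have "\<dots> = (LINT x|lebesgue_on A. LINT y|lborel. g (x, y))" using gA by simp
  also have "\<dots> = (LINT x|lebesgue_on A. LINT y|lebesgue_on B. f (x, y))"
    by (rule integral_cong_AE[OF _ measurable_marginal[OF fm] ae]) (use 3 in auto)
  finally show "(LINT z|lebesgue_on (A \<times> B). f z) = (LINT x|lebesgue_on A. LINT y|lebesgue_on B. f (x, y))" .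
qed

lemma Tonelli_lebesgue_on:
  fixes f :: "'a \<times> 'b \<Rightarrow> 'c::euclidean_space"
  assumes f: "f \<in> borel_measurable (lebesgue_on (A \<times> B))"
    and i1: "AE x in lebesgue_on A. integrable (lebesgue_on B) (\<lambda>y. f (x, y))"
    and i2: "integrable (lebesgue_on A) (\<lambda>x. LINT y|lebesgue_on B. norm (f (x, y)))"
  shows "integrable (lebesgue_on (A \<times> B)) f"
proof -
  obtain g where g: "g \<in> borel_measurable (lborel \<Otimes>\<^sub>M lborel)" "\<And>z. z \<notin> A \<times> B \<Longrightarrow> g z = 0"
    "AE z in lebesgue_on (A \<times> B). f z = g z"
    "AE x in lebesgue_on A. (AE y in lebesgue_on B. f (x, y) = g (x, y)) \<and> (\<lambda>y. f (x, y)) \<in> borel_measurable (lebesgue_on B)"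
    by (rule lebesgue_on_prod_borel[OF f], rule that) (assumption | blast)+
  have gb: "g \<in> borel_measurable borel" using g(1) unfolding lborel_prod by simp
  have gm: "g \<in> borel_measurable (lebesgue_on (A \<times> B))" using gb by (rule lebesgue_on_measurable_borelI)
  have g0: "x \<notin> A \<Longrightarrow> g (x, y) = 0" for x y using g(2) by auto
  have "integrable (lborel \<Otimes>\<^sub>M lborel) g"
  proof (rule lborel_pair.Fubini_integrable[OF g(1)])
    have "AE x in lebesgue_on A. integrable lborel (\<lambda>y. g (x, y))"
      using g(4) i1 by eventually_elim (use section_integral(2)[OF g(1,2), where f=f] in blast)
    thus "AE x in lborel. integrable lborel (\<lambda>y. g (x, y))"
      unfolding AE_lebesgue_on_iff[OF prod_sets_lebesgue(2)] by eventually_elim (use g0 in auto)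
    have b: "(\<lambda>x. LINT y|lborel. norm (g (x, y))) \<in> borel_measurable borel"
      using lborel.borel_measurable_lebesgue_integral[of "\<lambda>x y. norm (g (x, y))" lborel] g(1) by (simp add: case_prod_unfold)
    have ae: "AE x in lebesgue_on A. (LINT y|lebesgue_on B. norm (f (x, y))) = (LINT y|lborel. norm (g (x, y)))"
      using g(4) by eventually_elim (use section_integral(3)[OF g(1,2), where f=f] in auto)
    have "integrable (lebesgue_on A) (\<lambda>x. LINT y|lborel. norm (g (x, y)))"
      by (rule integrable_cong_AE_imp[OF i2 lebesgue_on_measurable_borelI[OF b]]) (use ae in \<open>auto simp: eq_commute\<close>)
    thus "integrable lborel (\<lambda>x. LINT y|lborel. norm (g (x, y)))"
      using integral_lebesgue_on_lborel(2)[OF b prod_sets_lebesgue(2)] g0 by simp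
  qed
  hence "integrable (lebesgue_on (A \<times> B)) g"
    using integral_lebesgue_on_lborel(2)[OF gb prod_sets_lebesgue(1) g(2)] unfolding lborel_prod by simp
  thus ?thesis using integrable_cong_AE[OF f gm g(3)] by simp
qed

text \<open>The converse of \<open>AE_lebesgue_on_prod\<close>, which fails for arbitrary sets:
  joint measurability of \<open>f\<close> makes the zero set of its Borel version measurable, and
  for such a set null slices give a null complement.\<close>

lemma AE_lebesgue_on_prodI:
  fixes f :: "'a \<times> 'b \<Rightarrow> 'c::euclidean_space"
  assumes f: "f \<in> borel_measurable (lebesgue_on (A \<times> B))"
    and ae: "AE x in lebesgue_on A. AE y in lebesgue_on B. f (x, y) = 0"
  shows "AE z in lebesgue_on (A \<times> B). f z = 0"
proof -
  obtain g where g: "g \<in> borel_measurable (lborel \<Otimes>\<^sub>M lborel)" "\<And>z. z \<notin> A \<times> B \<Longrightarrow> g z = 0"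
    "AE z in lebesgue_on (A \<times> B). f z = g z"
    "AE x in lebesgue_on A. (AE y in lebesgue_on B. f (x, y) = g (x, y)) \<and> (\<lambda>y. f (x, y)) \<in> borel_measurable (lebesgue_on B)"
    by (rule lebesgue_on_prod_borel[OF f], rule that) (assumption | blast)+
  have "AE x in lebesgue_on A. AE y in lebesgue_on B. g (x, y) = 0"
    using g(4) ae
  proof eventually_elim
    case (elim x)
    hence 1: "AE y in lebesgue_on B. f (x, y) = g (x, y)" by simp
    show ?case using 1 elim(2) by eventually_elim simp
  qed
  hence "AE x in lborel. AE y in lborel. g (x, y) = 0"
    unfolding AE_lebesgue_on_iff[OF prod_sets_lebesgue(2)] AE_lebesgue_on_iff[OF prod_sets_lebesgue(3)]
  proof eventually_elim
    case (elim x)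
    show ?case
    proof (cases "x \<in> A")
      case True
      with elim have "AE y in lborel. y \<in> B \<longrightarrow> g (x, y) = 0" by simp
      thus ?thesis by eventually_elim (use g(2) in auto)
    qed (use g(2) in auto)
  qed
  moreover have "{z \<in> space (lborel \<Otimes>\<^sub>M lborel). g z = 0} \<in> sets (lborel \<Otimes>\<^sub>M lborel)" using g(1) by measurable
  ultimately have "AE z in (lborel \<Otimes>\<^sub>M lborel). g z = 0" using lborel_pair.AE_pair_iff[of "\<lambda>x y. g (x, y) = 0"] by simp
  hence "AE z in lebesgue_on (A \<times> B). g z = 0"
    unfolding AE_lebesgue_on_iff[OF prod_sets_lebesgue(1)] lborel_prod by eventually_elim simp
  with g(3) show ?thesis by eventually_elim simp
qed

end

section \<open>Cylinders\<close>

lemma hpart_pt3 [simp]: "hpart (pt3 x t) = x" and pt3_3 [simp]: "pt3 x t $ 3 = t"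
  and pt3_hpart [simp]: "pt3 (hpart p) (p $ 3) = p"
  by (simp_all add: hpart_def pt3_def vec_eq_iff forall_2 forall_3)

lemma pt3_nth [simp]: "pt3 x t $ 1 = x $ 1" "pt3 x t $ 2 = x $ 2"
  by (simp_all add: pt3_def)

text \<open>The splitting as a map on the product type, where Fubini is available; being measure
  preserving, it transports integrals over cylinders to integrals over products.\<close>

definition pt3_pair :: "(real^2) \<times> real \<Rightarrow> real^3" where
  "pt3_pair z = pt3 (fst z) (snd z)"

lemma continuous_pt3_pair: "continuous_on UNIV pt3_pair"
proof -
  have eq: "pt3_pair = (\<lambda>z. (fst z $ 1) *\<^sub>R axis 1 1 + (fst z $ 2) *\<^sub>R axis 2 1 + snd z *\<^sub>R axis 3 1)"
    by (auto simp: pt3_pair_def pt3_def vec_eq_iff forall_3 axis_def)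
  show ?thesis unfolding eq by (intro continuous_intros)
qed

lemma continuous_hpart: "continuous_on UNIV hpart"
proof -
  have eq: "hpart = (\<lambda>x. (x $ 1) *\<^sub>R axis 1 1 + (x $ 2) *\<^sub>R axis 2 1)"
    by (auto simp: hpart_def vec_eq_iff forall_2 axis_def)
  show ?thesis unfolding eq by (intro continuous_intros)
qed

lemma prod_Basis_vec: "(\<Prod>b\<in>Basis. (v::real^'n) \<bullet> b) = (\<Prod>i\<in>UNIV. v $ i)"
proof -
  have eq: "(Basis :: (real^'n) set) = (\<lambda>i. axis i 1) ` UNIV" by (auto simp: Basis_vec_def)
  have "inj (\<lambda>i. axis i (1::real) :: real^'n)" by (auto simp: inj_on_def axis_eq_axis)
  from prod.reindex[OF this, of "\<lambda>b. v \<bullet> b"] show ?thesis unfolding eq by (simp add: inner_axis)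
qed

text \<open>Preimages of boxes are products of boxes with the same volume, and the volumes of boxes
  determine Lebesgue measure.\<close>

lemma distr_pt3_pair: "distr lborel borel pt3_pair = lborel"
proof (rule lborel_eqI[symmetric])
  have m: "pt3_pair \<in> borel_measurable lborel"
    using borel_measurable_continuous_onI[OF continuous_pt3_pair] by simp
  fix l u :: "real^3" assume lu: "\<And>b. b \<in> Basis \<Longrightarrow> l \<bullet> b \<le> u \<bullet> b"
  have le: "l $ i \<le> u $ i" for i using lu[of "axis i 1"] by (simp add: inner_axis axis_in_Basis_iff)
  have "pt3_pair -` box l u = box (hpart l) (hpart u) \<times> box (l $ 3) (u $ 3)"
    by (auto simp: mem_box_cart forall_3 forall_2 pt3_pair_def hpart_def)
  hence "emeasure (distr lborel borel pt3_pair) (box l u) = emeasure (lborel \<Otimes>\<^sub>M lborel) (box (hpart l) (hpart u) \<times> box (l $ 3) (u $ 3))"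
    by (subst emeasure_distr[OF m]) (auto simp: lborel_prod[symmetric])
  also have "\<dots> = emeasure lborel (box (hpart l) (hpart u)) * emeasure lborel (box (l $ 3) (u $ 3))"
    by (rule lborel.emeasure_pair_measure_Times) auto
  also have "emeasure lborel (box (hpart l) (hpart u)) = ennreal ((u $ 1 - l $ 1) * (u $ 2 - l $ 2))"
    using le prod_Basis_vec[of "hpart u - hpart l"]
    by (subst emeasure_lborel_box) (auto simp: UNIV_2 hpart_def Basis_vec_def inner_axis forall_2)
  also have "emeasure lborel (box (l $ 3) (u $ 3)) = ennreal (u $ 3 - l $ 3)"
    using le by (simp add: box_real)
  also have "ennreal ((u $ 1 - l $ 1) * (u $ 2 - l $ 2)) * ennreal (u $ 3 - l $ 3) = ennreal ((u $ 1 - l $ 1) * (u $ 2 - l $ 2) * (u $ 3 - l $ 3))"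
    by (rule ennreal_mult[symmetric]) (use le in auto)
  also have "(u $ 1 - l $ 1) * (u $ 2 - l $ 2) * (u $ 3 - l $ 3) = (\<Prod>b\<in>Basis. (u - l) \<bullet> b)"
    unfolding prod_Basis_vec UNIV_3 by (simp add: mult.assoc)
  finally show "emeasure (distr lborel borel pt3_pair) (box l u) = ennreal (\<Prod>b\<in>Basis. (u - l) \<bullet> b)" .
qed simp

lemma vimage_pt3_pair_cylinder: "pt3_pair -` cylinder \<omega> I = \<omega> \<times> I"
  by (auto simp: cylinder_def pt3_pair_def)

lemma AE_pt3_pair:
  assumes W: "W \<in> sets borel" and P: "AE x in lebesgue_on W. P x"
  shows "AE z in lebesgue_on (pt3_pair -` W). P (pt3_pair z)"
proof -
  have m: "pt3_pair \<in> borel_measurable lborel"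
    using borel_measurable_continuous_onI[OF continuous_pt3_pair] by simp
  have W': "pt3_pair -` W \<in> sets lebesgue" "W \<in> sets lebesgue"
    using measurable_sets[OF m W] W by auto
  have "AE x in distr lborel borel pt3_pair. x \<in> W \<longrightarrow> P x"
    using P unfolding distr_pt3_pair AE_lebesgue_on_iff[OF W'(2)] .
  from AE_distrD[OF m this] show ?thesis unfolding AE_lebesgue_on_iff[OF W'(1)] by simp
qed

lemma measurable_pt3_pair:
  fixes f :: "real^3 \<Rightarrow> 'b::euclidean_space"
  assumes W: "W \<in> sets borel" and f: "f \<in> borel_measurable (lebesgue_on W)"
  shows "(\<lambda>z. f (pt3_pair z)) \<in> borel_measurable (lebesgue_on (pt3_pair -` W))"
proof -
  have m: "pt3_pair \<in> borel_measurable borel"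
    using borel_measurable_continuous_onI[OF continuous_pt3_pair] by simp
  have W': "pt3_pair -` W \<in> sets lebesgue" "W \<in> sets lebesgue"
    using measurable_sets[OF m W] W by auto
  obtain g where g: "g \<in> borel_measurable borel" "AE x in lebesgue_on W. f x = g x"
    using ex_borel_lebesgue_on[OF f W'(2)] by blast
  have 1: "(\<lambda>z. g (pt3_pair z)) \<in> borel_measurable borel" using g(1) m by measurable
  have 2: "AE z in lebesgue_on (pt3_pair -` W). g (pt3_pair z) = f (pt3_pair z)"
    using AE_pt3_pair[OF W g(2)] by eventually_elim simp
  show ?thesis
    by (rule borel_measurable_lebesgue_on_AE[OF lebesgue_on_measurable_borelI[OF 1] 2 W'(1)])
qed

lemma integral_pt3_pair:
  fixes f :: "real^3 \<Rightarrow> 'b::euclidean_space"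
  assumes W: "W \<in> sets borel" and f: "integrable (lebesgue_on W) f"
  shows "integrable (lebesgue_on (pt3_pair -` W)) (\<lambda>z. f (pt3_pair z))"
    "(LINT z|lebesgue_on (pt3_pair -` W). f (pt3_pair z)) = (LINT x|lebesgue_on W. f x)"
proof -
  have m: "pt3_pair \<in> measurable lborel borel"
    using borel_measurable_continuous_onI[OF continuous_pt3_pair] by simp
  have W': "pt3_pair -` W \<in> sets lebesgue" "W \<in> sets lebesgue"
    using measurable_sets[OF m W] W by auto
  have fm: "f \<in> borel_measurable (lebesgue_on W)" using f by auto
  obtain g0 where g0: "g0 \<in> borel_measurable borel" "AE x in lebesgue_on W. f x = g0 x"
    using ex_borel_lebesgue_on[OF fm W'(2)] by blast
  define g where "g x = indicator W x *\<^sub>R g0 x" for x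
  have g: "g \<in> borel_measurable borel" unfolding g_def using W g0 by measurable
  have gz: "x \<notin> W \<Longrightarrow> g x = 0" for x by (simp add: g_def)
  have ae: "AE x in lebesgue_on W. f x = g x" using g0(2) AE_space by eventually_elim (simp add: g_def)
  have ae': "AE z in lebesgue_on (pt3_pair -` W). f (pt3_pair z) = g (pt3_pair z)" by (rule AE_pt3_pair[OF W ae])
  note gW = lebesgue_on_measurable_borelI[OF g]
  have gm: "(\<lambda>z. g (pt3_pair z)) \<in> borel_measurable borel" using g m by simp
  note gmW = lebesgue_on_measurable_borelI[OF gm]
  note fmW = measurable_pt3_pair[OF W fm]
  have "integrable (lebesgue_on W) g" using integrable_cong_AE[OF fm gW ae] f by simp
  hence gi: "integrable (distr lborel borel pt3_pair) g"
    unfolding distr_pt3_pair using integral_lebesgue_on_lborel(2)[OF g W'(2) gz] by simp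
  hence gi': "integrable lborel (\<lambda>z. g (pt3_pair z))" using integrable_distr_eq[OF m, of g] g by simp
  have z0: "z \<notin> pt3_pair -` W \<Longrightarrow> g (pt3_pair z) = 0" for z using gz by simp
  note * = integral_lebesgue_on_lborel[OF gm W'(1) z0]
  show "integrable (lebesgue_on (pt3_pair -` W)) (\<lambda>z. f (pt3_pair z))"
    using integrable_cong_AE[OF fmW gmW ae'] *(2) gi' by simp
  have "(LINT z|lebesgue_on (pt3_pair -` W). f (pt3_pair z)) = (LINT z|lborel. g (pt3_pair z))"
    using integral_cong_AE[OF fmW gmW ae'] *(1) by simp
  also have "\<dots> = (LINT x|distr lborel borel pt3_pair. g x)" using integral_distr[OF m, of g] g by simp
  also have "\<dots> = (LINT x|lebesgue_on W. f x)"
    unfolding distr_pt3_pair using integral_cong_AE[OF fm gW ae] integral_lebesgue_on_lborel(1)[OF g W'(2) gz] by simp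
  finally show "(LINT z|lebesgue_on (pt3_pair -` W). f (pt3_pair z)) = (LINT x|lebesgue_on W. f x)" .
qed

lemma lebesgue_on_indicator:
  fixes f :: "'a::euclidean_space \<Rightarrow> real"
  assumes "S \<subseteq> T" "S \<in> sets lebesgue" "T \<in> sets lebesgue"
  shows "integrable (lebesgue_on T) (\<lambda>x. indicator S x * f x) \<longleftrightarrow> integrable (lebesgue_on S) f"
    "(LINT x|lebesgue_on T. indicator S x * f x) = (LINT x|lebesgue_on S. f x)"
proof -
  have eq: "(\<lambda>x. indicator T x *\<^sub>R (indicator S x * f x)) = (\<lambda>x. indicator S x *\<^sub>R f x)"
    using assms(1) by (auto simp: fun_eq_iff indicator_def)
  have ST: "S \<inter> space lebesgue \<in> sets lebesgue" "T \<inter> space lebesgue \<in> sets lebesgue" using assms by auto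
  show "integrable (lebesgue_on T) (\<lambda>x. indicator S x * f x) \<longleftrightarrow> integrable (lebesgue_on S) f"
    unfolding integrable_restrict_space[OF ST(1)] integrable_restrict_space[OF ST(2)] eq ..
  show "(LINT x|lebesgue_on T. indicator S x * f x) = (LINT x|lebesgue_on S. f x)"
    unfolding integral_restrict_space[OF ST(1)] integral_restrict_space[OF ST(2)] eq ..
qed

section \<open>Elementary geometry of cylinders\<close>

lemma open_cylinder: "open \<omega> \<Longrightarrow> open I \<Longrightarrow> open (cylinder \<omega> I)"
proof -
  assume o: "open \<omega>" "open I"
  have eq: "cylinder \<omega> I = hpart -` \<omega> \<inter> (\<lambda>x. x $ 3) -` I" by (auto simp: cylinder_def)
  have "continuous_on UNIV (\<lambda>x::real^3. x $ 3)" by (intro continuous_intros)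
  thus ?thesis unfolding eq using o continuous_hpart by (intro open_Int open_vimage)
qed

lemma pt3_diff: "pt3 x t - pt3 y s = pt3 (x - y) (t - s)"
  by (simp add: pt3_def vec_eq_iff forall_3)

lemma norm_pt3_sq: "(norm (pt3 x t))\<^sup>2 = (norm x)\<^sup>2 + t\<^sup>2"
  unfolding power2_norm_eq_inner inner_vec_def by (simp add: sum_2 sum_3 power2_eq_square)

lemma norm_pt3_le: "norm (pt3 x t) \<le> norm x + \<bar>t\<bar>"
proof (rule power2_le_imp_le)
  show "(norm (pt3 x t))\<^sup>2 \<le> (norm x + \<bar>t\<bar>)\<^sup>2"
    by (simp add: norm_pt3_sq power2_sum)
qed simp

lemma norm_pt3_ge: "norm x \<le> norm (pt3 x t)" "\<bar>t\<bar> \<le> norm (pt3 x t)"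
  by (rule power2_le_imp_le; simp add: norm_pt3_sq)+

lemma bounded_cylinder:
  assumes "bounded \<omega>" "bounded I"
  shows "bounded (cylinder \<omega> I)"
proof -
  obtain a b where a: "\<And>x. x \<in> \<omega> \<Longrightarrow> norm x \<le> a" and b: "\<And>t. t \<in> I \<Longrightarrow> \<bar>t\<bar> \<le> b"
    using assms unfolding bounded_iff by auto
  show ?thesis unfolding bounded_iff
  proof (intro exI[of _ "a + b"] ballI)
    fix x assume "x \<in> cylinder \<omega> I"
    hence "norm (hpart x) \<le> a" "\<bar>x $ 3\<bar> \<le> b" using a b by (auto simp: cylinder_def)
    thus "norm x \<le> a + b" using norm_pt3_le[of "hpart x" "x $ 3"] by simp
  qed
qed

lemma lmeasurable_cylinder:
  "open \<omega> \<Longrightarrow> bounded \<omega> \<Longrightarrow> cylinder \<omega> {A<..<B} \<in> lmeasurable"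
  by (intro lmeasurable_open bounded_cylinder open_cylinder) auto

lemma pt3_in_closure_cylinder:
  assumes "x \<in> \<omega>" "A < B" "h \<in> {A, B}"
  shows "pt3 x h \<in> closure (cylinder \<omega> {A<..<B})"
  unfolding closure_approachable
proof (intro allI impI)
  fix e :: real assume e: "e > 0"
  have "h \<in> closure {A<..<B}" using assms by auto
  then obtain t where t: "t \<in> {A<..<B}" "dist t h < e" using e unfolding closure_approachable by blast
  have "dist (pt3 x t) (pt3 x h) \<le> \<bar>t - h\<bar>"
    using norm_pt3_le[of 0 "t - h"] by (simp add: dist_norm pt3_diff)
  thus "\<exists>y\<in>cylinder \<omega> {A<..<B}. dist y (pt3 x h) < e"
    using t assms(1) by (intro bexI[of _ "pt3 x t"]) (auto simp: cylinder_def dist_real_def)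
qed

section \<open>Means near a horizontal face of a cylinder\<close>

lemma integrable_lborel_pair_sections:
  fixes k :: "(real^2) \<times> real \<Rightarrow> 'b::euclidean_space"
  assumes "integrable lborel k"
  shows "AE x in lborel. integrable lborel (\<lambda>s. k (x, s))" "integrable lborel (\<lambda>x. LINT s|lborel. k (x, s))"
    "(LINT z|lborel. k z) = (LINT x|lborel. LINT s|lborel. k (x, s))"
proof -
  have k: "integrable (lborel \<Otimes>\<^sub>M lborel) k" unfolding lborel_prod by (rule assms)
  show "AE x in lborel. integrable lborel (\<lambda>s. k (x, s))" using lborel_pair.AE_integrable_fst'[OF k] .
  show "integrable lborel (\<lambda>x. LINT s|lborel. k (x, s))" using lborel_pair.integrable_fst'[OF k] .
  show "(LINT z|lborel. k z) = (LINT x|lborel. LINT s|lborel. k (x, s))"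
    using lborel_pair.integral_fst'[OF k] unfolding lborel_prod by simp
qed

text \<open>The half ball contains a disc of radius \<open>r / 2\<close> times an interval of length
  \<open>r / 2\<close> next to the face. The small disc has a quarter of the area of the disc of
  radius \<open>r\<close>, hence the factor 1/8.\<close>

lemma measure_Int_ball_cylinder_ge:
  assumes \<omega>: "open \<omega>" "bounded \<omega>" and AB: "A < B" "h \<in> {A, B}" and r: "0 < r" "r < B - A" "ball x r \<subseteq> \<omega>"
  shows "measure lebesgue (ball x r) * r / 8 \<le> measure lebesgue (cylinder \<omega> {A<..<B} \<inter> ball (pt3 x h) r)"
proof -
  define S where "S = cylinder \<omega> {A<..<B} \<inter> ball (pt3 x h) r"
  \<comment> \<open>The part of the interval next to the face \<open>h\<close>;
    \<open>r < B - A\<close> keeps it inside.\<close>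
  define J where "J = (if h = A then {A<..<A + r/2} else {B - r/2<..<B})"
  have So: "open S" "bounded S" using \<omega> by (auto simp: S_def intro!: open_Int open_cylinder)
  have Sb: "S \<in> sets borel" and Sm: "S \<in> lmeasurable" using So by (auto intro: lmeasurable_open)
  have int1: "integrable (lebesgue_on S) (\<lambda>x. 1::real)" by (rule integrable_const_lebesgue_on[OF Sm])
  have m: "pt3_pair \<in> borel_measurable borel"
    using borel_measurable_continuous_onI[OF continuous_pt3_pair] by simp
  have TS: "pt3_pair -` S \<in> sets lebesgue" using measurable_sets[OF m Sb] by auto
  have "integrable (lebesgue_on (pt3_pair -` S)) (\<lambda>z. 1::real)"
    using integral_pt3_pair(1)[OF Sb int1] .
  hence TSm: "pt3_pair -` S \<in> lmeasurable"
    using TS by (simp add: integrable_restrict_space lmeasurable_iff_integrable)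
  have eq: "measure lebesgue (pt3_pair -` S) = measure lebesgue S"
    using integral_pt3_pair(2)[OF Sb int1] TS Sm by (simp add: measure_restrict_space fmeasurableD)
  have sub: "ball x (r/2) \<times> J \<subseteq> pt3_pair -` S"
  proof
    fix z assume "z \<in> ball x (r/2) \<times> J"
    then obtain y t where z: "z = (y, t)" "dist x y < r/2" "t \<in> J" by auto
    have t: "\<bar>h - t\<bar> < r/2" "t \<in> {A<..<B}" using z(3) AB r by (auto simp: J_def split: if_splits)
    have "dist (pt3 x h) (pt3 y t) \<le> norm (x - y) + \<bar>h - t\<bar>" by (simp add: dist_norm pt3_diff norm_pt3_le)
    also have "\<dots> < r" using z(2) t(1) by (simp add: dist_norm)
    finally have "pt3 y t \<in> ball (pt3 x h) r" by simp
    moreover have "y \<in> \<omega>" using z(2) r by (intro subsetD[OF r(3)]) auto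
    ultimately show "z \<in> pt3_pair -` S" using z t by (simp add: S_def pt3_pair_def cylinder_def)
  qed
  have Jm: "emeasure lborel J = ennreal (r/2)" using r by (simp add: J_def)
  have "emeasure lborel (ball x (r/2) \<times> J) = emeasure (lborel \<Otimes>\<^sub>M lborel) (ball x (r/2) \<times> J)"
    unfolding lborel_prod ..
  also have "\<dots> = emeasure lborel (ball x (r/2)) * emeasure lborel J"
    by (rule lborel.emeasure_pair_measure_Times) (auto simp: J_def)
  also have "emeasure lborel (ball x (r/2)) = ennreal (measure lebesgue (ball x r) / 4)"
    using r by (simp add: emeasure_ball content_ball power_divide)
  also have "ennreal (measure lebesgue (ball x r) / 4) * emeasure lborel J = ennreal (measure lebesgue (ball x r) * r / 8)"
    using r unfolding Jm by (subst ennreal_mult[symmetric]) auto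
  finally have e: "emeasure lborel (ball x (r/2) \<times> J) = ennreal (measure lebesgue (ball x r) * r / 8)" .
  have bs: "ball x (r/2) \<times> J \<in> sets borel" by (auto simp: borel_prod[symmetric] J_def)
  have "measure lebesgue (ball x (r/2) \<times> J) = measure lebesgue (ball x r) * r / 8"
    using e bs r by (simp add: measure_def emeasure_completion)
  moreover have "measure lebesgue (ball x (r/2) \<times> J) \<le> measure lebesgue (pt3_pair -` S)"
    by (rule measure_mono_fmeasurable[OF sub _ TSm]) (use bs in auto)
  ultimately show ?thesis using eq by (simp add: S_def)
qed

text \<open>The estimate says that on a vertical line \<open>u\<close> differs from
  \<open>c x\<close> by at most the mass of \<open>k\<close> in the layer between the point and the
  face. The mean over a half ball is then bounded by a horizontal mean of this layer mass and of the
  oscillation of \<open>c\<close>. The layer mass tends to 0 with the thickness at almost every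
  \<open>x\<close>, and Lebesgue points in the horizontal plane control both means.\<close>

lemma cylinder_has_trace:
  fixes u :: "real^3 \<Rightarrow> real^3" and c :: "real^2 \<Rightarrow> real^3" and k :: "(real^2) \<times> real \<Rightarrow> real"
  assumes \<omega>: "open \<omega>" "bounded \<omega>" and AB: "A < B" "h \<in> {A, B}"
    and u: "integrable (lebesgue_on (cylinder \<omega> {A<..<B})) u" and c: "integrable (lebesgue_on \<omega>) c"
    and k: "integrable lborel k" "\<And>z. 0 \<le> k z"
    and est: "AE x in lebesgue_on \<omega>. AE t in lebesgue_on {A<..<B}.
       norm (u (pt3 x t) - c x) \<le> (LINT s|lborel. indicator {s. \<bar>s - h\<bar> \<le> \<bar>t - h\<bar>} s * k (x, s))"
  shows "AE x in lebesgue_on \<omega>. has_trace (cylinder \<omega> {A<..<B}) u (pt3 x h) (c x)"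
proof -
  let ?U = "cylinder \<omega> {A<..<B}"
  \<comment> \<open>The layer mass for thickness \<open>\<delta>\<close>. Its Lebesgue points are
    needed only for the thicknesses \<open>\<delta> n\<close>: countably many, hence one common null
    set.\<close>
  define Q where "Q \<delta> x = (LINT s|lborel. indicator {s. \<bar>s - h\<bar> \<le> \<delta>} s * k (x, s))" for \<delta> x
  define c' where "c' x = indicator \<omega> x *\<^sub>R c x" for x
  have kb: "k \<in> borel_measurable borel" using k(1) by auto
  have kb': "k \<in> borel_measurable (borel \<Otimes>\<^sub>M borel)" using kb by (simp only: borel_prod)
  have Us: "?U \<in> sets borel" "?U \<in> sets lebesgue" using open_cylinder[OF \<omega>(1), of "{A<..<B}"] by auto
  have \<omega>s: "\<omega> \<in> sets borel" "\<omega> \<in> sets lebesgue" using \<omega> by auto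
  have Is: "{A<..<B} \<in> sets borel" by simp
  have ind: "{s::real. \<bar>s - h\<bar> \<le> \<delta>} \<in> sets borel" for \<delta>
  proof -
    have "{s::real. \<bar>s - h\<bar> \<le> \<delta>} = {h - \<delta>..h + \<delta>}" by auto
    thus ?thesis by simp
  qed
  have kQ: "integrable lborel (\<lambda>z. indicator {s. \<bar>s - h\<bar> \<le> \<delta>} (snd z) * k z)" for \<delta>
  proof (rule Bochner_Integration.integrable_bound[OF k(1)])
    have "(\<lambda>z. indicator {s. \<bar>s - h\<bar> \<le> \<delta>} (snd z) * k z) \<in> borel_measurable (borel \<Otimes>\<^sub>M borel)"
      using kb' ind[of \<delta>] by measurable
    thus "(\<lambda>z. indicator {s. \<bar>s - h\<bar> \<le> \<delta>} (snd z) * k z) \<in> borel_measurable lborel" by (simp add: borel_prod)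
  qed (auto simp: indicator_def)
  have Qi: "integrable lebesgue (Q \<delta>)" for \<delta>
    using integrable_lborel_pair_sections(2)[OF kQ[of \<delta>]] unfolding Q_def[abs_def]
    by (subst integrable_completion) auto
  have Q0: "0 \<le> Q \<delta> x" for \<delta> x unfolding Q_def using k(2) by (intro integral_nonneg_AE AE_I2) auto
  have c'i: "integrable lebesgue c'" using c \<omega>s unfolding c'_def by (simp add: integrable_restrict_space)
  define \<delta> where "\<delta> n = 1 / real (Suc n)" for n
  have \<delta>0: "\<delta> n > 0" for n by (simp add: \<delta>_def)
  have kAE: "AE x in lebesgue_on \<omega>. integrable lborel (\<lambda>s. k (x, s))"
    unfolding AE_lebesgue_on_iff[OF \<omega>s(2)] using integrable_lborel_pair_sections(1)[OF k(1)] by eventually_elim simp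
  have good: "AE x in lebesgue. integrable lborel (\<lambda>s. k (x, s)) \<and> lebesgue_point c' x \<and> (\<forall>n. lebesgue_point (Q (\<delta> n)) x)"
    unfolding AE_conj_iff AE_all_countable
    by (intro conjI allI AE_lebesgue_point c'i Qi AE_completion integrable_lborel_pair_sections(1) k(1))
  have main: "has_trace ?U u (pt3 x h) (c x)"
    if x: "x \<in> \<omega>" and kx: "integrable lborel (\<lambda>s. k (x, s))" and cx: "lebesgue_point c' x"
       and Qx: "\<And>n. lebesgue_point (Q (\<delta> n)) x" for x
  proof -
    have Qlim: "(\<lambda>n. Q (\<delta> n) x) \<longlonglongrightarrow> (LINT s|(lborel :: real measure). 0)"
      unfolding Q_def
    proof (rule integral_dominated_convergence[where w="\<lambda>s. k (x, s)"])
      show "(\<lambda>s. indicat_real {s. \<bar>s - h\<bar> \<le> \<delta> n} s * k (x, s)) \<in> borel_measurable lborel" for n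
        using kx ind[of "\<delta> n"] by (intro borel_measurable_times borel_measurable_indicator) auto
      \<comment> \<open>The point \<open>s = h\<close> lies in every layer; for every other
        \<open>s\<close> the indicator is eventually 0.\<close>
      show "AE s in lborel. (\<lambda>n. indicat_real {s. \<bar>s - h\<bar> \<le> \<delta> n} s * k (x, s)) \<longlonglongrightarrow> 0"
        using AE_lborel_singleton[of h]
      proof eventually_elim
        case (elim s)
        hence "\<bar>s - h\<bar> > 0" by simp
        then obtain N where N: "1 / real (Suc N) < \<bar>s - h\<bar>" using nat_approx_posE by (metis)
        have "\<forall>n\<ge>N. indicat_real {s. \<bar>s - h\<bar> \<le> \<delta> n} s * k (x, s) = 0"
        proof (intro allI impI)
          fix n assume "N \<le> n"
          hence "\<delta> n \<le> 1 / real (Suc N)" by (simp add: \<delta>_def frac_le)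
          thus "indicat_real {s. \<bar>s - h\<bar> \<le> \<delta> n} s * k (x, s) = 0" using N by auto
        qed
        thus ?case by (intro tendsto_eventually) (auto simp: eventually_sequentially)
      qed
      show "AE s in lborel. norm (indicat_real {s. \<bar>s - h\<bar> \<le> \<delta> n} s * k (x, s)) \<le> k (x, s)" for n
        using k(2) by (intro AE_I2) (auto simp: indicator_def)
    qed (use kx in simp_all)
    obtain e where e: "e > 0" "ball x e \<subseteq> \<omega>" using \<omega>(1) x openE by blast
    let ?p = "pt3 x h"
    \<comment> \<open>The 16 is the vertical extent \<open>2 * r\<close> of the ball divided by the
      factor \<open>r / 8\<close> in the lower bound for the measure of the half ball.\<close>
    have bound: "(LINT y|lebesgue_on (?U \<inter> ball ?p r). norm (u y - c x)) / measure lebesgue (?U \<inter> ball ?p r)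
        \<le> 16 * ((LINT y|lebesgue_on (ball x r). Q (\<delta> n) y) /\<^sub>R measure lebesgue (ball x r)
              + (LINT y|lebesgue_on (ball x r). norm (c' y - c' x)) / measure lebesgue (ball x r))"
      if r: "0 < r" "r < min e (min (\<delta> n) (B - A))" for r n
    proof -
      have br: "ball x r \<subseteq> \<omega>" using e r by (meson less_imp_le min_less_iff_conj order_trans subset_ball)
      define S where "S = ?U \<inter> ball ?p r"
      have So: "open S" "bounded S" using \<omega> by (auto simp: S_def intro!: open_Int open_cylinder)
      have Sb: "S \<in> sets borel" "S \<in> lmeasurable" "S \<in> sets lebesgue" using So by (auto intro: lmeasurable_open)
      have uS: "integrable (lebesgue_on S) (\<lambda>y. norm (u y - c x))"
        by (intro integrable_norm Bochner_Integration.integrable_diff integrable_const_lebesgue_on Sb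
              integrable_lebesgue_on_subset[OF u Sb(3) Us(2)]) (auto simp: S_def)
      define F where "F z = indicator (pt3_pair -` S) z * norm (u (pt3_pair z) - c x)" for z
      have TS: "pt3_pair -` S \<in> sets lebesgue"
      proof -
        have "pt3_pair \<in> borel_measurable borel" using borel_measurable_continuous_onI[OF continuous_pt3_pair] by simp
        from measurable_sets[OF this Sb(1)] show ?thesis by auto
      qed
      have Tsub: "pt3_pair -` S \<subseteq> \<omega> \<times> {A<..<B}" by (auto simp: S_def pt3_pair_def cylinder_def)
      have prs: "\<omega> \<times> {A<..<B} \<in> sets lebesgue" using prod_sets_lebesgue(1)[OF \<omega>s(1) Is] .
      have Tint: "integrable (lebesgue_on (pt3_pair -` S)) (\<lambda>z. norm (u (pt3_pair z) - c x))"
        by (rule integral_pt3_pair(1)[OF Sb(1) uS])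
      have indeq: "indicat_real (\<omega> \<times> {A<..<B}) z * F z = indicat_real (pt3_pair -` S) z * norm (u (pt3_pair z) - c x)" for z
        using Tsub by (auto simp: F_def indicator_def)
      have Fi: "integrable (lebesgue_on (\<omega> \<times> {A<..<B})) F"
        using Tint TS prs by (simp add: integrable_restrict_space indeq)
      have "(LINT y|lebesgue_on S. norm (u y - c x)) = (LINT z|lebesgue_on (pt3_pair -` S). norm (u (pt3_pair z) - c x))"
        by (rule integral_pt3_pair(2)[OF Sb(1) uS, symmetric])
      also have "\<dots> = (LINT z|lebesgue_on (\<omega> \<times> {A<..<B}). F z)"
        using TS prs by (simp add: integral_restrict_space indeq)
      also have "\<dots> = (LINT y|lebesgue_on \<omega>. LINT t|lebesgue_on {A<..<B}. F (y, t))"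
        by (rule Fubini_lebesgue_on(3)[OF \<omega>s(1) Is Fi])
      also have "\<dots> \<le> (LINT y|lebesgue_on \<omega>. indicator (ball x r) y * ((Q (\<delta> n) y + norm (c' y - c' x)) * (2 * r)))"
      proof (rule integral_mono_AE)
        show "integrable (lebesgue_on \<omega>) (\<lambda>y. LINT t|lebesgue_on {A<..<B}. F (y, t))"
          by (rule Fubini_lebesgue_on(2)[OF \<omega>s(1) Is Fi])
        have "integrable (lebesgue_on (ball x r)) (\<lambda>y. (Q (\<delta> n) y + norm (c' y - c' x)) * (2 * r))"
          by (intro integrable_mult_left Bochner_Integration.integrable_add integrable_norm Bochner_Integration.integrable_diff
               integrable_lebesgue_on[OF Qi] integrable_lebesgue_on[OF c'i] integrable_const_lebesgue_on) auto
        thus "integrable (lebesgue_on \<omega>) (\<lambda>y. indicator (ball x r) y * ((Q (\<delta> n) y + norm (c' y - c' x)) * (2 * r)))"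
          by (subst lebesgue_on_indicator(1)[OF br]) (use \<omega>s in auto)
        show "AE y in lebesgue_on \<omega>. (LINT t|lebesgue_on {A<..<B}. F (y, t)) \<le>
            indicator (ball x r) y * ((Q (\<delta> n) y + norm (c' y - c' x)) * (2 * r))"
          using est Fubini_lebesgue_on(1)[OF \<omega>s(1) Is Fi] AE_space kAE
        proof eventually_elim
          case (elim y)
          have y: "y \<in> \<omega>" using elim by simp
          have ky: "integrable lborel (\<lambda>s. indicator {s. \<bar>s - h\<bar> \<le> \<delta> n} s * k (y, s))"
            using integrable_mult_indicator[of "{s. \<bar>s - h\<bar> \<le> \<delta> n}" lborel "\<lambda>s. k (y, s)"] elim(4) ind by simp
          define M where "M = indicator (ball x r) y * (Q (\<delta> n) y + norm (c' y - c' x))"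
          have M0: "0 \<le> M" using Q0 by (simp add: M_def)
          \<comment> \<open>A point of the half ball lies within \<open>r < \<delta> n\<close> of
            the face, so its layer is contained in the one of thickness
            \<open>\<delta> n\<close>.\<close>
          have ae: "AE t in lebesgue_on {A<..<B}. F (y, t) \<le> M * indicator (ball h r) t"
            using elim(1)
          proof eventually_elim
            case (elim t)
            show ?case
            proof (cases "(y, t) \<in> pt3_pair -` S")
              case False
              thus ?thesis using M0 by (simp add: F_def)
            next
              case True
              hence "dist ?p (pt3 y t) < r" by (simp add: S_def pt3_pair_def)
              hence d: "dist x y < r" "dist h t < r"
                using norm_pt3_ge(1)[of "x - y" "h - t"] norm_pt3_ge(2)[of "h - t" "x - y"] by (auto simp: dist_norm pt3_diff)
              have "(LINT s|lborel. indicator {s. \<bar>s - h\<bar> \<le> \<bar>t - h\<bar>} s * k (y, s)) \<le> Q (\<delta> n) y"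
                unfolding Q_def
                by (rule integral_mono'[OF ky]) (use d r k(2) in \<open>auto simp: indicator_def dist_real_def\<close>)
              hence "norm (u (pt3 y t) - c y) \<le> Q (\<delta> n) y" using elim by simp
              hence "norm (u (pt3 y t) - c x) \<le> Q (\<delta> n) y + norm (c y - c x)"
                using norm_triangle_ineq[of "u (pt3 y t) - c y" "c y - c x"] by simp
              thus ?thesis using True d y x by (simp add: F_def M_def c'_def pt3_pair_def)
            qed
          qed
          have "integrable lebesgue (indicat_real (ball h r))" by (simp flip: lmeasurable_iff_integrable)
          hence mi: "integrable (lebesgue_on {A<..<B}) (\<lambda>t. M * indicator (ball h r) t)"
            by (intro integrable_mult_right integrable_lebesgue_on) auto
          have "(LINT t|lebesgue_on {A<..<B}. F (y, t)) \<le> (LINT t|lebesgue_on {A<..<B}. M * indicator (ball h r) t)"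
            by (rule integral_mono_AE[OF elim(2) mi ae])
          also have "\<dots> \<le> M * (2 * r)"
          proof -
            have "(LINT t|lebesgue_on {A<..<B}. indicator (ball h r) t :: real) = measure lebesgue ({A<..<B} \<inter> ball h r)"
              by (simp add: measure_restrict_space Int_commute)
            also have "\<dots> \<le> measure lebesgue (ball h r)" by (rule measure_mono_fmeasurable) auto
            also have "\<dots> = 2 * r" using r by (simp add: ball_eq_greaterThanLessThan)
            finally show ?thesis using M0 by (simp add: mult_left_mono)
          qed
          finally show ?case by (simp add: M_def mult.assoc)
        qed
      qed
      also have "\<dots> = (LINT y|lebesgue_on (ball x r). (Q (\<delta> n) y + norm (c' y - c' x)) * (2 * r))"
        by (rule lebesgue_on_indicator(2)[OF br]) (use \<omega>s in auto)
      also have "\<dots> = ((LINT y|lebesgue_on (ball x r). Q (\<delta> n) y) + (LINT y|lebesgue_on (ball x r). norm (c' y - c' x))) * (2 * r)"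
      proof -
        have "integrable (lebesgue_on (ball x r)) (Q (\<delta> n))" by (rule integrable_lebesgue_on[OF Qi]) auto
        moreover have "integrable (lebesgue_on (ball x r)) (\<lambda>y. norm (c' y - c' x))"
          by (intro integrable_norm Bochner_Integration.integrable_diff integrable_lebesgue_on[OF c'i] integrable_const_lebesgue_on) auto
        ultimately show ?thesis by simp
      qed
      finally have num: "(LINT y|lebesgue_on S. norm (u y - c x)) \<le> \<dots>" .
      define m where "m = measure lebesgue (ball x r)"
      have m: "m > 0" using r by (simp add: m_def content_ball_pos)
      have den: "m * r / 8 \<le> measure lebesgue S"
        unfolding m_def S_def by (rule measure_Int_ball_cylinder_ge[OF \<omega> AB]) (use r br in auto)
      define N where "N = (LINT y|lebesgue_on (ball x r). Q (\<delta> n) y) + (LINT y|lebesgue_on (ball x r). norm (c' y - c' x))"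
      have N0: "0 \<le> N" using Q0 by (simp add: N_def integral_nonneg_AE)
      have "(LINT y|lebesgue_on S. norm (u y - c x)) / measure lebesgue S \<le> (N * (2 * r)) / (m * r / 8)"
        by (rule frac_le) (use num den m r N0 in \<open>auto simp: N_def\<close>)
      also have "\<dots> = 16 * (N / m)" using m r by (simp add: field_simps)
      finally show ?thesis by (simp add: S_def N_def m_def divide_inverse distrib_left mult.commute algebra_simps)
    qed
    show ?thesis unfolding has_trace_def
    proof (rule tendstoI)
      \<comment> \<open>The thickness \<open>\<delta> n\<close> is fixed first, by
        \<open>Qlim\<close>; only then does \<open>r\<close> tend to 0.\<close>
      fix \<epsilon> :: real assume \<epsilon>: "\<epsilon> > 0"
      have "\<forall>\<^sub>F n in sequentially. Q (\<delta> n) x < \<epsilon> / 16"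
        using Qlim \<epsilon> by (intro order_tendstoD(2)) auto
      then obtain n where n: "Q (\<delta> n) x < \<epsilon> / 16" by (auto simp: eventually_sequentially)
      have "((\<lambda>r. 16 * ((LINT y|lebesgue_on (ball x r). Q (\<delta> n) y) /\<^sub>R measure lebesgue (ball x r)
              + (LINT y|lebesgue_on (ball x r). norm (c' y - c' x)) / measure lebesgue (ball x r))) \<longlongrightarrow> 16 * (Q (\<delta> n) x + 0)) (at_right 0)"
        by (intro tendsto_mult tendsto_const tendsto_add lebesgue_point_average[OF Qi Qx] cx[unfolded lebesgue_point_def])
      hence "\<forall>\<^sub>F r in at_right 0. 16 * ((LINT y|lebesgue_on (ball x r). Q (\<delta> n) y) /\<^sub>R measure lebesgue (ball x r)
              + (LINT y|lebesgue_on (ball x r). norm (c' y - c' x)) / measure lebesgue (ball x r)) < \<epsilon>"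
        by (rule order_tendstoD(2)) (use n in simp)
      moreover have "\<forall>\<^sub>F r in at_right (0::real). 0 < r \<and> r < min e (min (\<delta> n) (B - A))"
        unfolding eventually_at_right_field using e \<delta>0[of n] AB
        by (intro exI[of _ "min e (min (\<delta> n) (B - A))"]) auto
      ultimately show "\<forall>\<^sub>F r in at_right 0. dist ((LINT y|lebesgue_on (?U \<inter> ball ?p r). norm (u y - c x)) / measure lebesgue (?U \<inter> ball ?p r)) 0 < \<epsilon>"
      proof eventually_elim
        case (elim r)
        from bound[of r n] elim
        have "(LINT y|lebesgue_on (?U \<inter> ball ?p r). norm (u y - c x)) / measure lebesgue (?U \<inter> ball ?p r) < \<epsilon>" by linarith
        moreover have "0 \<le> (LINT y|lebesgue_on (?U \<inter> ball ?p r). norm (u y - c x)) / measure lebesgue (?U \<inter> ball ?p r)"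
          by (intro divide_nonneg_nonneg integral_nonneg_AE) auto
        ultimately show ?case by (simp add: dist_real_def)
      qed
    qed
  qed
  from good have "AE x in lebesgue_on \<omega>. integrable lborel (\<lambda>s. k (x, s)) \<and> lebesgue_point c' x \<and> (\<forall>n. lebesgue_point (Q (\<delta> n)) x)"
    unfolding AE_lebesgue_on_iff[OF \<omega>s(2)] AE_completion_iff by eventually_elim simp
  with AE_space show ?thesis by eventually_elim (use main in auto)
qed

section \<open>Vertical primitives and integration by parts\<close>

lemma integral_pt3_pair_borel:
  fixes f :: "real^3 \<Rightarrow> real"
  assumes f: "f \<in> borel_measurable borel"
  shows "integrable lborel f \<longleftrightarrow> integrable lborel (\<lambda>z. f (pt3_pair z))"
    "(LINT x|lborel. f x) = (LINT z|lborel. f (pt3_pair z))"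
proof -
  have m: "pt3_pair \<in> measurable lborel borel"
    using borel_measurable_continuous_onI[OF continuous_pt3_pair] by simp
  have "integrable (distr lborel borel pt3_pair) f \<longleftrightarrow> integrable lborel (\<lambda>z. f (pt3_pair z))"
    by (rule integrable_distr_eq[OF m f])
  thus "integrable lborel f \<longleftrightarrow> integrable lborel (\<lambda>z. f (pt3_pair z))" unfolding distr_pt3_pair .
  have "(LINT x|distr lborel borel pt3_pair. f x) = (LINT z|lborel. f (pt3_pair z))"
    by (rule integral_distr[OF m f])
  thus "(LINT x|lborel. f x) = (LINT z|lborel. f (pt3_pair z))" unfolding distr_pt3_pair .
qed

lemma integrable_pair_mult:
  fixes Q :: "'a::euclidean_space \<Rightarrow> real" and b :: "'b::euclidean_space \<Rightarrow> real"
  assumes Q: "integrable lborel Q" and b: "integrable lborel b"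
  shows "integrable (lborel \<Otimes>\<^sub>M lborel) (\<lambda>z. Q (fst z) * b (snd z))"
proof (rule lborel_pair.Fubini_integrable)
  have [measurable]: "Q \<in> borel_measurable lborel" "b \<in> borel_measurable lborel" using Q b by auto
  show "(\<lambda>z. Q (fst z) * b (snd z)) \<in> borel_measurable (lborel \<Otimes>\<^sub>M lborel)" by measurable
  show "integrable lborel (\<lambda>x. LINT y|lborel. norm (Q (fst (x, y)) * b (snd (x, y))))"
    using Q by (simp add: abs_mult)
  show "AE x in lborel. integrable lborel (\<lambda>y. Q (fst (x, y)) * b (snd (x, y)))" using b by simp
qed

lemma integrable_pair_dominated:
  fixes F :: "(real^2) \<times> real \<Rightarrow> real"
  assumes F: "F \<in> borel_measurable borel" and Q: "integrable lborel Q" and b: "integrable lborel b"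
    and bound: "AE x in lborel. \<forall>t. \<bar>F (x, t)\<bar> \<le> Q x * b t"
  shows "integrable lborel F"
proof (rule Bochner_Integration.integrable_bound)
  show "integrable lborel (\<lambda>z. Q (fst z) * b (snd z))"
    using integrable_pair_mult[OF Q b] unfolding lborel_prod .
  have "AE x in lebesgue_on UNIV. \<forall>t. \<bar>F (x, t)\<bar> \<le> Q x * b t" using bound by (subst AE_lebesgue_on_iff) auto
  from AE_lebesgue_on_fst[of UNIV UNIV, OF _ _ this]
  have "AE z in lebesgue_on (UNIV \<times> UNIV). \<forall>t. \<bar>F (fst z, t)\<bar> \<le> Q (fst z) * b t" by simp
  hence "AE z in lborel. \<forall>t. \<bar>F (fst z, t)\<bar> \<le> Q (fst z) * b t" by (subst (asm) AE_lebesgue_on_iff) auto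
  thus "AE z in lborel. norm (F z) \<le> norm (Q (fst z) * b (snd z))"
  proof eventually_elim
    case (elim z)
    from elim[rule_format, of "snd z"] show ?case by simp
  qed
qed (use F in simp)

text \<open>Fubini on the region \<open>s < t\<close>: integrating \<open>\<eta>'\<close> over
  \<open>t > s\<close> gives \<open>- \<eta> s\<close>, since \<open>\<eta>\<close> vanishes far
  out. The primitive is never differentiated, so \<open>q\<close> may be merely integrable.\<close>

lemma integral_primitive_by_parts:
  fixes q \<eta> \<eta>' :: "real \<Rightarrow> real"
  assumes q: "integrable lborel q" and d: "\<And>t. (\<eta> has_real_derivative \<eta>' t) (at t)" and c: "continuous_on UNIV \<eta>'"
    and z: "\<And>t. \<bar>t\<bar> \<ge> R \<Longrightarrow> \<eta> t = 0 \<and> \<eta>' t = 0"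
  shows "(LINT t|lborel. (LINT s|lborel. indicator {..<t} s * q s) * \<eta>' t) = - (LINT s|lborel. q s * \<eta> s)"
proof -
  have qm [measurable]: "q \<in> borel_measurable borel" using q by auto
  have em [measurable]: "\<eta>' \<in> borel_measurable borel" using c by (rule borel_measurable_continuous_onI)
  have ei: "integrable lborel \<eta>'"
  proof -
    have "integrable lborel (\<lambda>t. indicator {-R..R} t *\<^sub>R \<eta>' t)"
      by (rule borel_integrable_compact) (auto intro: continuous_on_subset[OF c])
    moreover have "(\<lambda>t. indicator {-R..R} t *\<^sub>R \<eta>' t) = \<eta>'"
    proof
      fix t show "indicator {-R..R} t *\<^sub>R \<eta>' t = \<eta>' t" using z[of t] by (cases "\<bar>t\<bar> \<ge> R") (auto simp: indicator_def)
    qed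
    ultimately show ?thesis by simp
  qed
  have int: "integrable (lborel \<Otimes>\<^sub>M lborel) (\<lambda>(s, t). indicator {..<t} s * q s * \<eta>' t)"
  proof (rule Bochner_Integration.integrable_bound[OF integrable_pair_mult[OF q ei]])
    have "(\<lambda>(s, t). indicator {..<t} s * q s * \<eta>' t) = (\<lambda>z. (if fst z < snd z then q (fst z) * \<eta>' (snd z) else 0))"
      by (auto simp: fun_eq_iff indicator_def)
    also have "\<dots> \<in> borel_measurable (lborel \<Otimes>\<^sub>M lborel)" by measurable
    finally show "(\<lambda>(s, t). indicator {..<t} s * q s * \<eta>' t) \<in> borel_measurable (lborel \<Otimes>\<^sub>M lborel)" .
  qed (auto simp: indicator_def)
  have inner: "(LINT t|lborel. indicator {..<t} s * q s * \<eta>' t) = - (q s * \<eta> s)" for s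
  proof -
    \<comment> \<open>An upper limit at or above both \<open>s\<close> and \<open>R\<close>: the
      interval is nonempty and \<open>\<eta> m = 0\<close>.\<close>
    define m where "m = max s R"
    have "(LINT t|lborel. indicator {s..m} t *\<^sub>R \<eta>' t) = \<eta> m - \<eta> s"
      by (rule integral_FTC_Icc) (use d c in \<open>auto simp: m_def has_real_derivative_iff_has_vector_derivative[symmetric]
            intro: continuous_on_subset has_field_derivative_at_within\<close>)
    also have "\<eta> m = 0" using z[of m] by (auto simp: m_def)
    finally have 1: "(LINT t|lborel. indicator {s..m} t *\<^sub>R \<eta>' t) = - \<eta> s" by simp
    have "(LINT t|lborel. indicator {..<t} s * q s * \<eta>' t) = (LINT t|lborel. q s * (indicator {s..m} t *\<^sub>R \<eta>' t))"
    proof (rule integral_cong_AE)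
      \<comment> \<open>At \<open>t = s\<close> the two indicators differ, so this point is
        removed.\<close>
      show "AE t in lborel. indicator {..<t} s * q s * \<eta>' t = q s * (indicator {s..m} t *\<^sub>R \<eta>' t)"
        using AE_lborel_singleton[of s]
      proof eventually_elim
        case (elim t)
        show ?case
        proof (cases "t > m")
          case True
          hence "t > R" by (simp add: m_def)
          hence "\<bar>t\<bar> \<ge> R" by linarith
          thus ?thesis using z by simp
        next
          case False
          thus ?thesis using elim by (auto simp: indicator_def)
        qed
      qed
      have "(\<lambda>t. indicator {..<t} s * q s * \<eta>' t) = (\<lambda>t. if s < t then q s * \<eta>' t else 0)" by (auto simp: fun_eq_iff indicator_def)
      also have "\<dots> \<in> borel_measurable lborel" by measurable
      finally show "(\<lambda>t. indicator {..<t} s * q s * \<eta>' t) \<in> borel_measurable lborel" .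
    qed measurable
    also have "\<dots> = q s * (LINT t|lborel. indicator {s..m} t *\<^sub>R \<eta>' t)" by (rule integral_mult_right_zero)
    finally show ?thesis using 1 by simp
  qed
  have "(LINT t|lborel. (LINT s|lborel. indicator {..<t} s * q s) * \<eta>' t) = (LINT t|lborel. LINT s|lborel. indicator {..<t} s * q s * \<eta>' t)"
    by simp
  also have "\<dots> = (LINT s|lborel. LINT t|lborel. indicator {..<t} s * q s * \<eta>' t)"
    using lborel_pair.Fubini_integral[OF int] .
  also have "\<dots> = - (LINT s|lborel. q s * \<eta> s)" by (simp add: inner)
  finally show ?thesis .
qed

text \<open>The Cauchy-Schwarz inequality on an interval, read off from the nonnegative integral of
  the square of \<open>\<bar>q s\<bar> - m\<close> with \<open>m\<close> the mean of
  \<open>\<bar>q s\<bar>\<close>.\<close>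

lemma integral_abs_sq_le:
  fixes q :: "real \<Rightarrow> real"
  assumes q: "integrable lborel q" "integrable lborel (\<lambda>s. (q s)\<^sup>2)" and AB: "A < B"
    and z: "\<And>s. s \<notin> {A<..<B} \<Longrightarrow> q s = 0"
  shows "(LINT s|lborel. \<bar>q s\<bar>)\<^sup>2 \<le> (B - A) * (LINT s|lborel. (q s)\<^sup>2)"
proof -
  define a where "a = (LINT s|lborel. \<bar>q s\<bar>)"
  define m where "m = a / (B - A)"
  have ind: "integrable lborel (indicat_real {A<..<B})" using AB by (intro integrable_real_indicator) auto
  have "0 \<le> (LINT s|lborel. (q s)\<^sup>2 - 2 * m * \<bar>q s\<bar> + m\<^sup>2 * indicator {A<..<B} s)"
  proof (intro integral_nonneg_AE AE_I2)
    fix s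
    show "0 \<le> (q s)\<^sup>2 - 2 * m * \<bar>q s\<bar> + m\<^sup>2 * indicator {A<..<B} s"
      using zero_le_power2[of "\<bar>q s\<bar> - m"] z[of s]
      by (cases "s \<in> {A<..<B}") (auto simp: power2_eq_square algebra_simps)
  qed
  also have "\<dots> = (LINT s|lborel. (q s)\<^sup>2) - 2 * m * a + m\<^sup>2 * (B - A)"
    using q ind AB by (simp add: a_def)
  also have "\<dots> = (LINT s|lborel. (q s)\<^sup>2) - 2 * (m * a) + m * (m * (B - A))"
    by (simp add: power2_eq_square)
  also have "m * (B - A) = a" using AB by (simp add: m_def)
  finally have "m * a \<le> (LINT s|lborel. (q s)\<^sup>2)" by (simp add: mult.commute)
  hence "m * a * (B - A) \<le> (LINT s|lborel. (q s)\<^sup>2) * (B - A)" using AB by (intro mult_right_mono) auto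
  thus ?thesis using AB by (simp add: a_def m_def power2_eq_square mult.commute)
qed

text \<open>For \<open>g\<close> vanishing outside a cylinder this primitive along vertical lines
  starts from 0 at the bottom face; integrating from minus infinity avoids naming that face.\<close>

definition vprim :: "(real^3 \<Rightarrow> real) \<Rightarrow> real^3 \<Rightarrow> real" where
  "vprim g x = (LINT s|lborel. indicator {..<x $ 3} s * g (pt3 (hpart x) s))"

lemma pt3_measurable:
  fixes g :: "real^3 \<Rightarrow> real"
  assumes "g \<in> borel_measurable borel"
  shows "(\<lambda>z. g (pt3 (fst z) (snd z))) \<in> borel_measurable (borel \<Otimes>\<^sub>M borel)" "(\<lambda>s. g (pt3 x s)) \<in> borel_measurable borel"
proof -
  have m: "pt3_pair \<in> measurable borel borel"
    using borel_measurable_continuous_onI[OF continuous_pt3_pair] by simp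
  have "(\<lambda>z. g (pt3_pair z)) \<in> borel_measurable borel" using m assms by measurable
  thus 1: "(\<lambda>z. g (pt3 (fst z) (snd z))) \<in> borel_measurable (borel \<Otimes>\<^sub>M borel)"
    unfolding borel_prod by (simp add: pt3_pair_def)
  show "(\<lambda>s. g (pt3 x s)) \<in> borel_measurable borel"
    using measurable_compose[OF measurable_Pair1' 1, of x] by simp
qed

context
  fixes \<omega> :: "(real^2) set" and A B :: real and g :: "real^3 \<Rightarrow> real"
  assumes \<omega>: "open \<omega>" "bounded \<omega>" and AB: "A < B"
    and g: "g \<in> borel_measurable borel" "integrable lborel g" "integrable lborel (\<lambda>x. (g x)\<^sup>2)"
    and gz: "\<And>x. x \<notin> cylinder \<omega> {A<..<B} \<Longrightarrow> g x = 0"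
begin

lemma vprim_measurable: "vprim g \<in> borel_measurable borel"
proof -
  have h: "hpart \<in> borel_measurable borel" using continuous_hpart by (rule borel_measurable_continuous_onI)
  have "(\<lambda>z. (hpart (fst z), snd z)) \<in> measurable (borel \<Otimes>\<^sub>M lborel) (borel \<Otimes>\<^sub>M borel)" using h by measurable
  from measurable_compose[OF this pt3_measurable(1)[OF g(1)]]
  have [measurable]: "(\<lambda>z. g (pt3 (hpart (fst z)) (snd z))) \<in> borel_measurable (borel \<Otimes>\<^sub>M lborel)" by simp
  have "(\<lambda>z. indicator {..<fst z $ 3} (snd z) * g (pt3 (hpart (fst z)) (snd z)))
     = (\<lambda>z. if snd z < fst z $ 3 then g (pt3 (hpart (fst z)) (snd z)) else 0)" by (auto simp: fun_eq_iff indicator_def)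
  also have "\<dots> \<in> borel_measurable (borel \<Otimes>\<^sub>M lborel)" by measurable
  finally show ?thesis
    using lborel.borel_measurable_lebesgue_integral[of "\<lambda>x s. indicator {..<x $ 3} s * g (pt3 (hpart x) s)" borel]
    unfolding vprim_def[abs_def] by (simp add: case_prod_unfold)
qed

lemma vertical_sections:
  "AE x in lborel. integrable lborel (\<lambda>s. g (pt3 x s)) \<and> integrable lborel (\<lambda>s. (g (pt3 x s))\<^sup>2)"
  "integrable lborel (\<lambda>x. LINT s|lborel. (g (pt3 x s))\<^sup>2)"
proof -
  have g2: "(\<lambda>x. (g x)\<^sup>2) \<in> borel_measurable borel" using g(1) by measurable
  have 1: "integrable lborel (\<lambda>z. g (pt3_pair z))" using integral_pt3_pair_borel(1)[OF g(1)] g(2) by simp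
  have 2: "integrable lborel (\<lambda>z. (g (pt3_pair z))\<^sup>2)" using integral_pt3_pair_borel(1)[OF g2] g(3) by simp
  show "AE x in lborel. integrable lborel (\<lambda>s. g (pt3 x s)) \<and> integrable lborel (\<lambda>s. (g (pt3 x s))\<^sup>2)"
    using integrable_lborel_pair_sections(1)[OF 1] integrable_lborel_pair_sections(1)[OF 2]
    by eventually_elim (simp add: pt3_pair_def)
  show "integrable lborel (\<lambda>x. LINT s|lborel. (g (pt3 x s))\<^sup>2)"
    using integrable_lborel_pair_sections(2)[OF 2] by (simp add: pt3_pair_def)
qed

lemma gz_pt3: "s \<notin> {A<..<B} \<Longrightarrow> g (pt3 x s) = 0"
  by (rule gz) (simp add: cylinder_def)

lemma vprim_sq_le:
  assumes i: "integrable lborel (\<lambda>s. g (pt3 x s))" "integrable lborel (\<lambda>s. (g (pt3 x s))\<^sup>2)"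
  shows "(vprim g (pt3 x t))\<^sup>2 \<le> (B - A) * (LINT s|lborel. (g (pt3 x s))\<^sup>2)"
    "(LINT s|lborel. g (pt3 x s))\<^sup>2 \<le> (B - A) * (LINT s|lborel. (g (pt3 x s))\<^sup>2)"
proof -
  note CS = integral_abs_sq_le[OF i AB gz_pt3]
  have "\<bar>vprim g (pt3 x t)\<bar> \<le> (LINT s|lborel. \<bar>indicator {..<t} s * g (pt3 x s)\<bar>)"
    unfolding vprim_def by (simp add: integral_abs_bound)
  also have "\<dots> \<le> (LINT s|lborel. \<bar>g (pt3 x s)\<bar>)"
    by (rule integral_mono') (use i in \<open>auto simp: indicator_def\<close>)
  finally have "(vprim g (pt3 x t))\<^sup>2 \<le> (LINT s|lborel. \<bar>g (pt3 x s)\<bar>)\<^sup>2" by (metis abs_ge_zero power2_abs power_mono)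
  thus "(vprim g (pt3 x t))\<^sup>2 \<le> (B - A) * (LINT s|lborel. (g (pt3 x s))\<^sup>2)" using CS by linarith
  have "\<bar>LINT s|lborel. g (pt3 x s)\<bar> \<le> (LINT s|lborel. \<bar>g (pt3 x s)\<bar>)" by (rule integral_abs_bound)
  hence "(LINT s|lborel. g (pt3 x s))\<^sup>2 \<le> (LINT s|lborel. \<bar>g (pt3 x s)\<bar>)\<^sup>2" by (metis abs_ge_zero power2_abs power_mono)
  thus "(LINT s|lborel. g (pt3 x s))\<^sup>2 \<le> (B - A) * (LINT s|lborel. (g (pt3 x s))\<^sup>2)" using CS by linarith
qed

lemma cylinder_sets: "cylinder \<omega> {A<..<B} \<in> sets borel" "cylinder \<omega> {A<..<B} \<in> sets lebesgue"
  using open_cylinder[OF \<omega>(1), of "{A<..<B}"] by auto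

text \<open>The bound on the square of the primitive does not depend on the height, so it is
  dominated by an integrable function of \<open>x\<close> times the indicator of a bounded
  interval.\<close>

lemma vprim_L2: "vprim g \<in> L2 (cylinder \<omega> {A<..<B})"
proof -
  let ?U = "cylinder \<omega> {A<..<B}"
  define F where "F x = indicator ?U x * (vprim g x)\<^sup>2" for x
  have Fm: "F \<in> borel_measurable borel" unfolding F_def using vprim_measurable cylinder_sets by measurable
  have Fpm: "(\<lambda>z. F (pt3_pair z)) \<in> borel_measurable borel"
    using borel_measurable_continuous_onI[OF continuous_pt3_pair] Fm by measurable
  have "integrable lborel (\<lambda>z. F (pt3_pair z))"
  proof (rule integrable_pair_dominated[OF Fpm])
    show "integrable lborel (\<lambda>x. (B - A) * (LINT s|lborel. (g (pt3 x s))\<^sup>2))" using vertical_sections(2) by simp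
    show "integrable lborel (indicat_real {A<..<B})" using AB by (intro integrable_real_indicator) auto
    show "AE x in lborel. \<forall>t. \<bar>F (pt3_pair (x, t))\<bar> \<le> (B - A) * (LINT s|lborel. (g (pt3 x s))\<^sup>2) * indicat_real {A<..<B} t"
      using vertical_sections(1)
    proof eventually_elim
      case (elim x)
      show ?case
      proof
        fix t show "\<bar>F (pt3_pair (x, t))\<bar> \<le> (B - A) * (LINT s|lborel. (g (pt3 x s))\<^sup>2) * indicat_real {A<..<B} t"
          using vprim_sq_le(1)[of x t] elim AB
          by (auto simp: F_def pt3_pair_def cylinder_def indicator_def)
      qed
    qed
  qed
  hence "integrable lborel F" using integral_pt3_pair_borel(1)[OF Fm] by simp
  hence "integrable lebesgue (\<lambda>x. indicator ?U x *\<^sub>R (vprim g x)\<^sup>2)" using Fm by (simp add: F_def[abs_def] integrable_completion)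
  hence "integrable (lebesgue_on ?U) (\<lambda>x. (vprim g x)\<^sup>2)" using cylinder_sets by (simp add: integrable_restrict_space)
  moreover have "vprim g \<in> borel_measurable (lebesgue_on ?U)" by (rule lebesgue_on_measurable_borelI[OF vprim_measurable])
  ultimately show ?thesis by (simp add: L2_def)
qed

text \<open>One-dimensional integration by parts on almost every vertical line, integrated over the
  horizontal variable; thus \<open>g\<close> is the weak third derivative of
  \<open>vprim g\<close>.\<close>

lemma vprim_by_parts:
  assumes t: "test_function (cylinder \<omega> {A<..<B}) \<phi> d"
  shows "(LINT x|lebesgue_on (cylinder \<omega> {A<..<B}). vprim g x * d x $ 3) = - (LINT x|lebesgue_on (cylinder \<omega> {A<..<B}). g x * \<phi> x)"
proof -
  let ?U = "cylinder \<omega> {A<..<B}"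
  have lm: "?U \<in> lmeasurable" by (rule lmeasurable_cylinder[OF \<omega>])
  obtain K where K: "compact K" "K \<subseteq> ?U" "\<And>x. x \<notin> K \<Longrightarrow> \<phi> x = 0"
    and dd: "\<And>x. (\<phi> has_derivative (\<lambda>h. d x \<bullet> h)) (at x)"
    using t unfolding test_function_def by blast
  have d0: "d x = 0" if "x \<notin> K" for x
    using test_function_grad_zero[of \<phi> d x K] dd K compact_imp_closed that by blast
  have dU: "d x = 0" "\<phi> x = 0" if "x \<notin> ?U" for x using d0 K that by blast+
  have cont: "continuous_on UNIV \<phi>" "continuous_on UNIV d" using test_function_continuous[OF t] by blast+
  have \<phi>m: "\<phi> \<in> borel_measurable borel" and dm: "d \<in> borel_measurable borel"
    using cont by (auto intro: borel_measurable_continuous_onI)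
  have "vprim g \<in> L2 ?U" by (rule vprim_L2)
  hence Pi: "integrable (lebesgue_on ?U) (vprim g)" by (rule L2_integrable[OF lm])
  have F1m: "(\<lambda>x. vprim g x * d x $ 3) \<in> borel_measurable borel" using vprim_measurable dm by measurable
  have F2m: "(\<lambda>x. g x * \<phi> x) \<in> borel_measurable borel" using g(1) \<phi>m by measurable
  note I1 = integral_lebesgue_on_lborel[OF F1m cylinder_sets(2)]
  note I2 = integral_lebesgue_on_lborel[OF F2m cylinder_sets(2)]
  have gU: "integrable (lebesgue_on ?U) g" using integral_lebesgue_on_lborel(2)[OF g(1) cylinder_sets(2) gz] g(2) by simp
  have i1: "integrable lborel (\<lambda>x. vprim g x * d x $ 3)" using I1(2) dU test_function_integrable(3)[OF t Pi] by simp
  have i2: "integrable lborel (\<lambda>x. g x * \<phi> x)" using I2(2) dU test_function_integrable(1)[OF t gU] by simp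
  have p1: "integrable lborel (\<lambda>z. vprim g (pt3_pair z) * d (pt3_pair z) $ 3)" using i1 integral_pt3_pair_borel(1)[OF F1m] by simp
  have p2: "integrable lborel (\<lambda>z. g (pt3_pair z) * \<phi> (pt3_pair z))" using i2 integral_pt3_pair_borel(1)[OF F2m] by simp
  have "(LINT x|lebesgue_on ?U. vprim g x * d x $ 3) = (LINT x|lborel. LINT t|lborel. vprim g (pt3 x t) * d (pt3 x t) $ 3)"
    using I1(1) dU integral_pt3_pair_borel(2)[OF F1m] integrable_lborel_pair_sections(3)[OF p1] by (simp add: pt3_pair_def)
  also have "\<dots> = (LINT x|lborel. - (LINT s|lborel. g (pt3 x s) * \<phi> (pt3 x s)))"
  proof (rule integral_cong_AE)
    show "(\<lambda>x. LINT t|lborel. vprim g (pt3 x t) * d (pt3 x t) $ 3) \<in> borel_measurable lborel"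
      using integrable_lborel_pair_sections(2)[OF p1] by (simp add: pt3_pair_def borel_measurable_integrable)
    show "(\<lambda>x. - (LINT s|lborel. g (pt3 x s) * \<phi> (pt3 x s))) \<in> borel_measurable lborel"
      using integrable_lborel_pair_sections(2)[OF p2] by (simp add: pt3_pair_def borel_measurable_integrable)
    show "AE x in lborel. (LINT t|lborel. vprim g (pt3 x t) * d (pt3 x t) $ 3) = - (LINT s|lborel. g (pt3 x s) * \<phi> (pt3 x s))"
      using vertical_sections(1)
    proof eventually_elim
      case (elim x)
      obtain R where R: "\<And>y. y \<in> K \<Longrightarrow> norm y < R" using compact_imp_bounded[OF K(1)] bounded_pos_less by metis
      have "continuous_on UNIV (\<lambda>t::real. (x, t))" by (intro continuous_intros)
      from continuous_on_compose2[OF continuous_pt3_pair this]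
      have pc: "continuous_on UNIV (pt3 x)" by (simp add: pt3_pair_def)
      have "(LINT t|lborel. (LINT s|lborel. indicator {..<t} s * g (pt3 x s)) * d (pt3 x t) $ 3) = - (LINT s|lborel. g (pt3 x s) * \<phi> (pt3 x s))"
      proof (rule integral_primitive_by_parts)
        show "integrable lborel (\<lambda>s. g (pt3 x s))" using elim by simp
        show "((\<lambda>t. \<phi> (pt3 x t)) has_real_derivative d (pt3 x t) $ 3) (at t)" for t
        proof -
          define p where "p t = pt3 x 0 + t *\<^sub>R axis 3 1" for t
          have eq: "pt3 x = p"
            by (auto simp: fun_eq_iff p_def pt3_def vec_eq_iff forall_3 axis_def)
          have "((\<lambda>t. \<phi> (p t)) has_derivative (\<lambda>s. d (p t) \<bullet> (s *\<^sub>R axis 3 1))) (at t)"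
            by (rule has_derivative_compose[where f=p, OF _ dd]) (auto simp: p_def[abs_def] intro!: derivative_eq_intros)
          moreover have "(\<lambda>s. d (p t) \<bullet> (s *\<^sub>R axis 3 1)) = (*) (d (p t) $ 3)" by (auto simp: inner_axis)
          ultimately show ?thesis unfolding eq has_field_derivative_def by simp
        qed
        show "continuous_on UNIV (\<lambda>t. d (pt3 x t) $ 3)"
          by (intro continuous_on_component continuous_on_compose2[OF cont(2) pc]) auto
        show "\<phi> (pt3 x t) = 0 \<and> d (pt3 x t) $ 3 = 0" if "R \<le> \<bar>t\<bar>" for t
        proof -
          have "pt3 x t \<notin> K" using R[of "pt3 x t"] norm_pt3_ge(2)[of t x] that by fastforce
          thus ?thesis using d0 K(3) by simp
        qed
      qed
      thus ?case by (simp add: vprim_def)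
    qed
  qed
  also have "\<dots> = - (LINT x|lebesgue_on ?U. g x * \<phi> x)"
    using I2(1) dU integral_pt3_pair_borel(2)[OF F2m] integrable_lborel_pair_sections(3)[OF p2] by (simp add: pt3_pair_def)
  finally show ?thesis .
qed

end


section \<open>Traces of H1 functions on both faces of a cylinder\<close>

lemma AE_lebesgue_on_ex:
  fixes I :: "'a::euclidean_space set"
  assumes "open I" "I \<noteq> {}" "AE t in lebesgue_on I. P t"
  obtains t where "t \<in> I" "P t"
proof -
  have "\<exists>t\<in>I. P t"
  proof (rule ccontr)
    assume "\<not> (\<exists>t\<in>I. P t)"
    hence "AE t in lborel. t \<notin> I" using assms(1,3) AE_lebesgue_on_iff[of I P] by auto
    hence "emeasure lborel I = 0" using assms(1) by (auto simp: AE_iff_measurable[of I])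
    hence "I \<in> null_sets lborel" using assms(1) by auto
    hence "negligible I" by (simp add: negligible_iff_null_sets null_sets_completionI)
    thus False using assms(1,2) open_not_negligible by blast
  qed
  thus ?thesis using that by blast
qed

lemma L2_vecI:
  fixes f :: "'a::euclidean_space \<Rightarrow> real^'n"
  assumes "\<And>i. (\<lambda>x. f x $ i) \<in> L2 U"
  shows "f \<in> L2 U"
proof (rule L2_dominated)
  have "f = (\<lambda>x. \<Sum>i\<in>UNIV. (f x $ i) *\<^sub>R axis i 1)"
    using basis_expansion[of "f x" for x] by (auto simp: fun_eq_iff scalar_mult_eq_scaleR)
  moreover have "(\<lambda>x. \<Sum>i\<in>UNIV. (f x $ i) *\<^sub>R (axis i 1 :: real^'n)) \<in> borel_measurable (lebesgue_on U)"
    using L2D(1)[OF assms] by (intro borel_measurable_sum borel_measurable_scaleR borel_measurable_const)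
  ultimately show "f \<in> borel_measurable (lebesgue_on U)" by simp
  show "integrable (lebesgue_on U) (\<lambda>x. \<Sum>i\<in>UNIV. (norm (f x $ i))\<^sup>2)"
    by (intro Bochner_Integration.integrable_sum L2D(2) assms)
  show "AE x in lebesgue_on U. (norm (f x))\<^sup>2 \<le> (\<Sum>i\<in>UNIV. (norm (f x $ i))\<^sup>2)"
    by (intro AE_I2) (simp add: norm_vec_def L2_set_def sum_nonneg)
qed

lemma L2_vec_nth: "f \<in> L2 U \<Longrightarrow> (\<lambda>x. (f x :: 'b::euclidean_space^'n) $ i) \<in> L2 U"
  by (rule L2_dominated[of _ _ "\<lambda>x. (norm (f x))\<^sup>2"])
    (auto dest: L2D intro!: borel_measurable_vec_nth power_mono Finite_Cartesian_Product.norm_nth_le)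

text \<open>The third derivative of \<open>W\<close> vanishes weakly, so \<open>W\<close> takes
  equal values at any two Lebesgue points on one vertical line, and by Fubini almost every vertical
  line consists of such points up to a null set.\<close>

lemma vertical_constant:
  fixes W :: "real^3 \<Rightarrow> real^3"
  assumes \<omega>: "open \<omega>" "bounded \<omega>" and AB: "A < B" and W: "W \<in> L2 (cylinder \<omega> {A<..<B})"
    and weak: "\<And>\<phi> g i. test_function (cylinder \<omega> {A<..<B}) \<phi> g \<Longrightarrow> (LINT x|lebesgue_on (cylinder \<omega> {A<..<B}). W x $ i * g x $ 3) = 0"
  obtains c where "c \<in> L2 \<omega>" "AE x in lebesgue_on \<omega>. AE t in lebesgue_on {A<..<B}. W (pt3 x t) = c x"
proof -
  let ?U = "cylinder \<omega> {A<..<B}" and ?I = "{A<..<B}"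
  have Uo: "open ?U" using open_cylinder \<omega> by auto
  have Ub: "?U \<in> sets borel" and Us: "?U \<in> sets lebesgue" using Uo by auto
  have lm: "?U \<in> lmeasurable" by (rule lmeasurable_cylinder[OF \<omega>])
  have \<omega>b: "\<omega> \<in> sets borel" and \<omega>s: "\<omega> \<in> sets lebesgue" using \<omega> by auto
  have Ib: "?I \<in> sets borel" by simp
  have Wi: "integrable (lebesgue_on ?U) (\<lambda>x. W x $ i)" for i by (intro integrable_vec_nth L2_integrable[OF lm W])
  define E where "E x \<longleftrightarrow> (\<forall>i. lebesgue_point (\<lambda>x. indicator ?U x *\<^sub>R (W x $ i)) x)" for x
  have "AE x in lebesgue_on ?U. E x"
    unfolding E_def AE_all_countable using AE_lebesgue_point_on[OF Us Wi] by blast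
  from AE_pt3_pair[OF Ub this] have "AE z in lebesgue_on (\<omega> \<times> ?I). E (pt3_pair z)" unfolding vimage_pt3_pair_cylinder .
  from AE_lebesgue_on_prod[OF \<omega>b Ib this] have E: "AE x in lebesgue_on \<omega>. AE t in lebesgue_on ?I. E (pt3 x t)" by (simp add: pt3_pair_def)
  have const: "W (pt3 x t) = W (pt3 x s)" if x: "x \<in> \<omega>" and t: "t \<in> ?I" "E (pt3 x t)" and s: "s \<in> ?I" "E (pt3 x s)" for x t s
  proof -
    have "W (pt3 x t) $ i = W (pt3 x s) $ i" for i
    proof -
      define h where "h = pt3 0 (s - t)"
      have ps: "pt3 x s = pt3 x t + h" by (simp add: h_def pt3_def vec_eq_iff forall_3)
      have inU: "pt3 x t \<in> ?U" "pt3 x s \<in> ?U" using x t s by (auto simp: cylinder_def)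
      have seg: "closed_segment (pt3 x t) (pt3 x t + h) \<subseteq> ?U"
      proof
        fix y assume "y \<in> closed_segment (pt3 x t) (pt3 x t + h)"
        then obtain a where a: "0 \<le> a" "a \<le> 1" "y = (1 - a) *\<^sub>R pt3 x t + a *\<^sub>R pt3 x s" unfolding ps[symmetric] closed_segment_def by auto
        have y: "y = pt3 x ((1 - a) * t + a * s)" using a(3) by (simp add: pt3_def vec_eq_iff forall_3 algebra_simps)
        have "(1 - a) * t + a * s \<in> ?I"
          using convex_real_interval(8)[of A B] t s a unfolding convex_alt by auto
        thus "y \<in> ?U" using x by (simp add: y cylinder_def)
      qed
      show ?thesis
      proof (rule weak_directional_constant[OF Uo Wi _ seg])
        show "(LINT x|lebesgue_on ?U. W x $ i * (g x \<bullet> h)) = 0" if tf: "test_function ?U \<phi> g" for \<phi> g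
        proof -
          have "g x \<bullet> h = (s - t) * g x $ 3" for x by (simp add: h_def inner_vec_def sum_3 pt3_def)
          hence "(LINT x|lebesgue_on ?U. W x $ i * (g x \<bullet> h)) = (LINT x|lebesgue_on ?U. (s - t) * (W x $ i * g x $ 3))"
            by (simp add: mult_ac)
          also have "\<dots> = 0" using weak[OF tf] by simp
          finally show ?thesis .
        qed
        show "((\<lambda>r. (LINT y|lebesgue_on (ball (pt3 x t) r). W y $ i) /\<^sub>R measure lebesgue (ball (pt3 x t) r)) \<longlongrightarrow> W (pt3 x t) $ i) (at_right 0)"
          using t(2) by (intro lebesgue_point_on_average[OF Uo inU(1) Wi]) (simp add: E_def)
        show "((\<lambda>r. (LINT y|lebesgue_on (ball (pt3 x t + h) r). W y $ i) /\<^sub>R measure lebesgue (ball (pt3 x t + h) r)) \<longlongrightarrow> W (pt3 x s) $ i) (at_right 0)"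
          unfolding ps[symmetric] using s(2) by (intro lebesgue_point_on_average[OF Uo inU(2) Wi]) (simp add: E_def)
      qed
    qed
    thus ?thesis by (simp add: vec_eq_iff)
  qed
  \<comment> \<open>The vertical mean, not a chosen value on the line: as a marginal integral it is
    measurable in \<open>x\<close>.\<close>
  define c where "c x = (LINT t|lebesgue_on ?I. W (pt3 x t)) /\<^sub>R (B - A)" for x
  have mI: "measure lebesgue ?I = B - A" using AB by simp
  have cW: "AE x in lebesgue_on \<omega>. AE t in lebesgue_on ?I. W (pt3 x t) = c x"
    using E AE_space
  proof eventually_elim
    case (elim x)
    hence x: "x \<in> \<omega>" by simp
    obtain t where t: "t \<in> ?I" "E (pt3 x t)" using AE_lebesgue_on_ex[OF _ _ elim(1)] AB by auto
    have ae: "AE s in lebesgue_on ?I. W (pt3 x t) = W (pt3 x s)"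
      using elim(1) AE_space by eventually_elim (use const[OF x t] in auto)
    have m: "(\<lambda>s. W (pt3 x s)) \<in> borel_measurable (lebesgue_on ?I)"
      by (rule borel_measurable_lebesgue_on_AE[OF _ ae]) auto
    have "(LINT s|lebesgue_on ?I. W (pt3 x s)) = (LINT s|lebesgue_on ?I. W (pt3 x t))"
      by (rule integral_cong_AE) (use m ae in \<open>auto simp: eq_commute\<close>)
    also have "\<dots> = (B - A) *\<^sub>R W (pt3 x t)" using AB by (simp add: measure_restrict_space)
    finally have "c x = W (pt3 x t)" using AB by (simp add: c_def)
    thus ?case using ae by (simp add: eq_commute)
  qed
  have Wm: "(\<lambda>z. W (pt3_pair z)) \<in> borel_measurable (lebesgue_on (\<omega> \<times> ?I))"
    using measurable_pt3_pair[OF Ub L2D(1)[OF W]] by (simp add: vimage_pt3_pair_cylinder)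
  have cm: "c \<in> borel_measurable (lebesgue_on \<omega>)"
    using measurable_marginal[OF \<omega>b Ib Wm] unfolding c_def[abs_def] by (intro borel_measurable_scaleR) (auto simp: pt3_pair_def)
  have W2: "integrable (lebesgue_on (\<omega> \<times> ?I)) (\<lambda>z. (norm (W (pt3_pair z)))\<^sup>2)"
    using integral_pt3_pair(1)[OF Ub L2D(2)[OF W]] by (simp add: vimage_pt3_pair_cylinder)
  have Wx: "integrable (lebesgue_on \<omega>) (\<lambda>x. LINT t|lebesgue_on ?I. (norm (W (pt3 x t)))\<^sup>2)"
    using Fubini_lebesgue_on(2)[OF \<omega>b Ib W2] by (simp add: pt3_pair_def)
  have "c \<in> L2 \<omega>"
  proof (rule L2_dominated[OF cm])
    show "integrable (lebesgue_on \<omega>) (\<lambda>x. (LINT t|lebesgue_on ?I. (norm (W (pt3 x t)))\<^sup>2) / (B - A))" using Wx by simp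
    show "AE x in lebesgue_on \<omega>. (norm (c x))\<^sup>2 \<le> (LINT t|lebesgue_on ?I. (norm (W (pt3 x t)))\<^sup>2) / (B - A)"
      using cW
    proof eventually_elim
      case (elim x)
      have ae: "AE t in lebesgue_on ?I. (norm (c x))\<^sup>2 = (norm (W (pt3 x t)))\<^sup>2" using elim by eventually_elim simp
      have "(\<lambda>t. (norm (W (pt3 x t)))\<^sup>2) \<in> borel_measurable (lebesgue_on ?I)"
        by (rule borel_measurable_lebesgue_on_AE[OF _ ae]) auto
      hence "(LINT t|lebesgue_on ?I. (norm (W (pt3 x t)))\<^sup>2) = (LINT t|lebesgue_on ?I. (norm (c x))\<^sup>2)"
        by (intro integral_cong_AE) (use ae in \<open>auto simp: eq_commute\<close>)
      also have "\<dots> = (B - A) * (norm (c x))\<^sup>2" using AB by (simp add: measure_restrict_space)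
      finally show ?case using AB by simp
    qed
  qed
  thus ?thesis using cW that by blast
qed

text \<open>Subtracting the vertical primitive of the third derivative leaves a function that is
  constant on vertical lines. Its value is the trace on the bottom face, and adding the full
  vertical integral \<open>D\<close> gives the trace on the top face.\<close>

theorem cylinder_traces:
  assumes \<omega>: "open \<omega>" "bounded \<omega>" and AB: "A < B" and u: "has_weak_grad (cylinder \<omega> {A<..<B}) u G"
  obtains cA cB where "cA \<in> L2 \<omega>" "cB \<in> L2 \<omega>"
    "AE x in lebesgue_on \<omega>. has_trace (cylinder \<omega> {A<..<B}) u (pt3 x A) (cA x) \<and> has_trace (cylinder \<omega> {A<..<B}) u (pt3 x B) (cB x)"
proof -
  let ?U = "cylinder \<omega> {A<..<B}" and ?I = "{A<..<B}"
  have Uo: "open ?U" using open_cylinder \<omega> by auto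
  have Ub: "?U \<in> sets borel" and Us: "?U \<in> sets lebesgue" using Uo by auto
  have lm: "?U \<in> lmeasurable" by (rule lmeasurable_cylinder[OF \<omega>])
  have \<omega>b: "\<omega> \<in> sets borel" and \<omega>s: "\<omega> \<in> sets lebesgue" using \<omega> by auto
  have \<omega>lm: "\<omega> \<in> lmeasurable" using \<omega> by (simp add: lmeasurable_open)
  obtain Gb where Gb: "Gb \<in> borel_measurable borel" "AE x in lebesgue_on ?U. G x = Gb x"
    using ex_borel_lebesgue_on[OF L2D(1)[OF has_weak_gradD(2)[OF u]] Us] by blast
  \<comment> \<open>A Borel version of the third derivative, extended by 0, so that every vertical
    section is Borel and primitives are integrals over the whole line.\<close>
  define g where "g i x = indicator ?U x * Gb x $ i $ 3" for i x
  have gm: "g i \<in> borel_measurable borel" for i unfolding g_def using Gb(1) Ub by measurable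
  have gz: "g i x = 0" if "x \<notin> ?U" for i x using that by (simp add: g_def)
  have gae: "AE x in lebesgue_on ?U. G x $ i $ 3 = g i x" for i
    using Gb(2) AE_space by eventually_elim (simp add: g_def)
  have Gi2: "(\<lambda>x. G x $ i $ 3) \<in> L2 ?U" for i by (intro L2_vec_nth has_weak_gradD(2)[OF u])
  have gL: "g i \<in> L2 ?U" for i
    by (rule L2_dominated[OF lebesgue_on_measurable_borelI[OF gm] L2D(2)[OF Gi2[of i]]])
       (use gae[of i] in \<open>auto elim!: eventually_mono\<close>)
  have gi: "integrable lborel (g i)" for i
    using integral_lebesgue_on_lborel(2)[OF gm Us gz] L2_integrable[OF lm gL] by blast
  have g2i: "integrable lborel (\<lambda>x. (g i x)\<^sup>2)" for i
  proof -
    have "(\<lambda>x. (g i x)\<^sup>2) \<in> borel_measurable borel" using gm by measurable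
    from integral_lebesgue_on_lborel(2)[OF this Us] gz L2D(2)[OF gL[of i]] show ?thesis by simp
  qed
  note ctx = \<omega> AB gm gi g2i
  have vs1: "AE x in lborel. integrable lborel (\<lambda>s. g i (pt3 x s)) \<and> integrable lborel (\<lambda>s. (g i (pt3 x s))\<^sup>2)" for i
    by (rule vertical_sections(1)[OF ctx]) (rule gz)
  have vs2: "integrable lborel (\<lambda>x. LINT s|lborel. (g i (pt3 x s))\<^sup>2)" for i
    by (rule vertical_sections(2)[OF ctx]) (rule gz)
  have vq: "(LINT s|lborel. g i (pt3 x s))\<^sup>2 \<le> (B - A) * (LINT s|lborel. (g i (pt3 x s))\<^sup>2)"
    if "integrable lborel (\<lambda>s. g i (pt3 x s))" "integrable lborel (\<lambda>s. (g i (pt3 x s))\<^sup>2)" for i x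
    by (rule vprim_sq_le(2)[OF ctx gz that])
  have vL: "vprim (g i) \<in> L2 ?U" for i by (rule vprim_L2[OF ctx]) (rule gz)
  define P where "P x = (\<chi> i. vprim (g i) x)" for x
  have PL: "P \<in> L2 ?U" by (rule L2_vecI) (simp add: P_def vL)
  define W where "W x = 1 *\<^sub>R u x + (-1) *\<^sub>R P x" for x
  have WL: "W \<in> L2 ?U" unfolding W_def by (intro L2_lincomb has_weak_gradD(1)[OF u] PL)
  have weak: "(LINT x|lebesgue_on ?U. W x $ i * d x $ 3) = 0" if t: "test_function ?U \<phi> d" for \<phi> d i
  proof -
    have iu: "integrable (lebesgue_on ?U) (\<lambda>x. u x $ i * d x $ 3)"
      by (intro test_function_integrable(3)[OF t] integrable_vec_nth L2_integrable[OF lm has_weak_gradD(1)[OF u]])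
    have iP: "integrable (lebesgue_on ?U) (\<lambda>x. vprim (g i) x * d x $ 3)"
      by (intro test_function_integrable(3)[OF t] L2_integrable[OF lm] vL)
    have "(LINT x|lebesgue_on ?U. W x $ i * d x $ 3) = (LINT x|lebesgue_on ?U. u x $ i * d x $ 3 - vprim (g i) x * d x $ 3)"
      by (simp add: W_def P_def algebra_simps)
    also have "\<dots> = (LINT x|lebesgue_on ?U. u x $ i * d x $ 3) - (LINT x|lebesgue_on ?U. vprim (g i) x * d x $ 3)"
      using iu iP by simp
    also have "\<dots> = - (LINT x|lebesgue_on ?U. G x $ i $ 3 * \<phi> x) + (LINT x|lebesgue_on ?U. g i x * \<phi> x)"
      using has_weak_gradD(3)[OF u t, of i 3] vprim_by_parts[OF ctx gz t, of i] by simp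
    also have "(LINT x|lebesgue_on ?U. G x $ i $ 3 * \<phi> x) = (LINT x|lebesgue_on ?U. g i x * \<phi> x)"
    proof (rule integral_cong_AE)
      show "AE x in lebesgue_on ?U. G x $ i $ 3 * \<phi> x = g i x * \<phi> x" using gae[of i] by eventually_elim simp
    qed (use L2D(1)[OF Gi2] L2D(1)[OF gL] test_function_measurable(1)[OF t] in auto)
    finally show ?thesis by simp
  qed
  obtain cA where cA: "cA \<in> L2 \<omega>" "AE x in lebesgue_on \<omega>. AE t in lebesgue_on ?I. W (pt3 x t) = cA x"
  proof (rule vertical_constant[OF \<omega> AB WL])
    show "(LINT x|lebesgue_on ?U. W x $ i * d x $ 3) = 0" if "test_function ?U \<phi> d" for \<phi> d i
      by (rule weak[OF that])
  qed (rule that)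
  define D where "D x = (\<chi> i. LINT s|lborel. g i (pt3 x s))" for x
  have DL: "D \<in> L2 \<omega>"
  proof (rule L2_vecI)
    fix i
    have "integrable lborel (\<lambda>z. g i (pt3_pair z))" using integral_pt3_pair_borel(1)[OF gm] gi by simp
    from integrable_lborel_pair_sections(2)[OF this]
    have m: "(\<lambda>x. LINT s|lborel. g i (pt3 x s)) \<in> borel_measurable borel" by (auto simp: pt3_pair_def)
    show "(\<lambda>x. D x $ i) \<in> L2 \<omega>"
    proof (rule L2_dominated)
      show "(\<lambda>x. D x $ i) \<in> borel_measurable (lebesgue_on \<omega>)"
        using lebesgue_on_measurable_borelI[OF m] by (simp add: D_def)
      have "integrable lebesgue (\<lambda>x. (B - A) * (LINT s|lborel. (g i (pt3 x s))\<^sup>2))"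
        using vs2[of i] by (subst integrable_completion) auto
      thus "integrable (lebesgue_on \<omega>) (\<lambda>x. (B - A) * (LINT s|lborel. (g i (pt3 x s))\<^sup>2))"
        by (rule integrable_lebesgue_on[OF _ \<omega>s])
      show "AE x in lebesgue_on \<omega>. (norm (D x $ i))\<^sup>2 \<le> (B - A) * (LINT s|lborel. (g i (pt3 x s))\<^sup>2)"
        unfolding AE_lebesgue_on_iff[OF \<omega>s] using vs1[of i]
        by eventually_elim (use vq in \<open>auto simp: D_def\<close>)
    qed
  qed
  define cB where "cB x = 1 *\<^sub>R cA x + 1 *\<^sub>R D x" for x
  have cBL: "cB \<in> L2 \<omega>" unfolding cB_def by (intro L2_lincomb cA DL)
  define k where "k z = (\<Sum>i\<in>UNIV. \<bar>g i (pt3_pair z)\<bar>)" for z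
  have ki: "integrable lborel k"
    unfolding k_def using integral_pt3_pair_borel(1)[OF gm] gi
    by (intro Bochner_Integration.integrable_sum) (simp add: integrable_abs)
  have sec: "AE x in lebesgue_on \<omega>. \<forall>i. integrable lborel (\<lambda>s. g i (pt3 x s))"
    unfolding AE_lebesgue_on_iff[OF \<omega>s]
  proof -
    have "AE x in lborel. \<forall>i. integrable lborel (\<lambda>s. g i (pt3 x s)) \<and> integrable lborel (\<lambda>s. (g i (pt3 x s))\<^sup>2)"
      unfolding AE_all_countable using vs1 by blast
    thus "AE x in lborel. x \<in> \<omega> \<longrightarrow> (\<forall>i. integrable lborel (\<lambda>s. g i (pt3 x s)))" by eventually_elim simp
  qed
  \<comment> \<open>The weight \<open>\<sigma>\<close> lets one estimate serve both faces:
    \<open>indicator {..<t}\<close> for the bottom and \<open>indicator {..<t} s - 1\<close> for the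
    top.\<close>
  have bnd: "norm v \<le> (LINT s|lborel. indicator J s * k (x, s))"
    if i: "\<forall>i. integrable lborel (\<lambda>s. g i (pt3 x s))" and J: "J \<in> sets borel"
      and v: "\<And>i. v $ i = (LINT s|lborel. \<sigma> s * g i (pt3 x s))" and \<sigma>: "\<And>i s. \<bar>\<sigma> s * g i (pt3 x s)\<bar> \<le> indicator J s * \<bar>g i (pt3 x s)\<bar>"
    for v :: "real^3" and x J \<sigma>
  proof -
    have ii: "integrable lborel (\<lambda>s. indicator J s * \<bar>g i (pt3 x s)\<bar>)" for i
      using integrable_mult_indicator[of J lborel "\<lambda>s. \<bar>g i (pt3 x s)\<bar>"] i J by simp
    have "norm v \<le> (\<Sum>i\<in>UNIV. \<bar>v $ i\<bar>)" by (rule norm_le_l1_cart)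
    also have "\<dots> \<le> (\<Sum>i\<in>UNIV. LINT s|lborel. indicator J s * \<bar>g i (pt3 x s)\<bar>)"
    proof (rule sum_mono)
      fix i
      have "\<bar>v $ i\<bar> \<le> (LINT s|lborel. \<bar>\<sigma> s * g i (pt3 x s)\<bar>)" unfolding v by (rule integral_abs_bound)
      also have "\<dots> \<le> (LINT s|lborel. indicator J s * \<bar>g i (pt3 x s)\<bar>)"
        by (rule integral_mono'[OF ii]) (use \<sigma> in auto)
      finally show "\<bar>v $ i\<bar> \<le> (LINT s|lborel. indicator J s * \<bar>g i (pt3 x s)\<bar>)" .
    qed
    also have "\<dots> = (LINT s|lborel. (\<Sum>i\<in>UNIV. indicator J s * \<bar>g i (pt3 x s)\<bar>))"
      using ii by (intro Bochner_Integration.integral_sum[symmetric])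
    also have "\<dots> = (LINT s|lborel. indicator J s * k (x, s))"
      by (simp add: k_def pt3_pair_def sum_distrib_left)
    finally show ?thesis .
  qed
  have gzs: "g i (pt3 x s) = 0" if "s \<notin> ?I" for i x s using that by (intro gz) (simp add: cylinder_def)
  have Jb: "{s::real. \<bar>s - h\<bar> \<le> \<delta>} \<in> sets borel" for h \<delta>
  proof -
    have "{s::real. \<bar>s - h\<bar> \<le> \<delta>} = {h - \<delta>..h + \<delta>}" by auto
    thus ?thesis by simp
  qed
  have ui: "integrable (lebesgue_on ?U) u" by (rule L2_integrable[OF lm has_weak_gradD(1)[OF u]])
  have estA: "AE x in lebesgue_on \<omega>. AE t in lebesgue_on ?I.
       norm (u (pt3 x t) - cA x) \<le> (LINT s|lborel. indicator {s. \<bar>s - A\<bar> \<le> \<bar>t - A\<bar>} s * k (x, s))"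
    using cA(2) sec
  proof eventually_elim
    case (elim x)
    show ?case using elim(1) AE_space
    proof eventually_elim
      case (elim t)
      have t: "t \<in> ?I" using elim by simp
      show ?case
      proof (rule bnd[OF \<open>\<forall>i. integrable lborel (\<lambda>s. g i (pt3 x s))\<close> Jb, where \<sigma>="indicator {..<t}"])
        have "u (pt3 x t) - cA x = P (pt3 x t)" using elim(1) by (simp add: W_def algebra_simps)
        thus "(u (pt3 x t) - cA x) $ i = (LINT s|lborel. indicator {..<t} s * g i (pt3 x s))" for i by (simp add: P_def vprim_def)
        show "\<bar>indicator {..<t} s * g i (pt3 x s)\<bar> \<le> indicator {s. \<bar>s - A\<bar> \<le> \<bar>t - A\<bar>} s * \<bar>g i (pt3 x s)\<bar>" for i s
          using gzs[of s i x] t by (cases "s \<in> ?I") (auto simp: indicator_def)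
      qed
    qed
  qed
  have estB: "AE x in lebesgue_on \<omega>. AE t in lebesgue_on ?I.
       norm (u (pt3 x t) - cB x) \<le> (LINT s|lborel. indicator {s. \<bar>s - B\<bar> \<le> \<bar>t - B\<bar>} s * k (x, s))"
    using cA(2) sec
  proof eventually_elim
    case (elim x)
    note i = elim(2)
    show ?case using elim(1) AE_space
    proof eventually_elim
      case (elim t)
      have t: "t \<in> ?I" using elim by simp
      show ?case
      \<comment> \<open>The weight is minus the indicator of \<open>{t..}\<close>: since
        \<open>g\<close> vanishes above the cylinder, the integral runs from \<open>t\<close> up to
        the top face.\<close>
      proof (rule bnd[OF i Jb, where \<sigma>="\<lambda>s. indicator {..<t} s - 1"])
        have *: "u (pt3 x t) - cB x = P (pt3 x t) - D x" using elim(1) by (simp add: W_def cB_def algebra_simps)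
        show "(u (pt3 x t) - cB x) $ j = (LINT s|lborel. (indicator {..<t} s - 1) * g j (pt3 x s))" for j
        proof -
          have 1: "integrable lborel (\<lambda>s. indicator {..<t} s * g j (pt3 x s))"
            using integrable_mult_indicator[of "{..<t}" lborel "\<lambda>s. g j (pt3 x s)"] i by simp
          have "(LINT s|lborel. (indicator {..<t} s - 1) * g j (pt3 x s)) = (LINT s|lborel. indicator {..<t} s * g j (pt3 x s) - g j (pt3 x s))"
            by (simp add: left_diff_distrib)
          also have "\<dots> = vprim (g j) (pt3 x t) - (LINT s|lborel. g j (pt3 x s))"
            using 1 i by (simp add: vprim_def)
          finally show ?thesis using * by (simp add: P_def D_def)
        qed
        show "\<bar>(indicator {..<t} s - 1) * g i (pt3 x s)\<bar> \<le> indicator {s. \<bar>s - B\<bar> \<le> \<bar>t - B\<bar>} s * \<bar>g i (pt3 x s)\<bar>" for i s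
          using gzs[of s i x] t by (cases "s \<in> ?I") (auto simp: indicator_def)
      qed
    qed
  qed
  have "AE x in lebesgue_on \<omega>. has_trace ?U u (pt3 x A) (cA x)"
    by (rule cylinder_has_trace[OF \<omega> AB _ ui L2_integrable[OF \<omega>lm cA(1)] ki _ estA]) (auto simp: k_def sum_nonneg)
  moreover have "AE x in lebesgue_on \<omega>. has_trace ?U u (pt3 x B) (cB x)"
    by (rule cylinder_has_trace[OF \<omega> AB _ ui L2_integrable[OF \<omega>lm cBL] ki _ estB]) (auto simp: k_def sum_nonneg)
  ultimately show ?thesis using that[OF cA(1) cBL] by (simp add: AE_conj_iff)
qed

section \<open>Rigid displacements\<close>

lemma AE_lebesgue_translate:
  fixes c :: "'a::euclidean_space"
  assumes "AE x in lebesgue. P x"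
  shows "AE x in lebesgue. P (x + c)"
proof -
  have "AE x in distr lborel borel ((+) c). P x" using assms unfolding AE_completion_iff lborel_distr_plus .
  from AE_distrD[OF _ this] have "AE x in lborel. P (c + x)" by simp
  thus ?thesis unfolding AE_completion_iff by (simp add: add.commute)
qed

text \<open>Translates of a null set are null, so almost every point is good together with its
  translates along the axes. Such a frame of good points suffices to determine an affine
  map.\<close>

lemma AE_open_frame:
  fixes V :: "(real^'n::{finite,countable}) set"
  assumes V: "open V" "V \<noteq> {}" and P: "AE x in lebesgue. x \<in> V \<longrightarrow> P x"
  obtains x t where "t > 0" "x \<in> V" "P x" "\<And>i. x + t *\<^sub>R axis i 1 \<in> V" "\<And>i. P (x + t *\<^sub>R axis i 1)"
proof -
  obtain p e where e: "e > 0" "ball p e \<subseteq> V" using V by (meson ex_in_conv openE)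
  \<comment> \<open>Half of the radius is left for the base point, the other half for the
    shift.\<close>
  define t where "t = e / 2"
  have t: "t > 0" using e by (simp add: t_def)
  have 1: "AE x in lebesgue. \<forall>i. x + t *\<^sub>R axis i 1 \<in> V \<longrightarrow> P (x + t *\<^sub>R axis i 1)"
    unfolding AE_all_countable using AE_lebesgue_translate[OF P] by blast
  have "AE x in lebesgue_on (ball p t). P x \<and> (\<forall>i. x + t *\<^sub>R axis i 1 \<in> V \<longrightarrow> P (x + t *\<^sub>R axis i 1)) \<and> x \<in> ball p t"
  proof -
    have "AE x in lborel. x \<in> ball p t \<longrightarrow> P x \<and> (\<forall>i. x + t *\<^sub>R axis i 1 \<in> V \<longrightarrow> P (x + t *\<^sub>R axis i 1)) \<and> x \<in> ball p t"
      using 1 P unfolding AE_completion_iff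
    proof eventually_elim
      case (elim x)
      have "ball p t \<subseteq> V" using e by (auto simp: t_def)
      thus ?case using elim by blast
    qed
    thus ?thesis by (subst AE_lebesgue_on_iff) auto
  qed
  then obtain x where x: "x \<in> ball p t" "P x" "\<forall>i. x + t *\<^sub>R axis i 1 \<in> V \<longrightarrow> P (x + t *\<^sub>R axis i 1)"
    using AE_lebesgue_on_ex[of "ball p t"] t by (metis (no_types, lifting) ball_eq_empty linorder_not_less open_ball)
  have "x + t *\<^sub>R axis i 1 \<in> V" for i
  proof (rule subsetD[OF e(2)])
    have "dist p (x + t *\<^sub>R axis i 1) \<le> dist p x + norm (t *\<^sub>R axis i 1 :: real^'n)"
      using norm_triangle_ineq4[of "p - x" "t *\<^sub>R axis i 1"] by (simp add: dist_norm diff_diff_eq)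
    also have "\<dots> < e" using x(1) t by (simp add: t_def)
    finally show "x + t *\<^sub>R axis i 1 \<in> ball p e" by simp
  qed
  moreover have "x \<in> V" using x(1) e by (auto simp: t_def)
  ultimately show ?thesis using that[OF t, of x] x by blast
qed

lemma cross3_axis_zero:
  assumes "\<And>i. cross3 b (axis i 1) = 0"
  shows "b = 0"
proof -
  have "cross3 b (axis 1 1) $ k = 0" "cross3 b (axis 2 1) $ k = 0" for k using assms by simp_all
  from this(1)[of 2] this(1)[of 3] this(2)[of 3] show ?thesis
    by (simp add: cross3_def vec_eq_iff[of b] forall_3 axis_def)
qed

lemma rigid_zero_AE:
  assumes V: "open V" "V \<noteq> {}" and z: "AE x in lebesgue. x \<in> V \<longrightarrow> a + cross3 b x = 0"
  shows "a = 0 \<and> b = 0"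
proof -
  obtain x t where x: "t > 0" "x \<in> V" "a + cross3 b x = 0" "\<And>i. x + t *\<^sub>R axis i 1 \<in> V" "\<And>i. a + cross3 b (x + t *\<^sub>R axis i 1) = 0"
    by (rule AE_open_frame[OF V z], rule that) (assumption | blast)+
  have "cross3 b (axis i 1) = 0" for i
  proof -
    have "a + cross3 b (x + t *\<^sub>R axis i 1) = (a + cross3 b x) + t *\<^sub>R cross3 b (axis i 1)"
      by (simp add: cross_add_right cross_mult_right)
    thus ?thesis using x(1,3,5) by simp
  qed
  hence "b = 0" by (rule cross3_axis_zero)
  thus ?thesis using x(3) by simp
qed

text \<open>With a base point \<open>z\<close> and the shifted points \<open>y i\<close>, expanding
  the orthogonality relations among \<open>x\<close>, \<open>y i\<close> and \<open>z\<close>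
  expresses each component of \<open>u x - u z\<close> linearly in \<open>x - z\<close>. The same
  relations between two shifted points make the coefficient matrix skew, so it acts as a cross
  product.\<close>

lemma monotone_skew_imp_rigid:
  fixes u :: "real^3 \<Rightarrow> real^3"
  assumes V: "open V" "V \<noteq> {}" and ae: "AE x in lebesgue. x \<in> V \<longrightarrow> P x"
    and skew: "\<And>x y. x \<in> V \<Longrightarrow> y \<in> V \<Longrightarrow> P x \<Longrightarrow> P y \<Longrightarrow> (u x - u y) \<bullet> (x - y) = 0"
  shows "\<exists>a b. AE x in lebesgue. x \<in> V \<longrightarrow> u x = a + cross3 b x"
proof -
  obtain z t where z: "t > 0" "z \<in> V" "P z" "\<And>i. z + t *\<^sub>R axis i 1 \<in> V" "\<And>i. P (z + t *\<^sub>R axis i 1)"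
    by (rule AE_open_frame[OF V ae], rule that) (assumption | blast)+
  define v where "v x = u x - u z" for x
  define y where "y i = z + t *\<^sub>R axis i 1" for i
  have y: "y i \<in> V" "P (y i)" for i using z by (auto simp: y_def)
  have comp: "t * v x $ i = - (v (y i) \<bullet> (x - z))" if x: "x \<in> V" "P x" for x i
  proof -
    have 1: "v x \<bullet> (x - z) = 0" "v (y i) \<bullet> (y i - z) = 0" "(v x - v (y i)) \<bullet> (x - y i) = 0"
      using skew[OF x(1) z(2) x(2) z(3)] skew[OF y(1) z(2) y(2) z(3)] skew[OF x(1) y(1) x(2) y(2)]
      by (auto simp: v_def)
    have "x - y i = (x - z) - (y i - z)" by simp
    hence "v x \<bullet> (y i - z) + v (y i) \<bullet> (x - z) = 0" using 1 by (simp add: inner_diff_left inner_diff_right)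
    moreover have "v x \<bullet> (y i - z) = t * v x $ i" by (simp add: y_def inner_axis)
    ultimately show ?thesis by linarith
  qed
  define M where "M i j = - (v (y i) $ j) / t" for i j
  have vM: "v x $ i = M i 1 * (x - z) $ 1 + M i 2 * (x - z) $ 2 + M i 3 * (x - z) $ 3" if "x \<in> V" "P x" for x i
  proof -
    have "v x $ i = (t * v x $ i) / t" using z(1) by simp
    also have "t * v x $ i = - (v (y i) \<bullet> (x - z))" by (rule comp[OF that])
    finally show ?thesis by (simp add: M_def inner_vec_def sum_3 divide_inverse algebra_simps)
  qed
  have sk: "M i j = - M j i" for i j
  proof -
    have "t * v (y i) $ j = t * - v (y j) $ i" using comp[OF y, of i j] by (simp add: y_def inner_axis)
    hence "v (y i) $ j = - v (y j) $ i" using z(1) by (metis less_irrefl mult_left_cancel)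
    thus ?thesis by (simp add: M_def)
  qed
  \<comment> \<open>The axial vector of the skew matrix \<open>M\<close>.\<close>
  define b :: "real^3" where "b = vector [- M 2 3, M 1 3, - M 1 2]"
  have d: "M i i = 0" for i using sk[of i i] by simp
  have "u x = (u z - cross3 b z) + cross3 b x" if x: "x \<in> V" "P x" for x
  proof -
    have "v x = cross3 b (x - z)"
      using vM[OF x, of 1] vM[OF x, of 2] vM[OF x, of 3] sk[of 2 1] sk[of 3 1] sk[of 3 2] d
      by (simp add: vec_eq_iff forall_3 cross3_def b_def)
    thus ?thesis by (simp add: v_def cross_minus_right Cross3.right_diff_distrib algebra_simps)
  qed
  thus ?thesis using ae by (intro exI[of _ "u z - cross3 b z"] exI[of _ b]) (auto elim!: eventually_mono)
qed

lemma inner_vec_sum: "u \<bullet> (h::real^'n) = (\<Sum>i\<in>UNIV. h $ i * u $ i)"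
  by (simp add: inner_vec_def mult.commute)

lemma sym_part_zero_quad:
  assumes "sym_part M = 0"
  shows "(\<Sum>i\<in>UNIV. \<Sum>j\<in>UNIV. h $ i * h $ j * M $ i $ j) = 0"
proof -
  let ?S = "\<Sum>i\<in>UNIV. \<Sum>j\<in>UNIV. h $ i * h $ j * M $ i $ j"
  have sk: "M $ i $ j = - M $ j $ i" for i j
  proof -
    have "sym_part M $ i $ j = 0" using assms by simp
    thus ?thesis by (simp add: sym_part_def transpose_def)
  qed
  have "?S = (\<Sum>i\<in>UNIV. \<Sum>j\<in>UNIV. h $ i * h $ j * - M $ j $ i)" by (subst sk) simp
  also have "\<dots> = - (\<Sum>j\<in>UNIV. \<Sum>i\<in>UNIV. h $ j * h $ i * M $ j $ i)"
    by (subst sum.swap) (simp add: sum_negf mult.commute)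
  finally show ?thesis by simp
qed

text \<open>The derivative of \<open>u \<bullet> h\<close> along \<open>h\<close> is the quadratic
  form of the gradient at \<open>h\<close>, which sees only the vanishing symmetric part. A ball is
  convex, so any two of its points are joined by a segment inside \<open>U\<close>.\<close>

lemma locally_rigid:
  assumes U: "open U" "U \<in> lmeasurable" and G: "has_weak_grad U u G"
    and e0: "AE x in lebesgue_on U. sym_part (G x) = 0" and ball: "ball p e \<subseteq> U" "e > 0"
  shows "\<exists>a b. AE x in lebesgue. x \<in> ball p e \<longrightarrow> u x = a + cross3 b x"
proof -
  have Us: "U \<in> sets lebesgue" using U by auto
  have ui: "integrable (lebesgue_on U) u" by (rule L2_integrable[OF U(2) has_weak_gradD(1)[OF G]])
  have Gi: "integrable (lebesgue_on U) G" by (rule L2_integrable[OF U(2) has_weak_gradD(2)[OF G]])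
  define P where "P x = lebesgue_point (\<lambda>x. indicator U x *\<^sub>R u x) x" for x
  have "AE x in lebesgue_on U. P x" unfolding P_def by (rule AE_lebesgue_point_on[OF Us ui])
  hence "AE x in lebesgue. x \<in> U \<longrightarrow> P x" unfolding AE_lebesgue_on_iff[OF Us] AE_completion_iff .
  hence ae: "AE x in lebesgue. x \<in> ball p e \<longrightarrow> P x" by eventually_elim (use ball in blast)
  show ?thesis
  proof (rule monotone_skew_imp_rigid[OF open_ball _ ae])
    show "ball p e \<noteq> {}" using ball by simp
    fix x y assume x: "x \<in> ball p e" "P x" and y: "y \<in> ball p e" "P y"
    define h where "h = x - y"
    have xh: "x = y + h" by (simp add: h_def)
    have seg: "closed_segment y (y + h) \<subseteq> U"
      using closed_segment_subset[OF y(1) x(1) convex_ball] ball(1) xh by auto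
    have inU: "x \<in> U" "y \<in> U" using x y ball by auto
    have wi: "integrable (lebesgue_on U) (\<lambda>x. u x \<bullet> h)" using ui by simp
    have lim: "((\<lambda>r. (LINT y|lebesgue_on (ball z r). u y \<bullet> h) /\<^sub>R measure lebesgue (ball z r)) \<longlongrightarrow> u z \<bullet> h) (at_right 0)"
      if z: "z \<in> U" "P z" for z
    proof -
      obtain d where d: "d > 0" "ball z d \<subseteq> U" using U z openE by blast
      have "((\<lambda>r. ((LINT y|lebesgue_on (ball z r). u y) /\<^sub>R measure lebesgue (ball z r)) \<bullet> h) \<longlongrightarrow> u z \<bullet> h) (at_right 0)"
        using lebesgue_point_on_average[OF U(1) z(1) ui] z(2) by (intro tendsto_inner tendsto_const) (simp add: P_def)
      moreover have "\<forall>\<^sub>F r in at_right 0. ((LINT y|lebesgue_on (ball z r). u y) /\<^sub>R measure lebesgue (ball z r)) \<bullet> h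
          = (LINT y|lebesgue_on (ball z r). u y \<bullet> h) /\<^sub>R measure lebesgue (ball z r)"
        unfolding eventually_at_right_field
      proof (intro exI[of _ d] conjI allI impI d)
        fix r assume "0 < r" "r < d"
        hence "ball z r \<subseteq> U" using d by (meson less_imp_le order_trans subset_ball)
        hence "integrable (lebesgue_on (ball z r)) u" by (intro integrable_lebesgue_on_subset[OF ui _ Us]) auto
        thus "((LINT y|lebesgue_on (ball z r). u y) /\<^sub>R measure lebesgue (ball z r)) \<bullet> h
          = (LINT y|lebesgue_on (ball z r). u y \<bullet> h) /\<^sub>R measure lebesgue (ball z r)" by simp
      qed
      ultimately show ?thesis using tendsto_cong by fast
    qed
    have "u y \<bullet> h = u x \<bullet> h"
    proof (rule weak_directional_constant[OF U(1) wi _ seg lim[OF inU(2) y(2)]])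
      show "((\<lambda>r. (LINT y|lebesgue_on (ball (y + h) r). u y \<bullet> h) /\<^sub>R measure lebesgue (ball (y + h) r)) \<longlongrightarrow> u x \<bullet> h) (at_right 0)"
        using lim[OF inU(1) x(2)] unfolding xh[symmetric] .
      fix \<phi> g assume t: "test_function U \<phi> g"
      have 1: "integrable (lebesgue_on U) (\<lambda>x. u x $ i * g x $ j)" for i j
        by (intro test_function_integrable(3)[OF t] integrable_vec_nth ui)
      have 2: "integrable (lebesgue_on U) (\<lambda>x. G x $ i $ j * \<phi> x)" for i j
        by (intro test_function_integrable(1)[OF t] integrable_vec_nth Gi)
      have "(LINT x|lebesgue_on U. (u x \<bullet> h) * (g x \<bullet> h)) = (LINT x|lebesgue_on U. (\<Sum>i\<in>UNIV. \<Sum>j\<in>UNIV. h $ i * h $ j * (u x $ i * g x $ j)))"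
        unfolding inner_vec_sum[of _ h] sum_product by (simp add: mult_ac)
      also have "\<dots> = (\<Sum>i\<in>UNIV. \<Sum>j\<in>UNIV. h $ i * h $ j * (LINT x|lebesgue_on U. u x $ i * g x $ j))"
        using 1 by simp
      also have "\<dots> = - (\<Sum>i\<in>UNIV. \<Sum>j\<in>UNIV. h $ i * h $ j * (LINT x|lebesgue_on U. G x $ i $ j * \<phi> x))"
        by (simp add: has_weak_gradD(3)[OF G t] sum_negf)
      also have "(\<Sum>i\<in>UNIV. \<Sum>j\<in>UNIV. h $ i * h $ j * (LINT x|lebesgue_on U. G x $ i $ j * \<phi> x)) =
          (LINT x|lebesgue_on U. (\<Sum>i\<in>UNIV. \<Sum>j\<in>UNIV. h $ i * h $ j * (G x $ i $ j * \<phi> x)))" using 2 by simp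
      also have "\<dots> = (LINT x|lebesgue_on U. 0)"
      proof (rule integral_cong_AE)
        show "(\<lambda>x. \<Sum>i\<in>UNIV. \<Sum>j\<in>UNIV. h $ i * h $ j * (G x $ i $ j * \<phi> x)) \<in> borel_measurable (lebesgue_on U)"
          using 2 by (intro borel_measurable_sum borel_measurable_times borel_measurable_const borel_measurable_integrable)
        show "AE x in lebesgue_on U. (\<Sum>i\<in>UNIV. \<Sum>j\<in>UNIV. h $ i * h $ j * (G x $ i $ j * \<phi> x)) = 0"
          using e0
        proof eventually_elim
          case (elim x)
          have "(\<Sum>i\<in>UNIV. \<Sum>j\<in>UNIV. h $ i * h $ j * (G x $ i $ j * \<phi> x)) = (\<Sum>i\<in>UNIV. \<Sum>j\<in>UNIV. h $ i * h $ j * G x $ i $ j) * \<phi> x"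
            by (simp add: sum_distrib_right mult.assoc)
          thus ?case using sym_part_zero_quad[OF elim, of h] by simp
        qed
      qed simp
      finally show "(LINT x|lebesgue_on U. (u x \<bullet> h) * (g x \<bullet> h)) = 0" by simp
    qed
    thus "(u x - u y) \<bullet> (x - y) = 0" by (simp add: h_def inner_diff_left)
  qed
qed

text \<open>Rigid displacements that agree on a small ball coincide, so the points near which
  \<open>u\<close> equals one fixed rigid displacement form an open set whose complement in
  \<open>U\<close> is open too; connectedness makes it all of \<open>U\<close>.\<close>

theorem strain_zero_imp_rigid:
  assumes U: "open U" "U \<in> lmeasurable" "connected U" "U \<noteq> {}" and G: "has_weak_grad U u G"
    and e0: "AE x in lebesgue_on U. sym_part (G x) = 0"
  obtains a b where "AE x in lebesgue_on U. u x = a + cross3 b x"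
proof -
  have Us: "U \<in> sets lebesgue" using U by auto
  define R where "R p e a b \<longleftrightarrow> e > 0 \<and> ball p e \<subseteq> U \<and> (AE x in lebesgue. x \<in> ball p e \<longrightarrow> u x = a + cross3 b x)" for p e a b
  have loc: "\<exists>e a b. R p e a b" if p: "p \<in> U" for p
  proof -
    obtain e where e: "e > 0" "ball p e \<subseteq> U" using U(1) p openE by blast
    show ?thesis using locally_rigid[OF U(1,2) G e0 e(2,1)] e unfolding R_def by blast
  qed
  have Rsub: "R q (e - dist p q) a b" if "R p e a b" "q \<in> ball p e" for p q e a b
  proof -
    have s: "ball q (e - dist p q) \<subseteq> ball p e" by (simp add: ball_subset_ball_iff dist_commute)
    have "AE x in lebesgue. x \<in> ball q (e - dist p q) \<longrightarrow> u x = a + cross3 b x"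
    proof -
      have "AE x in lebesgue. x \<in> ball p e \<longrightarrow> u x = a + cross3 b x" using that(1) unfolding R_def by blast
      thus ?thesis by eventually_elim (use s in blast)
    qed
    thus ?thesis using that s unfolding R_def by auto
  qed
  obtain p0 where p0: "p0 \<in> U" using U by blast
  obtain e0 a b where r0: "R p0 e0 a b" using loc[OF p0] by blast
  define W where "W = {p. \<exists>e. R p e a b}"
  define Z where "Z = {p \<in> U. p \<notin> W}"
  have WU: "W \<subseteq> U" unfolding W_def R_def by auto
  have "open W" unfolding open_contains_ball
  proof
    fix p assume "p \<in> W"
    then obtain e where e: "R p e a b" by (auto simp: W_def)
    hence "ball p e \<subseteq> W" using Rsub unfolding W_def by blast
    thus "\<exists>e>0. ball p e \<subseteq> W" using e unfolding R_def by blast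
  qed
  \<comment> \<open>A point of \<open>Z\<close> has a ball with some rigid displacement given by
    \<open>a'\<close> and \<open>b'\<close>. If that ball met \<open>W\<close>, the two
    displacements would agree on a smaller ball, hence be equal, and the centre would lie in
    \<open>W\<close>.\<close>
  moreover have "open Z" unfolding open_contains_ball
  proof
    fix p assume p: "p \<in> Z"
    then obtain e a' b' where e: "R p e a' b'" using loc unfolding Z_def by blast
    have "ball p e \<subseteq> Z"
    proof
      fix q assume q: "q \<in> ball p e"
      have "q \<notin> W"
      proof
        assume "q \<in> W"
        then obtain d where d: "R q d a b" by (auto simp: W_def)
        have r': "R q (e - dist p q) a' b'" by (rule Rsub[OF e q])
        define c where "c = min d (e - dist p q)"
        have c: "c > 0" using d r' by (auto simp: c_def R_def)
        have "AE x in lebesgue. x \<in> ball q c \<longrightarrow> (a - a') + cross3 (b - b') x = 0"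
        proof -
          have "AE x in lebesgue. x \<in> ball q d \<longrightarrow> u x = a + cross3 b x"
            "AE x in lebesgue. x \<in> ball q (e - dist p q) \<longrightarrow> u x = a' + cross3 b' x"
            using d r' unfolding R_def by blast+
          thus ?thesis
        proof eventually_elim
          case (elim x)
          show ?case
          proof
            assume "x \<in> ball q c"
            hence "u x = a + cross3 b x" "u x = a' + cross3 b' x" using elim by (auto simp: c_def)
            thus "(a - a') + cross3 (b - b') x = 0" by (simp add: Cross3.left_diff_distrib algebra_simps)
          qed
        qed
        qed
        from rigid_zero_AE[OF open_ball _ this] c have "a = a'" "b = b'" by auto
        hence "p \<in> W" using e unfolding W_def by blast
        thus False using p by (simp add: Z_def)
      qed
      thus "q \<in> Z" using q e unfolding Z_def R_def by blast
    qed
    thus "\<exists>e>0. ball p e \<subseteq> Z" using e unfolding R_def by blast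
  qed
  moreover have "p0 \<in> W" using r0 by (auto simp: W_def)
  ultimately have WUeq: "W = U"
    using connectedD[OF U(3), of W Z] WU p0 unfolding Z_def by blast
  define F where "F = {ball p e | p e. R p e a b}"
  have UF: "\<Union>F = U"
  proof
    show "\<Union>F \<subseteq> U" unfolding F_def R_def by blast
    show "U \<subseteq> \<Union>F"
    proof
      fix p assume "p \<in> U"
      then obtain e where "R p e a b" using WUeq unfolding W_def by blast
      thus "p \<in> \<Union>F" unfolding F_def R_def by (intro UnionI[of "ball p e"]) auto
    qed
  qed
  have oF: "open S" if "S \<in> F" for S using that by (auto simp: F_def)
  \<comment> \<open>The exceptional null set depends on the ball; a countable subcover keeps the
    union null.\<close>
  obtain F' where F': "F' \<subseteq> F" "countable F'" "\<Union>F' = \<Union>F"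
    using Lindelof[OF oF] by blast
  have "AE x in lebesgue. \<forall>S\<in>F'. x \<in> S \<longrightarrow> u x = a + cross3 b x"
    unfolding AE_ball_countable[OF F'(2)]
  proof
    fix S assume "S \<in> F'"
    then obtain p e where "S = ball p e" "R p e a b" using F'(1) unfolding F_def by blast
    thus "AE x in lebesgue. x \<in> S \<longrightarrow> u x = a + cross3 b x" unfolding R_def by blast
  qed
  hence "AE x in lebesgue. x \<in> U \<longrightarrow> u x = a + cross3 b x"
  proof eventually_elim
    case (elim x)
    thus ?case using F'(3) UF by blast
  qed
  thus ?thesis using that unfolding AE_lebesgue_on_iff[OF Us] AE_completion_iff by blast
qed

lemma connected_cylinder:
  assumes "connected \<omega>"
  shows "connected (cylinder \<omega> {A<..<B})"
proof -
  have eq: "cylinder \<omega> {A<..<B} = pt3_pair ` (\<omega> \<times> {A<..<B})"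
  proof
    show "cylinder \<omega> {A<..<B} \<subseteq> pt3_pair ` (\<omega> \<times> {A<..<B})"
    proof
      fix x assume "x \<in> cylinder \<omega> {A<..<B}"
      thus "x \<in> pt3_pair ` (\<omega> \<times> {A<..<B})"
        by (intro image_eqI[of _ _ "(hpart x, x $ 3)"]) (auto simp: cylinder_def pt3_pair_def)
    qed
  qed (auto simp: cylinder_def pt3_pair_def)
  show ?thesis unfolding eq
    by (intro connected_continuous_image continuous_on_subset[OF continuous_pt3_pair] connected_Times assms) auto
qed

section \<open>Sets of zero surface measure\<close>

abbreviation cover_sum :: "(nat \<Rightarrow> (real^3) set) \<Rightarrow> ennreal" where
  "cover_sum C \<equiv> (\<Sum>i. ennreal (pi / 4 * (diameter (C i))\<^sup>2))"

text \<open>For null sets the supremum over meshes and the infimum over covers turn into a plain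
  \<delta>-\<epsilon> condition, the form in which the null sets below are treated.\<close>

lemma surface_measure_zero_iff:
  "surface_measure A = 0 \<longleftrightarrow>
     (\<forall>\<delta>>0. \<forall>\<epsilon>>0. \<exists>C. A \<subseteq> (\<Union>i. C i) \<and> (\<forall>i. bounded (C i) \<and> diameter (C i) \<le> \<delta>) \<and> cover_sum C < ennreal \<epsilon>)"
  (is "?L = ?R")
proof -
  let ?\<C> = "\<lambda>\<delta>. {C :: nat \<Rightarrow> (real^3) set. A \<subseteq> (\<Union>i. C i) \<and> (\<forall>i. bounded (C i) \<and> diameter (C i) \<le> \<delta>)}"
  have "?L \<longleftrightarrow> (\<forall>\<delta>>0. (INF C\<in>?\<C> \<delta>. cover_sum C) = 0)"
    unfolding surface_measure_def by (auto simp: SUP_bot_conv simp flip: bot_ennreal)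
  also have "\<dots> \<longleftrightarrow> ?R"
  proof (intro iffI allI impI)
    fix \<delta> \<epsilon> :: real assume *: "\<forall>\<delta>>0. (INF C\<in>?\<C> \<delta>. cover_sum C) = 0" and "0 < \<delta>" "0 < \<epsilon>"
    hence "(INF C\<in>?\<C> \<delta>. cover_sum C) < ennreal \<epsilon>" by simp
    thus "\<exists>C. A \<subseteq> (\<Union>i. C i) \<and> (\<forall>i. bounded (C i) \<and> diameter (C i) \<le> \<delta>) \<and> cover_sum C < ennreal \<epsilon>"
      unfolding INF_less_iff by blast
  next
    fix \<delta> :: real assume R: ?R and "0 < \<delta>"
    show "(INF C\<in>?\<C> \<delta>. cover_sum C) = 0"
    proof (rule ccontr)
      assume "(INF C\<in>?\<C> \<delta>. cover_sum C) \<noteq> 0"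
      hence "0 < (INF C\<in>?\<C> \<delta>. cover_sum C)" by (simp add: zero_less_iff_neq_zero)
      then obtain y where y: "0 < y" "y < (INF C\<in>?\<C> \<delta>. cover_sum C)" using dense by blast
      have yt: "y < top" using y(2) by (rule less_le_trans) simp
      define \<epsilon> where "\<epsilon> = enn2real y"
      have ye: "ennreal \<epsilon> = y" using yt by (simp add: \<epsilon>_def)
      have e: "0 < \<epsilon>" "ennreal \<epsilon> < (INF C\<in>?\<C> \<delta>. cover_sum C)"
        using y yt unfolding ye by (auto simp: \<epsilon>_def enn2real_positive_iff)
      obtain C where C: "C \<in> ?\<C> \<delta>" "cover_sum C < ennreal \<epsilon>" using R \<open>0 < \<delta>\<close> e(1) by blast
      have "(INF C\<in>?\<C> \<delta>. cover_sum C) \<le> cover_sum C" by (rule INF_lower[OF C(1)])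
      thus False using e(2) C(2) by (meson leD less_trans)
    qed
  qed
  finally show ?thesis .
qed

lemma surface_measure_empty: "surface_measure {} = 0"
  unfolding surface_measure_zero_iff
  by (intro allI impI exI[of _ "\<lambda>_. {}"]) (auto simp: diameter_def)

lemma surface_measure_subset_zero:
  assumes "A \<subseteq> B" "surface_measure B = 0"
  shows "surface_measure A = 0"
  unfolding surface_measure_zero_iff
proof (intro allI impI)
  fix \<delta> \<epsilon> :: real assume "0 < \<delta>" "0 < \<epsilon>"
  with assms(2) obtain C where "B \<subseteq> (\<Union>i. C i)" "\<forall>i. bounded (C i) \<and> diameter (C i) \<le> \<delta>" "cover_sum C < ennreal \<epsilon>"
    unfolding surface_measure_zero_iff by blast
  thus "\<exists>C. A \<subseteq> (\<Union>i. C i) \<and> (\<forall>i. bounded (C i) \<and> diameter (C i) \<le> \<delta>) \<and> cover_sum C < ennreal \<epsilon>"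
    using assms(1) by blast
qed

lemma sum_interleave:
  fixes f g :: "nat \<Rightarrow> ennreal"
  shows "(\<Sum>i<2 * n. if even i then f (i div 2) else g (i div 2)) = (\<Sum>i<n. f i) + (\<Sum>i<n. g i)"
  by (induction n) (auto simp: add_ac)

lemma surface_measure_Un_zero:
  assumes "surface_measure A = 0" "surface_measure B = 0"
  shows "surface_measure (A \<union> B) = 0"
  unfolding surface_measure_zero_iff
proof (intro allI impI)
  fix \<delta> \<epsilon> :: real assume d: "0 < \<delta>" "0 < \<epsilon>"
  hence h: "0 < \<epsilon> / 2" by simp
  obtain C where C: "A \<subseteq> (\<Union>i. C i)" "\<And>i. bounded (C i)" "\<And>i. diameter (C i) \<le> \<delta>" "cover_sum C < ennreal (\<epsilon> / 2)"
    using assms(1) d(1) h unfolding surface_measure_zero_iff by metis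
  obtain D where D: "B \<subseteq> (\<Union>i. D i)" "\<And>i. bounded (D i)" "\<And>i. diameter (D i) \<le> \<delta>" "cover_sum D < ennreal (\<epsilon> / 2)"
    using assms(2) d(1) h unfolding surface_measure_zero_iff by metis
  \<comment> \<open>A cover is a single sequence, so the two covers are interleaved.\<close>
  define E where "E i = (if even i then C (i div 2) else D (i div 2))" for i :: nat
  let ?f = "\<lambda>S::(real^3) set. ennreal (pi / 4 * (diameter S)\<^sup>2)"
  have EC: "E (2 * i) = C i" "E (2 * i + 1) = D i" for i by (auto simp: E_def)
  have "A \<union> B \<subseteq> (\<Union>i. E i)"
  proof
    fix x assume "x \<in> A \<union> B"
    then consider i where "x \<in> C i" | i where "x \<in> D i" using C(1) D(1) by blast
    thus "x \<in> (\<Union>i. E i)" by cases (metis EC UNIV_I UN_I)+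
  qed
  moreover have "cover_sum E < ennreal \<epsilon>"
  proof -
    have "(\<Sum>i<n. ?f (E i)) \<le> cover_sum C + cover_sum D" for n
    proof -
      have "(\<Sum>i<n. ?f (E i)) \<le> (\<Sum>i<2 * n. ?f (E i))" by (intro sum_mono2) auto
      also have "\<dots> = (\<Sum>i<2 * n. if even i then ?f (C (i div 2)) else ?f (D (i div 2)))"
        by (intro sum.cong) (auto simp: E_def)
      also have "\<dots> = (\<Sum>i<n. ?f (C i)) + (\<Sum>i<n. ?f (D i))" by (rule sum_interleave)
      also have "\<dots> \<le> cover_sum C + cover_sum D" by (intro add_mono sum_le_suminf) auto
      finally show ?thesis .
    qed
    hence "cover_sum E \<le> cover_sum C + cover_sum D" by (intro suminf_le_const) auto
    also have "\<dots> < ennreal (\<epsilon> / 2) + ennreal (\<epsilon> / 2)" by (rule add_strict_mono[OF C(4) D(4)])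
    also have "\<dots> = ennreal \<epsilon>" using d by (subst ennreal_plus[symmetric]) auto
    finally show ?thesis .
  qed
  ultimately show "\<exists>C. A \<union> B \<subseteq> (\<Union>i. C i) \<and> (\<forall>i. bounded (C i) \<and> diameter (C i) \<le> \<delta>) \<and> cover_sum C < ennreal \<epsilon>"
    using C D by (intro exI[of _ E]) (auto simp: E_def)
qed

text \<open>Cutting the segment into \<open>N\<close> equal pieces gives a sum of squared diameters
  of order \<open>1 / N\<close>: the exponent 2 beats the dimension 1.\<close>

lemma surface_measure_segment:
  fixes q d :: "real^3"
  assumes d: "norm d = 1" and R: "R > 0"
  shows "surface_measure {q + s *\<^sub>R d | s. \<bar>s\<bar> \<le> R} = 0"
  unfolding surface_measure_zero_iff
proof (intro allI impI)
  fix \<delta> \<epsilon> :: real assume de: "0 < \<delta>" "0 < \<epsilon>"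
  \<comment> \<open>The first bound makes the pieces no longer than \<open>\<delta>\<close>; the
    second makes the sum of the \<open>N\<close> squared lengths, \<open>4 * R\<^sup>2 / N\<close>,
    smaller than \<open>\<epsilon>\<close>.\<close>
  obtain N :: nat where N: "max (2 * R / \<delta>) (4 * R\<^sup>2 / \<epsilon>) < real N" using reals_Archimedean2 by blast
  have "0 < 2 * R / \<delta>" using R de by simp
  hence N0: "real N > 0" using N by linarith
  have N1: "2 * R / real N \<le> \<delta>" and N2: "4 * R\<^sup>2 / real N < \<epsilon>" using N N0 de by (auto simp: field_simps)
  define w where "w = 2 * R / real N"
  have w: "w > 0" using R N0 by (simp add: w_def)
  define C where "C i = (if i < N then {q + s *\<^sub>R d | s. - R + real i * w \<le> s \<and> s \<le> - R + real (Suc i) * w} else {})" for i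
  have distC: "dist x y \<le> w" if "x \<in> C i" "y \<in> C i" for x y i
  proof -
    obtain s t where st: "x = q + s *\<^sub>R d" "y = q + t *\<^sub>R d" "- R + real i * w \<le> s" "s \<le> - R + real (Suc i) * w"
      "- R + real i * w \<le> t" "t \<le> - R + real (Suc i) * w"
      using \<open>x \<in> C i\<close> \<open>y \<in> C i\<close> by (auto simp: C_def split: if_splits)
    have "dist x y = \<bar>s - t\<bar>" using d by (simp add: st(1,2) dist_norm flip: scaleR_left_diff_distrib)
    also have "\<dots> \<le> w" using st by (simp add: algebra_simps abs_le_iff)
    finally show ?thesis .
  qed
  have bC: "bounded (C i)" for i
  proof (cases "C i = {}")
    case False
    then obtain x where "x \<in> C i" by blast
    thus ?thesis using distC unfolding bounded_def by blast
  qed simp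
  have dC: "diameter (C i) \<le> w" for i using distC w by (intro diameter_le) (auto simp: dist_norm)
  have "{q + s *\<^sub>R d | s. \<bar>s\<bar> \<le> R} \<subseteq> (\<Union>i. C i)"
  proof
    fix x assume "x \<in> {q + s *\<^sub>R d | s. \<bar>s\<bar> \<le> R}"
    then obtain s where s: "x = q + s *\<^sub>R d" "\<bar>s\<bar> \<le> R" by blast
    \<comment> \<open>The minimum assigns the end point \<open>s = R\<close>, where the quotient
      equals \<open>N\<close>, to the last piece.\<close>
    define i where "i = min (nat \<lfloor>(s + R) / w\<rfloor>) (N - 1)"
    have sw: "0 \<le> (s + R) / w" using s w by simp
    have Nw: "real N * w = 2 * R" using N0 by (simp add: w_def)
    have iN: "i < N" using N0 by (auto simp: i_def)
    have l1: "real i \<le> (s + R) / w"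
    proof -
      have "real i \<le> real (nat \<lfloor>(s + R) / w\<rfloor>)" by (simp add: i_def)
      also have "\<dots> \<le> (s + R) / w" using sw by simp
      finally show ?thesis .
    qed
    have l2: "(s + R) / w \<le> real (Suc i)"
    proof (cases "nat \<lfloor>(s + R) / w\<rfloor> \<le> N - 1")
      case True
      hence "real (Suc i) = of_int \<lfloor>(s + R) / w\<rfloor> + 1" using sw by (simp add: i_def)
      thus ?thesis by linarith
    next
      case False
      hence "Suc i = N" using N0 by (simp add: i_def)
      have "s + R \<le> real N * w" using s Nw by simp
      thus ?thesis using w by (simp add: \<open>Suc i = N\<close> divide_le_eq del: of_nat_Suc)
    qed
    have "real i * w \<le> s + R" "s + R \<le> real (Suc i) * w" using l1 l2 w by (auto simp: le_divide_eq divide_le_eq simp del: of_nat_Suc)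
    hence "x \<in> C i" using iN s(1) by (auto simp: C_def intro!: exI[of _ s] simp del: of_nat_Suc)
    thus "x \<in> (\<Union>i. C i)" by blast
  qed
  moreover have "diameter (C i) \<le> \<delta>" for i using dC[of i] N1 by (simp add: w_def)
  moreover have "cover_sum C < ennreal \<epsilon>"
  proof -
    have "cover_sum C = (\<Sum>i<N. ennreal (pi / 4 * (diameter (C i))\<^sup>2))"
      by (rule suminf_finite) (auto simp: C_def)
    also have "\<dots> \<le> (\<Sum>i<N. ennreal (w\<^sup>2))"
    proof (rule sum_mono)
      fix i
      have "(diameter (C i))\<^sup>2 \<le> w\<^sup>2" using dC[of i] diameter_ge_0[OF bC] by (intro power_mono) auto
      moreover have "pi / 4 * (diameter (C i))\<^sup>2 \<le> 1 * (diameter (C i))\<^sup>2" using pi_less_4 by (intro mult_right_mono) auto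
      ultimately show "ennreal (pi / 4 * (diameter (C i))\<^sup>2) \<le> ennreal (w\<^sup>2)" by (intro ennreal_leI) linarith
    qed
    also have "\<dots> = ennreal (real N * w\<^sup>2)" by (simp add: ennreal_mult ennreal_of_nat_eq_real_of_nat)
    also have "real N * w\<^sup>2 = 4 * R\<^sup>2 / real N" using N0 by (simp add: w_def power2_eq_square field_simps)
    also have "ennreal (4 * R\<^sup>2 / real N) < ennreal \<epsilon>" using N2 de by (intro ennreal_lessI) auto
    finally show ?thesis .
  qed
  ultimately show "\<exists>C. {q + s *\<^sub>R d | s. \<bar>s\<bar> \<le> R} \<subseteq> (\<Union>i. C i) \<and> (\<forall>i. bounded (C i) \<and> diameter (C i) \<le> \<delta>) \<and> cover_sum C < ennreal \<epsilon>"
    using bC by (intro exI[of _ C]) blast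
qed

text \<open>If \<open>b\<close> is nonzero, two zeros differ by a multiple of \<open>b\<close>, so
  the zeros in the bounded set \<Gamma> lie in a segment, which has no area. If
  \<open>b = 0\<close>, a single zero gives \<open>a = 0\<close>.\<close>

lemma rigid_zero_surface:
  assumes \<Gamma>: "bounded \<Gamma>" "surface_measure \<Gamma> > 0" and z: "surface_measure {p \<in> \<Gamma>. a + cross3 b p \<noteq> 0} = 0"
  shows "a = 0 \<and> b = 0"
proof -
  define Z where "Z = {p \<in> \<Gamma>. a + cross3 b p = 0}"
  have nZ: "surface_measure Z \<noteq> 0"
  proof
    assume "surface_measure Z = 0"
    from surface_measure_Un_zero[OF this z] have "surface_measure (Z \<union> {p \<in> \<Gamma>. a + cross3 b p \<noteq> 0}) = 0" .
    moreover have "Z \<union> {p \<in> \<Gamma>. a + cross3 b p \<noteq> 0} = \<Gamma>" by (auto simp: Z_def)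
    ultimately show False using \<Gamma>(2) by simp
  qed
  then obtain q where q: "q \<in> Z" using surface_measure_empty by fastforce
  have "b = 0"
  proof (rule ccontr)
    assume b: "b \<noteq> 0"
    define d where "d = b /\<^sub>R norm b"
    have d: "norm d = 1" using b by (simp add: d_def)
    obtain K where K: "\<And>x. x \<in> \<Gamma> \<Longrightarrow> norm x \<le> K" using \<Gamma>(1) unfolding bounded_iff by blast
    define R where "R = 2 * \<bar>K\<bar> + 1"
    have "Z \<subseteq> {q + s *\<^sub>R d | s. \<bar>s\<bar> \<le> R}"
    proof
      fix x assume x: "x \<in> Z"
      have "cross3 b (x - q) = (a + cross3 b x) - (a + cross3 b q)" by (simp add: Cross3.right_diff_distrib)
      also have "\<dots> = 0" using x q by (simp add: Z_def)
      finally have "collinear {0, b, x - q}" by (simp add: cross_eq_0)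
      then obtain c where c: "x - q = c *\<^sub>R b" using b by (auto simp: collinear_lemma)
      have xe: "x = q + (c * norm b) *\<^sub>R d" using c b by (simp add: d_def algebra_simps)
      have "norm (x - q) \<le> 2 * \<bar>K\<bar>" using norm_triangle_ineq4[of x q] K[of x] K[of q] x q by (auto simp: Z_def)
      hence "\<bar>c * norm b\<bar> \<le> R" by (simp add: c R_def abs_mult)
      thus "x \<in> {q + s *\<^sub>R d | s. \<bar>s\<bar> \<le> R}" using xe by blast
    qed
    from surface_measure_subset_zero[OF this surface_measure_segment[OF d]] nZ show False by (force simp: R_def)
  qed
  thus ?thesis using q by (simp add: Z_def)
qed

section \<open>Elasticity tensors\<close>

lemma bilinear_tens: "bilinear tens"
  unfolding bilinear_def
  by (auto intro!: linearI simp: tens_def vec_eq_iff sum.distrib algebra_simps sum_distrib_left)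

lemma bounded_bilinear_tens: "bounded_bilinear tens"
  using bilinear_tens by (simp add: bilinear_conv_bounded_bilinear)

lemma tens_bound:
  "\<exists>K>0. \<forall>a \<eta> \<xi>. \<bar>tens a \<eta> \<bullet> \<xi>\<bar> \<le> K * norm a * (norm \<eta> * norm \<xi>)"
proof -
  obtain K where K: "K > 0" "\<And>a \<eta>. norm (tens a \<eta>) \<le> norm a * norm \<eta> * K"
    using bounded_bilinear.pos_bounded[OF bounded_bilinear_tens] by blast
  have "\<bar>tens a \<eta> \<bullet> \<xi>\<bar> \<le> K * norm a * (norm \<eta> * norm \<xi>)" for a \<eta> \<xi>
    using order_trans[OF Cauchy_Schwarz_ineq2[of "tens a \<eta>" \<xi>] mult_right_mono[OF K(2) norm_ge_zero]]
    by (simp add: mult_ac)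
  thus ?thesis using K(1) by blast
qed

lemma tens_measurable:
  assumes "f \<in> borel_measurable M" "g \<in> borel_measurable M" "h \<in> borel_measurable M"
  shows "(\<lambda>x. tens (f x) (g x) \<bullet> h x) \<in> borel_measurable M"
proof -
  have "continuous_on UNIV (\<lambda>x. tens (fst x) (snd x))"
    by (intro bounded_bilinear.continuous_on[OF bounded_bilinear_tens] continuous_intros)
  from borel_measurable_continuous_Pair[OF assms(1,2) this] assms(3) show ?thesis
    by (intro borel_measurable_inner) auto
qed

lemmas tens_lin = bounded_bilinear.add_right[OF bounded_bilinear_tens] bounded_bilinear.scaleR_right[OF bounded_bilinear_tens]
  bounded_bilinear.diff_right[OF bounded_bilinear_tens] bounded_bilinear.zero_right[OF bounded_bilinear_tens]
  bounded_bilinear.sum_right[OF bounded_bilinear_tens]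

lemma tens_L2_integrable:
  assumes a: "a \<in> Linf U" and S: "S \<in> L2 U" and T: "T \<in> L2 U"
  shows "integrable (lebesgue_on U) (\<lambda>x. tens (a x) (S x) \<bullet> T x)"
proof -
  obtain K where K: "K > 0" "\<And>a \<eta> \<xi>. \<bar>tens a \<eta> \<bullet> \<xi>\<bar> \<le> K * norm a * (norm \<eta> * norm \<xi>)"
    using tens_bound by blast
  obtain C where am: "a \<in> borel_measurable (lebesgue_on U)" and C: "AE x in lebesgue_on U. norm (a x) \<le> C"
    using a unfolding Linf_def by blast
  show ?thesis
  proof (rule Bochner_Integration.integrable_bound)
    show "integrable (lebesgue_on U) (\<lambda>x. K * C * ((norm (S x))\<^sup>2 + (norm (T x))\<^sup>2))"
      by (intro integrable_mult_right Bochner_Integration.integrable_add L2D S T)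
    show "(\<lambda>x. tens (a x) (S x) \<bullet> T x) \<in> borel_measurable (lebesgue_on U)"
      by (intro tens_measurable am L2D S T)
    show "AE x in lebesgue_on U. norm (tens (a x) (S x) \<bullet> T x) \<le> norm (K * C * ((norm (S x))\<^sup>2 + (norm (T x))\<^sup>2))"
      using C
    proof eventually_elim
      case (elim x)
      let ?s = "norm (S x)" and ?t = "norm (T x)"
      have C0: "0 \<le> C" using elim norm_ge_zero order_trans by blast
      have "2 * (?s * ?t) \<le> ?s\<^sup>2 + ?t\<^sup>2"
        using zero_le_power2[of "?s - ?t"] by (simp add: power2_eq_square algebra_simps)
      moreover have "0 \<le> ?s * ?t" by simp
      ultimately have st: "?s * ?t \<le> ?s\<^sup>2 + ?t\<^sup>2" by linarith
      have "\<bar>tens (a x) (S x) \<bullet> T x\<bar> \<le> K * norm (a x) * (?s * ?t)" by (rule K(2))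
      also have "\<dots> \<le> K * C * (?s\<^sup>2 + ?t\<^sup>2)"
        using K(1) elim C0 st by (intro mult_mono) auto
      finally show ?case using K(1) C0 by simp
    qed
  qed
qed

lemma AE_lebesgue_on_subset:
  assumes "AE x in lebesgue_on T. P x" "S \<subseteq> T" "S \<in> sets lebesgue" "T \<in> sets lebesgue"
  shows "AE x in lebesgue_on S. P x"
  using assms(1) unfolding AE_lebesgue_on_iff[OF assms(3)] AE_lebesgue_on_iff[OF assms(4)]
  by eventually_elim (use assms(2) in blast)

lemma elasticity_tensor_subset:
  assumes "elasticity_tensor \<alpha> T a" "S \<subseteq> T" "S \<in> sets lebesgue" "T \<in> sets lebesgue"
  shows "elasticity_tensor \<alpha> S a"
  using assms measurable_restrict_mono[of a lebesgue T borel S] AE_lebesgue_on_subset[OF _ assms(2-4)]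
  unfolding elasticity_tensor_def Linf_def by blast

lemma elasticity_tensor_nonneg:
  assumes a: "elasticity_tensor \<alpha> U a" and \<alpha>: "\<alpha> > 0" and S: "S \<in> L2 U"
  shows "0 \<le> (LINT x|lebesgue_on U. tens (a x) (S x) \<bullet> S x)"
    "(LINT x|lebesgue_on U. tens (a x) (S x) \<bullet> S x) \<le> 0 \<Longrightarrow> AE x in lebesgue_on U. S x = 0"
proof -
  have i: "integrable (lebesgue_on U) (\<lambda>x. tens (a x) (S x) \<bullet> S x)"
    using a S unfolding elasticity_tensor_def by (intro tens_L2_integrable) auto
  have i2: "integrable (lebesgue_on U) (\<lambda>x. (norm (S x))\<^sup>2)" by (rule L2D(2)[OF S])
  have c: "AE x in lebesgue_on U. \<alpha> * (norm (S x))\<^sup>2 \<le> tens (a x) (S x) \<bullet> S x"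
  proof -
    have "AE x in lebesgue_on U. \<forall>\<eta>. \<alpha> * (\<eta> \<bullet> \<eta>) \<le> tens (a x) \<eta> \<bullet> \<eta>" using a unfolding elasticity_tensor_def by blast
    thus ?thesis unfolding power2_norm_eq_inner by eventually_elim simp
  qed
  have le: "(LINT x|lebesgue_on U. \<alpha> * (norm (S x))\<^sup>2) \<le> (LINT x|lebesgue_on U. tens (a x) (S x) \<bullet> S x)"
    by (rule integral_mono_AE) (use i i2 c in auto)
  have n0: "0 \<le> (LINT x|lebesgue_on U. (norm (S x))\<^sup>2)" by simp
  hence "0 \<le> \<alpha> * (LINT x|lebesgue_on U. (norm (S x))\<^sup>2)" using \<alpha> by simp
  thus "0 \<le> (LINT x|lebesgue_on U. tens (a x) (S x) \<bullet> S x)" using le by simp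
  assume "(LINT x|lebesgue_on U. tens (a x) (S x) \<bullet> S x) \<le> 0"
  hence "\<alpha> * (LINT x|lebesgue_on U. (norm (S x))\<^sup>2) \<le> 0" using le by simp
  hence "(LINT x|lebesgue_on U. (norm (S x))\<^sup>2) = 0" using \<alpha> n0 by (simp add: mult_le_0_iff)
  hence "AE x in lebesgue_on U. (norm (S x))\<^sup>2 = 0" using i2 by (simp add: integral_nonneg_eq_0_iff_AE)
  thus "AE x in lebesgue_on U. S x = 0" by eventually_elim simp
qed

section \<open>Functions on the cell\<close>

lemma has_trace_sum:
  fixes f :: "'i \<Rightarrow> real^3 \<Rightarrow> real^3"
  assumes U: "U \<in> sets lebesgue" and "finite I"
    and f: "\<And>i. i \<in> I \<Longrightarrow> integrable (lebesgue_on U) (f i)" and t: "\<And>i. i \<in> I \<Longrightarrow> has_trace U (f i) p (z i)"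
  shows "has_trace U (\<lambda>x. \<Sum>i\<in>I. a i *\<^sub>R f i x) p (\<Sum>i\<in>I. a i *\<^sub>R z i)"
  using \<open>finite I\<close> f t
proof (induction I)
  case empty
  show ?case using has_trace_const[of U 0 p] by simp
next
  case (insert j I)
  have "integrable (lebesgue_on U) (\<lambda>x. \<Sum>i\<in>I. a i *\<^sub>R f i x)"
    using insert by (intro Bochner_Integration.integrable_sum integrable_scaleR_right) auto
  from has_trace_lincomb[OF U _ this, of "f j" p "z j" "\<Sum>i\<in>I. a i *\<^sub>R z i" "a j" 1] insert
  show ?case by simp
qed

lemma has_weak_grad_sum:
  fixes f :: "'i \<Rightarrow> real^3 \<Rightarrow> real^3"
  assumes U: "U \<in> lmeasurable" and "finite I" and f: "\<And>i. i \<in> I \<Longrightarrow> has_weak_grad U (f i) (G i)"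
  shows "has_weak_grad U (\<lambda>x. \<Sum>i\<in>I. a i *\<^sub>R f i x) (\<lambda>x. \<Sum>i\<in>I. a i *\<^sub>R G i x)"
  using \<open>finite I\<close> f
proof (induction I)
  case empty
  show ?case using has_weak_grad_const[OF U, of 0] by simp
next
  case (insert j I)
  from has_weak_grad_lincomb[OF U, of "f j" "G j" "\<lambda>x. \<Sum>i\<in>I. a i *\<^sub>R f i x" "\<lambda>x. \<Sum>i\<in>I. a i *\<^sub>R G i x" "a j" 1] insert
  show ?case by simp
qed

text \<open>The shape \<open>c + k *\<^sub>R v + sum\<close> covers both uses: \<open>k = 0\<close>
  builds test functions from correctors, \<open>k = 1\<close> subtracts such a combination from the
  unfolded displacement.\<close>

lemma has_trace_comb:
  fixes f :: "3 \<Rightarrow> real^3 \<Rightarrow> real^3"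
  assumes U: "U \<in> lmeasurable" and v: "integrable (lebesgue_on U) v" "has_trace U v p w"
    and f: "\<And>i. integrable (lebesgue_on U) (f i)" "\<And>i. has_trace U (f i) p (z i)"
  shows "has_trace U (\<lambda>x. c + k *\<^sub>R v x + (\<Sum>i\<in>UNIV. a i *\<^sub>R f i x)) p (c + k *\<^sub>R w + (\<Sum>i\<in>UNIV. a i *\<^sub>R z i))"
proof -
  have Us: "U \<in> sets lebesgue" using U by auto
  have 1: "has_trace U (\<lambda>x. \<Sum>i\<in>UNIV. a i *\<^sub>R f i x) p (\<Sum>i\<in>UNIV. a i *\<^sub>R z i)"
    by (rule has_trace_sum[OF Us]) (use f in auto)
  have 2: "integrable (lebesgue_on U) (\<lambda>x. \<Sum>i\<in>UNIV. a i *\<^sub>R f i x)"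
    using f(1) by (intro Bochner_Integration.integrable_sum integrable_scaleR_right) auto
  have 3: "has_trace U (\<lambda>x. 1 *\<^sub>R c + k *\<^sub>R v x) p (1 *\<^sub>R c + k *\<^sub>R w)"
    by (rule has_trace_lincomb[OF Us integrable_const_lebesgue_on[OF U] v(1) has_trace_const v(2)])
  have 4: "integrable (lebesgue_on U) (\<lambda>x. 1 *\<^sub>R c + k *\<^sub>R v x)"
    using v(1) by (intro Bochner_Integration.integrable_add integrable_scaleR_right integrable_const_lebesgue_on U) auto
  from has_trace_lincomb[OF Us 4 2 3 1, of 1 1] show ?thesis by simp
qed

lemma has_weak_grad_comb:
  fixes f :: "3 \<Rightarrow> real^3 \<Rightarrow> real^3"
  assumes U: "U \<in> lmeasurable" and v: "has_weak_grad U v G" and f: "\<And>i. has_weak_grad U (f i) (F i)"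
  shows "has_weak_grad U (\<lambda>x. c + k *\<^sub>R v x + (\<Sum>i\<in>UNIV. a i *\<^sub>R f i x)) (\<lambda>x. k *\<^sub>R G x + (\<Sum>i\<in>UNIV. a i *\<^sub>R F i x))"
proof -
  have 1: "has_weak_grad U (\<lambda>x. 1 *\<^sub>R c + k *\<^sub>R v x) (\<lambda>x. 1 *\<^sub>R 0 + k *\<^sub>R G x)"
    by (rule has_weak_grad_lincomb[OF U has_weak_grad_const[OF U] v])
  have 2: "has_weak_grad U (\<lambda>x. \<Sum>i\<in>UNIV. a i *\<^sub>R f i x) (\<lambda>x. \<Sum>i\<in>UNIV. a i *\<^sub>R F i x)"
    by (rule has_weak_grad_sum[OF U]) (use f in auto)
  from has_weak_grad_lincomb[OF U 1 2, of 1 1] show ?thesis by simp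
qed

lemma H1_integrable: "U \<in> lmeasurable \<Longrightarrow> u \<in> H1 U \<Longrightarrow> integrable (lebesgue_on U) u"
  by (auto simp: H1_def dest!: has_weak_gradD(1) intro: L2_integrable)

lemma H1_per_comb:
  fixes f :: "3 \<Rightarrow> real^3 \<Rightarrow> real^3"
  assumes U: "U \<in> lmeasurable" and v: "v \<in> H1_per U" and f: "\<And>i. f i \<in> H1_per U"
  shows "(\<lambda>x. c + k *\<^sub>R v x + (\<Sum>i\<in>UNIV. a i *\<^sub>R f i x)) \<in> H1_per U"
proof -
  have vH: "v \<in> H1 U" and fH: "f i \<in> H1 U" for i using v f by (auto simp: H1_per_def)
  note vi = H1_integrable[OF U vH] note fi = H1_integrable[OF U fH]
  obtain G where G: "has_weak_grad U v G" using vH by (auto simp: H1_def)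
  obtain F where F: "\<And>i. has_weak_grad U (f i) (F i)" using fH unfolding H1_def mem_Collect_eq by metis
  have "(\<lambda>x. c + k *\<^sub>R v x + (\<Sum>i\<in>UNIV. a i *\<^sub>R f i x)) \<in> H1 U"
    using has_weak_grad_comb[where v=v and f=f and F=F and c=c and k=k and a=a, OF U G F] unfolding H1_def by blast
  \<comment> \<open>Stated for arbitrary pairs of points \<open>p z\<close> and \<open>q z\<close>,
    to serve both pairs of opposite lateral faces.\<close>
  moreover have per: "AE z in M. \<exists>d. has_trace U (\<lambda>x. c + k *\<^sub>R v x + (\<Sum>i\<in>UNIV. a i *\<^sub>R f i x)) (p z) d \<and>
        has_trace U (\<lambda>x. c + k *\<^sub>R v x + (\<Sum>i\<in>UNIV. a i *\<^sub>R f i x)) (q z) d"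
    if 1: "AE z in M. \<exists>d. has_trace U v (p z) d \<and> has_trace U v (q z) d"
      and 2: "\<And>i. AE z in M. \<exists>d. has_trace U (f i) (p z) d \<and> has_trace U (f i) (q z) d" for M p and q :: "real^2 \<Rightarrow> real^3"
  proof -
    have "AE z in M. \<forall>i. \<exists>d. has_trace U (f i) (p z) d \<and> has_trace U (f i) (q z) d"
      unfolding AE_all_countable using 2 by blast
    with 1 show ?thesis
    proof eventually_elim
      case (elim z)
      obtain d where d: "has_trace U v (p z) d" "has_trace U v (q z) d" using elim(1) by blast
      obtain e where e: "\<And>i. has_trace U (f i) (p z) (e i)" "\<And>i. has_trace U (f i) (q z) (e i)" using elim(2) by metis
      show ?case using has_trace_comb[where f=f and z=e, OF U vi d(1) fi e(1)] has_trace_comb[where f=f and z=e, OF U vi d(2) fi e(2)] by blast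
    qed
  qed
  ultimately show ?thesis
    using v f unfolding H1_per_def mem_Collect_eq by (intro conjI per) auto
qed

text \<open>A frame of three non-collinear points in the plane already fixes a rigid
  displacement.\<close>

lemma rigid_zero_horizontal:
  fixes V :: "(real^2) set"
  assumes V: "open V" "V \<noteq> {}" and z: "AE z in lebesgue_on V. a + cross3 b (pt3 z 0) = 0"
  shows "a = 0 \<and> b = 0"
proof -
  have "V \<in> sets lebesgue" using V by auto
  hence ae: "AE z in lebesgue. z \<in> V \<longrightarrow> a + cross3 b (pt3 z 0) = 0"
    using z unfolding AE_completion_iff by (simp add: AE_lebesgue_on_iff)
  obtain z t where z: "t > 0" "z \<in> V" "a + cross3 b (pt3 z 0) = 0" "\<And>i. z + t *\<^sub>R axis i 1 \<in> V"
      "\<And>i. a + cross3 b (pt3 (z + t *\<^sub>R axis i 1) 0) = 0"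
    by (rule AE_open_frame[OF V ae], rule that) (assumption | blast)+
  have c0: "cross3 b (pt3 (axis i 1) 0) = 0" for i
  proof -
    have "pt3 (z + t *\<^sub>R axis i 1) 0 = pt3 z 0 + t *\<^sub>R pt3 (axis i 1) 0" by (simp add: pt3_def vec_eq_iff forall_3)
    hence "a + cross3 b (pt3 (z + t *\<^sub>R axis i 1) 0) = (a + cross3 b (pt3 z 0)) + t *\<^sub>R cross3 b (pt3 (axis i 1) 0)"
      by (simp add: cross_add_right cross_mult_right)
    thus ?thesis using z(1,3,5) by simp
  qed
  have "cross3 b (pt3 (axis 1 1) 0) $ k = 0" "cross3 b (pt3 (axis 2 1) 0) $ k = 0" for k using c0 by simp_all
  from this(1)[of 2] this(1)[of 3] this(2)[of 3] have "b = 0"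
    by (simp add: cross3_def vec_eq_iff[of b] forall_3 axis_def pt3_def)
  thus ?thesis using z(3) by simp
qed

text \<open>With zero strain the right-hand side of Korn's inequality is 0 whatever the constant, so
  \<open>w\<close> equals one rigid displacement on the whole of \<open>Y0\<close>. Being
  continuous, that displacement takes its trace as its value on the bottom face, where it must
  vanish.\<close>

lemma cell_strain_zero:
  assumes Y: "open Y0" "bounded Y0" "korn_domain Y0" and face: "\<And>z. z \<in> unit_square \<Longrightarrow> pt3 z 0 \<in> closure Y0"
    and w: "w \<in> H1 Y0" and e0: "AE y in lebesgue_on Y0. strain Y0 w y = 0"
    and tr: "AE z in lebesgue_on unit_square. has_trace Y0 w (pt3 z 0) 0"
  shows "AE y in lebesgue_on Y0. w y = 0"
proof -
  have Ys: "Y0 \<in> sets lebesgue" using Y by auto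
  have Ylm: "Y0 \<in> lmeasurable" using Y by (simp add: lmeasurable_open)
  obtain C where C: "\<And>v. v \<in> H1 Y0 \<Longrightarrow> \<exists>a b. norm_H1 Y0 (\<lambda>y. v y - (a + cross3 b y)) \<le> C * norm_L2 Y0 (strain Y0 v)"
    using Y(3) unfolding korn_domain_def by blast
  obtain a b where ab: "norm_H1 Y0 (\<lambda>y. w y - (a + cross3 b y)) \<le> C * norm_L2 Y0 (strain Y0 w)" using C[OF w] by blast
  have "(LINT y|lebesgue_on Y0. (norm (strain Y0 w y))\<^sup>2) = (LINT y|lebesgue_on Y0. 0)"
    by (rule integral_cong_AE) (use L2D(1)[OF strain_L2[OF w]] e0 in auto)
  hence "norm_L2 Y0 (strain Y0 w) = 0" by (simp add: norm_L2_def)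
  define r where "r y = a + cross3 b y" for y
  have rc: "continuous_on UNIV r" unfolding r_def
    by (intro continuous_intros continuous_on_cross)
  have "(norm_L2 Y0 (\<lambda>y. w y - r y))\<^sup>2 \<le> 0"
  proof -
    have "sqrt ((norm_L2 Y0 (\<lambda>y. w y - r y))\<^sup>2 + (norm_L2 Y0 (weak_grad Y0 (\<lambda>y. w y - r y)))\<^sup>2) \<le> 0"
      using ab \<open>norm_L2 Y0 (strain Y0 w) = 0\<close> by (simp add: norm_H1_def r_def)
    hence "(norm_L2 Y0 (\<lambda>y. w y - r y))\<^sup>2 + (norm_L2 Y0 (weak_grad Y0 (\<lambda>y. w y - r y)))\<^sup>2 \<le> 0" by simp
    thus ?thesis by (smt (verit) zero_le_power2)
  qed
  hence "(LINT y|lebesgue_on Y0. (norm (w y - r y))\<^sup>2) \<le> 0" by (simp add: norm_L2_def)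
  hence z: "(LINT y|lebesgue_on Y0. (norm (w y - r y))\<^sup>2) = 0" by (intro antisym) simp_all
  have wL: "w \<in> L2 Y0" using w by (auto simp: H1_def dest: has_weak_gradD)
  have rm: "r \<in> borel_measurable (lebesgue_on Y0)"
    using rc by (intro lebesgue_on_measurable_borelI borel_measurable_continuous_onI)
  have "bounded (r ` closure Y0)" using Y(2) rc
    by (intro compact_imp_bounded compact_continuous_image continuous_on_subset[OF rc]) (auto simp: compact_closure)
  then obtain B where B: "\<And>y. y \<in> Y0 \<Longrightarrow> norm (r y) \<le> B"
    unfolding bounded_iff using closure_subset by blast
  \<comment> \<open>A zero Bochner integral carries information only for an integrable function;
    hence the square integrability of \<open>r\<close>, and with it that of the difference.\<close>
  have rL: "r \<in> L2 Y0"
  proof (rule L2_dominated[OF rm])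
    show "integrable (lebesgue_on Y0) (\<lambda>y. B\<^sup>2)" by (rule integrable_const_lebesgue_on[OF Ylm])
    show "AE y in lebesgue_on Y0. (norm (r y))\<^sup>2 \<le> B\<^sup>2" using B by (intro AE_I2 power_mono) auto
  qed
  have "(\<lambda>y. 1 *\<^sub>R w y + (-1) *\<^sub>R r y) \<in> L2 Y0" by (rule L2_lincomb[OF wL rL])
  hence "integrable (lebesgue_on Y0) (\<lambda>y. (norm (w y - r y))\<^sup>2)" using L2D(2) by fastforce
  hence "AE y in lebesgue_on Y0. (norm (w y - r y))\<^sup>2 = 0" using z by (simp add: integral_nonneg_eq_0_iff_AE)
  hence wr: "AE y in lebesgue_on Y0. w y = r y" by eventually_elim simp
  have r0: "AE z in lebesgue_on unit_square. r (pt3 z 0) = 0"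
    using tr AE_space
  proof eventually_elim
    case (elim z)
    hence p: "pt3 z 0 \<in> closure Y0" using face by simp
    have "has_trace Y0 r (pt3 z 0) 0"
      using elim(1) has_trace_cong_AE[OF Ys L2D(1)[OF wL] rm wr] by blast
    from has_trace_unique[OF Y(1) p L2_integrable[OF Ylm rL] has_trace_continuous[OF Y(1) p rc] this]
    show ?case .
  qed
  have sq: "open unit_square" "unit_square \<noteq> {}"
  proof -
    have eq: "unit_square = box 0 1" by (auto simp: mem_box_cart)
    show "open unit_square" unfolding eq by (rule open_box)
    have "(\<chi> i. 1/2) \<in> unit_square" by simp
    thus "unit_square \<noteq> {}" by blast
  qed
  have "a = 0 \<and> b = 0"
    by (rule rigid_zero_horizontal[OF sq]) (use r0 in \<open>simp add: r_def\<close>)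
  thus ?thesis using wr by (simp add: r_def)
qed

section \<open>Unfolded functions\<close>

lemma norm_H1_nonneg: "0 \<le> norm_H1 U u"
  by (simp add: norm_H1_def)

text \<open>Each splitting of the sum into two costs a factor 2, at most 8 after three of them; 16
  leaves room.\<close>

lemma norm_sq_sum5:
  fixes a b :: "'b::real_inner" and w :: "3 \<Rightarrow> 'b"
  shows "(norm (a + b + (\<Sum>i\<in>UNIV. w i)))\<^sup>2 \<le> 16 * ((norm a)\<^sup>2 + (norm b)\<^sup>2 + (\<Sum>i\<in>UNIV. (norm (w i))\<^sup>2))"
proof -
  have 2: "(norm (x + y))\<^sup>2 \<le> 2 * (norm x)\<^sup>2 + 2 * (norm y)\<^sup>2" for x y :: 'b
  proof -
    have "(norm (x + y))\<^sup>2 \<le> (norm x + norm y)\<^sup>2" by (intro power_mono norm_triangle_ineq norm_ge_zero)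
    also have "\<dots> \<le> 2 * (norm x)\<^sup>2 + 2 * (norm y)\<^sup>2"
      using zero_le_power2[of "norm x - norm y"] by (simp add: power2_eq_square algebra_simps)
    finally show ?thesis .
  qed
  have "(norm (a + b + (w 1 + w 2 + w 3)))\<^sup>2 \<le> 16 * ((norm a)\<^sup>2 + (norm b)\<^sup>2 + ((norm (w 1))\<^sup>2 + (norm (w 2))\<^sup>2 + (norm (w 3))\<^sup>2))"
    using 2[of "a + b" "w 1 + w 2 + w 3"] 2[of a b] 2[of "w 1 + w 2" "w 3"] 2[of "w 1" "w 2"]
      zero_le_power2[of "norm a"] zero_le_power2[of "norm b"] zero_le_power2[of "norm (w 1)"] zero_le_power2[of "norm (w 2)"]
      zero_le_power2[of "norm (w 3)"] by (simp only: distrib_left)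
  thus ?thesis by (simp add: sum_3)
qed

context
  fixes \<omega> :: "(real^2) set" and Y0 :: "(real^3) set"
  assumes \<omega>: "open \<omega>" "bounded \<omega>" and Y: "open Y0" "bounded Y0"
begin

lemma unfolded_sets:
  "\<omega> \<in> sets borel" "\<omega> \<in> sets lebesgue" "\<omega> \<in> lmeasurable"
  "Y0 \<in> sets borel" "Y0 \<in> sets lebesgue" "Y0 \<in> lmeasurable" "\<omega> \<times> Y0 \<in> sets lebesgue"
  using \<omega> Y prod_sets_lebesgue(1)[of \<omega> Y0] by (auto intro: lmeasurable_open)

lemma has_weak_grad_y_weak_grad_y:
  "v \<in> meas_H1_per \<omega> Y0 \<Longrightarrow> has_weak_grad_y \<omega> Y0 v (weak_grad_y \<omega> Y0 v)"
  unfolding meas_H1_per_def weak_grad_y_def by (simp add: someI_ex)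

lemma has_weak_grad_yD:
  assumes "has_weak_grad_y \<omega> Y0 v G"
  shows "(\<lambda>z. G (fst z) (snd z)) \<in> borel_measurable (lebesgue_on (\<omega> \<times> Y0))"
    "AE x in lebesgue_on \<omega>. has_weak_grad Y0 (v x) (G x)"
  using assms by (auto simp: has_weak_grad_y_def case_prod_unfold)

text \<open>Uniqueness on slices, lifted to the product by the joint measurability of both
  gradients.\<close>

lemma has_weak_grad_y_unique:
  assumes G: "has_weak_grad_y \<omega> Y0 v G" and H: "has_weak_grad_y \<omega> Y0 v H"
  shows "AE z in lebesgue_on (\<omega> \<times> Y0). G (fst z) (snd z) = H (fst z) (snd z)"
proof -
  have m: "(\<lambda>z. G (fst z) (snd z) - H (fst z) (snd z)) \<in> borel_measurable (lebesgue_on (\<omega> \<times> Y0))"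
    using has_weak_grad_yD(1)[OF G] has_weak_grad_yD(1)[OF H] by simp
  have "AE x in lebesgue_on \<omega>. AE y in lebesgue_on Y0. G (fst (x, y)) (snd (x, y)) - H (fst (x, y)) (snd (x, y)) = 0"
    using has_weak_grad_yD(2)[OF G] has_weak_grad_yD(2)[OF H]
  proof eventually_elim
    case (elim x)
    from has_weak_grad_unique[OF Y(1) unfolded_sets(6) elim] show ?case by eventually_elim simp
  qed
  from AE_lebesgue_on_prodI[OF unfolded_sets(1,4) m this] show ?thesis by eventually_elim simp
qed

text \<open>\<open>strain\<close> picks a gradient for each slice separately,
  \<open>strain_y\<close> one jointly measurable gradient for the family. Test functions in the
  corrector equations and Korn's inequality use the former, the energy on the product uses the
  latter.\<close>

lemma strain_y_AE_strain:
  assumes v: "v \<in> meas_H1_per \<omega> Y0"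
  shows "AE x in lebesgue_on \<omega>. AE y in lebesgue_on Y0. strain Y0 (v x) y = strain_y \<omega> Y0 v x y"
  using has_weak_grad_yD(2)[OF has_weak_grad_y_weak_grad_y[OF v]]
proof eventually_elim
  case (elim x)
  from strain_AE[OF Y(1) unfolded_sets(6) elim] show ?case by eventually_elim (simp add: strain_y_def)
qed

lemma norm_H1_sq:
  assumes "has_weak_grad Y0 u G"
  shows "(norm_H1 Y0 u)\<^sup>2 = (LINT y|lebesgue_on Y0. (norm (u y))\<^sup>2) + (LINT y|lebesgue_on Y0. (norm (G y))\<^sup>2)"
proof -
  have H: "u \<in> H1 Y0" using assms by (auto simp: H1_def)
  have "(LINT y|lebesgue_on Y0. (norm (weak_grad Y0 u y))\<^sup>2) = (LINT y|lebesgue_on Y0. (norm (G y))\<^sup>2)"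
  proof (rule integral_cong_AE)
    show "(\<lambda>y. (norm (weak_grad Y0 u y))\<^sup>2) \<in> borel_measurable (lebesgue_on Y0)"
      using L2D(1)[OF has_weak_gradD(2)[OF has_weak_grad_weak_grad[OF H]]] by simp
    show "(\<lambda>y. (norm (G y))\<^sup>2) \<in> borel_measurable (lebesgue_on Y0)" using L2D(1)[OF has_weak_gradD(2)[OF assms]] by simp
    show "AE y in lebesgue_on Y0. (norm (weak_grad Y0 u y))\<^sup>2 = (norm (G y))\<^sup>2"
      using weak_grad_AE[OF Y(1) unfolded_sets(6) assms] by eventually_elim simp
  qed
  thus ?thesis by (simp add: norm_H1_def norm_L2_def)
qed

text \<open>\<open>norm_H1\<close> involves a gradient chosen slice by slice; measurability comes
  from the joint gradient, which gives the same norm for almost every \<open>x\<close>.\<close>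

lemma norm_H1_measurable:
  assumes v: "v \<in> meas_H1_per \<omega> Y0"
  shows "(\<lambda>x. (norm_H1 Y0 (v x))\<^sup>2) \<in> borel_measurable (lebesgue_on \<omega>)"
proof -
  let ?G = "weak_grad_y \<omega> Y0 v"
  note G = has_weak_grad_y_weak_grad_y[OF v]
  have vm: "(\<lambda>z. v (fst z) (snd z)) \<in> borel_measurable (lebesgue_on (\<omega> \<times> Y0))"
    using v by (simp add: meas_H1_per_def case_prod_unfold)
  have 1: "(\<lambda>x. LINT y|lebesgue_on Y0. (norm (v x y))\<^sup>2) \<in> borel_measurable (lebesgue_on \<omega>)"
    using measurable_marginal[OF unfolded_sets(1,4), of "\<lambda>z. (norm (v (fst z) (snd z)))\<^sup>2"] vm by simp
  have 2: "(\<lambda>x. LINT y|lebesgue_on Y0. (norm (?G x y))\<^sup>2) \<in> borel_measurable (lebesgue_on \<omega>)"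
    using measurable_marginal[OF unfolded_sets(1,4), of "\<lambda>z. (norm (?G (fst z) (snd z)))\<^sup>2"] has_weak_grad_yD(1)[OF G] by simp
  have ae: "AE x in lebesgue_on \<omega>. (LINT y|lebesgue_on Y0. (norm (v x y))\<^sup>2) + (LINT y|lebesgue_on Y0. (norm (?G x y))\<^sup>2) = (norm_H1 Y0 (v x))\<^sup>2"
    using has_weak_grad_yD(2)[OF G] by eventually_elim (simp add: norm_H1_sq)
  show ?thesis by (rule borel_measurable_lebesgue_on_AE[OF borel_measurable_add[OF 1 2] ae unfolded_sets(2)])
qed

lemma weak_grad_y_L2:
  assumes v: "v \<in> L2_H1_per \<omega> Y0"
  shows "(\<lambda>z. weak_grad_y \<omega> Y0 v (fst z) (snd z)) \<in> L2 (\<omega> \<times> Y0)"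
proof -
  let ?G = "weak_grad_y \<omega> Y0 v"
  have vm: "v \<in> meas_H1_per \<omega> Y0" and vi: "integrable (lebesgue_on \<omega>) (\<lambda>x. (norm_H1 Y0 (v x))\<^sup>2)"
    using v by (auto simp: L2_H1_per_def)
  note G = has_weak_grad_yD[OF has_weak_grad_y_weak_grad_y[OF vm]]
  have m: "(\<lambda>z. (norm (?G (fst z) (snd z)))\<^sup>2) \<in> borel_measurable (lebesgue_on (\<omega> \<times> Y0))" using G(1) by simp
  have "integrable (lebesgue_on (\<omega> \<times> Y0)) (\<lambda>z. (norm (?G (fst z) (snd z)))\<^sup>2)"
  proof (rule Tonelli_lebesgue_on[OF unfolded_sets(1,4) m])
    show "AE x in lebesgue_on \<omega>. integrable (lebesgue_on Y0) (\<lambda>y. (norm (?G (fst (x, y)) (snd (x, y))))\<^sup>2)"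
      using G(2) by eventually_elim (auto dest!: has_weak_gradD(2) L2D(2))
    show "integrable (lebesgue_on \<omega>) (\<lambda>x. LINT y|lebesgue_on Y0. norm ((norm (?G (fst (x, y)) (snd (x, y))))\<^sup>2))"
    proof (rule Bochner_Integration.integrable_bound[OF vi])
      show "(\<lambda>x. LINT y|lebesgue_on Y0. norm ((norm (?G (fst (x, y)) (snd (x, y))))\<^sup>2)) \<in> borel_measurable (lebesgue_on \<omega>)"
        using measurable_marginal[OF unfolded_sets(1,4) m] by simp
      show "AE x in lebesgue_on \<omega>. norm (LINT y|lebesgue_on Y0. norm ((norm (?G (fst (x, y)) (snd (x, y))))\<^sup>2)) \<le> norm ((norm_H1 Y0 (v x))\<^sup>2)"
        using G(2) by eventually_elim (simp add: norm_H1_sq)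
    qed
  qed
  thus ?thesis using G(1) by (simp add: L2_def)
qed

lemma strain_y_L2:
  assumes v: "v \<in> L2_H1_per \<omega> Y0"
  shows "(\<lambda>z. strain_y \<omega> Y0 v (fst z) (snd z)) \<in> L2 (\<omega> \<times> Y0)"
  using L2_sym_part[OF weak_grad_y_L2[OF v]] by (simp add: strain_y_def)

text \<open>The coefficients do not depend on \<open>y\<close>, so on each slice the combination has
  constant coefficients, and \<open>G\<close> collects the joint gradients.\<close>

lemma meas_H1_per_comb:
  fixes k :: real
  assumes v: "v \<in> meas_H1_per \<omega> Y0" and X: "\<And>i::3. X i \<in> meas_H1_per \<omega> Y0"
    and c: "c \<in> borel_measurable (lebesgue_on \<omega>)" and h: "h \<in> borel_measurable (lebesgue_on \<omega>)"
  defines "w \<equiv> \<lambda>x y. c x + k *\<^sub>R v x y + (\<Sum>i\<in>UNIV. (h x $ i) *\<^sub>R X i x y)"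
    and "G \<equiv> \<lambda>x y. k *\<^sub>R weak_grad_y \<omega> Y0 v x y + (\<Sum>i\<in>UNIV. (h x $ i) *\<^sub>R weak_grad_y \<omega> Y0 (X i) x y)"
  shows "has_weak_grad_y \<omega> Y0 w G" "w \<in> meas_H1_per \<omega> Y0"
    "AE z in lebesgue_on (\<omega> \<times> Y0). strain_y \<omega> Y0 w (fst z) (snd z) =
       k *\<^sub>R strain_y \<omega> Y0 v (fst z) (snd z) + (\<Sum>i\<in>UNIV. (h (fst z) $ i) *\<^sub>R strain_y \<omega> Y0 (X i) (fst z) (snd z))"
proof -
  note Gv = has_weak_grad_yD[OF has_weak_grad_y_weak_grad_y[OF v]]
  note GX = has_weak_grad_yD[OF has_weak_grad_y_weak_grad_y[OF X]]
  have hm: "(\<lambda>z. h (fst z) $ i) \<in> borel_measurable (lebesgue_on (\<omega> \<times> Y0))" for i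
    by (intro borel_measurable_vec_nth measurable_lebesgue_on_fst[OF unfolded_sets(1,4) h])
  have cm: "(\<lambda>z. c (fst z)) \<in> borel_measurable (lebesgue_on (\<omega> \<times> Y0))"
    by (intro measurable_lebesgue_on_fst[OF unfolded_sets(1,4) c])
  have vm: "(\<lambda>z. v (fst z) (snd z)) \<in> borel_measurable (lebesgue_on (\<omega> \<times> Y0))"
    and Xm: "(\<lambda>z. X i (fst z) (snd z)) \<in> borel_measurable (lebesgue_on (\<omega> \<times> Y0))" for i
    using v X[of i] by (simp_all add: meas_H1_per_def case_prod_unfold)
  have wm: "(\<lambda>z. w (fst z) (snd z)) \<in> borel_measurable (lebesgue_on (\<omega> \<times> Y0))"
    unfolding w_def using cm vm Xm hm
    by (intro borel_measurable_add borel_measurable_scaleR borel_measurable_sum borel_measurable_const) auto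
  have Gm: "(\<lambda>z. G (fst z) (snd z)) \<in> borel_measurable (lebesgue_on (\<omega> \<times> Y0))"
    unfolding G_def using Gv(1) GX(1) hm
    by (intro borel_measurable_add borel_measurable_scaleR borel_measurable_sum borel_measurable_const) auto
  have GXall: "AE x in lebesgue_on \<omega>. \<forall>i. has_weak_grad Y0 (X i x) (weak_grad_y \<omega> Y0 (X i) x)"
    unfolding AE_all_countable using GX(2) by blast
  have "AE x in lebesgue_on \<omega>. has_weak_grad Y0 (w x) (G x)"
    using Gv(2) GXall
  proof eventually_elim
    case (elim x)
    show ?case unfolding w_def G_def by (rule has_weak_grad_comb[OF unfolded_sets(6) elim(1)]) (use elim(2) in auto)
  qed
  thus wG: "has_weak_grad_y \<omega> Y0 w G" using Gm by (simp add: has_weak_grad_y_def case_prod_unfold)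
  have "AE x in lebesgue_on \<omega>. v x \<in> H1_per Y0" using v by (simp add: meas_H1_per_def)
  moreover have "AE x in lebesgue_on \<omega>. \<forall>i. X i x \<in> H1_per Y0"
    unfolding AE_all_countable using X by (simp add: meas_H1_per_def)
  ultimately have "AE x in lebesgue_on \<omega>. w x \<in> H1_per Y0"
  proof eventually_elim
    case (elim x)
    show ?case unfolding w_def by (rule H1_per_comb[OF unfolded_sets(6) elim(1)]) (use elim(2) in auto)
  qed
  thus wM: "w \<in> meas_H1_per \<omega> Y0" using wm wG unfolding meas_H1_per_def by (auto simp: case_prod_unfold)
  have sum_sym: "sym_part (\<Sum>i\<in>I. a i *\<^sub>R M i) = (\<Sum>i\<in>I. a i *\<^sub>R sym_part (M i))" if "finite I" for I :: "3 set" and a M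
    using that
  proof induction
    case empty
    show ?case by (simp add: sym_part_def transpose_def vec_eq_iff)
  next
    case (insert j I)
    thus ?case using sym_part_lincomb[of "a j" "M j" 1 "\<Sum>i\<in>I. a i *\<^sub>R M i"] by simp
  qed
  show "AE z in lebesgue_on (\<omega> \<times> Y0). strain_y \<omega> Y0 w (fst z) (snd z) =
       k *\<^sub>R strain_y \<omega> Y0 v (fst z) (snd z) + (\<Sum>i\<in>UNIV. (h (fst z) $ i) *\<^sub>R strain_y \<omega> Y0 (X i) (fst z) (snd z))"
    using has_weak_grad_y_unique[OF has_weak_grad_y_weak_grad_y[OF wM] wG]
  proof eventually_elim
    case (elim z)
    show ?case unfolding strain_y_def elim unfolding G_def
      using sym_part_lincomb[of k "weak_grad_y \<omega> Y0 v (fst z) (snd z)" 1 "\<Sum>i\<in>UNIV. (h (fst z) $ i) *\<^sub>R weak_grad_y \<omega> Y0 (X i) (fst z) (snd z)"]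
      by (simp add: sum_sym)
  qed
qed

text \<open>A square integrable coefficient times a field whose H1 norm is bounded uniformly in
  \<open>x\<close> is square integrable with values in H1. This explains the asymmetry between
  \<open>v\<close> and the fields \<open>X i\<close> in the hypotheses.\<close>

lemma L2_H1_per_comb:
  assumes v: "v \<in> L2_H1_per \<omega> Y0" and X: "\<And>i::3. X i \<in> Linf_H1_per \<omega> Y0"
    and c: "c \<in> L2 \<omega>" and h: "h \<in> L2 \<omega>"
  shows "(\<lambda>x y. c x + k *\<^sub>R v x y + (\<Sum>i\<in>UNIV. (h x $ i) *\<^sub>R X i x y)) \<in> L2_H1_per \<omega> Y0" (is "?w \<in> _")
proof -
  have vm: "v \<in> meas_H1_per \<omega> Y0" and vi: "integrable (lebesgue_on \<omega>) (\<lambda>x. (norm_H1 Y0 (v x))\<^sup>2)"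
    using v by (auto simp: L2_H1_per_def)
  have Xm: "X i \<in> meas_H1_per \<omega> Y0" for i using X by (simp add: Linf_H1_per_def)
  obtain C where C: "\<And>i. AE x in lebesgue_on \<omega>. norm_H1 Y0 (X i x) \<le> C i"
    using X unfolding Linf_H1_per_def mem_Collect_eq by metis
  note W = meas_H1_per_comb[where v=v and X=X and c=c and h=h and k=k, OF vm Xm L2D(1)[OF c] L2D(1)[OF h]]
  let ?Gv = "weak_grad_y \<omega> Y0 v" and ?GX = "\<lambda>i. weak_grad_y \<omega> Y0 (X i)"
  define m where "m = measure lebesgue Y0"
  have m0: "0 \<le> m" by (simp add: m_def)
  \<comment> \<open>Obtained by integrating the pointwise bounds \<open>A\<close> and
    \<open>B\<close> below over the cell and replacing the norms of the correctors by
    \<open>C i\<close>.\<close>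
  define bd where "bd x = 16 * (m * (norm (c x))\<^sup>2 + k\<^sup>2 * (norm_H1 Y0 (v x))\<^sup>2 + (\<Sum>i\<in>UNIV. (norm (h x $ i))\<^sup>2 * (C i)\<^sup>2))" for x
  have "integrable (lebesgue_on \<omega>) (\<lambda>x. (norm_H1 Y0 (?w x))\<^sup>2)"
  proof (rule Bochner_Integration.integrable_bound)
    show "integrable (lebesgue_on \<omega>) bd" unfolding bd_def
      by (intro integrable_mult_right Bochner_Integration.integrable_add Bochner_Integration.integrable_sum integrable_mult_left
            L2D(2) c vi L2_vec_nth h)
    show "(\<lambda>x. (norm_H1 Y0 (?w x))\<^sup>2) \<in> borel_measurable (lebesgue_on \<omega>)" by (rule norm_H1_measurable[OF W(2)])
    have "AE x in lebesgue_on \<omega>. \<forall>i. has_weak_grad Y0 (X i x) (?GX i x) \<and> norm_H1 Y0 (X i x) \<le> C i"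
      unfolding AE_all_countable AE_conj_iff using C has_weak_grad_yD(2)[OF has_weak_grad_y_weak_grad_y[OF Xm]] by blast
    with has_weak_grad_yD(2)[OF has_weak_grad_y_weak_grad_y[OF vm]] has_weak_grad_yD(2)[OF W(1)]
    show "AE x in lebesgue_on \<omega>. norm ((norm_H1 Y0 (?w x))\<^sup>2) \<le> norm (bd x)"
    proof eventually_elim
      case (elim x)
      have L: "v x \<in> L2 Y0" "?Gv x \<in> L2 Y0" "X i x \<in> L2 Y0" "?GX i x \<in> L2 Y0" for i
        using elim(1,3) has_weak_gradD by blast+
      define A where "A y = 16 * ((norm (c x))\<^sup>2 + k\<^sup>2 * (norm (v x y))\<^sup>2 + (\<Sum>i\<in>UNIV. (norm (h x $ i))\<^sup>2 * (norm (X i x y))\<^sup>2))" for y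
      define B where "B y = 16 * (k\<^sup>2 * (norm (?Gv x y))\<^sup>2 + (\<Sum>i\<in>UNIV. (norm (h x $ i))\<^sup>2 * (norm (?GX i x y))\<^sup>2))" for y
      note ii = L2D(2)[OF L(1)] L2D(2)[OF L(2)] L2D(2)[OF L(3)] L2D(2)[OF L(4)]
      have Ai: "integrable (lebesgue_on Y0) A" unfolding A_def
        by (intro integrable_mult_right Bochner_Integration.integrable_add Bochner_Integration.integrable_sum ii
            integrable_const_lebesgue_on unfolded_sets)
      have Bi: "integrable (lebesgue_on Y0) B" unfolding B_def
        by (intro integrable_mult_right Bochner_Integration.integrable_add Bochner_Integration.integrable_sum ii)
      have IA: "(LINT y|lebesgue_on Y0. A y) = 16 * (m * (norm (c x))\<^sup>2 + k\<^sup>2 * (LINT y|lebesgue_on Y0. (norm (v x y))\<^sup>2)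
          + (\<Sum>i\<in>UNIV. (norm (h x $ i))\<^sup>2 * (LINT y|lebesgue_on Y0. (norm (X i x y))\<^sup>2)))"
      proof -
        have i1: "integrable (lebesgue_on Y0) (\<lambda>y. (norm (c x))\<^sup>2)" by (rule integrable_const_lebesgue_on[OF unfolded_sets(6)])
        have i2: "integrable (lebesgue_on Y0) (\<lambda>y. k\<^sup>2 * (norm (v x y))\<^sup>2)" using ii(1) by simp
        have i3: "integrable (lebesgue_on Y0) (\<lambda>y. (norm (h x $ i))\<^sup>2 * (norm (X i x y))\<^sup>2)" for i using ii(3) by simp
        have i4: "integrable (lebesgue_on Y0) (\<lambda>y. \<Sum>i\<in>UNIV. (norm (h x $ i))\<^sup>2 * (norm (X i x y))\<^sup>2)"
          by (intro Bochner_Integration.integrable_sum i3)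
        show ?thesis
          unfolding A_def integral_mult_right_zero Bochner_Integration.integral_add[OF Bochner_Integration.integrable_add[OF i1 i2] i4]
            Bochner_Integration.integral_add[OF i1 i2] Bochner_Integration.integral_sum[OF i3]
          using unfolded_sets by (simp add: measure_restrict_space m_def)
      qed
      have IB: "(LINT y|lebesgue_on Y0. B y) = 16 * (k\<^sup>2 * (LINT y|lebesgue_on Y0. (norm (?Gv x y))\<^sup>2)
          + (\<Sum>i\<in>UNIV. (norm (h x $ i))\<^sup>2 * (LINT y|lebesgue_on Y0. (norm (?GX i x y))\<^sup>2)))"
        unfolding B_def using ii by (simp del: norm_real)
      have nX: "(norm_H1 Y0 (X i x))\<^sup>2 = (LINT y|lebesgue_on Y0. (norm (X i x y))\<^sup>2) + (LINT y|lebesgue_on Y0. (norm (?GX i x y))\<^sup>2)" for i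
        using elim(3) by (intro norm_H1_sq) blast
      have "(LINT y|lebesgue_on Y0. (norm (?w x y))\<^sup>2) \<le> (LINT y|lebesgue_on Y0. A y)"
      proof (rule integral_mono'[OF Ai])
        fix y
        show "(norm (?w x y))\<^sup>2 \<le> A y" unfolding A_def
          using norm_sq_sum5[of "c x" "k *\<^sub>R v x y" "\<lambda>i. (h x $ i) *\<^sub>R X i x y"] by (simp add: power_mult_distrib)
      qed (auto simp: A_def sum_nonneg)
      moreover have "(LINT y|lebesgue_on Y0. (norm (k *\<^sub>R ?Gv x y + (\<Sum>i\<in>UNIV. (h x $ i) *\<^sub>R ?GX i x y)))\<^sup>2) \<le> (LINT y|lebesgue_on Y0. B y)"
      proof (rule integral_mono'[OF Bi])
        fix y
        show "(norm (k *\<^sub>R ?Gv x y + (\<Sum>i\<in>UNIV. (h x $ i) *\<^sub>R ?GX i x y)))\<^sup>2 \<le> B y" unfolding B_def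
          using norm_sq_sum5[of 0 "k *\<^sub>R ?Gv x y" "\<lambda>i. (h x $ i) *\<^sub>R ?GX i x y"] by (simp add: power_mult_distrib)
      qed (auto simp: B_def sum_nonneg)
      ultimately have "(norm_H1 Y0 (?w x))\<^sup>2 \<le> (LINT y|lebesgue_on Y0. A y) + (LINT y|lebesgue_on Y0. B y)"
        unfolding norm_H1_sq[OF elim(2)] by linarith
      also have "\<dots> = 16 * (m * (norm (c x))\<^sup>2 + k\<^sup>2 * (norm_H1 Y0 (v x))\<^sup>2 + (\<Sum>i\<in>UNIV. (norm (h x $ i))\<^sup>2 * (norm_H1 Y0 (X i x))\<^sup>2))"
        unfolding IA IB norm_H1_sq[OF elim(1)] nX by (simp add: distrib_left sum.distrib)
      also have "\<dots> \<le> bd x" unfolding bd_def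
        using elim(3) by (intro mult_left_mono add_left_mono sum_mono power_mono) (auto simp: norm_H1_nonneg)
      finally have "(norm_H1 Y0 (?w x))\<^sup>2 \<le> bd x" .
      thus ?case by simp
    qed
  qed
  thus ?thesis using W(2) by (simp add: L2_H1_per_def)
qed

lemma Linf_H1_per_L2: "X \<in> Linf_H1_per \<omega> Y0 \<Longrightarrow> X \<in> L2_H1_per \<omega> Y0"
proof -
  assume X: "X \<in> Linf_H1_per \<omega> Y0"
  then obtain C where C: "AE x in lebesgue_on \<omega>. norm_H1 Y0 (X x) \<le> C" and m: "X \<in> meas_H1_per \<omega> Y0"
    by (auto simp: Linf_H1_per_def)
  have "integrable (lebesgue_on \<omega>) (\<lambda>x. (norm_H1 Y0 (X x))\<^sup>2)"
  proof (rule Bochner_Integration.integrable_bound[OF integrable_const_lebesgue_on[OF unfolded_sets(3)] norm_H1_measurable[OF m]])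
    show "AE x in lebesgue_on \<omega>. norm ((norm_H1 Y0 (X x))\<^sup>2) \<le> norm (C\<^sup>2)"
      using C by eventually_elim (simp add: power_mono norm_H1_nonneg)
  qed
  thus "X \<in> L2_H1_per \<omega> Y0" using m by (simp add: L2_H1_per_def)
qed

end

section \<open>The transmission problem\<close>

lemma L2_cong_AE:
  fixes u v :: "'a::euclidean_space \<Rightarrow> 'b::euclidean_space"
  assumes "u \<in> L2 U" "AE x in lebesgue_on U. u x = v x" "U \<in> sets lebesgue"
  shows "v \<in> L2 U"
  by (rule L2_dominated[OF borel_measurable_lebesgue_on_AE[OF L2D(1)[OF assms(1)] assms(2,3)] L2D(2)[OF assms(1)]])
     (use assms(2) in \<open>auto elim!: eventually_mono\<close>)

text \<open>\<open>trace_at\<close> is a definite description; existence from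
  \<open>cylinder_traces\<close> and uniqueness at points of the closure identify it almost
  everywhere.\<close>

lemma trace_cylinder:
  assumes \<omega>: "open \<omega>" "bounded \<omega>" and AB: "A < B" "h \<in> {A, B}" and u: "u \<in> H1 (cylinder \<omega> {A<..<B})"
  defines "\<tau> \<equiv> \<lambda>x. trace_at (cylinder \<omega> {A<..<B}) u (pt3 x h)"
  shows "\<tau> \<in> L2 \<omega>" "AE x in lebesgue_on \<omega>. has_trace (cylinder \<omega> {A<..<B}) u (pt3 x h) (\<tau> x)"
proof -
  let ?U = "cylinder \<omega> {A<..<B}"
  have U: "open ?U" "?U \<in> lmeasurable" using \<omega> open_cylinder lmeasurable_cylinder by auto
  have \<omega>s: "\<omega> \<in> sets lebesgue" using \<omega> by auto
  obtain G where G: "has_weak_grad ?U u G" using u by (auto simp: H1_def)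
  obtain c where c: "c \<in> L2 \<omega>" "AE x in lebesgue_on \<omega>. has_trace ?U u (pt3 x h) (c x)"
  proof (rule cylinder_traces[OF \<omega> AB(1) G])
    fix cA cB assume "cA \<in> L2 \<omega>" "cB \<in> L2 \<omega>"
      and *: "AE x in lebesgue_on \<omega>. has_trace ?U u (pt3 x A) (cA x) \<and> has_trace ?U u (pt3 x B) (cB x)"
    show ?thesis
    proof (cases "h = A")
      case True
      show ?thesis by (rule that[OF \<open>cA \<in> L2 \<omega>\<close>]) (use * True in \<open>auto elim!: eventually_mono\<close>)
    next
      case False
      hence "h = B" using AB by auto
      show ?thesis by (rule that[OF \<open>cB \<in> L2 \<omega>\<close>]) (use * \<open>h = B\<close> in \<open>auto elim!: eventually_mono\<close>)
    qed
  qed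
  have eq: "AE x in lebesgue_on \<omega>. c x = \<tau> x"
    using c(2) AE_space
  proof eventually_elim
    case (elim x)
    show ?case unfolding \<tau>_def
      by (rule trace_at_eq[OF U(1) pt3_in_closure_cylinder[OF _ AB] H1_integrable[OF U(2) u] elim(1), symmetric]) (use elim in simp)
  qed
  show "\<tau> \<in> L2 \<omega>" by (rule L2_cong_AE[OF c(1) eq \<omega>s])
  show "AE x in lebesgue_on \<omega>. has_trace ?U u (pt3 x h) (\<tau> x)"
    using c(2) eq by eventually_elim simp
qed

lemma trace_at_diff:
  assumes \<omega>: "open \<omega>" "bounded \<omega>" and AB: "A < B" "h \<in> {A, B}"
    and u: "u \<in> H1 (cylinder \<omega> {A<..<B})" and v: "v \<in> H1 (cylinder \<omega> {A<..<B})"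
  shows "AE x in lebesgue_on \<omega>. trace_at (cylinder \<omega> {A<..<B}) (\<lambda>y. u y - v y) (pt3 x h) =
     trace_at (cylinder \<omega> {A<..<B}) u (pt3 x h) - trace_at (cylinder \<omega> {A<..<B}) v (pt3 x h)"
  using trace_cylinder(2)[OF \<omega> AB u] trace_cylinder(2)[OF \<omega> AB v] AE_space
proof eventually_elim
  case (elim x)
  let ?U = "cylinder \<omega> {A<..<B}"
  have U: "open ?U" "?U \<in> lmeasurable" "?U \<in> sets lebesgue" using \<omega> open_cylinder lmeasurable_cylinder by auto
  note ui = H1_integrable[OF U(2) u] and vi = H1_integrable[OF U(2) v]
  have "has_trace ?U (\<lambda>y. u y - v y) (pt3 x h) (trace_at ?U u (pt3 x h) - trace_at ?U v (pt3 x h))"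
    using has_trace_lincomb[OF U(3) ui vi elim(1,2), of 1 "-1"] by simp
  thus ?case
    by (intro trace_at_eq[OF U(1) pt3_in_closure_cylinder[OF _ AB]]) (use elim ui vi in auto)
qed

lemma H1_diff: "U \<in> lmeasurable \<Longrightarrow> u \<in> H1 U \<Longrightarrow> v \<in> H1 U \<Longrightarrow> (\<lambda>x. u x - v x) \<in> H1 U"
  using H1_lincomb[of U u v 1 "-1"] by simp

lemma H1_zero_on_diff:
  assumes U: "U \<in> lmeasurable" and u: "u \<in> H1_zero_on \<Gamma> U" and v: "v \<in> H1_zero_on \<Gamma> U"
  shows "(\<lambda>x. u x - v x) \<in> H1_zero_on \<Gamma> U"
proof -
  have H: "u \<in> H1 U" "v \<in> H1 U" and z: "surface_measure {p \<in> \<Gamma>. \<not> has_trace U u p 0} = 0" "surface_measure {p \<in> \<Gamma>. \<not> has_trace U v p 0} = 0"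
    using u v by (auto simp: H1_zero_on_def)
  have "has_trace U (\<lambda>x. u x - v x) p 0" if "has_trace U u p 0" "has_trace U v p 0" for p
    using has_trace_lincomb[OF fmeasurableD[OF U] H1_integrable[OF U H(1)] H1_integrable[OF U H(2)] that, of 1 "-1"] by simp
  hence "{p \<in> \<Gamma>. \<not> has_trace U (\<lambda>x. u x - v x) p 0} \<subseteq> {p \<in> \<Gamma>. \<not> has_trace U u p 0} \<union> {p \<in> \<Gamma>. \<not> has_trace U v p 0}" by blast
  from surface_measure_subset_zero[OF this surface_measure_Un_zero[OF z]] H1_diff[OF U H]
  show ?thesis by (simp add: H1_zero_on_def)
qed

lemma H1_zero_on_zero: "U \<in> lmeasurable \<Longrightarrow> (\<lambda>x. 0) \<in> H1_zero_on \<Gamma> U"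
  using has_weak_grad_const[of U 0]
  by (auto simp: H1_zero_on_def H1_def has_trace_const surface_measure_empty)

lemma sym_part_zero: "sym_part 0 = 0"
  by (simp add: sym_part_def transpose_def vec_eq_iff)

text \<open>The gradient of the zero function is a chosen representative, so it is known to vanish
  only almost everywhere.\<close>

lemma energy_zero:
  assumes "open U" "U \<in> lmeasurable"
  shows "energy U a u (\<lambda>x. 0) = 0"
proof -
  have "AE x in lebesgue_on U. tens (a x) (strain U u x) \<bullet> strain U (\<lambda>x. 0) x = 0"
    using strain_AE[OF assms has_weak_grad_const[OF assms(2), of 0]]
    by eventually_elim (simp add: sym_part_zero)
  thus ?thesis unfolding energy_def by (rule integral_eq_zero_AE)
qed

lemma energy_diff_left:
  assumes U: "open U" "U \<in> lmeasurable" and a: "a \<in> Linf U" and H: "u \<in> H1 U" "v \<in> H1 U" "w \<in> H1 U"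
  shows "energy U a (\<lambda>x. u x - v x) w = energy U a u w - energy U a v w"
proof -
  have i: "integrable (lebesgue_on U) (\<lambda>x. tens (a x) (strain U z x) \<bullet> strain U w x)" if "z \<in> H1 U" for z
    by (intro tens_L2_integrable a strain_L2 that H)
  have d: "(\<lambda>x. u x - v x) \<in> H1 U" by (rule H1_diff[OF U(2) H(1,2)])
  have "AE x in lebesgue_on U. strain U (\<lambda>x. u x - v x) x = strain U u x - strain U v x"
    using strain_lincomb[OF U H(1,2), of 1 "-1"] by simp
  hence ae: "AE x in lebesgue_on U. tens (a x) (strain U (\<lambda>x. u x - v x) x) \<bullet> strain U w x
     = tens (a x) (strain U u x) \<bullet> strain U w x - tens (a x) (strain U v x) \<bullet> strain U w x"
    by eventually_elim (simp add: tens_lin inner_diff_left)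
  have "energy U a (\<lambda>x. u x - v x) w = (LINT x|lebesgue_on U. tens (a x) (strain U u x) \<bullet> strain U w x - tens (a x) (strain U v x) \<bullet> strain U w x)"
    unfolding energy_def
    by (rule integral_cong_AE[OF _ _ ae]) (use i[OF d] i[OF H(1)] i[OF H(2)] in auto)
  thus ?thesis unfolding energy_def using i[OF H(1)] i[OF H(2)] by simp
qed

section \<open>Standing assumptions, lifts of interface values, orthogonality to the
  correctors\<close>

context
  fixes \<omega> :: "(real^2) set" and L \<alpha> :: real and \<Gamma> Y0 :: "(real^3) set" and f :: "real^3 \<Rightarrow> real^3"
    and ab aa :: "real^3 \<Rightarrow> real^3^3^3^3" and aM :: "real^2 \<Rightarrow> real^3 \<Rightarrow> real^3^3^3^3"
    and X :: "3 \<Rightarrow> real^2 \<Rightarrow> real^3 \<Rightarrow> real^3"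
  assumes \<omega>: "open \<omega>" "bounded \<omega>" and \<omega>c: "connected \<omega>" "\<omega> \<noteq> {}" and L: "L > 0"
    and \<Gamma>: "\<Gamma> \<subseteq> frontier (cylinder \<omega> {-L<..<0})" "surface_measure \<Gamma> > 0"
    and Y: "open Y0" "bounded Y0"
    and faces: "\<forall>z\<in>unit_square. pt3 z 0 \<in> closure Y0 \<and> pt3 z 1 \<in> closure Y0"
    and korn: "korn_domain Y0" and \<alpha>: "\<alpha> > 0"
    and ab: "elasticity_tensor \<alpha> (cylinder \<omega> {-L<..<0}) ab"
    and aa: "elasticity_tensor \<alpha> (cylinder \<omega> {0<..<L}) aa"
    and aM: "elasticity_tensor \<alpha> (\<omega> \<times> Y0) (\<lambda>(x', y). aM x' y)"
    and corr: "correctors \<omega> Y0 aM X"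
begin

abbreviation (input) "Ub \<equiv> cylinder \<omega> {-L<..<0}"
abbreviation (input) "Ua \<equiv> cylinder \<omega> {0<..<L}"
abbreviation (input) "trb v x \<equiv> trace_at Ub v (pt3 x 0)"
abbreviation (input) "tra v x \<equiv> trace_at Ua v (pt3 x 0)"
abbreviation (input) "jump va vb x \<equiv> tra va x - trb vb x"
abbreviation (input) "eX i x y \<equiv> strain_y \<omega> Y0 (X i) x y"
abbreviation (input) "SX h z \<equiv> (\<Sum>i\<in>UNIV. (h (fst z) $ i) *\<^sub>R eX i (fst z) (snd z))"
abbreviation (input) "H \<equiv> interface_matrix \<omega> Y0 aM X"

lemma face:
  assumes "z \<in> unit_square"
  shows "pt3 z 0 \<in> closure Y0" "pt3 z 1 \<in> closure Y0"
  using faces assms by blast+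

lemmas unf = unfolded_sets[OF \<omega> Y]

lemma sq: "open unit_square" "unit_square \<noteq> {}" "unit_square \<in> sets borel"
proof -
  have eq: "unit_square = box 0 1" by (auto simp: mem_box_cart)
  show "open unit_square" unfolding eq by (rule open_box)
  thus "unit_square \<in> sets borel" by simp
  have "(\<chi> i. 1/2) \<in> unit_square" by simp
  thus "unit_square \<noteq> {}" by blast
qed

lemma cyl: "open Ub" "Ub \<in> lmeasurable" "open Ua" "Ua \<in> lmeasurable"
  using \<omega> open_cylinder lmeasurable_cylinder by auto

lemma X_Linf: "X i \<in> Linf_H1_per \<omega> Y0" and X_meas: "X i \<in> meas_H1_per \<omega> Y0" and X_L2: "X i \<in> L2_H1_per \<omega> Y0"
proof -
  show 1: "X i \<in> Linf_H1_per \<omega> Y0" using corr by (simp add: correctors_def)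
  show "X i \<in> L2_H1_per \<omega> Y0" by (rule Linf_H1_per_L2[OF \<omega> Y 1])
  show "X i \<in> meas_H1_per \<omega> Y0" using 1 by (simp add: Linf_H1_per_def)
qed

lemma X_H1: "AE x in lebesgue_on \<omega>. \<forall>i. X i x \<in> H1 Y0"
  unfolding AE_all_countable using X_meas by (auto simp: meas_H1_per_def H1_per_def elim!: eventually_mono)

lemma X_trace: "AE p in lebesgue_on (\<omega> \<times> unit_square). \<forall>i.
    has_trace Y0 (X i (fst p)) (pt3 (snd p) 1) (axis i 1) \<and> has_trace Y0 (X i (fst p)) (pt3 (snd p) 0) 0"
  unfolding AE_all_countable using corr by (simp add: correctors_def case_prod_unfold)

lemma trb_facts:
  assumes "v \<in> H1 Ub"
  shows "trb v \<in> L2 \<omega>" "AE x in lebesgue_on \<omega>. has_trace Ub v (pt3 x 0) (trb v x)"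
  using trace_cylinder[OF \<omega> _ _ assms, of 0] L by auto

lemma tra_facts:
  assumes "v \<in> H1 Ua"
  shows "tra v \<in> L2 \<omega>" "AE x in lebesgue_on \<omega>. has_trace Ua v (pt3 x 0) (tra v x)"
  using trace_cylinder[OF \<omega> _ _ assms, of 0] L by auto

lemma jump_L2: "va \<in> H1 Ua \<Longrightarrow> vb \<in> H1 Ub \<Longrightarrow> (\<lambda>x. jump va vb x) \<in> L2 \<omega>"
  using L2_lincomb[OF tra_facts(1) trb_facts(1), of va vb 1 "-1"] by simp

text \<open>Every corrector has value 0 on the bottom face, and the i-th one has value
  \<open>axis i 1\<close> on the top face; so the sum contributes nothing below and \<open>h\<close>
  above.\<close>

lemma comb_trace:
  assumes vH: "v \<in> L2_H1_per \<omega> Y0" and t: "AE p in lebesgue_on (\<omega> \<times> unit_square). has_trace Y0 (v (fst p)) (pt3 (snd p) 0) (\<beta>0 (fst p)) \<and> has_trace Y0 (v (fst p)) (pt3 (snd p) 1) (\<beta>1 (fst p))"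
  shows "AE p in lebesgue_on (\<omega> \<times> unit_square).
     has_trace Y0 (\<lambda>y. c (fst p) + k *\<^sub>R v (fst p) y + (\<Sum>i\<in>UNIV. (h (fst p) $ i) *\<^sub>R X i (fst p) y)) (pt3 (snd p) 0) (c (fst p) + k *\<^sub>R \<beta>0 (fst p)) \<and>
     has_trace Y0 (\<lambda>y. c (fst p) + k *\<^sub>R v (fst p) y + (\<Sum>i\<in>UNIV. (h (fst p) $ i) *\<^sub>R X i (fst p) y)) (pt3 (snd p) 1) (c (fst p) + k *\<^sub>R \<beta>1 (fst p) + h (fst p))"
proof -
  have "AE x in lebesgue_on \<omega>. v x \<in> H1 Y0" using vH by (auto simp: L2_H1_per_def meas_H1_per_def H1_per_def elim!: eventually_mono)
  from AE_lebesgue_on_fst[OF unf(1) sq(3) this] AE_lebesgue_on_fst[OF unf(1) sq(3) X_H1] X_trace t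
  show ?thesis
  proof eventually_elim
    case (elim p)
    let ?x = "fst p"
    have vi: "integrable (lebesgue_on Y0) (v ?x)" using elim(1) by (rule H1_integrable[OF unf(6)])
    have Xi: "integrable (lebesgue_on Y0) (X i ?x)" for i using elim(2) by (intro H1_integrable[OF unf(6)]) blast
    have e: "(\<Sum>i\<in>UNIV. (h ?x $ i) *\<^sub>R axis i 1) = h ?x" using basis_expansion[of "h ?x"] by (simp add: scalar_mult_eq_scaleR)
    show ?case
    proof
      show "has_trace Y0 (\<lambda>y. c ?x + k *\<^sub>R v ?x y + (\<Sum>i\<in>UNIV. (h ?x $ i) *\<^sub>R X i ?x y)) (pt3 (snd p) 0) (c ?x + k *\<^sub>R \<beta>0 ?x)"
        using has_trace_comb[where f="\<lambda>i. X i ?x" and z="\<lambda>i. 0" and a="\<lambda>i. h ?x $ i" and c="c ?x" and k=k, OF unf(6) vi _ Xi, of "pt3 (snd p) 0" "\<beta>0 ?x"] elim(3,4) by simp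
      show "has_trace Y0 (\<lambda>y. c ?x + k *\<^sub>R v ?x y + (\<Sum>i\<in>UNIV. (h ?x $ i) *\<^sub>R X i ?x y)) (pt3 (snd p) 1) (c ?x + k *\<^sub>R \<beta>1 ?x + h ?x)"
        using has_trace_comb[where f="\<lambda>i. X i ?x" and z="\<lambda>i. axis i 1" and a="\<lambda>i. h ?x $ i" and c="c ?x" and k=k, OF unf(6) vi _ Xi, of "pt3 (snd p) 1" "\<beta>1 ?x"] elim(3,4) by (simp add: e)
    qed
  qed
qed

text \<open>With \<open>c\<close> the trace from below and \<open>h\<close> the jump, this is the
  combination of correctors in the representation formula, its two sums rearranged as
  \<open>c\<close> plus the correctors weighted by the jump. The term with factor 0 brings it into
  the shape of the combination lemmas.\<close>

definition lift :: "(real^2 \<Rightarrow> real^3) \<Rightarrow> (real^2 \<Rightarrow> real^3) \<Rightarrow> real^2 \<Rightarrow> real^3 \<Rightarrow> real^3" where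
  "lift c h = (\<lambda>x y. c x + 0 *\<^sub>R X 1 x y + (\<Sum>i\<in>UNIV. (h x $ i) *\<^sub>R X i x y))"

lemma lift_L2: "c \<in> L2 \<omega> \<Longrightarrow> h \<in> L2 \<omega> \<Longrightarrow> lift c h \<in> L2_H1_per \<omega> Y0"
  unfolding lift_def by (rule L2_H1_per_comb[OF \<omega> Y X_L2]) (use X_Linf in auto)

lemma strain_lift:
  assumes "c \<in> L2 \<omega>" "h \<in> L2 \<omega>"
  shows "AE z in lebesgue_on (\<omega> \<times> Y0). strain_y \<omega> Y0 (lift c h) (fst z) (snd z) = SX h z"
  using meas_H1_per_comb(3)[where X=X and v="X 1" and c=c and h=h and k=0, OF \<omega> Y X_meas X_meas L2D(1)[OF assms(1)] L2D(1)[OF assms(2)]]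
  unfolding lift_def by simp

lemma SX_L2: "h \<in> L2 \<omega> \<Longrightarrow> (\<lambda>z. SX h z) \<in> L2 (\<omega> \<times> Y0)"
  by (rule L2_cong_AE[OF strain_y_L2[OF \<omega> Y lift_L2] strain_lift unf(7)]) (auto intro: L2_const[OF unf(3), of 0])

text \<open>Provides the test functions that turn the unfolded problem into the reduced one: the
  interface values from above and below are unrelated, and the lift bridges their jump. Existence
  and square integrability of traces on the cylinders enter here.\<close>

lemma lift_V_prime:
  assumes vb: "vb \<in> H1_zero_on \<Gamma> Ub" and va: "va \<in> H1 Ua"
  shows "(vb, va, lift (trb vb) (\<lambda>x. jump va vb x)) \<in> V_prime \<omega> L \<Gamma> Y0"
proof -
  have vbH: "vb \<in> H1 Ub" using vb by (simp add: H1_zero_on_def)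
  let ?w = "lift (trb vb) (\<lambda>x. jump va vb x)"
  have tX: "AE p in lebesgue_on (\<omega> \<times> unit_square). has_trace Y0 (X 1 (fst p)) (pt3 (snd p) 0) 0 \<and> has_trace Y0 (X 1 (fst p)) (pt3 (snd p) 1) (axis 1 1)"
    using X_trace by eventually_elim blast
  have tr: "AE p in lebesgue_on (\<omega> \<times> unit_square). has_trace Y0 (?w (fst p)) (pt3 (snd p) 0) (trb vb (fst p)) \<and> has_trace Y0 (?w (fst p)) (pt3 (snd p) 1) (tra va (fst p))"
    using comb_trace[OF X_L2 tX, of "trb vb" 0 "\<lambda>x. jump va vb x"] unfolding lift_def by eventually_elim simp
  have "AE p in lebesgue_on (\<omega> \<times> unit_square). \<exists>c. has_trace Ub vb (pt3 (fst p) 0) c \<and> has_trace Y0 (?w (fst p)) (pt3 (snd p) 0) c"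
    using tr AE_lebesgue_on_fst[OF unf(1) sq(3) trb_facts(2)[OF vbH]] by eventually_elim blast
  moreover have "AE p in lebesgue_on (\<omega> \<times> unit_square). \<exists>c. has_trace Ua va (pt3 (fst p) 0) c \<and> has_trace Y0 (?w (fst p)) (pt3 (snd p) 1) c"
    using tr AE_lebesgue_on_fst[OF unf(1) sq(3) tra_facts(2)[OF va]] by eventually_elim blast
  ultimately show ?thesis
    using vb va lift_L2[OF trb_facts(1)[OF vbH] jump_L2[OF va vbH]] by (simp add: V_prime_def case_prod_unfold)
qed

lemma aM_Linf: "(\<lambda>z. aM (fst z) (snd z)) \<in> Linf (\<omega> \<times> Y0)"
  using aM by (simp add: elasticity_tensor_def case_prod_unfold)

lemma aM_section: "AE x in lebesgue_on \<omega>. aM x \<in> Linf Y0"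
proof -
  obtain C where m: "(\<lambda>z. aM (fst z) (snd z)) \<in> borel_measurable (lebesgue_on (\<omega> \<times> Y0))"
    and C: "AE z in lebesgue_on (\<omega> \<times> Y0). norm (aM (fst z) (snd z)) \<le> C"
    using aM_Linf by (auto simp: Linf_def)
  obtain g where g: "g \<in> borel_measurable (lborel \<Otimes>\<^sub>M lborel)" "\<And>z. z \<notin> \<omega> \<times> Y0 \<Longrightarrow> g z = 0"
    "AE z in lebesgue_on (\<omega> \<times> Y0). aM (fst z) (snd z) = g z"
    "AE x in lebesgue_on \<omega>. (AE y in lebesgue_on Y0. aM (fst (x, y)) (snd (x, y)) = g (x, y)) \<and> (\<lambda>y. aM (fst (x, y)) (snd (x, y))) \<in> borel_measurable (lebesgue_on Y0)"
    by (rule lebesgue_on_prod_borel[OF unf(1,4) m], rule that) (assumption | blast)+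
  from g(4) AE_lebesgue_on_prod[OF unf(1,4) C] show ?thesis
    by eventually_elim (auto simp: Linf_def)
qed

lemma eX_section: "AE x in lebesgue_on \<omega>. \<forall>i. (\<lambda>y. eX i x y) \<in> L2 Y0"
  unfolding AE_all_countable
proof
  fix i
  show "AE x in lebesgue_on \<omega>. (\<lambda>y. eX i x y) \<in> L2 Y0"
    using has_weak_grad_yD(2)[OF \<omega> Y has_weak_grad_y_weak_grad_y[OF \<omega> Y X_meas[of i]]]
    by eventually_elim (auto simp: strain_y_def dest!: has_weak_gradD(2) intro: L2_sym_part)
qed

text \<open>For almost every \<open>x\<close> the slice of \<open>W\<close> is admissible in the
  corrector equations; the coefficients of \<open>h\<close> are constant on the cell and leave the
  inner integral, and Fubini assembles the slices.\<close>

lemma corrector_orthogonal: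
  assumes W: "W \<in> L2_H1_per \<omega> Y0" and h: "h \<in> L2 \<omega>"
    and t: "AE p in lebesgue_on (\<omega> \<times> unit_square). has_trace Y0 (W (fst p)) (pt3 (snd p) 0) 0 \<and> has_trace Y0 (W (fst p)) (pt3 (snd p) 1) 0"
  shows "(LINT z|lebesgue_on (\<omega> \<times> Y0). tens (aM (fst z) (snd z)) (SX h z) \<bullet> strain_y \<omega> Y0 W (fst z) (snd z)) = 0"
proof -
  have Wm: "W \<in> meas_H1_per \<omega> Y0" using W by (simp add: L2_H1_per_def)
  have i: "integrable (lebesgue_on (\<omega> \<times> Y0)) (\<lambda>z. tens (aM (fst z) (snd z)) (SX h z) \<bullet> strain_y \<omega> Y0 W (fst z) (snd z))"
    by (rule tens_L2_integrable[OF aM_Linf SX_L2[OF h] strain_y_L2[OF \<omega> Y W]])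
  have WH: "AE x in lebesgue_on \<omega>. W x \<in> H1_per Y0" using Wm by (simp add: meas_H1_per_def)
  \<comment> \<open>The exceptional null set is the same for all test functions, so the test
    function may vary with \<open>x\<close>.\<close>
  have eqn: "AE x in lebesgue_on \<omega>. \<forall>i. \<forall>\<psi>\<in>V0_cell Y0. (LINT y|lebesgue_on Y0. tens (aM x y) (eX i x y) \<bullet> strain Y0 \<psi> y) = 0"
    unfolding AE_all_countable using corr by (simp add: correctors_def)
  have "AE x in lebesgue_on \<omega>. (LINT y|lebesgue_on Y0. tens (aM x y) (SX h (x, y)) \<bullet> strain_y \<omega> Y0 W x y) = 0"
    using AE_lebesgue_on_prod[OF unf(1) sq(3) t] WH eqn aM_section eX_section strain_y_AE_strain[OF \<omega> Y Wm]
  proof eventually_elim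
    case (elim x)
    have V0: "W x \<in> V0_cell Y0" using elim(1,2) by (simp add: V0_cell_def)
    have H1: "W x \<in> H1 Y0" using elim(2) by (simp add: H1_per_def)
    have sL: "strain Y0 (W x) \<in> L2 Y0" by (rule strain_L2[OF H1])
    have ii: "integrable (lebesgue_on Y0) (\<lambda>y. tens (aM x y) (eX i x y) \<bullet> strain Y0 (W x) y)" for i
      using elim(4,5) sL by (intro tens_L2_integrable) auto
    have "(LINT y|lebesgue_on Y0. tens (aM x y) (SX h (x, y)) \<bullet> strain_y \<omega> Y0 W x y) =
      (LINT y|lebesgue_on Y0. (\<Sum>i\<in>UNIV. h x $ i * (tens (aM x y) (eX i x y) \<bullet> strain Y0 (W x) y)))"
    proof (rule integral_cong_AE)
      have sum: "(\<lambda>y. \<Sum>i\<in>UNIV. h x $ i * (tens (aM x y) (eX i x y) \<bullet> strain Y0 (W x) y)) \<in> borel_measurable (lebesgue_on Y0)"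
        using ii by (intro borel_measurable_sum borel_measurable_times borel_measurable_const borel_measurable_integrable)
      thus "(\<lambda>y. \<Sum>i\<in>UNIV. h x $ i * (tens (aM x y) (eX i x y) \<bullet> strain Y0 (W x) y)) \<in> borel_measurable (lebesgue_on Y0)" .
      have ae: "AE y in lebesgue_on Y0. (\<Sum>i\<in>UNIV. h x $ i * (tens (aM x y) (eX i x y) \<bullet> strain Y0 (W x) y)) = tens (aM x y) (SX h (x, y)) \<bullet> strain_y \<omega> Y0 W x y"
        using elim(6) by eventually_elim (simp add: tens_lin inner_sum_left)
      show "(\<lambda>y. tens (aM x y) (SX h (x, y)) \<bullet> strain_y \<omega> Y0 W x y) \<in> borel_measurable (lebesgue_on Y0)"
        by (rule borel_measurable_lebesgue_on_AE[OF sum ae unf(5)])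
      show "AE y in lebesgue_on Y0. tens (aM x y) (SX h (x, y)) \<bullet> strain_y \<omega> Y0 W x y = (\<Sum>i\<in>UNIV. h x $ i * (tens (aM x y) (eX i x y) \<bullet> strain Y0 (W x) y))"
        using ae by eventually_elim (rule sym)
    qed
    also have "\<dots> = (\<Sum>i\<in>UNIV. h x $ i * (LINT y|lebesgue_on Y0. tens (aM x y) (eX i x y) \<bullet> strain Y0 (W x) y))"
      using ii by simp
    also have "\<dots> = 0" using elim(3) V0 by simp
    finally show ?case .
  qed
  hence "(LINT x|lebesgue_on \<omega>. LINT y|lebesgue_on Y0. tens (aM x y) (SX h (x, y)) \<bullet> strain_y \<omega> Y0 W x y) = 0"
    by (rule integral_eq_zero_AE)
  thus ?thesis using Fubini_lebesgue_on(3)[OF unf(1,4) i] by simp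
qed

section \<open>Representation of the unfolded displacement\<close>

lemma aM_product: "elasticity_tensor \<alpha> (\<omega> \<times> Y0) (\<lambda>z. aM (fst z) (snd z))"
  using aM by (simp add: case_prod_unfold)

text \<open>The common boundary value in \<open>V_prime\<close> is existential; uniqueness of
  boundary values replaces it by \<open>trace_at\<close> of the displacement in the
  cylinder.\<close>

lemma unfolded_solutionD:
  assumes "unfolded_solution \<omega> L \<Gamma> Y0 ab aa aM f ub ua u0"
  shows "ub \<in> H1_zero_on \<Gamma> Ub" "ub \<in> H1 Ub" "ua \<in> H1 Ua" "u0 \<in> L2_H1_per \<omega> Y0"
    "AE p in lebesgue_on (\<omega> \<times> unit_square). has_trace Y0 (u0 (fst p)) (pt3 (snd p) 0) (trb ub (fst p)) \<and> has_trace Y0 (u0 (fst p)) (pt3 (snd p) 1) (tra ua (fst p))"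
    "\<And>vb va v0. (vb, va, v0) \<in> V_prime \<omega> L \<Gamma> Y0 \<Longrightarrow>
       energy Ub ab ub vb + energy Ua aa ua va
       + (LINT z|lebesgue_on (\<omega> \<times> Y0). tens (aM (fst z) (snd z)) (strain_y \<omega> Y0 u0 (fst z) (snd z)) \<bullet> strain_y \<omega> Y0 v0 (fst z) (snd z))
       = load Ub f vb + load Ua f va"
proof -
  have V: "(ub, ua, u0) \<in> V_prime \<omega> L \<Gamma> Y0" using assms by (simp add: unfolded_solution_def)
  show 1: "ub \<in> H1_zero_on \<Gamma> Ub" "ua \<in> H1 Ua" "u0 \<in> L2_H1_per \<omega> Y0" using V by (auto simp: V_prime_def)
  show 2: "ub \<in> H1 Ub" using 1(1) by (simp add: H1_zero_on_def)
  have tb: "AE p in lebesgue_on (\<omega> \<times> unit_square). \<exists>c. has_trace Ub ub (pt3 (fst p) 0) c \<and> has_trace Y0 (u0 (fst p)) (pt3 (snd p) 0) c"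
    and ta: "AE p in lebesgue_on (\<omega> \<times> unit_square). \<exists>c. has_trace Ua ua (pt3 (fst p) 0) c \<and> has_trace Y0 (u0 (fst p)) (pt3 (snd p) 1) c"
    using V by (simp_all add: V_prime_def case_prod_unfold)
  show "AE p in lebesgue_on (\<omega> \<times> unit_square). has_trace Y0 (u0 (fst p)) (pt3 (snd p) 0) (trb ub (fst p)) \<and> has_trace Y0 (u0 (fst p)) (pt3 (snd p) 1) (tra ua (fst p))"
    using tb ta AE_space
  proof eventually_elim
    case (elim p)
    have x: "fst p \<in> \<omega>" using elim(3) by auto
    obtain c where c: "has_trace Ub ub (pt3 (fst p) 0) c" "has_trace Y0 (u0 (fst p)) (pt3 (snd p) 0) c" using elim(1) by blast
    obtain d where d: "has_trace Ua ua (pt3 (fst p) 0) d" "has_trace Y0 (u0 (fst p)) (pt3 (snd p) 1) d" using elim(2) by blast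
    have "trb ub (fst p) = c"
      by (rule trace_at_eq[OF cyl(1) pt3_in_closure_cylinder[OF x] H1_integrable[OF cyl(2) 2] c(1)]) (use L in auto)
    moreover have "tra ua (fst p) = d"
      by (rule trace_at_eq[OF cyl(3) pt3_in_closure_cylinder[OF x] H1_integrable[OF cyl(4) 1(2)] d(1)]) (use L in auto)
    ultimately show ?case using c d by simp
  qed
  show "energy Ub ab ub vb + energy Ua aa ua va
       + (LINT z|lebesgue_on (\<omega> \<times> Y0). tens (aM (fst z) (snd z)) (strain_y \<omega> Y0 u0 (fst z) (snd z)) \<bullet> strain_y \<omega> Y0 v0 (fst z) (snd z))
       = load Ub f vb + load Ua f va" if "(vb, va, v0) \<in> V_prime \<omega> L \<Gamma> Y0" for vb va v0
    using assms that unfolding unfolded_solution_def case_prod_unfold by fastforce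
qed

text \<open>The difference \<open>W\<close> is a test function both for the unfolded equation,
  paired with zero displacements in the cylinders, and for the corrector equations; subtracting the
  two identities leaves the energy of \<open>W\<close>. The strain identity is recorded separately
  because it is what enters the energy.\<close>

lemma representation:
  assumes sol: "unfolded_solution \<omega> L \<Gamma> Y0 ab aa aM f ub ua u0"
  shows "AE z in lebesgue_on (\<omega> \<times> Y0). u0 (fst z) (snd z) = lift (trb ub) (\<lambda>x. jump ua ub x) (fst z) (snd z)"
    "AE z in lebesgue_on (\<omega> \<times> Y0). strain_y \<omega> Y0 u0 (fst z) (snd z) = SX (\<lambda>x. jump ua ub x) z"
proof -
  note S = unfolded_solutionD[OF sol]
  define h where "h = (\<lambda>x. jump ua ub x)"
  \<comment> \<open>\<open>u0\<close> minus the lift of its face values, in the shape of the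
    combination lemmas: the minus signs sit in the coefficients.\<close>
  define W where "W = (\<lambda>x y. - trb ub x + 1 *\<^sub>R u0 x y + (\<Sum>i\<in>UNIV. ((- h x) $ i) *\<^sub>R X i x y))"
  have hL: "h \<in> L2 \<omega>" unfolding h_def by (rule jump_L2[OF S(3,2)])
  have nhL: "(\<lambda>x. - h x) \<in> L2 \<omega>" using L2_lincomb[OF hL hL, of "-1" 0] by simp
  have nb: "(\<lambda>x. - trb ub x) \<in> L2 \<omega>" using L2_lincomb[OF trb_facts(1)[OF S(2)] trb_facts(1)[OF S(2)], of "-1" 0] by simp
  have WL: "W \<in> L2_H1_per \<omega> Y0" unfolding W_def
    by (rule L2_H1_per_comb[OF \<omega> Y S(4) X_Linf nb nhL])
  have u0m: "u0 \<in> meas_H1_per \<omega> Y0" using S(4) by (simp add: L2_H1_per_def)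
  have Wm: "W \<in> meas_H1_per \<omega> Y0" using WL by (simp add: L2_H1_per_def)
  have eW: "AE z in lebesgue_on (\<omega> \<times> Y0). strain_y \<omega> Y0 W (fst z) (snd z) = strain_y \<omega> Y0 u0 (fst z) (snd z) - SX h z"
    using meas_H1_per_comb(3)[where X=X and v=u0 and c="\<lambda>x. - trb ub x" and h="\<lambda>x. - h x" and k=1, OF \<omega> Y u0m X_meas L2D(1)[OF nb] L2D(1)[OF nhL]]
    unfolding W_def by eventually_elim (simp add: sum_negf)
  have Wt: "AE p in lebesgue_on (\<omega> \<times> unit_square). has_trace Y0 (W (fst p)) (pt3 (snd p) 0) 0 \<and> has_trace Y0 (W (fst p)) (pt3 (snd p) 1) 0"
    using comb_trace[OF S(4) S(5), of "\<lambda>x. - trb ub x" 1 "\<lambda>x. - h x"]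
    unfolding W_def by eventually_elim (simp add: h_def)
  have WV: "(\<lambda>x. 0, \<lambda>x. 0, W) \<in> V_prime \<omega> L \<Gamma> Y0"
  proof -
    have "AE p in lebesgue_on (\<omega> \<times> unit_square). \<exists>c. has_trace Ub (\<lambda>x. 0) (pt3 (fst p) 0) c \<and> has_trace Y0 (W (fst p)) (pt3 (snd p) 0) c"
      using Wt by eventually_elim (use has_trace_const in blast)
    moreover have "AE p in lebesgue_on (\<omega> \<times> unit_square). \<exists>c. has_trace Ua (\<lambda>x. 0) (pt3 (fst p) 0) c \<and> has_trace Y0 (W (fst p)) (pt3 (snd p) 1) c"
      using Wt by eventually_elim (use has_trace_const in blast)
    moreover have "(\<lambda>x. 0) \<in> H1 Ua" using has_weak_grad_const[OF cyl(4), of 0] by (auto simp: H1_def)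
    ultimately show ?thesis using WL H1_zero_on_zero[OF cyl(2)] by (simp add: V_prime_def case_prod_unfold)
  qed
  let ?B = "\<lambda>S T. LINT z|lebesgue_on (\<omega> \<times> Y0). tens (aM (fst z) (snd z)) (S z) \<bullet> T z"
  let ?e = "\<lambda>v z. strain_y \<omega> Y0 v (fst z) (snd z)"
  have 1: "?B (?e u0) (?e W) = 0"
    using S(6)[OF WV] energy_zero[OF cyl(1,2)] energy_zero[OF cyl(3,4)] by (simp add: load_def)
  have 2: "?B (\<lambda>z. SX h z) (?e W) = 0" by (rule corrector_orthogonal[OF WL hL Wt])
  note eL = strain_y_L2[OF \<omega> Y S(4)] strain_y_L2[OF \<omega> Y WL]
  have i1: "integrable (lebesgue_on (\<omega> \<times> Y0)) (\<lambda>z. tens (aM (fst z) (snd z)) (?e u0 z) \<bullet> ?e W z)"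
    and i2: "integrable (lebesgue_on (\<omega> \<times> Y0)) (\<lambda>z. tens (aM (fst z) (snd z)) (SX h z) \<bullet> ?e W z)"
    and i3: "integrable (lebesgue_on (\<omega> \<times> Y0)) (\<lambda>z. tens (aM (fst z) (snd z)) (?e W z) \<bullet> ?e W z)"
    by (intro tens_L2_integrable[OF aM_Linf] eL SX_L2 hL)+
  have ae: "AE z in lebesgue_on (\<omega> \<times> Y0). tens (aM (fst z) (snd z)) (?e W z) \<bullet> ?e W z
      = tens (aM (fst z) (snd z)) (?e u0 z) \<bullet> ?e W z - tens (aM (fst z) (snd z)) (SX h z) \<bullet> ?e W z"
    using eW
  proof eventually_elim
    case (elim z)
    have "tens (aM (fst z) (snd z)) (?e W z) = tens (aM (fst z) (snd z)) (?e u0 z) - tens (aM (fst z) (snd z)) (SX h z)"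
      unfolding elim by (rule bounded_bilinear.diff_right[OF bounded_bilinear_tens])
    thus ?case by (simp only: inner_diff_left)
  qed
  have "?B (?e W) (?e W) = (LINT z|lebesgue_on (\<omega> \<times> Y0). tens (aM (fst z) (snd z)) (?e u0 z) \<bullet> ?e W z - tens (aM (fst z) (snd z)) (SX h z) \<bullet> ?e W z)"
    by (rule integral_cong_AE[OF _ _ ae]) (use i1 i2 i3 in \<open>auto intro!: borel_measurable_diff\<close>)
  also have "\<dots> = 0" using 1 2 Bochner_Integration.integral_diff[OF i1 i2] by simp
  finally have eW0: "AE z in lebesgue_on (\<omega> \<times> Y0). ?e W z = 0"
    by (intro elasticity_tensor_nonneg(2)[OF aM_product \<alpha> eL(2)]) simp
  thus "AE z in lebesgue_on (\<omega> \<times> Y0). ?e u0 z = SX (\<lambda>x. jump ua ub x) z"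
    using eW unfolding h_def by eventually_elim simp
  have W_H1: "AE x in lebesgue_on \<omega>. W x \<in> H1 Y0" using Wm by (auto simp: meas_H1_per_def H1_per_def elim!: eventually_mono)
  have "AE x in lebesgue_on \<omega>. AE y in lebesgue_on Y0. W (fst (x, y)) (snd (x, y)) = 0"
    using AE_lebesgue_on_prod[OF unf(1,4) eW0] strain_y_AE_strain[OF \<omega> Y Wm] W_H1 AE_lebesgue_on_prod[OF unf(1) sq(3) Wt]
  proof eventually_elim
    case (elim x)
    have "AE y in lebesgue_on Y0. strain Y0 (W x) y = 0" using elim(1,2) by eventually_elim simp
    moreover have "AE z in lebesgue_on unit_square. has_trace Y0 (W x) (pt3 z 0) 0" using elim(4) by eventually_elim simp
    ultimately show ?case using cell_strain_zero[OF Y korn face(1) elim(3)] by simp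
  qed
  moreover have "(\<lambda>z. W (fst z) (snd z)) \<in> borel_measurable (lebesgue_on (\<omega> \<times> Y0))"
    using Wm by (simp add: meas_H1_per_def case_prod_unfold)
  ultimately have "AE z in lebesgue_on (\<omega> \<times> Y0). W (fst z) (snd z) = 0" by (intro AE_lebesgue_on_prodI[OF unf(1,4)])
  thus "AE z in lebesgue_on (\<omega> \<times> Y0). u0 (fst z) (snd z) = lift (trb ub) (\<lambda>x. jump ua ub x) (fst z) (snd z)"
  proof eventually_elim
    case (elim z)
    have "W (fst z) (snd z) = u0 (fst z) (snd z) - lift (trb ub) h (fst z) (snd z)"
      unfolding W_def lift_def by (simp add: sum_negf)
    thus ?case unfolding h_def[symmetric] using elim by simp
  qed
qed

section \<open>The interface matrix and the reduced problem\<close>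

lemma entry_integrable:
  "AE x in lebesgue_on \<omega>. \<forall>i j. integrable (lebesgue_on Y0) (\<lambda>y. tens (aM x y) (eX i x y) \<bullet> eX j x y)"
  using aM_section eX_section by eventually_elim (intro allI tens_L2_integrable; blast)

lemma H_sym: "AE x in lebesgue_on \<omega>. \<forall>i j. H x $ i $ j = H x $ j $ i"
proof -
  have "AE z in lebesgue_on (\<omega> \<times> Y0). \<forall>\<eta> \<xi>. tens (aM (fst z) (snd z)) \<eta> \<bullet> \<xi> = tens (aM (fst z) (snd z)) \<xi> \<bullet> \<eta>"
    using aM_product by (simp add: elasticity_tensor_def)
  from AE_lebesgue_on_prod[OF unf(1,4) this] entry_integrable show ?thesis
  proof eventually_elim
    case (elim x)
    show ?case
    proof (intro allI)
      fix i j
      have "AE y in lebesgue_on Y0. tens (aM x y) (eX i x y) \<bullet> eX j x y = tens (aM x y) (eX j x y) \<bullet> eX i x y"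
        using elim(1) by eventually_elim simp
      hence "(LINT y|lebesgue_on Y0. tens (aM x y) (eX i x y) \<bullet> eX j x y) = (LINT y|lebesgue_on Y0. tens (aM x y) (eX j x y) \<bullet> eX i x y)"
        by (intro integral_cong_AE) (use elim(2) in auto)
      thus "H x $ i $ j = H x $ j $ i" by (simp add: interface_matrix_def)
    qed
  qed
qed

text \<open>The tensor is bounded and the correctors are bounded in H1 uniformly in
  \<open>x\<close>; strains are no larger than gradients, so each entry is bounded by the squared H1
  bounds of two correctors.\<close>

lemma H_Linf: "(\<lambda>x. H x $ i $ j) \<in> Linf \<omega>"
proof -
  let ?G = "\<lambda>i. weak_grad_y \<omega> Y0 (X i)"
  obtain K where K: "K > 0" "\<And>a \<eta> \<xi>. \<bar>tens a \<eta> \<bullet> \<xi>\<bar> \<le> K * norm a * (norm \<eta> * norm \<xi>)" using tens_bound by blast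
  obtain M where M: "AE z in lebesgue_on (\<omega> \<times> Y0). norm (aM (fst z) (snd z)) \<le> M" using aM_Linf by (auto simp: Linf_def)
  obtain C where C: "\<And>i. AE x in lebesgue_on \<omega>. norm_H1 Y0 (X i x) \<le> C i"
    using X_Linf unfolding Linf_H1_per_def mem_Collect_eq by metis
  have i: "integrable (lebesgue_on (\<omega> \<times> Y0)) (\<lambda>z. tens (aM (fst z) (snd z)) (eX i (fst z) (snd z)) \<bullet> eX j (fst z) (snd z))"
    by (intro tens_L2_integrable[OF aM_Linf] strain_y_L2[OF \<omega> Y X_L2])
  have m: "(\<lambda>x. H x $ i $ j) \<in> borel_measurable (lebesgue_on \<omega>)"
    using measurable_marginal[OF unf(1,4) borel_measurable_integrable[OF i]] by (simp add: interface_matrix_def)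
  have bd: "AE x in lebesgue_on \<omega>. norm (H x $ i $ j) \<le> K * \<bar>M\<bar> * ((C i)\<^sup>2 + (C j)\<^sup>2)"
    using AE_lebesgue_on_prod[OF unf(1,4) M] C[of i] C[of j] entry_integrable
      has_weak_grad_yD(2)[OF \<omega> Y has_weak_grad_y_weak_grad_y[OF \<omega> Y X_meas[of i]]]
      has_weak_grad_yD(2)[OF \<omega> Y has_weak_grad_y_weak_grad_y[OF \<omega> Y X_meas[of j]]]
  proof eventually_elim
    case (elim x)
    have Gi: "integrable (lebesgue_on Y0) (\<lambda>y. (norm (?G i x y))\<^sup>2)" by (rule L2D(2)[OF has_weak_gradD(2)[OF elim(5)]])
    have Gj: "integrable (lebesgue_on Y0) (\<lambda>y. (norm (?G j x y))\<^sup>2)" by (rule L2D(2)[OF has_weak_gradD(2)[OF elim(6)]])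
    have le: "(LINT y|lebesgue_on Y0. (norm (?G l x y))\<^sup>2) \<le> (C l)\<^sup>2" if "has_weak_grad Y0 (X l x) (?G l x)" "norm_H1 Y0 (X l x) \<le> C l" for l
    proof -
      have "(LINT y|lebesgue_on Y0. (norm (?G l x y))\<^sup>2) \<le> (norm_H1 Y0 (X l x))\<^sup>2"
        unfolding norm_H1_sq[OF \<omega> Y that(1)] by simp
      also have "\<dots> \<le> (C l)\<^sup>2" using that(2) by (simp add: power_mono norm_H1_nonneg)
      finally show ?thesis .
    qed
    have "norm (H x $ i $ j) = \<bar>LINT y|lebesgue_on Y0. tens (aM x y) (eX i x y) \<bullet> eX j x y\<bar>" by (simp add: interface_matrix_def)
    also have "\<dots> \<le> (LINT y|lebesgue_on Y0. \<bar>tens (aM x y) (eX i x y) \<bullet> eX j x y\<bar>)" by (rule integral_abs_bound)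
    also have "\<dots> \<le> (LINT y|lebesgue_on Y0. K * \<bar>M\<bar> * ((norm (?G i x y))\<^sup>2 + (norm (?G j x y))\<^sup>2))"
    proof (rule integral_mono_AE)
      show "integrable (lebesgue_on Y0) (\<lambda>y. \<bar>tens (aM x y) (eX i x y) \<bullet> eX j x y\<bar>)" using elim(4) by (intro integrable_abs) blast
      show "integrable (lebesgue_on Y0) (\<lambda>y. K * \<bar>M\<bar> * ((norm (?G i x y))\<^sup>2 + (norm (?G j x y))\<^sup>2))" using Gi Gj by simp
      show "AE y in lebesgue_on Y0. \<bar>tens (aM x y) (eX i x y) \<bullet> eX j x y\<bar> \<le> K * \<bar>M\<bar> * ((norm (?G i x y))\<^sup>2 + (norm (?G j x y))\<^sup>2)"
        using elim(1)
      proof eventually_elim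
        case (elim y)
        let ?s = "norm (?G i x y)" and ?t = "norm (?G j x y)"
        have "2 * (?s * ?t) \<le> ?s\<^sup>2 + ?t\<^sup>2" using zero_le_power2[of "?s - ?t"] by (simp add: power2_eq_square algebra_simps)
        moreover have "0 \<le> ?s * ?t" by simp
        ultimately have st: "?s * ?t \<le> ?s\<^sup>2 + ?t\<^sup>2" by linarith
        have "norm (eX i x y) * norm (eX j x y) \<le> ?s * ?t"
          unfolding strain_y_def by (intro mult_mono norm_sym_part_le) auto
        hence "norm (eX i x y) * norm (eX j x y) \<le> ?s\<^sup>2 + ?t\<^sup>2" using st by linarith
        moreover have "norm (aM x y) \<le> \<bar>M\<bar>" using elim by simp
        ultimately have "K * norm (aM x y) * (norm (eX i x y) * norm (eX j x y)) \<le> K * \<bar>M\<bar> * (?s\<^sup>2 + ?t\<^sup>2)"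
          using K(1) by (intro mult_mono) auto
        thus ?case using K(2) order_trans by blast
      qed
    qed
    also have "\<dots> = K * \<bar>M\<bar> * ((LINT y|lebesgue_on Y0. (norm (?G i x y))\<^sup>2) + (LINT y|lebesgue_on Y0. (norm (?G j x y))\<^sup>2))"
      using Gi Gj by simp
    also have "\<dots> \<le> K * \<bar>M\<bar> * ((C i)\<^sup>2 + (C j)\<^sup>2)"
      using K(1) le[OF elim(5,2)] le[OF elim(6,3)] by (intro mult_left_mono add_mono) auto
    finally show ?case .
  qed
  show ?thesis unfolding Linf_def using m bd by blast
qed

text \<open>\<open>h x\<close> and \<open>k x\<close> are constant on the cell, so the cell integral
  reduces to the matrix of corrector energies. The identity serves in both directions: it produces
  the interface term, and it lets the sign of that term be read off the cell tensor.\<close>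

lemma SX_form:
  assumes h: "h \<in> L2 \<omega>" and k: "k \<in> L2 \<omega>"
  shows "integrable (lebesgue_on \<omega>) (\<lambda>x. (H x *v h x) \<bullet> k x)"
    "(LINT z|lebesgue_on (\<omega> \<times> Y0). tens (aM (fst z) (snd z)) (SX h z) \<bullet> SX k z) = (LINT x|lebesgue_on \<omega>. (H x *v h x) \<bullet> k x)"
proof -
  let ?I = "\<lambda>x. LINT y|lebesgue_on Y0. tens (aM x y) (SX h (x, y)) \<bullet> SX k (x, y)"
  have i: "integrable (lebesgue_on (\<omega> \<times> Y0)) (\<lambda>z. tens (aM (fst z) (snd z)) (SX h z) \<bullet> SX k z)"
    by (intro tens_L2_integrable[OF aM_Linf] SX_L2 h k)
  note F = Fubini_lebesgue_on[OF unf(1,4) i]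
  have Ii: "integrable (lebesgue_on \<omega>) ?I" using F(2) by simp
  have ae: "AE x in lebesgue_on \<omega>. ?I x = (H x *v h x) \<bullet> k x"
    using H_sym entry_integrable
  proof eventually_elim
    case (elim x)
    have pt: "tens (aM x y) (SX h (x, y)) \<bullet> SX k (x, y) = (\<Sum>j\<in>UNIV. \<Sum>i\<in>UNIV. k x $ j * (h x $ i * (tens (aM x y) (eX i x y) \<bullet> eX j x y)))" for y
      by (simp add: tens_lin inner_sum_left inner_sum_right sum_distrib_left)
    have "?I x = (\<Sum>j\<in>UNIV. \<Sum>i\<in>UNIV. k x $ j * (h x $ i * (LINT y|lebesgue_on Y0. tens (aM x y) (eX i x y) \<bullet> eX j x y)))"
      unfolding pt using elim(2) by simp
    \<comment> \<open>The definition yields the entry with \<open>i\<close> as first index; symmetry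
      of \<open>H\<close> swaps the indices into the order that \<open>*v\<close> expects.\<close>
    also have "\<dots> = (\<Sum>j\<in>UNIV. \<Sum>i\<in>UNIV. k x $ j * (h x $ i * H x $ j $ i))"
      using elim(1) by (simp add: interface_matrix_def)
    also have "\<dots> = (H x *v h x) \<bullet> k x"
      by (simp add: inner_vec_def matrix_vector_mult_def sum_distrib_left sum_distrib_right mult_ac)
    finally show ?case .
  qed
  have m: "(\<lambda>x. (H x *v h x) \<bullet> k x) \<in> borel_measurable (lebesgue_on \<omega>)"
    by (rule borel_measurable_lebesgue_on_AE[OF borel_measurable_integrable[OF Ii] ae unf(2)])
  show "integrable (lebesgue_on \<omega>) (\<lambda>x. (H x *v h x) \<bullet> k x)"
    by (rule integrable_cong_AE_imp[OF Ii m]) (use ae in \<open>auto simp: eq_commute\<close>)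
  show "(LINT z|lebesgue_on (\<omega> \<times> Y0). tens (aM (fst z) (snd z)) (SX h z) \<bullet> SX k z) = (LINT x|lebesgue_on \<omega>. (H x *v h x) \<bullet> k x)"
    using F(3) integral_cong_AE[OF borel_measurable_integrable[OF Ii] m ae] by simp
qed

text \<open>The strains of the solution and of a lift are both combinations of corrector strains, so
  testing with lifts makes the cell term depend on the two interface jumps only.\<close>

lemma interface_solution_of_unfolded:
  assumes sol: "unfolded_solution \<omega> L \<Gamma> Y0 ab aa aM f ub ua u0"
  shows "interface_solution \<omega> L \<Gamma> ab aa H f ua ub"
  unfolding interface_solution_def
proof (intro conjI ballI)
  note S = unfolded_solutionD[OF sol]
  show "ua \<in> H1 Ua" "ub \<in> H1_zero_on \<Gamma> Ub" by (rule S)+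
  fix va vb assume va: "va \<in> H1 Ua" and vb: "vb \<in> H1_zero_on \<Gamma> Ub"
  have vbH: "vb \<in> H1 Ub" using vb by (simp add: H1_zero_on_def)
  let ?h = "\<lambda>x. jump ua ub x" and ?k = "\<lambda>x. jump va vb x"
  have hL: "?h \<in> L2 \<omega>" "?k \<in> L2 \<omega>" by (rule jump_L2 S va vbH)+
  let ?v0 = "lift (trb vb) ?k"
  have v0L: "?v0 \<in> L2_H1_per \<omega> Y0" by (rule lift_L2[OF trb_facts(1)[OF vbH] hL(2)])
  have "(LINT z|lebesgue_on (\<omega> \<times> Y0). tens (aM (fst z) (snd z)) (strain_y \<omega> Y0 u0 (fst z) (snd z)) \<bullet> strain_y \<omega> Y0 ?v0 (fst z) (snd z))
    = (LINT z|lebesgue_on (\<omega> \<times> Y0). tens (aM (fst z) (snd z)) (SX ?h z) \<bullet> SX ?k z)"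
  proof (rule integral_cong_AE)
    show "(\<lambda>z. tens (aM (fst z) (snd z)) (strain_y \<omega> Y0 u0 (fst z) (snd z)) \<bullet> strain_y \<omega> Y0 ?v0 (fst z) (snd z)) \<in> borel_measurable (lebesgue_on (\<omega> \<times> Y0))"
      by (intro borel_measurable_integrable tens_L2_integrable[OF aM_Linf] strain_y_L2[OF \<omega> Y] S v0L)
    show "(\<lambda>z. tens (aM (fst z) (snd z)) (SX ?h z) \<bullet> SX ?k z) \<in> borel_measurable (lebesgue_on (\<omega> \<times> Y0))"
      by (intro borel_measurable_integrable tens_L2_integrable[OF aM_Linf] SX_L2 hL)
    show "AE z in lebesgue_on (\<omega> \<times> Y0). tens (aM (fst z) (snd z)) (strain_y \<omega> Y0 u0 (fst z) (snd z)) \<bullet> strain_y \<omega> Y0 ?v0 (fst z) (snd z)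
      = tens (aM (fst z) (snd z)) (SX ?h z) \<bullet> SX ?k z"
      using representation(2)[OF sol] strain_lift[OF trb_facts(1)[OF vbH] hL(2)] by eventually_elim simp
  qed
  also have "\<dots> = (LINT x|lebesgue_on \<omega>. (H x *v ?h x) \<bullet> ?k x)" by (rule SX_form(2)[OF hL])
  finally show "energy Ub ab ub vb + energy Ua aa ua va + (LINT x|lebesgue_on \<omega>. (H x *v ?h x) \<bullet> ?k x) = load Ub f vb + load Ua f va"
    using S(6)[OF lift_V_prime[OF vb va]] by simp
qed

section \<open>Uniqueness for the reduced problem\<close>

lemma trace_of_AE_rigid:
  assumes U: "open U" "U \<in> lmeasurable" and p: "p \<in> closure U" and v: "v \<in> H1 U"
    and r: "AE x in lebesgue_on U. v x = a + cross3 b x" and t: "has_trace U v p c"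
  shows "a + cross3 b p = c"
proof -
  have rc: "continuous_on UNIV (\<lambda>x. a + cross3 b x)" by (intro continuous_intros continuous_on_cross)
  have rm: "(\<lambda>x. a + cross3 b x) \<in> borel_measurable (lebesgue_on U)"
    using rc by (intro lebesgue_on_measurable_borelI borel_measurable_continuous_onI)
  have vi: "integrable (lebesgue_on U) v" by (rule H1_integrable[OF U(2) v])
  have ri: "integrable (lebesgue_on U) (\<lambda>x. a + cross3 b x)"
    by (rule integrable_cong_AE_imp[OF vi rm]) (use r in \<open>auto simp: eq_commute\<close>)
  have "has_trace U (\<lambda>x. a + cross3 b x) p c"
    using t has_trace_cong_AE[OF fmeasurableD[OF U(2)] borel_measurable_integrable[OF vi] rm r] by blast
  from has_trace_unique[OF U(1) p ri has_trace_continuous[OF U(1) p rc] this] show ?thesis .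
qed

text \<open>Tested with the difference, the equations say that three nonnegative energies sum to
  zero. The lower difference is rigid and zero on \<Gamma>, hence zero; the vanishing cell energy
  forces the jump to vanish, so the upper difference is a rigid displacement that is zero on the
  interface.\<close>

lemma interface_solution_unique:
  assumes u: "interface_solution \<omega> L \<Gamma> ab aa H f ua ub" and w: "interface_solution \<omega> L \<Gamma> ab aa H f wa wb"
  shows "(AE x in lebesgue_on Ua. wa x = ua x) \<and> (AE x in lebesgue_on Ub. wb x = ub x)"
proof -
  have ua: "ua \<in> H1 Ua" and wa: "wa \<in> H1 Ua" and ub: "ub \<in> H1_zero_on \<Gamma> Ub" and wb: "wb \<in> H1_zero_on \<Gamma> Ub"
    using u w by (auto simp: interface_solution_def)
  have ubH: "ub \<in> H1 Ub" and wbH: "wb \<in> H1 Ub" using ub wb by (auto simp: H1_zero_on_def)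
  define da where "da = (\<lambda>x. wa x - ua x)"
  define db where "db = (\<lambda>x. wb x - ub x)"
  have da: "da \<in> H1 Ua" unfolding da_def by (rule H1_diff[OF cyl(4) wa ua])
  have db: "db \<in> H1_zero_on \<Gamma> Ub" unfolding db_def by (rule H1_zero_on_diff[OF cyl(2) wb ub])
  have dbH: "db \<in> H1 Ub" using db by (auto simp: H1_zero_on_def)
  let ?j = "\<lambda>x. jump da db x"
  have jL: "?j \<in> L2 \<omega>" "(\<lambda>x. jump wa wb x) \<in> L2 \<omega>" "(\<lambda>x. jump ua ub x) \<in> L2 \<omega>"
    by (rule jump_L2 da dbH wa wbH ua ubH)+
  have jd: "AE x in lebesgue_on \<omega>. ?j x = jump wa wb x - jump ua ub x"
    using trace_at_diff[OF \<omega> _ _ wa ua, of 0] trace_at_diff[OF \<omega> _ _ wbH ubH, of 0] L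
    unfolding da_def db_def by (auto elim!: eventually_elim2)
  have aL: "ab \<in> Linf Ub" "aa \<in> Linf Ua" using ab aa by (auto simp: elasticity_tensor_def)
  have E: "energy Ub ab wb db + energy Ua aa wa da + (LINT x|lebesgue_on \<omega>. (H x *v jump wa wb x) \<bullet> ?j x)
      = energy Ub ab ub db + energy Ua aa ua da + (LINT x|lebesgue_on \<omega>. (H x *v jump ua ub x) \<bullet> ?j x)"
    using u w da db unfolding interface_solution_def by fastforce
  have Eb: "energy Ub ab db db = energy Ub ab wb db - energy Ub ab ub db"
    using energy_diff_left[OF cyl(1,2) aL(1) wbH ubH dbH] by (simp add: db_def)
  have Ea: "energy Ua aa da da = energy Ua aa wa da - energy Ua aa ua da"
    using energy_diff_left[OF cyl(3,4) aL(2) wa ua da] by (simp add: da_def)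
  have ae: "AE x in lebesgue_on \<omega>. (H x *v ?j x) \<bullet> ?j x = (H x *v jump wa wb x) \<bullet> ?j x - (H x *v jump ua ub x) \<bullet> ?j x"
    using jd
  proof eventually_elim
    case (elim x)
    have "H x *v ?j x = H x *v jump wa wb x - H x *v jump ua ub x"
      unfolding elim by (rule matrix_vector_mult_diff_distrib)
    thus ?case by (simp only: inner_diff_left)
  qed
  note i = SX_form(1)[OF jL(1) jL(1)] SX_form(1)[OF jL(2) jL(1)] SX_form(1)[OF jL(3) jL(1)]
  have Ej: "(LINT x|lebesgue_on \<omega>. (H x *v ?j x) \<bullet> ?j x)
     = (LINT x|lebesgue_on \<omega>. (H x *v jump wa wb x) \<bullet> ?j x) - (LINT x|lebesgue_on \<omega>. (H x *v jump ua ub x) \<bullet> ?j x)"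
  proof -
    have "(LINT x|lebesgue_on \<omega>. (H x *v ?j x) \<bullet> ?j x) = (LINT x|lebesgue_on \<omega>. (H x *v jump wa wb x) \<bullet> ?j x - (H x *v jump ua ub x) \<bullet> ?j x)"
      by (rule integral_cong_AE[OF borel_measurable_integrable[OF i(1)] _ ae])
        (intro borel_measurable_diff borel_measurable_integrable i)
    thus ?thesis using Bochner_Integration.integral_diff[OF i(2,3)] by simp
  qed
  \<comment> \<open>The interface term rewritten as a cell energy, whose sign follows from
    coercivity of \<open>aM\<close>.\<close>
  let ?B = "LINT z|lebesgue_on (\<omega> \<times> Y0). tens (aM (fst z) (snd z)) (SX ?j z) \<bullet> SX ?j z"
  have tot: "energy Ub ab db db + energy Ua aa da da + ?B = 0"
    using E Eb Ea Ej SX_form(2)[OF jL(1) jL(1)] by linarith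
  note nb = elasticity_tensor_nonneg[OF ab \<alpha> strain_L2[OF dbH], folded energy_def]
    and na = elasticity_tensor_nonneg[OF aa \<alpha> strain_L2[OF da], folded energy_def]
    and nj = elasticity_tensor_nonneg[OF aM_product \<alpha> SX_L2[OF jL(1)]]
  have sb: "AE x in lebesgue_on Ub. strain Ub db x = 0" by (rule nb(2)) (use tot nb(1) na(1) nj(1) in linarith)
  have sa: "AE x in lebesgue_on Ua. strain Ua da x = 0" by (rule na(2)) (use tot nb(1) na(1) nj(1) in linarith)
  have sj: "AE z in lebesgue_on (\<omega> \<times> Y0). SX ?j z = 0" by (rule nj(2)) (use tot nb(1) na(1) nj(1) in linarith)
  have conn: "connected Ub" "connected Ua" by (rule connected_cylinder[OF \<omega>c(1)])+
  obtain x0 where x0: "x0 \<in> \<omega>" using \<omega>c(2) by blast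
  have "pt3 x0 (- L / 2) \<in> Ub" "pt3 x0 (L / 2) \<in> Ua" using x0 L by (auto simp: cylinder_def)
  hence ne: "Ub \<noteq> {}" "Ua \<noteq> {}" by blast+
  obtain a b where r: "AE x in lebesgue_on Ub. db x = a + cross3 b x"
    by (rule strain_zero_imp_rigid[OF cyl(1,2) conn(1) ne(1) has_weak_grad_weak_grad[OF dbH]])
      (use sb in \<open>simp_all add: strain_def\<close>)
  have "a = 0 \<and> b = 0"
  proof (rule rigid_zero_surface[OF _ \<Gamma>(2)])
    have bU: "bounded Ub" using \<omega> by (intro bounded_cylinder) auto
    have "\<Gamma> \<subseteq> closure Ub" using \<Gamma>(1) by (auto simp: frontier_def)
    thus "bounded \<Gamma>" by (rule bounded_subset[OF bounded_closure[OF bU]])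
    have "{p \<in> \<Gamma>. a + cross3 b p \<noteq> 0} \<subseteq> {p \<in> \<Gamma>. \<not> has_trace Ub db p 0}"
    proof safe
      fix p assume p: "p \<in> \<Gamma>" "has_trace Ub db p 0" and n: "a + cross3 b p \<noteq> 0"
      have "p \<in> closure Ub" using p(1) \<Gamma>(1) by (auto simp: frontier_def)
      from trace_of_AE_rigid[OF cyl(1,2) this dbH r p(2)] n show False by blast
    qed
    thus "surface_measure {p \<in> \<Gamma>. a + cross3 b p \<noteq> 0} = 0"
      by (rule surface_measure_subset_zero) (use db in \<open>simp add: H1_zero_on_def\<close>)
  qed
  \<comment> \<open>Zero is written as a rigid displacement so that \<open>trace_of_AE_rigid\<close>
    applies.\<close>
  hence db0: "AE x in lebesgue_on Ub. db x = 0 + cross3 0 x" using r by simp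
  have trb0: "AE x in lebesgue_on \<omega>. trb db x = 0"
    using trb_facts(2)[OF dbH] AE_space
  proof eventually_elim
    case (elim x)
    have "pt3 x 0 \<in> closure Ub" by (rule pt3_in_closure_cylinder) (use elim L in auto)
    from trace_of_AE_rigid[OF cyl(1,2) this dbH db0 elim(1)] show ?case by simp
  qed
  \<comment> \<open>Goes from 0 on the bottom face to the jump on the top face, with zero strain:
    Korn makes it vanish, and its top value with it.\<close>
  define \<psi> where "\<psi> = lift (\<lambda>x. 0) ?j"
  have z0: "(\<lambda>x. 0) \<in> L2 \<omega>" by (rule L2_const[OF unf(3)])
  have \<psi>L: "\<psi> \<in> L2_H1_per \<omega> Y0" unfolding \<psi>_def by (rule lift_L2[OF z0 jL(1)])
  have \<psi>m: "\<psi> \<in> meas_H1_per \<omega> Y0" using \<psi>L by (simp add: L2_H1_per_def)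
  have \<psi>H: "AE x in lebesgue_on \<omega>. \<psi> x \<in> H1 Y0" using \<psi>m by (auto simp: meas_H1_per_def H1_per_def elim!: eventually_mono)
  have tX: "AE p in lebesgue_on (\<omega> \<times> unit_square). has_trace Y0 (X 1 (fst p)) (pt3 (snd p) 0) 0 \<and> has_trace Y0 (X 1 (fst p)) (pt3 (snd p) 1) (axis 1 1)"
    using X_trace by eventually_elim blast
  have \<psi>t: "AE p in lebesgue_on (\<omega> \<times> unit_square). has_trace Y0 (\<psi> (fst p)) (pt3 (snd p) 0) 0 \<and> has_trace Y0 (\<psi> (fst p)) (pt3 (snd p) 1) (?j (fst p))"
    using comb_trace[OF X_L2 tX, of "\<lambda>x. 0" 0 ?j] unfolding \<psi>_def lift_def by eventually_elim simp
  have \<psi>e: "AE z in lebesgue_on (\<omega> \<times> Y0). strain_y \<omega> Y0 \<psi> (fst z) (snd z) = 0"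
    using strain_lift[OF z0 jL(1)] sj unfolding \<psi>_def by eventually_elim simp
  have j0: "AE x in lebesgue_on \<omega>. ?j x = 0"
    using AE_lebesgue_on_prod[OF unf(1,4) \<psi>e] strain_y_AE_strain[OF \<omega> Y \<psi>m] \<psi>H AE_lebesgue_on_prod[OF unf(1) sq(3) \<psi>t]
  proof eventually_elim
    case (elim x)
    have "AE y in lebesgue_on Y0. strain Y0 (\<psi> x) y = 0" using elim(1,2) by eventually_elim simp
    moreover have "AE z in lebesgue_on unit_square. has_trace Y0 (\<psi> x) (pt3 z 0) 0" using elim(4) by eventually_elim simp
    ultimately have "AE y in lebesgue_on Y0. \<psi> x y = 0" using cell_strain_zero[OF Y korn face(1) elim(3)] by simp
    hence 0: "AE y in lebesgue_on Y0. \<psi> x y = 0 + cross3 0 y" by simp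
    \<comment> \<open>One point of the top face suffices, since the value there does not depend on
      \<open>z\<close>.\<close>
    obtain z where z: "z \<in> unit_square" "has_trace Y0 (\<psi> (fst (x, z))) (pt3 (snd (x, z)) 0) 0 \<and> has_trace Y0 (\<psi> (fst (x, z))) (pt3 (snd (x, z)) 1) (?j (fst (x, z)))"
      by (rule AE_lebesgue_on_ex[OF sq(1,2) elim(4)])
    from trace_of_AE_rigid[OF Y(1) unf(6) face(2)[OF z(1)] elim(3) 0, of "?j x"] z(2) show ?case by simp
  qed
  obtain a' b' where r': "AE x in lebesgue_on Ua. da x = a' + cross3 b' x"
    by (rule strain_zero_imp_rigid[OF cyl(3,4) conn(2) ne(2) has_weak_grad_weak_grad[OF da]])
      (use sa in \<open>simp_all add: strain_def\<close>)
  have "a' = 0 \<and> b' = 0"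
  proof (rule rigid_zero_horizontal[OF \<omega>(1) \<omega>c(2)])
    show "AE x in lebesgue_on \<omega>. a' + cross3 b' (pt3 x 0) = 0"
      using tra_facts(2)[OF da] j0 trb0 AE_space
    proof eventually_elim
      case (elim x)
      have "pt3 x 0 \<in> closure Ua" by (rule pt3_in_closure_cylinder) (use elim L in auto)
      from trace_of_AE_rigid[OF cyl(3,4) this da r' elim(1)] elim(2,3) show ?case by simp
    qed
  qed
  hence "AE x in lebesgue_on Ua. da x = 0" using r' by simp
  moreover have "AE x in lebesgue_on Ub. db x = 0" using db0 by simp
  ultimately show ?thesis by (simp add: da_def db_def)
qed

end

theorem theorem6p2:
  fixes \<omega> :: "(real^2) set" and L \<alpha> t0 :: real and \<Gamma> S0 Y0 :: "(real^3) set"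
    and m :: nat and Yh :: "nat \<Rightarrow> (real^3) set" and \<nu> f ub ua :: "real^3 \<Rightarrow> real^3"
    and ab aa :: "real^3 \<Rightarrow> real^3^3^3^3" and aM :: "real^2 \<Rightarrow> real^3 \<Rightarrow> real^3^3^3^3"
    and u0 :: "real^2 \<Rightarrow> real^3 \<Rightarrow> real^3" and X :: "3 \<Rightarrow> real^2 \<Rightarrow> real^3 \<Rightarrow> real^3"
    and H :: "real^2 \<Rightarrow> real^3^3"
  assumes "open \<omega>" "bounded \<omega>" "connected \<omega>" "\<omega> \<noteq> {}" "lipschitz_boundary \<omega>" "L > 0"
    and "\<Gamma> \<subseteq> frontier (cylinder \<omega> {-L<..<0})" "surface_measure \<Gamma> > 0"
    and "f \<in> L2 (cylinder \<omega> {-L<..<L})"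
    and "\<And>j. j \<in> {1..m} \<Longrightarrow> open (Yh j) \<and> lipschitz_boundary (Yh j) \<and> connected (frontier (Yh j))"
    and "\<And>j k. j \<in> {1..m} \<Longrightarrow> k \<in> {1..m} \<Longrightarrow> j \<noteq> k \<Longrightarrow> closure (Yh j) \<inter> closure (Yh k) = {}"
    and "(\<Union>j\<in>{1..m}. closure (Yh j)) \<subseteq> unit_cube"
    and "oriented_surfaces S0 \<nu>" "S0 \<subseteq> unit_cube - (\<Union>j\<in>{1..m}. closure (Yh j))"
    and "Y0 = unit_cube - ((\<Union>j\<in>{1..m}. closure (Yh j)) \<union> S0)"
    and "t0 > 0" "\<And>x. x \<in> S0 \<Longrightarrow> closed_segment (x - t0 *\<^sub>R \<nu> x) (x + t0 *\<^sub>R \<nu> x) - {x} \<subseteq> Y0"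
    and "korn_domain Y0"
    and "\<alpha> > 0"
    and "elasticity_tensor \<alpha> (cylinder \<omega> {-L<..<0}) ab"
    and "elasticity_tensor \<alpha> (cylinder \<omega> {0<..<L}) aa"
    and "elasticity_tensor \<alpha> (\<omega> \<times> unit_cube) (\<lambda>(x', y). aM x' y)"
    and "correctors \<omega> Y0 aM X"
    and "H = interface_matrix \<omega> Y0 aM X"
    and "unfolded_solution \<omega> L \<Gamma> Y0 ab aa aM f ub ua u0"
  shows "(AE (x', y) in lebesgue_on (\<omega> \<times> Y0).
           u0 x' y =
             (\<Sum>i\<in>UNIV. (trace_at (cylinder \<omega> {0<..<L}) ua (pt3 x' 0) $ i) *\<^sub>R X i x' y)
           + (\<Sum>i\<in>UNIV. (trace_at (cylinder \<omega> {-L<..<0}) ub (pt3 x' 0) $ i) *\<^sub>R (axis i 1 - X i x' y)))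
    \<and> (\<forall>i j. (\<lambda>x'. H x' $ i $ j) \<in> Linf \<omega>)
    \<and> (AE x' in lebesgue_on \<omega>. transpose (H x') = H x')
    \<and> (interface_solution \<omega> L \<Gamma> ab aa H f ua ub)
    \<and> (\<forall>wa wb. interface_solution \<omega> L \<Gamma> ab aa H f wa wb \<longrightarrow>
           (AE x in lebesgue_on (cylinder \<omega> {0<..<L}). wa x = ua x) \<and>
           (AE x in lebesgue_on (cylinder \<omega> {-L<..<0}). wb x = ub x))"
proof -
  define K where "K = (\<Union>j\<in>{1..m}. closure (Yh j)) \<union> S0"
  have cube: "unit_cube = box 0 1" by (auto simp: mem_box_cart)
  have Kc: "closed K" using assms(13) unfolding K_def oriented_surfaces_def by (intro closed_Un closed_UN) auto
  have Kcube: "K \<subseteq> unit_cube" using assms(12,14) unfolding K_def by blast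
  have Y0: "Y0 = unit_cube - K" using assms(15) by (simp add: K_def)
  have Yo: "open Y0" unfolding Y0 cube using Kc by (intro open_Diff open_box)
  have Yb: "bounded Y0" unfolding Y0 cube by (rule bounded_subset[OF bounded_box]) blast
  \<comment> \<open>Holes and cracks form a closed subset of the open cube, so they keep away from
    each boundary point of the cube, and near such a point \<open>Y0\<close> is the full
    cube.\<close>
  have face: "p \<in> closure Y0" if p: "p \<in> closure unit_cube" "p \<notin> unit_cube" for p
    unfolding closure_approachable
  proof (intro allI impI)
    fix e :: real assume e: "e > 0"
    have "p \<in> - K" "open (- K)" using p Kcube Kc by auto
    then obtain d where d: "d > 0" "ball p d \<subseteq> - K" using openE by blast
    have "0 < min e d" using e d by simp
    then obtain y where y: "y \<in> unit_cube" "dist y p < min e d"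
      using p(1) unfolding closure_approachable by blast
    have "y \<in> ball p d" using y(2) by (simp add: dist_commute)
    hence "y \<in> Y0" using y(1) d(2) Y0 by blast
    thus "\<exists>y\<in>Y0. dist y p < e" using y by auto
  qed
  have cl: "pt3 z t \<in> closure unit_cube" if "z \<in> unit_square" "0 \<le> t" "t \<le> 1" for z t
  proof -
    have "(\<chi> i. 1/2) \<in> box (0::real^3) 1" by (simp add: mem_box_cart)
    hence "box (0::real^3) 1 \<noteq> {}" by blast
    hence "closure unit_cube = cbox (0::real^3) 1" unfolding cube by (rule closure_box)
    moreover have "pt3 z t \<in> cbox 0 1" using that by (auto simp: mem_box_cart forall_3 less_imp_le)
    ultimately show ?thesis by simp
  qed
  have faces: "\<forall>z\<in>unit_square. pt3 z 0 \<in> closure Y0 \<and> pt3 z 1 \<in> closure Y0"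
  proof
    fix z assume z: "z \<in> unit_square"
    have n: "pt3 z t \<notin> unit_cube" if "t = 0 \<or> t = 1" for t using that by (auto simp: forall_3)
    show "pt3 z 0 \<in> closure Y0 \<and> pt3 z 1 \<in> closure Y0"
      using face[OF cl[OF z, of 0] n] face[OF cl[OF z, of 1] n] by simp
  qed
  \<comment> \<open>The tensor is given on the whole cube; bounds, symmetry and coercivity pass to
    the perforated and cracked cell.\<close>
  have aM: "elasticity_tensor \<alpha> (\<omega> \<times> Y0) (\<lambda>(x', y). aM x' y)"
  proof (rule elasticity_tensor_subset[OF assms(22)])
    show "\<omega> \<times> Y0 \<subseteq> \<omega> \<times> unit_cube" unfolding Y0 by blast
    show "\<omega> \<times> Y0 \<in> sets lebesgue" using assms(1) Yo by (intro prod_sets_lebesgue(1)) auto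
    show "\<omega> \<times> unit_cube \<in> sets lebesgue" unfolding cube using assms(1) by (intro prod_sets_lebesgue(1)) auto
  qed
  note ctx = assms(1,2,3,4,6,7,8) Yo Yb faces assms(18,19,20,21) aM assms(23)
  have H: "H = interface_matrix \<omega> Y0 aM X" by (rule assms(24))
  note sol = assms(25)
  let ?ta = "\<lambda>x. trace_at (cylinder \<omega> {0<..<L}) ua (pt3 x 0)" and ?tb = "\<lambda>x. trace_at (cylinder \<omega> {-L<..<0}) ub (pt3 x 0)"
  have rep: "AE z in lebesgue_on (\<omega> \<times> Y0). u0 (fst z) (snd z) =
       (\<Sum>i\<in>UNIV. (?ta (fst z) $ i) *\<^sub>R X i (fst z) (snd z)) + (\<Sum>i\<in>UNIV. (?tb (fst z) $ i) *\<^sub>R (axis i 1 - X i (fst z) (snd z)))"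
    using representation(1)[OF ctx sol]
  proof eventually_elim
    case (elim z)
    have e: "(\<Sum>i\<in>UNIV. (?tb (fst z) $ i) *\<^sub>R axis i 1) = ?tb (fst z)"
      using basis_expansion[of "?tb (fst z)"] by (simp add: scalar_mult_eq_scaleR)
    show ?case unfolding elim lift_def[OF ctx]
      by (simp add: scaleR_diff_left scaleR_diff_right sum_subtractf e)
  qed
  have iface: "interface_solution \<omega> L \<Gamma> ab aa H f ua ub"
    unfolding H by (rule interface_solution_of_unfolded[OF ctx sol])
  show ?thesis
  proof (intro conjI allI impI)
    show "AE (x', y) in lebesgue_on (\<omega> \<times> Y0). u0 x' y =
       (\<Sum>i\<in>UNIV. (?ta x' $ i) *\<^sub>R X i x' y) + (\<Sum>i\<in>UNIV. (?tb x' $ i) *\<^sub>R (axis i 1 - X i x' y))"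
      using rep by (simp add: case_prod_unfold)
    show "(\<lambda>x'. H x' $ i $ j) \<in> Linf \<omega>" for i j unfolding H by (rule H_Linf[OF ctx])
    show "AE x' in lebesgue_on \<omega>. transpose (H x') = H x'"
      unfolding H using H_sym[OF ctx] by eventually_elim (simp add: transpose_def vec_eq_iff)
    show "interface_solution \<omega> L \<Gamma> ab aa H f ua ub" by (rule iface)
    fix wa wb assume w: "interface_solution \<omega> L \<Gamma> ab aa H f wa wb"
    note uniq = interface_solution_unique[OF ctx iface[unfolded H] w[unfolded H]]
    show "AE x in lebesgue_on (cylinder \<omega> {0<..<L}). wa x = ua x" using uniq by blast
    show "AE x in lebesgue_on (cylinder \<omega> {-L<..<0}). wb x = ub x" using uniq by blast
  qed
qed

end
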